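(* Let $(M,\eta^1,\ldots,\eta^k,\omega^1,\ldots,\omega^k,V)$ be a $k$-cosymplectic manifold with $\dim M=n(k+1)+k$, and let $R_1,\ldots,R_k$ be its Reeb vector fields. Every point $x\in M$ admits a neighbourhood with local coordinates $\{x^\alpha,y^i,y^\alpha_i\}$, with $1\leq\alpha\leq k$ and $1\leq i\leq n$, such that $$\eta^\alpha=\mathrm{d}x^\alpha,\qquad \omega^\alpha=\sum_{i=1}^n\mathrm{d}y^i\wedge\mathrm{d}y^\alpha_i,\qquad\alpha=1,\ldots,k,$$ and, in these coordinates, $R_\alpha=\dfrac{\partial}{\partial x^\alpha}$ for $\alpha=1,\ldots,k$, and moreover: - if $k\neq1$, then $V=\left\langle\dfrac{\partial}{\partial y^\alpha_i}\right\rangle_{\alpha=1,\ldots,k,\ i=1,\ldots,n}$; - if $k=1$ and $[\ker\omega,V]\subset\ker\omega\oplus V$ (with $\omega=\omega^1$), then $V=\left\langle\dfrac{\partial}{\partial y^1_i}\right\rangle_{i=1,\ldots,n}$.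
   Context: All manifolds are real, smooth, Hausdorff, connected, second countable and finite-dimensional; all structures are smooth. For a two-form $\omega$, $\ker\omega=\{v\in TM\mid\omega(v,\cdot)=0\}$. Let $M$ be an $(n(k+1)+k)$-dimensional manifold. A $k$-cosymplectic structure on $M$ is a family $(\eta^\alpha,\omega^\alpha,V)$, $1\leq\alpha\leq k$, where $\eta^1,\ldots,\eta^k$ are closed one-forms on $M$, $\omega^1,\ldots,\omega^k$ are closed two-forms on $M$, and $V$ is an integrable $nk$-dimensional distribution on $M$ such that: (1) $\eta^1\wedge\cdots\wedge\eta^k\neq0$ (at every point), $\eta^\alpha|_V=0$, $\omega^\alpha|_{V\times V}=0$ for all $\alpha$; (2) $\bigcap_{\alpha=1}^k(\ker\eta^\alpha\cap\ker\omega^\alpha)=\{0\}$ and $\operatorname{rank}\bigcap_{\alpha=1}^k\ker\omega^\alpha=k$. Then $M$ with this structure is a $k$-cosymplectic manifold. Its Reeb vector fields are the unique vector fields $R_1,\ldots,R_k$ on $M$ such that $\iota_{R_\alpha}\eta^\beta=\delta^\beta_\alpha$ and $\iota_{R_\alpha}\omega^\beta=0$ for $\alpha,\beta=1,\ldots,k$. The condition $[A,B]\subset C$ for distributions $A,B,C$ means that the Lie bracket of any vector field taking values in $A$ with any vector field taking values in $B$ takes values in $C$. *)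

theory Defs
  imports
    "HOL-Analysis.Analysis"
    "HOL-Library.Function_Algebras"
    "HOL-Combinatorics.Permutations"
begin

section \<open>Functions as a real vector space\<close>

text \<open>Addition on functions is the pointwise one of \<^theory>\<open>HOL-Library.Function_Algebras\<close>.
  With pointwise scaling, \<^const>\<open>subspace\<close>, \<^const>\<open>span\<close> and \<^const>\<open>dim\<close> apply to tangent spaces.\<close>

instantiation "fun" :: (type, real_vector) real_vector
begin

definition scaleR_fun :: "real \<Rightarrow> ('a \<Rightarrow> 'b) \<Rightarrow> 'a \<Rightarrow> 'b"
  where "scaleR_fun r f = (\<lambda>x. r *\<^sub>R f x)"

instance
  by standard (auto simp: scaleR_fun_def plus_fun_def fun_eq_iff algebra_simps)

end


section \<open>Smooth manifolds\<close>

text \<open>Only used for open \<open>S\<close>: all iterated directional derivatives up to order \<open>j\<close> exist, and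
  those of order \<open>j\<close> are continuous.\<close>

fun Ck_on :: "nat \<Rightarrow> 'a::euclidean_space set \<Rightarrow> ('a \<Rightarrow> 'b::euclidean_space) \<Rightarrow> bool" where
  "Ck_on 0 S f \<longleftrightarrow> continuous_on S f"
| "Ck_on (Suc j) S f \<longleftrightarrow>
     (\<forall>x\<in>S. f differentiable (at x)) \<and> (\<forall>v. Ck_on j S (\<lambda>x. frechet_derivative f (at x) v))"

definition smooth_on :: "'a::euclidean_space set \<Rightarrow> ('a \<Rightarrow> 'b::euclidean_space) \<Rightarrow> bool" where
  "smooth_on S f \<longleftrightarrow> (\<forall>j. Ck_on j S f)"

text \<open>A chart is a pair of its domain and its coordinate map. The values of the coordinate map
  outside the domain are irrelevant.\<close>

type_synonym ('m, 'e) chart = "'m set \<times> ('m \<Rightarrow> 'e)"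

definition chart_inv :: "('m, 'e) chart \<Rightarrow> 'e \<Rightarrow> 'm" where
  "chart_inv c = inv_into (fst c) (snd c)"

definition is_chart :: "('m::topological_space, 'e::euclidean_space) chart \<Rightarrow> bool" where
  "is_chart c \<longleftrightarrow> open (fst c) \<and> open (snd c ` fst c) \<and>
     homeomorphism (fst c) (snd c ` fst c) (snd c) (chart_inv c)"

definition smoothly_compatible ::
    "('m, 'e::euclidean_space) chart \<Rightarrow> ('m, 'e) chart \<Rightarrow> bool" where
  "smoothly_compatible c d \<longleftrightarrow>
     smooth_on (snd c ` (fst c \<inter> fst d)) (snd d \<circ> chart_inv c) \<and>
     smooth_on (snd d ` (fst c \<inter> fst d)) (snd c \<circ> chart_inv d)"

text \<open>The manifold is the whole type \<open>'m\<close> (Hausdorff and second countable by its sort), with a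
  maximal smooth atlas modelled on \<open>'e\<close>; its dimension is \<open>DIM('e)\<close>.\<close>

definition smooth_manifold ::
    "('m::{t2_space, second_countable_topology}, 'e::euclidean_space) chart set \<Rightarrow> bool" where
  "smooth_manifold A \<longleftrightarrow>
     connected (UNIV :: 'm set) \<and>
     (\<forall>c\<in>A. is_chart c) \<and>
     (\<Union>c\<in>A. fst c) = UNIV \<and>
     (\<forall>c\<in>A. \<forall>d\<in>A. smoothly_compatible c d) \<and>
     (\<forall>c. is_chart c \<and> (\<forall>d\<in>A. smoothly_compatible c d) \<longrightarrow> c \<in> A)"


section \<open>Tangent vectors and vector fields\<close>

text \<open>A tangent vector at \<open>p\<close> assigns to each chart around \<open>p\<close> a component vector in \<open>'e\<close>, subject
  to the transformation law under change of charts; it is \<open>0\<close> on all other charts, so that tangent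
  vectors at \<open>p\<close> are equal iff their components are.\<close>

type_synonym ('m, 'e) tvec = "('m, 'e) chart \<Rightarrow> 'e"

definition tangent_space ::
    "('m, 'e::euclidean_space) chart set \<Rightarrow> 'm \<Rightarrow> ('m, 'e) tvec set" where
  "tangent_space A p =
     {v. (\<forall>c. \<not> (c \<in> A \<and> p \<in> fst c) \<longrightarrow> v c = 0) \<and>
         (\<forall>c\<in>A. \<forall>d\<in>A. p \<in> fst c \<and> p \<in> fst d \<longrightarrow>
            v d = frechet_derivative (snd d \<circ> chart_inv c) (at (snd c p)) (v c))}"

text \<open>The tangent vector at \<open>p\<close> with components \<open>e\<close> in the chart \<open>c\<close>. The coordinates of a chart
  \<open>c\<close> are indexed by \<open>e \<in> Basis\<close>, and \<open>coord_vec A c e p\<close> is then the coordinate vector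
  \<open>\<partial>/\<partial>(coord c e)\<close> at \<open>p\<close>.\<close>

definition coord_vec ::
    "('m, 'e::euclidean_space) chart set \<Rightarrow> ('m, 'e) chart \<Rightarrow> 'e \<Rightarrow> 'm \<Rightarrow> ('m, 'e) tvec" where
  "coord_vec A c e p = (\<lambda>d. if d \<in> A \<and> p \<in> fst d
     then frechet_derivative (snd d \<circ> chart_inv c) (at (snd c p)) e else 0)"

definition coord :: "('m, 'e::euclidean_space) chart \<Rightarrow> 'e \<Rightarrow> 'm \<Rightarrow> real" where
  "coord c e q = snd c q \<bullet> e"

definition vector_field_on ::
    "('m, 'e::euclidean_space) chart set \<Rightarrow> 'm set \<Rightarrow> ('m \<Rightarrow> ('m, 'e) tvec) \<Rightarrow> bool" where
  "vector_field_on A U X \<longleftrightarrow>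
     (\<forall>p\<in>U. X p \<in> tangent_space A p) \<and>
     (\<forall>c\<in>A. smooth_on (snd c ` (fst c \<inter> U)) (\<lambda>z. X (chart_inv c z) c))"

abbreviation vector_field ::
    "('m, 'e::euclidean_space) chart set \<Rightarrow> ('m \<Rightarrow> ('m, 'e) tvec) \<Rightarrow> bool" where
  "vector_field A X \<equiv> vector_field_on A UNIV X"

text \<open>In coordinates, \<open>[X, Y]\<^sup>j = \<Sum>i. X\<^sup>i \<partial>\<^sub>iY\<^sup>j - Y\<^sup>i \<partial>\<^sub>iX\<^sup>j\<close>.\<close>

definition lie_bracket ::
    "('m, 'e::euclidean_space) chart set \<Rightarrow> ('m \<Rightarrow> ('m, 'e) tvec) \<Rightarrow> ('m \<Rightarrow> ('m, 'e) tvec)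
      \<Rightarrow> 'm \<Rightarrow> ('m, 'e) tvec" where
  "lie_bracket A X Y p = (\<lambda>c. if c \<in> A \<and> p \<in> fst c
     then frechet_derivative (\<lambda>z. Y (chart_inv c z) c) (at (snd c p)) (X p c)
        - frechet_derivative (\<lambda>z. X (chart_inv c z) c) (at (snd c p)) (Y p c)
     else 0)"


section \<open>Differential forms\<close>

type_synonym ('m, 'e) form1 = "'m \<Rightarrow> ('m, 'e) tvec \<Rightarrow> real"
type_synonym ('m, 'e) form2 = "'m \<Rightarrow> ('m, 'e) tvec \<Rightarrow> ('m, 'e) tvec \<Rightarrow> real"

definition linear_form_on :: "'v::real_vector set \<Rightarrow> ('v \<Rightarrow> real) \<Rightarrow> bool" where
  "linear_form_on T f \<longleftrightarrow>
     (\<forall>u\<in>T. \<forall>v\<in>T. \<forall>a b. f (a *\<^sub>R u + b *\<^sub>R v) = a * f u + b * f v)"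

text \<open>Local representatives, meaningful for \<open>z \<in> snd c ` fst c\<close> only.\<close>

definition rep1 ::
    "('m, 'e::euclidean_space) chart set \<Rightarrow> ('m, 'e) chart \<Rightarrow> ('m, 'e) form1
      \<Rightarrow> 'e \<Rightarrow> 'e \<Rightarrow> real" where
  "rep1 A c \<eta> z u = \<eta> (chart_inv c z) (coord_vec A c u (chart_inv c z))"

definition rep2 ::
    "('m, 'e::euclidean_space) chart set \<Rightarrow> ('m, 'e) chart \<Rightarrow> ('m, 'e) form2
      \<Rightarrow> 'e \<Rightarrow> 'e \<Rightarrow> 'e \<Rightarrow> real" where
  "rep2 A c \<omega> z u v =
     \<omega> (chart_inv c z) (coord_vec A c u (chart_inv c z)) (coord_vec A c v (chart_inv c z))"

definition one_form ::
    "('m, 'e::euclidean_space) chart set \<Rightarrow> ('m, 'e) form1 \<Rightarrow> bool" where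
  "one_form A \<eta> \<longleftrightarrow>
     (\<forall>p. linear_form_on (tangent_space A p) (\<eta> p)) \<and>
     (\<forall>c\<in>A. \<forall>u. smooth_on (snd c ` fst c) (\<lambda>z. rep1 A c \<eta> z u))"

definition two_form ::
    "('m, 'e::euclidean_space) chart set \<Rightarrow> ('m, 'e) form2 \<Rightarrow> bool" where
  "two_form A \<omega> \<longleftrightarrow>
     (\<forall>p. \<forall>v\<in>tangent_space A p.
        linear_form_on (tangent_space A p) (\<lambda>u. \<omega> p u v) \<and>
        linear_form_on (tangent_space A p) (\<omega> p v) \<and>
        \<omega> p v v = 0) \<and>
     (\<forall>c\<in>A. \<forall>u v. smooth_on (snd c ` fst c) (\<lambda>z. rep2 A c \<omega> z u v))"

text \<open>Exterior derivatives, as local representatives in the chart \<open>c\<close> at \<open>z\<close>; the vectors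
  \<open>u\<close>, \<open>v\<close>, \<open>w\<close> are constant in the chart, so no bracket terms occur.\<close>

definition ext_deriv1 ::
    "('m, 'e::euclidean_space) chart set \<Rightarrow> ('m, 'e) chart \<Rightarrow> ('m, 'e) form1
      \<Rightarrow> 'e \<Rightarrow> 'e \<Rightarrow> 'e \<Rightarrow> real" where
  "ext_deriv1 A c \<eta> z u v =
     frechet_derivative (\<lambda>z. rep1 A c \<eta> z v) (at z) u
   - frechet_derivative (\<lambda>z. rep1 A c \<eta> z u) (at z) v"

definition ext_deriv2 ::
    "('m, 'e::euclidean_space) chart set \<Rightarrow> ('m, 'e) chart \<Rightarrow> ('m, 'e) form2
      \<Rightarrow> 'e \<Rightarrow> 'e \<Rightarrow> 'e \<Rightarrow> 'e \<Rightarrow> real" where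
  "ext_deriv2 A c \<omega> z u v w =
     frechet_derivative (\<lambda>z. rep2 A c \<omega> z v w) (at z) u
   - frechet_derivative (\<lambda>z. rep2 A c \<omega> z u w) (at z) v
   + frechet_derivative (\<lambda>z. rep2 A c \<omega> z u v) (at z) w"

definition closed_one_form ::
    "('m, 'e::euclidean_space) chart set \<Rightarrow> ('m, 'e) form1 \<Rightarrow> bool" where
  "closed_one_form A \<eta> \<longleftrightarrow> one_form A \<eta> \<and>
     (\<forall>c\<in>A. \<forall>z\<in>snd c ` fst c. \<forall>u v. ext_deriv1 A c \<eta> z u v = 0)"

definition closed_two_form ::
    "('m, 'e::euclidean_space) chart set \<Rightarrow> ('m, 'e) form2 \<Rightarrow> bool" where
  "closed_two_form A \<omega> \<longleftrightarrow> two_form A \<omega> \<and>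
     (\<forall>c\<in>A. \<forall>z\<in>snd c ` fst c. \<forall>u v w. ext_deriv2 A c \<omega> z u v w = 0)"

text \<open>The differential of a (locally defined) function. By the chain rule, the chart around \<open>p\<close>
  in which it is computed does not matter.\<close>

definition differential ::
    "('m, 'e::euclidean_space) chart set \<Rightarrow> ('m \<Rightarrow> real) \<Rightarrow> ('m, 'e) form1" where
  "differential A f p v =
     (let c = (SOME c. c \<in> A \<and> p \<in> fst c)
      in frechet_derivative (f \<circ> chart_inv c) (at (snd c p)) (v c))"

definition wedge11 :: "('m, 'e) form1 \<Rightarrow> ('m, 'e) form1 \<Rightarrow> ('m, 'e) form2" where
  "wedge11 \<theta> \<zeta> p u v = \<theta> p u * \<zeta> p v - \<theta> p v * \<zeta> p u"

text \<open>\<open>(\<eta>\<^sup>1 \<and> \<dots> \<and> \<eta>\<^sup>k)(v\<^sub>1, \<dots>, v\<^sub>k)\<close> at \<open>p\<close>.\<close>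

definition wedge_family ::
    "nat \<Rightarrow> (nat \<Rightarrow> ('m, 'e) form1) \<Rightarrow> 'm \<Rightarrow> (nat \<Rightarrow> ('m, 'e) tvec) \<Rightarrow> real" where
  "wedge_family k \<eta> p v =
     (\<Sum>\<sigma> | \<sigma> permutes {1..k}. of_int (sign \<sigma>) * (\<Prod>\<alpha>=1..k. \<eta> \<alpha> p (v (\<sigma> \<alpha>))))"

definition ker1 ::
    "('m, 'e::euclidean_space) chart set \<Rightarrow> ('m, 'e) form1 \<Rightarrow> 'm \<Rightarrow> ('m, 'e) tvec set" where
  "ker1 A \<eta> p = {v \<in> tangent_space A p. \<eta> p v = 0}"

definition ker2 ::
    "('m, 'e::euclidean_space) chart set \<Rightarrow> ('m, 'e) form2 \<Rightarrow> 'm \<Rightarrow> ('m, 'e) tvec set" where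
  "ker2 A \<omega> p = {v \<in> tangent_space A p. \<forall>w\<in>tangent_space A p. \<omega> p v w = 0}"


section \<open>Distributions\<close>

type_synonym ('m, 'e) distrib = "'m \<Rightarrow> ('m, 'e) tvec set"

definition distribution ::
    "('m::topological_space, 'e::euclidean_space) chart set \<Rightarrow> nat \<Rightarrow> ('m, 'e) distrib \<Rightarrow> bool" where
  "distribution A r D \<longleftrightarrow>
     (\<forall>p. D p \<subseteq> tangent_space A p \<and> subspace (D p) \<and> dim (D p) = r) \<and>
     (\<forall>p. \<exists>U X. open U \<and> p \<in> U \<and>
        (\<forall>i\<in>{1..r}. vector_field_on A U (X i)) \<and>
        (\<forall>q\<in>U. D q = span ((\<lambda>i. X i q) ` {1..r})))"

text \<open>\<open>N\<close> is an \<open>r\<close>-dimensional embedded submanifold (described by slice charts, the subspace \<open>S\<close>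
  of the model space playing the role of \<open>\<real>\<^sup>r\<close>) with \<open>T\<^sub>qN = D\<^sub>q\<close> for all \<open>q \<in> N\<close>. Immersed integral
  manifolds are locally of this form, so embedded ones suffice in the definition of
  integrability.\<close>

definition integral_manifold ::
    "('m, 'e::euclidean_space) chart set \<Rightarrow> nat \<Rightarrow> ('m, 'e) distrib \<Rightarrow> 'm set \<Rightarrow> bool" where
  "integral_manifold A r D N \<longleftrightarrow>
     (\<forall>q\<in>N. \<exists>c\<in>A. q \<in> fst c \<and> (\<exists>S. subspace S \<and> dim S = r \<and>
        snd c ` (N \<inter> fst c) = {z \<in> snd c ` fst c. z - snd c q \<in> S} \<and>
        D q = {v \<in> tangent_space A q. v c \<in> S}))"

definition integrable_distribution ::
    "('m::topological_space, 'e::euclidean_space) chart set \<Rightarrow> nat \<Rightarrow> ('m, 'e) distrib \<Rightarrow> bool" where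
  "integrable_distribution A r D \<longleftrightarrow>
     distribution A r D \<and> (\<forall>p. \<exists>N. p \<in> N \<and> integral_manifold A r D N)"

text \<open>\<open>[B, C] \<subseteq> D\<close>\<close>

definition bracket_in ::
    "('m, 'e::euclidean_space) chart set \<Rightarrow> ('m, 'e) distrib \<Rightarrow> ('m, 'e) distrib
      \<Rightarrow> ('m, 'e) distrib \<Rightarrow> bool" where
  "bracket_in A B C D \<longleftrightarrow>
     (\<forall>X Y. vector_field A X \<and> vector_field A Y \<and> (\<forall>p. X p \<in> B p) \<and> (\<forall>p. Y p \<in> C p) \<longrightarrow>
        (\<forall>p. lie_bracket A X Y p \<in> D p))"

definition distrib_sum ::
    "('m, 'e::euclidean_space) distrib \<Rightarrow> ('m, 'e) distrib \<Rightarrow> ('m, 'e) distrib" where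
  "distrib_sum B C p = {u + v | u v. u \<in> B p \<and> v \<in> C p}"


section \<open>\<open>k\<close>-cosymplectic manifolds\<close>

text \<open>The families \<open>\<eta>\<close>, \<open>\<omega>\<close> and \<open>R\<close> are indexed by \<open>{1..k}\<close>; other values are irrelevant.\<close>

definition k_cosymplectic ::
    "('m::{t2_space, second_countable_topology}, 'e::euclidean_space) chart set \<Rightarrow> nat \<Rightarrow> nat
      \<Rightarrow> (nat \<Rightarrow> ('m, 'e) form1) \<Rightarrow> (nat \<Rightarrow> ('m, 'e) form2) \<Rightarrow> ('m, 'e) distrib \<Rightarrow> bool" where
  "k_cosymplectic A k n \<eta> \<omega> V \<longleftrightarrow>
     smooth_manifold A \<and> 1 \<le> k \<and> DIM('e) = n * (k + 1) + k \<and>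
     (\<forall>\<alpha>\<in>{1..k}. closed_one_form A (\<eta> \<alpha>) \<and> closed_two_form A (\<omega> \<alpha>)) \<and>
     integrable_distribution A (n * k) V \<and>
     (\<forall>p. \<exists>v. (\<forall>\<alpha>\<in>{1..k}. v \<alpha> \<in> tangent_space A p) \<and> wedge_family k \<eta> p v \<noteq> 0) \<and>
     (\<forall>\<alpha>\<in>{1..k}. \<forall>p. \<forall>v\<in>V p. \<eta> \<alpha> p v = 0) \<and>
     (\<forall>\<alpha>\<in>{1..k}. \<forall>p. \<forall>v\<in>V p. \<forall>w\<in>V p. \<omega> \<alpha> p v w = 0) \<and>
     (\<forall>p. (\<Inter>\<alpha>\<in>{1..k}. ker1 A (\<eta> \<alpha>) p \<inter> ker2 A (\<omega> \<alpha>) p) = {0}) \<and>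
     (\<forall>p. dim (\<Inter>\<alpha>\<in>{1..k}. ker2 A (\<omega> \<alpha>) p) = k)"

definition reeb_fields ::
    "('m, 'e::euclidean_space) chart set \<Rightarrow> nat \<Rightarrow> (nat \<Rightarrow> ('m, 'e) form1)
      \<Rightarrow> (nat \<Rightarrow> ('m, 'e) form2) \<Rightarrow> (nat \<Rightarrow> 'm \<Rightarrow> ('m, 'e) tvec) \<Rightarrow> bool" where
  "reeb_fields A k \<eta> \<omega> R \<longleftrightarrow>
     (\<forall>\<alpha>\<in>{1..k}. vector_field A (R \<alpha>) \<and>
        (\<forall>\<beta>\<in>{1..k}. \<forall>p. \<eta> \<beta> p (R \<alpha> p) = (if \<alpha> = \<beta> then 1 else 0) \<and>
           (\<forall>w\<in>tangent_space A p. \<omega> \<beta> p (R \<alpha> p) w = 0)))"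

text \<open>Names for the coordinates: \<open>CX \<alpha>\<close> for \<open>x\<^sup>\<alpha>\<close>, \<open>CY i\<close> for \<open>y\<^sup>i\<close> and \<open>CP \<alpha> i\<close> for \<open>y\<^sup>\<alpha>\<^sub>i\<close>. A bijection
  from \<open>coord_names k n\<close> to \<open>Basis\<close> attaches them to the coordinates of a chart.\<close>

datatype coord_name = CX nat | CY nat | CP nat nat

definition coord_names :: "nat \<Rightarrow> nat \<Rightarrow> coord_name set" where
  "coord_names k n =
     CX ` {1..k} \<union> CY ` {1..n} \<union> {CP \<alpha> i | \<alpha> i. \<alpha> \<in> {1..k} \<and> i \<in> {1..n}}"

end

theory Submission
  imports Defs
begin

text \<open>Let \<open>E = V \<oplus> \<langle>R\<^sub>1, \<dots>, R\<^sub>k\<rangle>\<close>.  All the \<open>\<omega>\<^sup>\<alpha>\<close> vanish on \<open>E\<close>, and \<open>dim M - rank E = n\<close>.  The structure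
  has its normal form near a point as soon as \<open>E\<close> is involutive.  In that case \<open>frobenius\<close> provides
  coordinates in which \<open>E\<close> is a constant subspace \<open>L\<close>.  Let \<open>y\<^sup>1, \<dots>, y\<^sup>n\<close> be linear functions with common
  kernel \<open>L\<close>.  A homotopy that contracts along \<open>L\<close> first gives each \<open>\<omega>\<^sup>\<alpha>\<close> a primitive that vanishes on \<open>L\<close>,
  hence is a combination of the \<open>dy\<^sup>i\<close>; its coefficients are, up to sign, the functions \<open>y\<^sup>\<alpha>\<^sub>i\<close>
  (\<open>isotropic_primitive\<close>).  Primitives of the \<open>\<eta>\<^sup>\<alpha>\<close> are the \<open>x\<^sup>\<alpha>\<close>.  A vector annihilated by all these
  differentials is in all kernels, so it is \<open>0\<close>; as there are exactly \<open>dim M\<close> functions, they are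
  coordinates by the inverse function theorem (\<open>darboux_from_frame\<close>).  In these coordinates, \<open>R\<^sub>\<alpha>\<close> can be
  read off from \<open>\<eta>\<close>, \<open>\<omega>\<close> and \<open>R\<^sub>\<alpha> \<in> E\<close>, and \<open>V\<close> is annihilated by the \<open>dx\<^sup>\<alpha>\<close> and the \<open>dy\<^sup>i\<close>, so that it is
  spanned by the \<open>\<partial>/\<partial>y\<^sup>\<alpha>\<^sub>i\<close> for dimension reasons.

  The involutivity of \<open>E\<close> consists of three inclusions.  Firstly \<open>[V, V] \<subseteq> V\<close>, because vector fields in
  \<open>V\<close> are tangent to the integral manifolds (\<open>integrable_imp_involutive\<close>).  Secondly \<open>[R\<^sub>\<alpha>, R\<^sub>\<beta>] = 0\<close>,
  because closedness puts this bracket into all kernels (\<open>reeb_fields_commute\<close>).  The third one,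
  \<open>[R\<^sub>\<alpha>, V] \<subseteq> E\<close>, depends on \<open>k\<close>.  Closedness of \<open>\<omega>\<^sup>\<beta>\<close> says that \<open>\<omega>\<^sup>\<beta>([R\<^sub>\<alpha>, X], Y)\<close> is symmetric in
  \<open>X, Y \<in> V\<close>, for every \<open>\<beta>\<close>.  If \<open>k \<ge> 2\<close>, then \<open>V\<close> contains vectors that pair with \<open>TM/E\<close> through one single
  \<open>\<omega>\<^sup>\<beta>\<close> only, and symmetry for two different \<open>\<beta>\<close> forces \<open>[R\<^sub>\<alpha>, X]\<close> into \<open>E\<close>
  (\<open>symmetric_implies_transverse\<close>, \<open>reeb_invariance\<close>).  If \<open>k = 1\<close>, then the inclusion is the
  bracket condition; as that condition speaks of vector fields on all of \<open>M\<close>, local sections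
  of \<open>V\<close> have to be cut off (\<open>local_bracket_condition\<close>).

  If \<open>k = 1\<close> and the bracket condition fails, nothing is claimed about \<open>V\<close>, and another isotropic
  distribution can replace it: a frame of Hamiltonian vector fields of functions in involution is
  built one field at a time, each function being a first integral of the fields found so far
  (\<open>lagrangian_frame\<close>).

  The analysis takes place on open subsets of the model space: calculus of smooth maps,
  the smooth inverse function theorem, smooth dependence of integral equations on parameters,
  the Frobenius theorem and the Poincare lemma.\<close>

section \<open>Smooth maps, possibly depending on a parameter\<close>

text \<open>The parameter \<open>t\<close> enters continuously only and is never differentiated.  This is the regularity that
  survives integration over \<open>t\<close> and that solutions of integral equations have in the time variable.\<close>

fun Ck_family :: "'t::topological_space set \<Rightarrow> nat \<Rightarrow> 'a::euclidean_space set
    \<Rightarrow> ('t \<Rightarrow> 'a \<Rightarrow> 'b::euclidean_space) \<Rightarrow> bool" where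
  "Ck_family T 0 S f \<longleftrightarrow> continuous_on (T \<times> S) (\<lambda>p. f (fst p) (snd p))"
| "Ck_family T (Suc j) S f \<longleftrightarrow> continuous_on (T \<times> S) (\<lambda>p. f (fst p) (snd p)) \<and>
     (\<forall>t\<in>T. \<forall>x\<in>S. f t differentiable (at x)) \<and>
     (\<forall>v. Ck_family T j S (\<lambda>t x. frechet_derivative (f t) (at x) v))"

definition smooth_family :: "'t::topological_space set \<Rightarrow> 'a::euclidean_space set
    \<Rightarrow> ('t \<Rightarrow> 'a \<Rightarrow> 'b::euclidean_space) \<Rightarrow> bool" where
  "smooth_family T S f \<longleftrightarrow> (\<forall>j. Ck_family T j S f)"

lemma frechet_derivative_cong_open:
  assumes "open S" "x \<in> S" "\<And>y. y \<in> S \<Longrightarrow> f y = g y"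
  shows "frechet_derivative f (at x) = frechet_derivative g (at x)"
proof -
  have "(f has_derivative D) (at x) \<longleftrightarrow> (g has_derivative D) (at x)" for D
    using assms by (metis has_derivative_transform_within_open)
  then show ?thesis unfolding frechet_derivative_def by presburger
qed

lemma differentiable_cong_open:
  assumes "open S" "x \<in> S" "\<And>y. y \<in> S \<Longrightarrow> f y = g y" "f differentiable (at x)"
  shows "g differentiable (at x)"
  using assms unfolding differentiable_def by (metis has_derivative_transform_within_open)

lemma frechet_derivative_sum_Basis:
  fixes f :: "'a::euclidean_space \<Rightarrow> 'b::real_normed_vector"
  assumes "f differentiable (at x)"
  shows "frechet_derivative f (at x) v = (\<Sum>b\<in>Basis. (v \<bullet> b) *\<^sub>R frechet_derivative f (at x) b)"
proof -
  have l: "linear (frechet_derivative f (at x))"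
    using assms by (rule linear_frechet_derivative)
  have "frechet_derivative f (at x) v = frechet_derivative f (at x) (\<Sum>b\<in>Basis. (v \<bullet> b) *\<^sub>R b)"
    by (simp add: euclidean_representation)
  also have "\<dots> = (\<Sum>b\<in>Basis. (v \<bullet> b) *\<^sub>R frechet_derivative f (at x) b)"
    using l by (simp add: linear_sum linear_cmul)
  finally show ?thesis .
qed

lemma Ck_family_cong:
  assumes "open S" "\<And>t x. t \<in> T \<Longrightarrow> x \<in> S \<Longrightarrow> f t x = g t x" "Ck_family T j S f"
  shows "Ck_family T j S g"
  using assms(2,3)
proof (induction j arbitrary: f g)
  case 0
  then show ?case by (auto intro: continuous_on_eq)
next
  case (Suc j)
  have c: "continuous_on (T \<times> S) (\<lambda>p. g (fst p) (snd p))"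
    using Suc.prems by (auto intro: continuous_on_eq)
  have d: "g t differentiable at x" if "t \<in> T" "x \<in> S" for t x
  proof (rule differentiable_cong_open[OF assms(1), of x "f t" "g t"])
    show "f t differentiable at x" using Suc.prems(2) that by simp
  qed (use Suc.prems(1) that in blast)+
  have "Ck_family T j S (\<lambda>t x. frechet_derivative (g t) (at x) v)" for v
  proof (rule Suc.IH[of "\<lambda>t x. frechet_derivative (f t) (at x) v"])
    show "frechet_derivative (f t) (at x) v = frechet_derivative (g t) (at x) v"
      if "t \<in> T" "x \<in> S" for t x
    proof -
      have "frechet_derivative (f t) (at x) = frechet_derivative (g t) (at x)"
        by (rule frechet_derivative_cong_open[OF assms(1) that(2)]) (rule Suc.prems(1)[OF that(1)])
      then show ?thesis by simp
    qed
  qed (use Suc.prems(2) in simp)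
  then show ?case using c d by simp
qed

lemma Ck_family_SucI:
  assumes "open S" "continuous_on (T \<times> S) (\<lambda>p. f (fst p) (snd p))"
    "\<And>t x. t \<in> T \<Longrightarrow> x \<in> S \<Longrightarrow> (f t has_derivative f' t x) (at x)"
    "\<And>v. Ck_family T j S (\<lambda>t x. f' t x v)"
  shows "Ck_family T (Suc j) S f"
proof -
  have eq: "frechet_derivative (f t) (at x) = f' t x" if "t \<in> T" "x \<in> S" for t x
    using assms(3)[OF that] frechet_derivative_at by metis
  have "Ck_family T j S (\<lambda>t x. frechet_derivative (f t) (at x) v)" for v
    by (rule Ck_family_cong[OF assms(1) _ assms(4)[of v]]) (simp add: eq)
  then show ?thesis using assms(2,3) by (auto simp: differentiable_def)
qed

lemma Ck_family_continuous:
  "Ck_family T j S f \<Longrightarrow> continuous_on (T \<times> S) (\<lambda>p. f (fst p) (snd p))"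
  by (cases j) auto

lemma continuous_on_compose_pair:
  assumes "continuous_on (T \<times> S) (\<lambda>p. f (fst p) (snd p))"
    "continuous_on A a" "continuous_on A b" "\<And>x. x \<in> A \<Longrightarrow> a x \<in> T" "\<And>x. x \<in> A \<Longrightarrow> b x \<in> S"
  shows "continuous_on A (\<lambda>x. f (a x) (b x))"
proof -
  have "continuous_on A (\<lambda>x. f (fst (a x, b x)) (snd (a x, b x)))"
    by (rule continuous_on_compose2[OF assms(1)]) (use assms(2-) in \<open>auto intro: continuous_intros\<close>)
  then show ?thesis by simp
qed

lemma Ck_family_deriv:
  assumes "Ck_family T (Suc j) S f" "t \<in> T" "x \<in> S"
  shows "(f t has_derivative frechet_derivative (f t) (at x)) (at x)"
  using assms frechet_derivative_works by auto

lemma Ck_family_Suc_mono: "Ck_family T (Suc j) S f \<Longrightarrow> Ck_family T j S f"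
proof (induction j arbitrary: f)
  case (Suc j)
  then have "Ck_family T j S (\<lambda>t x. frechet_derivative (f t) (at x) v)" for v
    by auto
  then show ?case using Suc.prems by auto
qed auto

lemma Ck_family_param:
  assumes "open S" "continuous_on T g"
  shows "Ck_family T j S (\<lambda>t x. g t)"
  using assms(2)
proof (induction j arbitrary: g)
  case 0
  then show ?case
    by (simp, intro continuous_on_compose2[OF 0, of _ fst]) (auto intro: continuous_intros)
next
  case (Suc j)
  have "continuous_on (T \<times> S) (\<lambda>p. g (fst p))"
    by (intro continuous_on_compose2[OF Suc.prems, of _ fst]) (auto intro: continuous_intros)
  then show ?case
    by (intro Ck_family_SucI[OF assms(1), where f' = "\<lambda>_ _ _. 0"]) (auto intro!: Suc.IH)
qed

lemma Ck_family_const: "open S \<Longrightarrow> Ck_family T j S (\<lambda>t x. c)"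
  by (rule Ck_family_param) auto

lemma Ck_family_bounded_linear:
  assumes "open S" "bounded_linear L"
  shows "Ck_family T j S (\<lambda>t x. L x)"
proof -
  have c: "continuous_on (T \<times> S) (\<lambda>p. L (snd p))"
    by (intro continuous_intros bounded_linear.continuous_on[OF assms(2)])
  show ?thesis
  proof (cases j)
    case (Suc i)
    show ?thesis unfolding Suc
      by (rule Ck_family_SucI[OF assms(1), where f' = "\<lambda>_ _. L"])
        (use c assms in \<open>auto intro: bounded_linear_imp_has_derivative Ck_family_const\<close>)
  qed (use c in auto)
qed

lemma Ck_family_add:
  assumes "open S" "Ck_family T j S f" "Ck_family T j S g"
  shows "Ck_family T j S (\<lambda>t x. f t x + g t x)"
  using assms(2,3)
proof (induction j arbitrary: f g)
  case (Suc j)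
  show ?case
    by (rule Ck_family_SucI[OF assms(1), where f' = "\<lambda>t x v. frechet_derivative (f t) (at x) v
            + frechet_derivative (g t) (at x) v"])
       (use Suc.prems in \<open>auto intro!: continuous_intros has_derivative_add Suc.IH
          simp: frechet_derivative_works[symmetric]\<close>)
qed (auto intro: continuous_intros)

lemma Ck_family_bounded_bilinear:
  fixes bil :: "'b::euclidean_space \<Rightarrow> 'c::euclidean_space \<Rightarrow> 'd::euclidean_space"
  assumes "bounded_bilinear bil" "open S" "Ck_family T j S f" "Ck_family T j S g"
  shows "Ck_family T j S (\<lambda>t x. bil (f t x) (g t x))"
  using assms(3,4)
proof (induction j arbitrary: f g)
  case 0
  then show ?case using bounded_bilinear.continuous_on[OF assms(1)] by auto
next
  case (Suc j)
  note m = Suc.prems[THEN Ck_family_Suc_mono]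
  show ?case
  proof (rule Ck_family_SucI[OF assms(2)])
    show "continuous_on (T \<times> S) (\<lambda>p. bil (f (fst p) (snd p)) (g (fst p) (snd p)))"
      using Suc.prems[THEN Ck_family_continuous] bounded_bilinear.continuous_on[OF assms(1)]
      by auto
    show "((\<lambda>x. bil (f t x) (g t x)) has_derivative
        (\<lambda>v. bil (f t x) (frechet_derivative (g t) (at x) v)
           + bil (frechet_derivative (f t) (at x) v) (g t x))) (at x)"
      if "t \<in> T" "x \<in> S" for t x
      using bounded_bilinear.FDERIV[OF assms(1) Suc.prems[THEN Ck_family_deriv, OF that]] .
    show "Ck_family T j S (\<lambda>t x. bil (f t x) (frechet_derivative (g t) (at x) v)
           + bil (frechet_derivative (f t) (at x) v) (g t x))" for v
      using Suc.prems m by (intro Ck_family_add[OF assms(2)] Suc.IH) auto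
  qed
qed

lemma Ck_family_linear_compose:
  assumes "open S" "bounded_linear L" "Ck_family T j S f"
  shows "Ck_family T j S (\<lambda>t x. L (f t x))"
  using assms(3)
proof (induction j arbitrary: f)
  case 0
  then show ?case using bounded_linear.continuous_on[OF assms(2)] by auto
next
  case (Suc j)
  show ?case
    by (rule Ck_family_SucI[OF assms(1), where f' = "\<lambda>t x v. L (frechet_derivative (f t) (at x) v)"])
       (use Suc in \<open>auto intro!: bounded_linear.continuous_on[OF assms(2)]
          bounded_linear.has_derivative[OF assms(2)]
          simp: frechet_derivative_works[symmetric]\<close>)
qed

lemma Ck_family_sum:
  assumes "open S" "\<And>i. i \<in> I \<Longrightarrow> Ck_family T j S (f i)"
  shows "Ck_family T j S (\<lambda>t x. \<Sum>i\<in>I. f i t x)"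
  using assms(2)
proof (induction I rule: infinite_finite_induct)
  case (insert i I)
  then show ?case using Ck_family_add[OF assms(1), of T j "f i" "\<lambda>t x. \<Sum>i\<in>I. f i t x"] by auto
qed (auto intro: Ck_family_const assms)

lemma Ck_family_compose:
  fixes g :: "'t::topological_space \<Rightarrow> 'b::euclidean_space \<Rightarrow> 'c::euclidean_space"
  assumes "open S" "open R" "\<And>t x. t \<in> T \<Longrightarrow> x \<in> S \<Longrightarrow> f t x \<in> R"
    "Ck_family T j S f" "Ck_family T j R g"
  shows "Ck_family T j S (\<lambda>t x. g t (f t x))"
  using assms(4,5)
proof (induction j arbitrary: g)
  case 0
  have "continuous_on (T \<times> S) (\<lambda>p. (fst p, f (fst p) (snd p)))"
    using 0 by (auto intro!: continuous_intros)
  moreover have "(\<lambda>p. (fst p, f (fst p) (snd p))) ` (T \<times> S) \<subseteq> T \<times> R"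
    using assms(3) by auto
  ultimately show ?case
    using continuous_on_compose2[OF Ck_family_continuous[OF 0(2)],
        of "T \<times> S" "\<lambda>p. (fst p, f (fst p) (snd p))"] by simp
next
  case (Suc j)
  note m = Suc.prems[THEN Ck_family_Suc_mono]
  have dg: "g t differentiable at (f t x)" if "t \<in> T" "x \<in> S" for t x
    using Suc.prems(2) assms(3)[OF that] that by auto
  show ?case
  proof (rule Ck_family_SucI[OF assms(1)])
    have "continuous_on (T \<times> S) (\<lambda>p. (fst p, f (fst p) (snd p)))"
      using Suc.prems by (auto intro!: continuous_intros)
    moreover have "(\<lambda>p. (fst p, f (fst p) (snd p))) ` (T \<times> S) \<subseteq> T \<times> R"
      using assms(3) by auto
    ultimately show "continuous_on (T \<times> S) (\<lambda>p. g (fst p) (f (fst p) (snd p)))"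
      using continuous_on_compose2[OF Ck_family_continuous[OF Suc.prems(2)],
          of "T \<times> S" "\<lambda>p. (fst p, f (fst p) (snd p))"] by simp
    show "((\<lambda>x. g t (f t x)) has_derivative
       (\<lambda>v. \<Sum>b\<in>Basis. (frechet_derivative (f t) (at x) v \<bullet> b) *\<^sub>R
               frechet_derivative (g t) (at (f t x)) b)) (at x)" if "t \<in> T" "x \<in> S" for t x
    proof -
      have "((g t \<circ> f t) has_derivative
          frechet_derivative (g t) (at (f t x)) \<circ> frechet_derivative (f t) (at x)) (at x)"
        using Ck_family_deriv[OF Suc.prems(1) that] Ck_family_deriv[OF Suc.prems(2)] that assms(3)
        by (intro diff_chain_at) blast+
      moreover have "frechet_derivative (g t) (at (f t x)) \<circ> frechet_derivative (f t) (at x)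
          = (\<lambda>v. \<Sum>b\<in>Basis. (frechet_derivative (f t) (at x) v \<bullet> b) *\<^sub>R
               frechet_derivative (g t) (at (f t x)) b)"
        unfolding o_def by (rule ext, rule frechet_derivative_sum_Basis[OF dg[OF that]])
      ultimately show ?thesis unfolding o_def by metis
    qed
    show "Ck_family T j S (\<lambda>t x. \<Sum>b\<in>Basis. (frechet_derivative (f t) (at x) v \<bullet> b) *\<^sub>R
               frechet_derivative (g t) (at (f t x)) b)" for v
      by (intro Ck_family_sum[OF assms(1)] Ck_family_bounded_bilinear[OF bounded_bilinear_scaleR assms(1)]
          Ck_family_linear_compose[OF assms(1) bounded_linear_inner_left] Suc.IH m)
        (use Suc.prems in auto)
  qed
qed

lemma continuous_on_snd: "continuous_on S f \<Longrightarrow> continuous_on (T \<times> S) (\<lambda>p. f (snd p))"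
  by (rule continuous_on_compose2[of S f _ snd]) (auto intro: continuous_intros)

lemma continuous_on_snd_iff:
  fixes S :: "'a::topological_space set"
  shows "continuous_on ({0::real} \<times> S) (\<lambda>p. f (snd p)) \<longleftrightarrow> continuous_on S f"
proof
  assume "continuous_on ({0::real} \<times> S) (\<lambda>p. f (snd p))"
  moreover have "continuous_on S (Pair (0::real))" by (intro continuous_intros)
  ultimately show "continuous_on S f"
    using continuous_on_compose2[of "{0::real} \<times> S" "\<lambda>p. f (snd p)" S "Pair 0"] by auto
qed (rule continuous_on_snd)

text \<open>The closure properties of smooth maps are the case of a one-point parameter space.\<close>

lemma Ck_on_iff_family:
  fixes f :: "'a::euclidean_space \<Rightarrow> 'b::euclidean_space"
  assumes "open S"
  shows "Ck_on j S f \<longleftrightarrow> Ck_family {0::real} j S (\<lambda>_. f)"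
proof (induction j arbitrary: f)
  case (Suc j)
  have "continuous_on S f" if "\<forall>x\<in>S. f differentiable at x"
    using that by (auto intro!: differentiable_imp_continuous_on simp: differentiable_on_def
          differentiable_at_withinI)
  then show ?case using Suc by (auto simp: continuous_on_snd_iff)
qed (simp add: continuous_on_snd_iff)

lemma smooth_on_iff_family: "open S \<Longrightarrow> smooth_on S f \<longleftrightarrow> smooth_family {0::real} S (\<lambda>_. f)"
  unfolding smooth_on_def smooth_family_def by (simp add: Ck_on_iff_family)

lemma smooth_on_imp_family:
  assumes "open S" "smooth_on S f"
  shows "smooth_family T S (\<lambda>_. f)"
proof -
  have "Ck_family T j S (\<lambda>_. f)" if "Ck_family {0::real} j S (\<lambda>_. f)" for j f
    using that by (induction j arbitrary: f) (auto simp: continuous_on_snd_iff continuous_on_snd)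
  then show ?thesis using assms unfolding smooth_on_iff_family[OF assms(1)] smooth_family_def by blast
qed

lemma smooth_family_cong:
  "open S \<Longrightarrow> (\<And>t x. t \<in> T \<Longrightarrow> x \<in> S \<Longrightarrow> f t x = g t x) \<Longrightarrow> smooth_family T S f \<Longrightarrow> smooth_family T S g"
  unfolding smooth_family_def using Ck_family_cong by blast

lemma smooth_family_compose:
  assumes "open S" "open R" "\<And>t x. t \<in> T \<Longrightarrow> x \<in> S \<Longrightarrow> f t x \<in> R"
    "smooth_family T S f" "smooth_family T R g"
  shows "smooth_family T S (\<lambda>t x. g t (f t x))"
  using assms Ck_family_compose unfolding smooth_family_def by blast

lemma smooth_family_compose_on:
  assumes "open S" "open R" "\<And>t x. t \<in> T \<Longrightarrow> x \<in> S \<Longrightarrow> f t x \<in> R"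
    "smooth_family T S f" "smooth_on R g"
  shows "smooth_family T S (\<lambda>t x. g (f t x))"
  using smooth_family_compose[OF assms(1-4) smooth_on_imp_family[OF assms(2,5)]] by simp

lemma smooth_family_param: "open (S::_::euclidean_space set) \<Longrightarrow> continuous_on T g \<Longrightarrow> smooth_family T S (\<lambda>t x. g t)"
  unfolding smooth_family_def using Ck_family_param by blast

lemma smooth_family_add:
  "open S \<Longrightarrow> smooth_family T S f \<Longrightarrow> smooth_family T S g \<Longrightarrow> smooth_family T S (\<lambda>t x. f t x + g t x)"
  unfolding smooth_family_def using Ck_family_add by blast

lemma smooth_family_bilinear:
  "bounded_bilinear bil \<Longrightarrow> open S \<Longrightarrow> smooth_family T S f \<Longrightarrow> smooth_family T S g
     \<Longrightarrow> smooth_family T S (\<lambda>t x. bil (f t x) (g t x))"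
  unfolding smooth_family_def using Ck_family_bounded_bilinear by blast

lemmas smooth_family_scaleR = smooth_family_bilinear[OF bounded_bilinear_scaleR]

lemma smooth_family_linear_compose:
  "open S \<Longrightarrow> bounded_linear L \<Longrightarrow> smooth_family T S f \<Longrightarrow> smooth_family T S (\<lambda>t x. L (f t x))"
  unfolding smooth_family_def using Ck_family_linear_compose by blast

lemma smooth_family_bounded_linear:
  "open S \<Longrightarrow> bounded_linear L \<Longrightarrow> smooth_family T S (\<lambda>t x. L x)"
  unfolding smooth_family_def using Ck_family_bounded_linear by blast

lemma smooth_family_sum:
  "open S \<Longrightarrow> (\<And>i. i \<in> I \<Longrightarrow> smooth_family T S (f i)) \<Longrightarrow> smooth_family T S (\<lambda>t x. \<Sum>i\<in>I. f i t x)"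
  unfolding smooth_family_def by (intro allI Ck_family_sum) auto

lemma smooth_on_cong:
  "open S \<Longrightarrow> (\<And>x. x \<in> S \<Longrightarrow> f x = g x) \<Longrightarrow> smooth_on S f \<Longrightarrow> smooth_on S g"
  by (simp add: smooth_on_iff_family smooth_family_cong[of S "{0::real}" "\<lambda>_. f" "\<lambda>_. g"])

lemma smooth_on_subset:
  "smooth_on S f \<Longrightarrow> S' \<subseteq> S \<Longrightarrow> smooth_on S' f"
proof -
  have "Ck_on j S' f" if "Ck_on j S f" "S' \<subseteq> S" for j
    using that by (induction j arbitrary: f) (auto intro: continuous_on_subset)
  then show "smooth_on S f \<Longrightarrow> S' \<subseteq> S \<Longrightarrow> smooth_on S' f" unfolding smooth_on_def by blast
qed

lemma smooth_on_local:
  assumes "\<And>x. x \<in> S \<Longrightarrow> \<exists>N. open N \<and> x \<in> N \<and> smooth_on N f"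
  shows "smooth_on S f"
proof -
  have *: "Ck_on j S f" if "\<And>x. x \<in> S \<Longrightarrow> \<exists>N. open N \<and> x \<in> N \<and> Ck_on j N f" for j
    using that
  proof (induction j arbitrary: f)
    case 0
    show ?case
    proof (simp add: continuous_on_eq_continuous_within, intro ballI)
      fix x assume "x \<in> S"
      then obtain N where "open N" "x \<in> N" "continuous_on N f" using 0 by auto
      then have "isCont f x" by (simp add: continuous_on_eq_continuous_at)
      then show "continuous (at x within S) f" by (rule continuous_at_imp_continuous_at_within)
    qed
  next
    case (Suc j)
    show ?case
    proof (simp, intro conjI ballI allI)
      show "f differentiable at x" if "x \<in> S" for x using Suc.prems[OF that] by auto
      show "Ck_on j S (\<lambda>x. frechet_derivative f (at x) v)" for v
        by (rule Suc.IH) (use Suc.prems in fastforce)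
    qed
  qed
  show ?thesis
    unfolding smooth_on_def
  proof
    fix j show "Ck_on j S f"
      by (rule *) (use assms in \<open>unfold smooth_on_def, blast\<close>)
  qed
qed

lemma smooth_on_const: "open S \<Longrightarrow> smooth_on S (\<lambda>x. c)"
  by (simp add: smooth_on_iff_family smooth_family_param)

lemma smooth_on_bounded_linear: "open S \<Longrightarrow> bounded_linear L \<Longrightarrow> smooth_on S L"
  by (simp add: smooth_on_iff_family smooth_family_bounded_linear)

lemma smooth_on_id: "open S \<Longrightarrow> smooth_on S (\<lambda>x. x)"
  by (rule smooth_on_bounded_linear) (auto intro: bounded_linear_ident)

lemma smooth_on_add:
  "open S \<Longrightarrow> smooth_on S f \<Longrightarrow> smooth_on S g \<Longrightarrow> smooth_on S (\<lambda>x. f x + g x)"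
  by (simp add: smooth_on_iff_family smooth_family_add)

lemma smooth_on_linear_compose:
  "open S \<Longrightarrow> bounded_linear L \<Longrightarrow> smooth_on S f \<Longrightarrow> smooth_on S (\<lambda>x. L (f x))"
  using smooth_family_linear_compose[of S L "{0::real}" "\<lambda>_. f"] by (simp add: smooth_on_iff_family)

lemma smooth_on_minus: "open S \<Longrightarrow> smooth_on S f \<Longrightarrow> smooth_on S (\<lambda>x. - f x)"
  by (rule smooth_on_linear_compose) (auto intro: bounded_linear_minus bounded_linear_ident)

lemma smooth_on_diff:
  "open S \<Longrightarrow> smooth_on S f \<Longrightarrow> smooth_on S g \<Longrightarrow> smooth_on S (\<lambda>x. f x - g x)"
  using smooth_on_add[of S f "\<lambda>x. - g x"] smooth_on_minus[of S g] by simp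

lemma smooth_on_bilinear:
  "bounded_bilinear bil \<Longrightarrow> open S \<Longrightarrow> smooth_on S f \<Longrightarrow> smooth_on S g
     \<Longrightarrow> smooth_on S (\<lambda>x. bil (f x) (g x))"
  using smooth_family_bilinear[of bil S "{0::real}" "\<lambda>_. f" "\<lambda>_. g"] by (simp add: smooth_on_iff_family)

lemmas smooth_on_scaleR = smooth_on_bilinear[OF bounded_bilinear_scaleR]
lemmas smooth_on_inner = smooth_on_bilinear[OF bounded_bilinear_inner]
lemmas smooth_on_mult = smooth_on_bilinear[OF bounded_bilinear_mult]

lemma smooth_on_sum:
  "open S \<Longrightarrow> (\<And>i. i \<in> I \<Longrightarrow> smooth_on S (f i)) \<Longrightarrow> smooth_on S (\<lambda>x. \<Sum>i\<in>I. f i x)"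
  by (simp add: smooth_on_iff_family smooth_family_sum[where f = "\<lambda>i _. f i"])

lemma smooth_on_compose:
  "open S \<Longrightarrow> open R \<Longrightarrow> smooth_on S f \<Longrightarrow> smooth_on R g \<Longrightarrow> (\<And>x. x \<in> S \<Longrightarrow> f x \<in> R)
     \<Longrightarrow> smooth_on S (\<lambda>x. g (f x))"
  by (simp add: smooth_on_iff_family smooth_family_compose[where f = "\<lambda>_. f" and g = "\<lambda>_. g"])

lemmas smooth_on_intros = smooth_on_const smooth_on_id smooth_on_add smooth_on_diff smooth_on_minus
  smooth_on_scaleR smooth_on_inner smooth_on_mult smooth_on_sum

lemma smooth_on_differentiable: "smooth_on S f \<Longrightarrow> x \<in> S \<Longrightarrow> f differentiable (at x)"
  unfolding smooth_on_def by (metis Ck_on.simps(2))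

lemma smooth_on_has_derivative:
  "smooth_on S f \<Longrightarrow> x \<in> S \<Longrightarrow> (f has_derivative frechet_derivative f (at x)) (at x)"
  using smooth_on_differentiable frechet_derivative_works by blast

lemma smooth_on_linear_derivative:
  "smooth_on S f \<Longrightarrow> x \<in> S \<Longrightarrow> linear (frechet_derivative f (at x))"
  using smooth_on_differentiable linear_frechet_derivative by blast

lemma smooth_on_deriv: "smooth_on S f \<Longrightarrow> smooth_on S (\<lambda>x. frechet_derivative f (at x) v)"
  unfolding smooth_on_def by (metis Ck_on.simps(2))

lemma smooth_on_continuous: "smooth_on S f \<Longrightarrow> continuous_on S f"
  unfolding smooth_on_def by (metis Ck_on.simps(1))

lemma smooth_on_linear_apply:
  fixes M :: "'a::euclidean_space \<Rightarrow> 'b::euclidean_space \<Rightarrow> 'c::euclidean_space"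
  assumes "open S" "\<And>x. x \<in> S \<Longrightarrow> linear (M x)" "\<And>v. smooth_on S (\<lambda>x. M x v)" "smooth_on S g"
  shows "smooth_on S (\<lambda>x. M x (g x))"
proof (rule smooth_on_cong[OF assms(1)])
  show "smooth_on S (\<lambda>x. \<Sum>b\<in>Basis. (g x \<bullet> b) *\<^sub>R M x b)"
    by (intro smooth_on_intros assms)
  show "(\<Sum>b\<in>Basis. (g x \<bullet> b) *\<^sub>R M x b) = M x (g x)" if "x \<in> S" for x
    using linear_sum[OF assms(2)[OF that], of "\<lambda>b. (g x \<bullet> b) *\<^sub>R b" Basis]
    by (simp add: linear_cmul[OF assms(2)[OF that]] euclidean_representation)
qed

lemma frechet_derivative_compose_smooth:
  assumes "smooth_on S f" "x \<in> S" "smooth_on R g" "f x \<in> R"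
  shows "frechet_derivative (\<lambda>x. g (f x)) (at x) v
       = frechet_derivative g (at (f x)) (frechet_derivative f (at x) v)"
proof -
  have "((g \<circ> f) has_derivative frechet_derivative g (at (f x)) \<circ> frechet_derivative f (at x)) (at x)"
    using assms by (intro diff_chain_at smooth_on_has_derivative) auto
  then show ?thesis unfolding o_def using frechet_derivative_at by (metis (no_types, lifting))
qed

subsection \<open>Differentiation under the integral sign\<close>

lemma has_derivative_integral_family:
  fixes f :: "real \<Rightarrow> 'a::euclidean_space \<Rightarrow> 'b::euclidean_space"
  assumes "open S" "Ck_family {0..1} (Suc j) S f" "x \<in> S"
  shows "((\<lambda>x. integral {0..1} (\<lambda>t. f t x)) has_derivative
           (\<lambda>v. integral {0..1} (\<lambda>t. frechet_derivative (f t) (at x) v))) (at x)"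
proof -
  obtain e where e: "e > 0" "ball x e \<subseteq> S" using assms openE by blast
  define D where "D = (\<lambda>x t. Blinfun (frechet_derivative (f t) (at x)))"
  have bl: "bounded_linear (frechet_derivative (f t) (at x))" if "t \<in> {0..1}" "x \<in> S" for t x
    using Ck_family_deriv[OF assms(2) that] has_derivative_bounded_linear by blast
  have D: "blinfun_apply (D x t) = frechet_derivative (f t) (at x)" if "t \<in> {0..1}" "x \<in> S" for t x
    unfolding D_def using bl[OF that] by (rule bounded_linear_Blinfun_apply)
  have swap: "continuous_on (S \<times> {0..1}) (\<lambda>p. h (snd p) (fst p))"
    if "continuous_on ({0..1} \<times> S) (\<lambda>p. h (fst p) (snd p))" for h :: "real \<Rightarrow> 'a \<Rightarrow> 'b"
  proof -
    have "continuous_on (S \<times> {0..1}) (\<lambda>p. h (fst (snd p, fst p)) (snd (snd p, fst p)))"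
      by (rule continuous_on_compose2[OF that]) (auto intro!: continuous_intros)
    then show ?thesis by simp
  qed
  have cD: "continuous_on (S \<times> {0..1}) (\<lambda>(x, t). D x t)"
  proof (rule continuous_on_blinfun_componentwise)
    fix i :: 'a
    have "continuous_on ({0..1} \<times> S) (\<lambda>p. frechet_derivative (f (fst p)) (at (snd p)) i)"
      using assms(2) by (auto dest: Ck_family_continuous)
    from swap[OF this]
    show "continuous_on (S \<times> {0..1}) (\<lambda>p. blinfun_apply (case p of (x, t) \<Rightarrow> D x t) i)"
      by (rule continuous_on_eq) (auto simp: D)
  qed
  have ci: "continuous_on {0..1} (\<lambda>t. f t y)" if "y \<in> S" for y
    by (rule continuous_on_compose_pair[OF Ck_family_continuous[OF assms(2)]])
       (use that in \<open>auto intro: continuous_intros\<close>)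
  have "((\<lambda>x. integral (cbox 0 1) (\<lambda>t. f t x)) has_derivative integral (cbox 0 1) (D x))
      (at x within ball x e)"
  proof (rule leibniz_rule)
    show "((\<lambda>x. f t x) has_derivative blinfun_apply (D y t)) (at y within ball x e)"
      if "y \<in> ball x e" "t \<in> cbox 0 1" for y t
    proof -
      have "y \<in> S" "t \<in> {0..1}" using that e by auto
      then show ?thesis
        using D[of t y] Ck_family_deriv[OF assms(2), of t y] by (simp add: has_derivative_at_withinI)
    qed
    show "(\<lambda>t. f t y) integrable_on cbox 0 1" if "y \<in> ball x e" for y
      using ci[of y] that e by (auto intro!: integrable_continuous_interval)
    show "continuous_on (ball x e \<times> cbox 0 1) (\<lambda>(x, t). D x t)"
      using cD by (rule continuous_on_subset) (use e in auto)
  qed (use e in auto)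
  note L = this
  have 1: "((\<lambda>x. integral {0..1} (\<lambda>t. f t x)) has_derivative integral {0..1} (D x)) (at x)"
  proof -
    have "at x within ball x e = at x" by (rule at_within_open) (simp_all add: e(1))
    then show ?thesis using L unfolding cbox_interval by metis
  qed
  have "D x integrable_on {0..1}"
  proof (rule integrable_continuous_interval)
    have "continuous_on (S \<times> {0..1}) (\<lambda>p. D (fst p) (snd p))"
      using cD by (simp add: case_prod_unfold)
    then show "continuous_on {0..1} (D x)"
      by (rule continuous_on_compose_pair[where a = "\<lambda>_. x" and b = "\<lambda>t. t"])
        (simp_all add: assms(3) continuous_on_id)
  qed
  then have 2: "blinfun_apply (integral {0..1} (D x)) v = integral {0..1} (\<lambda>t. blinfun_apply (D x t) v)" for v
    by (rule blinfun_apply_integral)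
  have 3: "integral {0..1} (\<lambda>t. blinfun_apply (D x t) v)
      = integral {0..1} (\<lambda>t. frechet_derivative (f t) (at x) v)" for v
    by (rule integral_cong) (simp add: D assms(3))
  show ?thesis using 1 unfolding 2 3 .
qed

lemma Ck_family_integral:
  fixes f :: "real \<Rightarrow> 'a::euclidean_space \<Rightarrow> 'b::euclidean_space"
  assumes "open S" "Ck_family {0..1} j S f"
  shows "Ck_family {0::real} j S (\<lambda>_ x. integral {0..1} (\<lambda>t. f t x))"
proof -
  have cont: "continuous_on ({0::real} \<times> S) (\<lambda>p. integral {0..1} (\<lambda>t. f t (snd p)))"
    if "continuous_on ({0..1} \<times> S) (\<lambda>p. f (fst p) (snd p))" for f :: "real \<Rightarrow> 'a \<Rightarrow> 'b"
  proof -
    have "continuous_on (S \<times> cbox 0 1) (\<lambda>(x, t). f t x)"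
    proof -
      have "continuous_on (S \<times> {0..1}) (\<lambda>p. f (fst (snd p, fst p)) (snd (snd p, fst p)))"
        by (rule continuous_on_compose2[OF that]) (auto intro!: continuous_intros)
      then show ?thesis by (simp add: case_prod_unfold)
    qed
    from integral_continuous_on_param[OF this]
    have "continuous_on S (\<lambda>x. integral {0..1} (\<lambda>t. f t x))" by simp
    then show ?thesis
      by (rule continuous_on_snd)
  qed
  show ?thesis using assms(2)
  proof (induction j arbitrary: f)
    case 0
    then show ?case using cont[of f] by simp
  next
    case (Suc j)
    show ?case
    proof (rule Ck_family_SucI[OF assms(1)])
      show "Ck_family {0::real} j S (\<lambda>t x. integral {0..1} (\<lambda>t. frechet_derivative (f t) (at x) v))" for v
        by (rule Suc.IH) (use Suc.prems in auto)
      show "continuous_on ({0::real} \<times> S) (\<lambda>p. integral {0..1} (\<lambda>t. f t (snd p)))"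
        by (rule cont[OF Ck_family_continuous[OF Suc.prems]])
    qed (rule has_derivative_integral_family[OF assms(1) Suc.prems])
  qed
qed

lemma smooth_on_integral:
  fixes f :: "real \<Rightarrow> 'a::euclidean_space \<Rightarrow> 'b::euclidean_space"
  shows "open S \<Longrightarrow> smooth_family {0..1} S f \<Longrightarrow> smooth_on S (\<lambda>x. integral {0..1} (\<lambda>t. f t x))"
  by (simp add: smooth_on_iff_family smooth_family_def Ck_family_integral)

lemma frechet_derivative_integral:
  fixes f :: "real \<Rightarrow> 'a::euclidean_space \<Rightarrow> 'b::euclidean_space"
  assumes "open S" "smooth_family {0..1} S f" "x \<in> S"
  shows "frechet_derivative (\<lambda>x. integral {0..1} (\<lambda>t. f t x)) (at x) v
      = integral {0..1} (\<lambda>t. frechet_derivative (f t) (at x) v)"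
proof -
  have "Ck_family {0..1} (Suc 0) S f" using assms(2) unfolding smooth_family_def by blast
  from has_derivative_integral_family[OF assms(1) this assms(3)] show ?thesis
    using frechet_derivative_at by (metis (no_types, lifting))
qed

section \<open>The smooth inverse function theorem\<close>

lemma has_derivative_scaleR_null:
  fixes g :: "'a::real_normed_vector \<Rightarrow> real" and k :: "'a \<Rightarrow> 'b::real_normed_vector"
  assumes g: "(g has_derivative g') (at x)" "g x = 0" and k: "isCont k x"
  shows "((\<lambda>y. g y *\<^sub>R k y) has_derivative (\<lambda>h. g' h *\<^sub>R k x)) (at x)"
proof -
  have bl: "bounded_linear g'" using g(1) by (rule has_derivative_bounded_linear)
  obtain B where B: "B > 0" "\<And>h. norm (g' h) \<le> norm h * B"
    using bounded_linear.pos_bounded[OF bl] by blast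
  obtain d1 where d1: "d1 > 0" "\<And>y. norm (y - x) < d1 \<Longrightarrow> norm (g y - g' (y - x)) \<le> norm (y - x)"
    using g unfolding has_derivative_at_alt by (auto dest!: spec[of _ "1::real"])
  have gb: "norm (g y) \<le> (1 + B) * norm (y - x)" if "norm (y - x) < d1" for y
    using d1(2)[OF that] B(2)[of "y - x"] norm_triangle_sub[of "g y" "g' (y - x)"]
    by (simp add: algebra_simps)
  have "((\<lambda>y. g y *\<^sub>R (k y - k x)) has_derivative (\<lambda>h. 0)) (at x)"
    unfolding has_derivative_at_alt
  proof (intro conjI allI impI)
    fix e :: real assume "e > 0"
    then have "e / (1 + B) > 0" using B(1) by simp
    then obtain d2 where d2: "d2 > 0" "\<And>y. norm (y - x) < d2 \<Longrightarrow> norm (k y - k x) < e / (1 + B)"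
      using k unfolding continuous_at_eps_delta dist_norm by blast
    show "\<exists>d>0. \<forall>y. norm (y - x) < d \<longrightarrow>
        norm (g y *\<^sub>R (k y - k x) - g x *\<^sub>R (k x - k x) - 0) \<le> e * norm (y - x)"
    proof (intro exI[of _ "min d1 d2"] conjI allI impI)
      fix y assume y: "norm (y - x) < min d1 d2"
      have "norm (g y) * norm (k y - k x) \<le> ((1 + B) * norm (y - x)) * (e / (1 + B))"
        using gb[of y] d2(2)[of y] y B(1) by (intro mult_mono) simp_all
      also have "\<dots> = e * norm (y - x)" using B(1) by simp
      finally show "norm (g y *\<^sub>R (k y - k x) - g x *\<^sub>R (k x - k x) - 0) \<le> e * norm (y - x)"
        by simp
    qed (use d1 d2 in simp)
  qed simp
  moreover have "((\<lambda>y. g y *\<^sub>R k x) has_derivative (\<lambda>h. g' h *\<^sub>R k x)) (at x)"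
    using g(1) by (rule has_derivative_scaleR_left)
  ultimately have "((\<lambda>y. g y *\<^sub>R (k y - k x) + g y *\<^sub>R k x) has_derivative
      (\<lambda>h. 0 + g' h *\<^sub>R k x)) (at x)"
    by (rule has_derivative_add)
  then show ?thesis by (simp add: algebra_simps)
qed

lemma linear_sum_Basis:
  fixes f :: "'a::euclidean_space \<Rightarrow> 'b::real_vector"
  assumes "linear f"
  shows "f v = (\<Sum>b\<in>Basis. (v \<bullet> b) *\<^sub>R f b)"
proof -
  have "f v = f (\<Sum>b\<in>Basis. (v \<bullet> b) *\<^sub>R b)" by (simp add: euclidean_representation)
  also have "\<dots> = (\<Sum>b\<in>Basis. (v \<bullet> b) *\<^sub>R f b)"
    by (simp add: linear_sum[OF assms] linear_cmul[OF assms])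
  finally show ?thesis .
qed

lemma linear_norm_le_Basis:
  fixes f :: "'a::euclidean_space \<Rightarrow> 'b::real_normed_vector"
  assumes "linear f"
  shows "norm (f v) \<le> (\<Sum>b\<in>Basis. norm (f b)) * norm v"
proof -
  have "norm (f v) \<le> (\<Sum>b\<in>Basis. norm ((v \<bullet> b) *\<^sub>R f b))"
    unfolding linear_sum_Basis[OF assms, of v] by (rule norm_sum)
  also have "\<dots> \<le> (\<Sum>b\<in>Basis. norm (f b) * norm v)"
  proof (rule sum_mono)
    fix b :: 'a assume "b \<in> Basis"
    then have "\<bar>v \<bullet> b\<bar> * norm (f b) \<le> norm v * norm (f b)"
      by (intro mult_right_mono Basis_le_norm) simp_all
    then show "norm ((v \<bullet> b) *\<^sub>R f b) \<le> norm (f b) * norm v" by (simp add: mult.commute)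
  qed
  finally show ?thesis by (simp add: sum_distrib_right)
qed

context
  fixes S :: "'a::euclidean_space set" and M N :: "'a \<Rightarrow> 'b::euclidean_space \<Rightarrow> 'b"
  assumes op: "open S"
    and linM: "\<And>x. x \<in> S \<Longrightarrow> linear (M x)" and linN: "\<And>x. x \<in> S \<Longrightarrow> linear (N x)"
    and MN: "\<And>x w. x \<in> S \<Longrightarrow> M x (N x w) = w" and NM: "\<And>x w. x \<in> S \<Longrightarrow> N x (M x w) = w"
begin

lemma linear_inverse_continuous:
  assumes M: "\<And>v. continuous_on S (\<lambda>x. M x v)" and x0: "x0 \<in> S"
  shows "isCont (\<lambda>x. N x w) x0"
proof -
  obtain C where C: "C > 0" "\<And>v. norm (N x0 v) \<le> C * norm v"
    using linear_bounded_pos[OF linN[OF x0]] by blast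
  have cM: "isCont (\<lambda>x. M x v) x0" for v
    using M[of v] op x0 by (simp add: continuous_on_eq_continuous_at)
  define m where "m x = (\<Sum>b\<in>Basis. norm (M x b - M x0 b))" for x
  have "isCont m x0"
    unfolding m_def by (intro continuous_intros cM)
  then have "(m \<longlongrightarrow> 0) (at x0)"
    by (simp add: isCont_def m_def)
  then have "\<forall>\<^sub>F x in at x0. m x < 1 / (2 * C)"
  proof (rule order_tendstoD(2))
    show "0 < 1 / (2 * C)" using C(1) by simp
  qed
  moreover have "\<forall>\<^sub>F x in at x0. x \<in> S" using op x0 by (rule eventually_at_in_open')
  ultimately have ev: "\<forall>\<^sub>F x in at x0. norm (N x w - N x0 w)
      \<le> 2 * C * norm (M x0 (N x0 w) - M x (N x0 w))"
  proof eventually_elim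
    case (elim x)
    define u where "u = N x w - N x0 w"
    have "norm (M x u - M x0 u) \<le> m x * norm u"
      using linear_norm_le_Basis[OF linear_compose_sub[OF linM[OF elim(2)] linM[OF x0]]]
      by (simp add: m_def)
    also have "\<dots> \<le> 1 / (2 * C) * norm u" using elim(1) by (intro mult_right_mono) simp_all
    finally have 1: "norm (M x u - M x0 u) \<le> 1 / (2 * C) * norm u" .
    have "norm u \<le> C * norm (M x0 u)" using C(2)[of "M x0 u"] NM[OF x0] by simp
    also have "\<dots> \<le> C * (norm (M x u) + 1 / (2 * C) * norm u)"
      using 1 C(1) norm_triangle_sub[of "M x0 u" "M x u"]
      by (intro mult_left_mono) (simp_all add: norm_minus_commute)
    also have "\<dots> = C * norm (M x u) + norm u / 2" using C(1) by (simp add: field_simps)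
    finally have "norm u \<le> 2 * C * norm (M x u)" by simp
    moreover have "M x u = M x0 (N x0 w) - M x (N x0 w)"
      unfolding u_def by (simp add: linear_diff[OF linM[OF elim(2)]] MN[OF elim(2)] MN[OF x0])
    ultimately show ?case by (simp add: u_def)
  qed
  have "isCont (\<lambda>x. 2 * C * norm (M x0 (N x0 w) - M x (N x0 w))) x0"
    by (intro continuous_intros cM)
  then have "((\<lambda>x. 2 * C * norm (M x0 (N x0 w) - M x (N x0 w))) \<longlongrightarrow> 0) (at x0)"
    by (simp add: isCont_def)
  with ev have "((\<lambda>x. N x w - N x0 w) \<longlongrightarrow> 0) (at x0)"
    by (rule Lim_null_comparison)
  then show ?thesis by (simp add: isCont_def LIM_zero_iff)
qed

text \<open>Differentiating \<open>M x (N x w) = w\<close> gives \<open>DN = - N \<circ> DM \<circ> N\<close>; the double sum is this expression in the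
  standard basis.\<close>

lemma linear_inverse_has_derivative:
  assumes M: "\<And>v. continuous_on S (\<lambda>x. M x v)" and x0: "x0 \<in> S"
    and dM: "\<And>v. ((\<lambda>x. M x v) has_derivative M' v) (at x0)"
  shows "((\<lambda>x. N x w) has_derivative
     (\<lambda>h. - (\<Sum>b\<in>Basis. ((\<Sum>c\<in>Basis. (N x0 w \<bullet> c) *\<^sub>R M' c h) \<bullet> b) *\<^sub>R N x0 b))) (at x0)"
proof -
  define r where "r x = (\<Sum>c\<in>Basis. (N x0 w \<bullet> c) *\<^sub>R M x c) - w" for x
  have r: "r x = M x (N x0 w) - w" if "x \<in> S" for x
    unfolding r_def linear_sum_Basis[OF linM[OF that], of "N x0 w"] ..
  have r': "(r has_derivative (\<lambda>h. \<Sum>c\<in>Basis. (N x0 w \<bullet> c) *\<^sub>R M' c h)) (at x0)"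
    unfolding r_def
    by (rule has_derivative_eq_rhs)
       (rule has_derivative_diff has_derivative_sum has_derivative_scaleR_right dM has_derivative_const
        | simp)+
  have rx0: "r x0 = 0" using r[OF x0] MN[OF x0] by simp
  have "((\<lambda>x. N x0 w - (\<Sum>b\<in>Basis. (r x \<bullet> b) *\<^sub>R N x b)) has_derivative
     (\<lambda>h. 0 - (\<Sum>b\<in>Basis. ((\<Sum>c\<in>Basis. (N x0 w \<bullet> c) *\<^sub>R M' c h) \<bullet> b) *\<^sub>R N x0 b))) (at x0)"
  proof (intro has_derivative_diff has_derivative_const has_derivative_sum)
    fix b :: 'b assume "b \<in> Basis"
    show "((\<lambda>x. (r x \<bullet> b) *\<^sub>R N x b) has_derivative
        (\<lambda>h. ((\<Sum>c\<in>Basis. (N x0 w \<bullet> c) *\<^sub>R M' c h) \<bullet> b) *\<^sub>R N x0 b)) (at x0)"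
    proof (rule has_derivative_scaleR_null)
      show "((\<lambda>x. r x \<bullet> b) has_derivative
          (\<lambda>h. (\<Sum>c\<in>Basis. (N x0 w \<bullet> c) *\<^sub>R M' c h) \<bullet> b)) (at x0)"
        using r' by (rule has_derivative_inner_left)
      show "r x0 \<bullet> b = 0" using rx0 by simp
      show "isCont (\<lambda>x. N x b) x0" using M x0 by (rule linear_inverse_continuous)
    qed
  qed
  then have "((\<lambda>x. N x0 w - (\<Sum>b\<in>Basis. (r x \<bullet> b) *\<^sub>R N x b)) has_derivative
     (\<lambda>h. - (\<Sum>b\<in>Basis. ((\<Sum>c\<in>Basis. (N x0 w \<bullet> c) *\<^sub>R M' c h) \<bullet> b) *\<^sub>R N x0 b))) (at x0)"
    by simp
  then show ?thesis
  proof (rule has_derivative_transform_within_open[OF _ op x0])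
    fix x assume x: "x \<in> S"
    have "(\<Sum>b\<in>Basis. (r x \<bullet> b) *\<^sub>R N x b) = N x (r x)"
      using linear_sum_Basis[OF linN[OF x], of "r x"] by simp
    also have "\<dots> = N x0 w - N x w"
      by (simp add: r[OF x] linear_diff[OF linN[OF x]] NM[OF x])
    finally show "N x0 w - (\<Sum>b\<in>Basis. (r x \<bullet> b) *\<^sub>R N x b) = N x w" by simp
  qed
qed

text \<open>The formula for the derivative of \<open>N\<close> contains \<open>N\<close> itself and one derivative of \<open>M\<close>, which gains one
  order of differentiability per induction step.\<close>

lemma Ck_family_linear_inverse:
  "(\<And>v. Ck_family {0::real} j S (\<lambda>_ x. M x v)) \<Longrightarrow> Ck_family {0::real} j S (\<lambda>_ x. N x w)"
proof (induction j arbitrary: w)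
  case 0
  then have "continuous_on S (\<lambda>x. M x v)" for v
    using 0[of v] continuous_on_snd_iff[of S "\<lambda>x. M x v"] by simp
  then have "continuous_on S (\<lambda>x. N x w)"
    using linear_inverse_continuous op by (simp add: continuous_on_eq_continuous_at)
  from continuous_on_snd[OF this] show ?case by simp
next
  case (Suc j)
  have cM: "continuous_on S (\<lambda>x. M x v)" for v
    using Ck_family_continuous[OF Suc.prems[of v]] continuous_on_snd_iff[of S "\<lambda>x. M x v"] by simp
  have dM: "((\<lambda>x. M x v) has_derivative frechet_derivative (\<lambda>x. M x v) (at x)) (at x)"
    if "x \<in> S" for x v
    using Ck_family_deriv[OF Suc.prems[of v], of 0 x] that by simp
  have IH: "Ck_family {0::real} j S (\<lambda>_ x. N x w)" for w
    by (rule Suc.IH) (rule Ck_family_Suc_mono[OF Suc.prems])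
  show ?case
  proof (rule Ck_family_SucI[OF op])
    show "continuous_on ({0::real} \<times> S) (\<lambda>p. N (snd p) w)"
      using linear_inverse_continuous[OF cM] op
      by (intro continuous_on_snd) (simp add: continuous_on_eq_continuous_at)
    show "((\<lambda>x. N x w) has_derivative (\<lambda>h. - (\<Sum>b\<in>Basis. ((\<Sum>c\<in>Basis. (N x w \<bullet> c) *\<^sub>R
          frechet_derivative (\<lambda>x. M x c) (at x) h) \<bullet> b) *\<^sub>R N x b))) (at x)" if "x \<in> S" for x
      by (rule linear_inverse_has_derivative[OF cM that]) (rule dM[OF that])
    show "Ck_family {0::real} j S (\<lambda>_ x. - (\<Sum>b\<in>Basis. ((\<Sum>c\<in>Basis. (N x w \<bullet> c) *\<^sub>R
          frechet_derivative (\<lambda>x. M x c) (at x) v) \<bullet> b) *\<^sub>R N x b))" for v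
    proof (intro Ck_family_linear_compose[OF op bounded_linear_minus[OF bounded_linear_ident]]
          Ck_family_sum[OF op] Ck_family_bounded_bilinear[OF bounded_bilinear_scaleR op]
          Ck_family_linear_compose[OF op bounded_linear_inner_left] IH)
      show "Ck_family {0::real} j S (\<lambda>_ x. frechet_derivative (\<lambda>x. M x c) (at x) v)" for c
        using Suc.prems[of c] by simp
    qed
  qed
qed

lemma smooth_on_linear_inverse:
  assumes "\<And>v. smooth_on S (\<lambda>x. M x v)"
  shows "smooth_on S (\<lambda>x. N x w)"
  using assms Ck_family_linear_inverse unfolding smooth_on_iff_family[OF op] smooth_family_def by meson

end

lemma linear_injective_inverse:
  fixes f :: "'a::euclidean_space \<Rightarrow> 'a"
  assumes "linear f" "\<And>v. f v = 0 \<Longrightarrow> v = 0"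
  obtains g where "linear g" "\<And>v. g (f v) = v" "\<And>v. f (g v) = v"
proof -
  have "inj f" using assms by (simp add: linear_injective_0)
  then show thesis using linear_injective_isomorphism[OF assms(1)] that by metis
qed

definition diffeo :: "'a::euclidean_space set \<Rightarrow> 'a set \<Rightarrow> ('a \<Rightarrow> 'a) \<Rightarrow> ('a \<Rightarrow> 'a) \<Rightarrow> bool" where
  "diffeo W V f g \<longleftrightarrow> open W \<and> open V \<and> homeomorphism W V f g \<and> smooth_on W f \<and> smooth_on V g"

text \<open>The inverse \<open>g\<close> is differentiable with \<open>Dg = (Df \<circ> g)\<^sup>-\<^sup>1\<close>.  If \<open>g\<close> is \<open>j\<close> times continuously
  differentiable, then so is the right-hand side.\<close>

theorem smooth_inverse_function:
  fixes f :: "'a::euclidean_space \<Rightarrow> 'a"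
  assumes U: "open U" and f: "smooth_on U f" and p: "p \<in> U"
    and inj: "\<And>v. frechet_derivative f (at p) v = 0 \<Longrightarrow> v = 0"
  obtains W V g where "diffeo W V f g" "W \<subseteq> U" "p \<in> W"
proof -
  define f' where "f' x = Blinfun (frechet_derivative f (at x))" for x
  have f': "blinfun_apply (f' x) = frechet_derivative f (at x)" if "x \<in> U" for x
    unfolding f'_def using smooth_on_has_derivative[OF f that]
    by (intro bounded_linear_Blinfun_apply has_derivative_bounded_linear)
  have 1: "(f has_derivative blinfun_apply (f' x)) (at x)" if "x \<in> U" for x
    unfolding f'[OF that] by (rule smooth_on_has_derivative[OF f that])
  have 2: "continuous_on U f'"
  proof (rule continuous_on_blinfun_componentwise)
    fix i :: 'a
    have "continuous_on U (\<lambda>x. frechet_derivative f (at x) i)"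
      by (intro smooth_on_continuous smooth_on_deriv f)
    then show "continuous_on U (\<lambda>x. blinfun_apply (f' x) i)"
      by (rule continuous_on_eq) (simp add: f')
  qed
  obtain h where h: "linear h" "\<And>v. h (frechet_derivative f (at p) v) = v"
    using linear_injective_inverse[OF smooth_on_linear_derivative[OF f p] inj] by metis
  define invf where "invf = Blinfun h"
  have invf: "blinfun_apply invf = h"
    unfolding invf_def by (rule bounded_linear_Blinfun_apply) (simp add: h(1) linear_conv_bounded_linear[symmetric])
  have 3: "invf o\<^sub>L f' p = id_blinfun"
    by (rule blinfun_eqI) (simp add: invf f'[OF p] h(2))
  obtain W V g g' where W: "open W" "W \<subseteq> U" "p \<in> W" "open V" "f p \<in> V" "homeomorphism W V f g"
    and g': "\<And>y. y \<in> V \<Longrightarrow> (g has_derivative (g' y)) (at y)"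
    "\<And>y. y \<in> V \<Longrightarrow> g' y = inv (blinfun_apply (f' (g y)))"
    "\<And>y. y \<in> V \<Longrightarrow> bij (blinfun_apply (f' (g y)))"
    using inverse_function_theorem[OF U 1 2 p 3] by blast
  have gW: "g y \<in> W" if "y \<in> V" for y using W(6) that unfolding homeomorphism_def by blast
  then have gU: "g y \<in> U" if "y \<in> V" for y using W(2) that by blast
  define M where "M y = frechet_derivative f (at (g y))" for y
  have M: "blinfun_apply (f' (g y)) = M y" if "y \<in> V" for y
    using f'[OF gU[OF that]] by (simp add: M_def)
  have linM: "linear (M y)" if "y \<in> V" for y
    unfolding M_def by (rule smooth_on_linear_derivative[OF f gU[OF that]])
  have bijM: "bij (M y)" if "y \<in> V" for y using g'(3)[OF that] M[OF that] by simp
  have g'M: "g' y = inv (M y)" if "y \<in> V" for y using g'(2)[OF that] M[OF that] by simp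
  have ling': "linear (g' y)" if "y \<in> V" for y
    using g'(1)[OF that] by (rule has_derivative_linear)
  have Mg: "M y (g' y w) = w" if "y \<in> V" for y w
    using bijM[OF that] by (simp add: g'M[OF that] bij_inv_eq_iff[symmetric] bij_is_surj surj_f_inv_f)
  have gM: "g' y (M y w) = w" if "y \<in> V" for y w
    using bijM[OF that] by (simp add: g'M[OF that] bij_is_inj)
  have "Ck_family {0::real} j V (\<lambda>_. g)" for j
  proof (induction j)
    case 0
    have "continuous_on V g" using W(6) unfolding homeomorphism_def by blast
    then show ?case by (simp add: continuous_on_snd)
  next
    case (Suc j)
    have Mj: "Ck_family {0::real} j V (\<lambda>_ y. M y v)" for v
      unfolding M_def
    proof (rule Ck_family_compose[where f = "\<lambda>_. g" and g = "\<lambda>_ x. frechet_derivative f (at x) v"])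
      show "Ck_family {0::real} j U (\<lambda>_ x. frechet_derivative f (at x) v)"
        using smooth_on_deriv[OF f, of v] U by (simp add: smooth_on_iff_family smooth_family_def)
    qed (use W U gU Suc.IH in blast)+
    show ?case
    proof (rule Ck_family_SucI[OF W(4)])
      have "continuous_on V g" using W(6) unfolding homeomorphism_def by blast
      then show "continuous_on ({0::real} \<times> V) (\<lambda>p. g (snd p))" by (rule continuous_on_snd)
      show "Ck_family {0::real} j V (\<lambda>_ y. g' y v)" for v
        by (rule Ck_family_linear_inverse[OF W(4) linM ling' Mg gM Mj])
    qed (rule g'(1))
  qed
  then have "smooth_on V g"
    unfolding smooth_on_iff_family[OF W(4)] smooth_family_def by blast
  then have "diffeo W V f g"
    unfolding diffeo_def using W smooth_on_subset[OF f W(2)] by blast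
  then show thesis using that W by blast
qed

lemma diffeoD:
  assumes "diffeo W V f g"
  shows "open W" "open V" "smooth_on W f" "smooth_on V g"
    "\<And>x. x \<in> W \<Longrightarrow> f x \<in> V" "\<And>y. y \<in> V \<Longrightarrow> g y \<in> W"
    "\<And>x. x \<in> W \<Longrightarrow> g (f x) = x" "\<And>y. y \<in> V \<Longrightarrow> f (g y) = y" "f ` W = V" "g ` V = W"
  using assms unfolding diffeo_def homeomorphism_def by blast+

lemma diffeo_sym: "diffeo W V f g \<Longrightarrow> diffeo V W g f"
  unfolding diffeo_def using homeomorphism_symD by blast

lemma diffeo_derivative_inverse:
  assumes "diffeo W V f g" "x \<in> W"
  shows "frechet_derivative g (at (f x)) (frechet_derivative f (at x) v) = v"
proof -
  note d = diffeoD[OF assms(1)]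
  have "frechet_derivative (\<lambda>x. g (f x)) (at x) v
      = frechet_derivative g (at (f x)) (frechet_derivative f (at x) v)"
    by (rule frechet_derivative_compose_smooth[OF d(3) assms(2) d(4) d(5)[OF assms(2)]])
  moreover have "frechet_derivative (\<lambda>x. g (f x)) (at x) = frechet_derivative (\<lambda>x. x) (at x)"
    by (rule frechet_derivative_cong_open[OF d(1) assms(2)]) (rule d(7))
  ultimately show ?thesis by (simp add: frechet_derivative_ident)
qed

lemma diffeo_derivative_inverse':
  assumes "diffeo W V f g" "x \<in> W"
  shows "frechet_derivative f (at x) (frechet_derivative g (at (f x)) w) = w"
  using diffeo_derivative_inverse[OF diffeo_sym[OF assms(1)], of "f x" w] diffeoD(5,7)[OF assms(1,2)]
  by simp

lemma diffeo_subset: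
  assumes "diffeo W V f g" "open W'" "W' \<subseteq> W"
  shows "diffeo W' (f ` W') f g"
proof -
  note d = diffeoD[OF assms(1)]
  have "f ` W' = V \<inter> g -` W'" using d(5-8) assms(3) by force
  moreover have "open (V \<inter> g -` W')"
    using continuous_open_preimage[OF smooth_on_continuous[OF d(4)] d(2) assms(2)] .
  ultimately have o: "open (f ` W')" by simp
  have s: "f ` W' \<subseteq> V" using d(5) assms(3) by blast
  have "homeomorphism W' (f ` W') f g"
    using assms(1,3) unfolding diffeo_def by (blast intro: homeomorphism_of_subsets)
  then show ?thesis
    unfolding diffeo_def using o assms(2) smooth_on_subset[OF d(3) assms(3)] smooth_on_subset[OF d(4) s]
    by blast
qed

lemma diffeo_compose:
  assumes "diffeo W V f g" "diffeo V X h k"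
  shows "diffeo W X (\<lambda>x. h (f x)) (\<lambda>x. g (k x))"
proof -
  note d = diffeoD[OF assms(1)] and e = diffeoD[OF assms(2)]
  have "homeomorphism W X (h \<circ> f) (g \<circ> k)"
    using assms unfolding diffeo_def by (blast intro: homeomorphism_compose)
  then show ?thesis
    unfolding diffeo_def o_def
    using smooth_on_compose[OF d(1) e(1) d(3) e(3) d(5)] smooth_on_compose[OF e(2) e(1) e(4) d(4) e(6)]
      d(1) e(2) by blast
qed

section \<open>Smooth dependence of solutions of integral equations on parameters\<close>

text \<open>The assumption is applied at a point where \<open>norm (g t)\<close> is maximal.  This is the substitute for
  Gronwall's inequality.\<close>

lemma sup_contraction:
  fixes g :: "real \<Rightarrow> 'b::real_normed_vector"
  assumes "continuous_on {0..1} g"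
    and step: "\<And>t B. t \<in> {0..1} \<Longrightarrow> (\<And>s. s \<in> {0..1} \<Longrightarrow> norm (g s) \<le> B) \<Longrightarrow> norm (g t) \<le> c + r * B"
    and "r < 1" "t \<in> {0..1}"
  shows "norm (g t) \<le> c / (1 - r)"
proof -
  have "continuous_on {0..1} (\<lambda>t. norm (g t))" using assms(1) by (rule continuous_on_norm)
  then obtain x where x: "x \<in> {0..1}" "\<And>s. s \<in> {0..1} \<Longrightarrow> norm (g s) \<le> norm (g x)"
    using continuous_attains_sup[of "{0..1::real}" "\<lambda>t. norm (g t)"] by auto
  have "norm (g x) \<le> c + r * norm (g x)" using step[OF x(1)] x(2) by blast
  then have "norm (g x) \<le> c / (1 - r)" using assms(3) by (simp add: field_simps)
  then show ?thesis using x(2)[OF assms(4)] by linarith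
qed

lemma mult_unit_interval: "t \<in> {0..1::real} \<Longrightarrow> s \<in> {0..1} \<Longrightarrow> t * s \<in> {0..1}"
  by (simp add: mult_le_one)

lemma scaled_integral_bound:
  fixes h :: "real \<Rightarrow> 'b::euclidean_space"
  assumes "t \<in> {0..1}" "continuous_on {0..1} (\<lambda>s. h (t * s))"
    "\<And>s. s \<in> {0..1} \<Longrightarrow> norm (h s) \<le> B"
  shows "norm (t *\<^sub>R integral {0..1} (\<lambda>s. h (t * s))) \<le> B"
proof -
  have "norm (integral {0..1} (\<lambda>s. h (t * s))) \<le> B * (1 - 0)"
    using assms(2) by (rule integral_bound[OF zero_le_one]) (rule assms(3)[OF mult_unit_interval[OF assms(1)]])
  then have "\<bar>t\<bar> * norm (integral {0..1} (\<lambda>s. h (t * s))) \<le> 1 * B"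
    using assms(1) by (intro mult_mono) simp_all
  then show ?thesis by simp
qed

text \<open>The equation is \<open>\<phi> t = a + \<integral>\<^sub>0\<^sup>t F s (\<phi> s) ds\<close>, with the integral rescaled to \<open>{0..1}\<close> so that the domain of
  integration does not depend on \<open>t\<close>.  The Picard iterates converge uniformly for \<open>t \<in> {0..1}\<close> and \<open>z\<close> in a
  compact ball, so their limit is continuous in both variables.\<close>

lemma picard_existence:
  fixes F :: "real \<Rightarrow> 'z::euclidean_space \<Rightarrow> 'b::euclidean_space \<Rightarrow> 'b"
  assumes W: "open W"
    and cF: "continuous_on (({0..1} \<times> W) \<times> UNIV) (\<lambda>p. F (fst (fst p)) (snd (fst p)) (snd p))"
    and ca: "continuous_on W a"
    and Lip: "\<And>s z y y'. s \<in> {0..1} \<Longrightarrow> z \<in> W \<Longrightarrow> norm (F s z y - F s z y') \<le> 1/2 * norm (y - y')"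
  shows "\<exists>\<phi>. continuous_on ({0..1} \<times> W) (\<lambda>p. \<phi> (fst p) (snd p)) \<and> (\<forall>t\<in>{0..1}. \<forall>z\<in>W.
       \<phi> t z = a z + t *\<^sub>R integral {0..1} (\<lambda>s. F (t * s) z (\<phi> (t * s) z)))"
proof -
  define T where "T \<psi> p = a (snd p) + fst p *\<^sub>R integral {0..1} (\<lambda>s. F (fst p * s) (snd p) (\<psi> (fst p * s, snd p)))"
    for \<psi> :: "real \<times> 'z \<Rightarrow> 'b" and p
  let ?D = "{0..1::real} \<times> W"
  have cH: "continuous_on (?D \<times> {0..1}) (\<lambda>q. F (fst (fst q) * snd q) (snd (fst q)) (\<psi> (fst (fst q) * snd q, snd (fst q))))"
    if "continuous_on ?D \<psi>" for \<psi>
  proof -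
    have m: "(fst (fst q) * snd q, snd (fst q)) \<in> ?D" if "q \<in> ?D \<times> {0..1}" for q
      using that by (auto intro: mult_le_one)
    have "continuous_on (?D \<times> {0..1}) (\<lambda>q. \<psi> (fst (fst q) * snd q, snd (fst q)))"
      by (rule continuous_on_compose2[OF that]) (use m in \<open>auto intro!: continuous_intros\<close>)
    then show ?thesis
      by (intro continuous_on_compose_pair[OF cF[folded fst_conv snd_conv],
          where a = "\<lambda>q. (fst (fst q) * snd q, snd (fst q))", simplified])
        (use m in \<open>auto intro!: continuous_intros\<close>)
  qed
  have cT: "continuous_on ?D (T \<psi>)" if "continuous_on ?D \<psi>" for \<psi>
  proof -
    have "continuous_on ?D (\<lambda>p. integral (cbox 0 1) (\<lambda>s. F (fst p * s) (snd p) (\<psi> (fst p * s, snd p))))"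
      by (rule integral_continuous_on_param) (use cH[OF that] in \<open>simp add: case_prod_unfold\<close>)
    moreover have "continuous_on ?D (\<lambda>p. a (snd p))" using ca by (rule continuous_on_snd)
    ultimately show ?thesis unfolding T_def by (auto intro!: continuous_intros)
  qed
  have ci: "continuous_on {0..1} (\<lambda>s. F (fst p * s) (snd p) (\<psi> (fst p * s, snd p)))"
    if "continuous_on ?D \<psi>" "p \<in> ?D" for \<psi> p
  proof -
    have "continuous_on {0..1} (\<lambda>s::real. (p, s))" by (intro continuous_intros)
    from continuous_on_compose2[OF cH[OF that(1)] this] that(2) show ?thesis by auto
  qed
  have contr: "norm (T \<psi> (t, z) - T \<psi>' (t, z)) \<le> 1/2 * B"
    if c: "continuous_on ?D \<psi>" "continuous_on ?D \<psi>'" and tz: "t \<in> {0..1}" "z \<in> W"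
      and B: "\<And>s. s \<in> {0..1} \<Longrightarrow> norm (\<psi> (s, z) - \<psi>' (s, z)) \<le> B" for \<psi> \<psi>' t z B
  proof -
    define h where "h s = F s z (\<psi> (s, z)) - F s z (\<psi>' (s, z))" for s
    have p: "(t, z) \<in> ?D" using tz by simp
    note i = ci[OF c(1) p, simplified] ci[OF c(2) p, simplified]
    have ch: "continuous_on {0..1} (\<lambda>s. h (t * s))" unfolding h_def by (intro continuous_intros i)
    have eq: "T \<psi> (t, z) - T \<psi>' (t, z) = t *\<^sub>R integral {0..1} (\<lambda>s. h (t * s))"
      unfolding T_def h_def
      by (simp add: integral_diff[OF i[THEN integrable_continuous_interval]] scaleR_diff_right)
    have hB: "norm (h s) \<le> 1/2 * B" if "s \<in> {0..1}" for s
      using Lip[OF that tz(2), of "\<psi> (s, z)" "\<psi>' (s, z)"] B[OF that] unfolding h_def by linarith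
    show ?thesis unfolding eq by (rule scaled_integral_bound[OF tz(1) ch hB])
  qed
  define P where "P n = (T ^^ n) (\<lambda>p. a (snd p))" for n
  have PS: "P (Suc n) = T (P n)" for n by (simp add: P_def)
  have cP: "continuous_on ?D (P n)" for n
  proof (induction n)
    case 0
    then show ?case unfolding P_def using continuous_on_snd[OF ca] by simp
  next
    case (Suc n)
    then show ?case unfolding PS by (rule cT)
  qed
  define \<phi> where "\<phi> p = P 0 p + (\<Sum>i. P (Suc i) p - P i p)" for p
  have unif: "uniform_limit ({0..1} \<times> cball z e) P \<phi> sequentially"
    if e: "cball z e \<subseteq> W" for z e
  proof -
    let ?K = "{0..1::real} \<times> cball z e"
    have KD: "?K \<subseteq> ?D" using e by blast
    have "compact ?K" by (intro compact_Times) simp_all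
    moreover have "continuous_on ?K (\<lambda>p. P 1 p - P 0 p)"
      by (intro continuous_intros continuous_on_subset[OF cP KD])
    ultimately have "bounded ((\<lambda>p. P 1 p - P 0 p) ` ?K)"
      by (intro compact_imp_bounded compact_continuous_image)
    then obtain B where B: "\<And>p. p \<in> ?K \<Longrightarrow> norm (P 1 p - P 0 p) \<le> B"
      unfolding bounded_iff by blast
    have bd: "norm (P (Suc n) p - P n p) \<le> B * (1/2) ^ n" if "p \<in> ?K" for n p
      using that
    proof (induction n arbitrary: p)
      case 0
      then show ?case using B[of p] by simp
    next
      case (Suc n)
      obtain t x where p: "p = (t, x)" "t \<in> {0..1}" "x \<in> cball z e" using Suc.prems by blast
      have "norm (T (P (Suc n)) (t, x) - T (P n) (t, x)) \<le> 1/2 * (B * (1/2) ^ n)"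
        by (rule contr[OF cP cP p(2)]) (use p e Suc.IH in auto)
      then show ?case unfolding PS[of "Suc n"] PS[of n, symmetric] p by (simp add: PS)
    qed
    have "summable (\<lambda>n. B * (1/2 :: real) ^ n)"
      by (intro summable_mult summable_geometric) simp
    with bd have "uniform_limit ?K (\<lambda>n p. \<Sum>i<n. P (Suc i) p - P i p) (\<lambda>p. \<Sum>i. P (Suc i) p - P i p) sequentially"
      by (intro Weierstrass_m_test)
    then have "uniform_limit ?K (\<lambda>n p. P 0 p + (\<Sum>i<n. P (Suc i) p - P i p)) \<phi> sequentially"
      unfolding \<phi>_def by (intro uniform_limit_intros)
    moreover have "P 0 p + (\<Sum>i<n. P (Suc i) p - P i p) = P n p" for n p
      using sum_lessThan_telescope[of "\<lambda>i. P i p" n] by simp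
    ultimately show ?thesis by (simp only:)
  qed
  have c\<phi>: "continuous_on ?D \<phi>"
    unfolding continuous_on_eq_continuous_within
  proof (rule ballI)
    fix p assume p: "p \<in> ?D"
    then obtain t z where tz: "p = (t, z)" "t \<in> {0..1}" "z \<in> W" by blast
    obtain e where e: "e > 0" "cball z e \<subseteq> W" using W tz(3) open_contains_cball by blast
    have "continuous_on ({0..1} \<times> cball z e) \<phi>"
      by (rule uniform_limit_theorem[OF _ unif[OF e(2)]])
         (use e in \<open>auto intro!: always_eventually continuous_on_subset[OF cP]\<close>)
    then have "continuous_on (({0..1} \<times> W) \<inter> (UNIV \<times> ball z e)) \<phi>"
      by (rule continuous_on_subset) (use e in auto)
    then have "continuous (at p within (({0..1} \<times> W) \<inter> (UNIV \<times> ball z e))) \<phi>"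
      unfolding continuous_on_eq_continuous_within using tz e(1) by simp
    moreover have "at p within (({0..1} \<times> W) \<inter> (UNIV \<times> ball z e)) = at p within ({0..1} \<times> W)"
      by (rule at_within_nhd[of _ "UNIV \<times> ball z e"]) (use tz e(1) in \<open>auto intro!: open_Times\<close>)
    ultimately show "continuous (at p within ?D) \<phi>" by simp
  qed
  have fixp: "\<phi> (t, z) = T \<phi> (t, z)" if tz: "t \<in> {0..1}" "z \<in> W" for t z
  proof -
    obtain e where e: "e > 0" "cball z e \<subseteq> W" using W tz(2) open_contains_cball by blast
    have "norm (T \<phi> (t, z) - \<phi> (t, z)) \<le> d" if d: "d > 0" for d
    proof -
      have "\<forall>\<^sub>F n in sequentially. \<forall>p\<in>{0..1} \<times> cball z e. dist (P n p) (\<phi> p) < d/2"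
        using unif[OF e(2)] d unfolding uniform_limit_iff by (meson half_gt_zero)
      then obtain n where n: "\<And>m p. m \<ge> n \<Longrightarrow> p \<in> {0..1} \<times> cball z e \<Longrightarrow> dist (P m p) (\<phi> p) < d/2"
        unfolding eventually_sequentially by blast
      have in_K: "(s, z) \<in> {0..1} \<times> cball z e" if "s \<in> {0..1}" for s using that e(1) by simp
      have "norm (T \<phi> (t, z) - T (P n) (t, z)) \<le> 1/2 * (d/2)"
      proof (rule contr[OF c\<phi> cP tz])
        fix s :: real assume "s \<in> {0..1}"
        from n[OF order_refl in_K[OF this]] show "norm (\<phi> (s, z) - P n (s, z)) \<le> d/2"
          by (simp add: dist_norm norm_minus_commute)
      qed
      moreover have "norm (T (P n) (t, z) - \<phi> (t, z)) \<le> d/2"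
        using n[of "Suc n", OF _ in_K[OF tz(1)]] by (simp add: PS dist_norm)
      ultimately show ?thesis
        using norm_diff_triangle_le[of "T \<phi> (t, z)" "T (P n) (t, z)" "1/2 * (d/2)" "\<phi> (t, z)" "d/2"] d
        by simp
    qed
    then have "norm (T \<phi> (t, z) - \<phi> (t, z)) \<le> 0" by (rule field_le_epsilon) simp
    then show ?thesis by simp
  qed
  show ?thesis
  proof (intro exI[of _ "\<lambda>t z. \<phi> (t, z)"] conjI ballI)
    show "continuous_on ({0..1} \<times> W) (\<lambda>p. \<phi> (fst p, snd p))" using c\<phi> by simp
    show "\<phi> (t, z) = a z + t *\<^sub>R integral {0..1} (\<lambda>s. F (t * s) z (\<phi> (t * s, z)))"
      if "t \<in> {0..1}" "z \<in> W" for t z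
      using fixp[OF that] by (simp add: T_def)
  qed
qed

lemma uniformly_close_in_parameter:
  fixes \<phi> :: "real \<Rightarrow> 'z::euclidean_space \<Rightarrow> 'b::metric_space"
  assumes "continuous_on ({0..1} \<times> W) (\<lambda>p. \<phi> (fst p) (snd p))" "open W" "z \<in> W" "e > 0"
  shows "\<exists>d>0. \<forall>h. norm h < d \<longrightarrow> z + h \<in> W \<and> (\<forall>s\<in>{0..1}. dist (\<phi> s (z + h)) (\<phi> s z) < e)"
proof -
  obtain r where r: "r > 0" "cball z r \<subseteq> W" using assms(2,3) open_contains_cball by blast
  let ?K = "{0..1::real} \<times> cball z r"
  have "compact ?K" by (intro compact_Times) simp_all
  moreover have "continuous_on ?K (\<lambda>p. \<phi> (fst p) (snd p))"
    using assms(1) by (rule continuous_on_subset) (use r in auto)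
  ultimately have "uniformly_continuous_on ?K (\<lambda>p. \<phi> (fst p) (snd p))"
    by (intro compact_uniformly_continuous)
  then obtain d where d: "d > 0" "\<And>p q. p \<in> ?K \<Longrightarrow> q \<in> ?K \<Longrightarrow> dist q p < d \<Longrightarrow>
      dist (\<phi> (fst q) (snd q)) (\<phi> (fst p) (snd p)) < e"
    using assms(4) unfolding uniformly_continuous_on_def by metis
  have b: "z + h \<in> cball z r" if "norm h < min d r" for h
    using that by (simp add: dist_norm)
  show ?thesis
  proof (intro exI[of _ "min d r"] conjI allI impI ballI)
    show "min d r > 0" using d r by simp
    show "z + h \<in> W" if "norm h < min d r" for h using b[OF that] r by blast
    show "dist (\<phi> s (z + h)) (\<phi> s z) < e" if "norm h < min d r" "s \<in> {0..1}" for s h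
      using d(2)[of "(s, z)" "(s, z + h)"] b[OF that(1)] that r(1)
      by (simp add: dist_Pair_Pair dist_norm)
  qed
qed

text \<open>The derivative is uniformly continuous near the compact curve \<open>x\<close>, so that one \<open>d\<close> serves all times.\<close>

lemma uniform_remainder:
  fixes F :: "real \<Rightarrow> 'a::euclidean_space \<Rightarrow> 'b::euclidean_space"
  assumes X: "open X" and F: "Ck_family {0..1} (Suc 0) X F"
    and x: "continuous_on {0..1} x" "\<And>s. s \<in> {0..1} \<Longrightarrow> x s \<in> X" and e: "e > 0"
  shows "\<exists>d>0. \<forall>s\<in>{0..1}. \<forall>k. norm k < d \<longrightarrow>
    norm (F s (x s + k) - F s (x s) - frechet_derivative (F s) (at (x s)) k) \<le> e * norm k"
proof -
  have "compact (x ` {0..1})" using x(1) by (intro compact_continuous_image) simp_all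
  moreover have "x ` {0..1} \<subseteq> X" using x(2) by blast
  ultimately obtain r where r: "r > 0" "(\<Union>y\<in>x ` {0..1}. ball y r) \<subseteq> X"
    using compact_subset_open_imp_ball_epsilon_subset[OF _ X] by blast
  have rX: "x s + k \<in> X" if "s \<in> {0..1}" "k \<in> ball 0 r" for s k
  proof -
    have "x s + k \<in> ball (x s) r" using that(2) by (simp add: dist_norm)
    then show ?thesis using r(2) that(1) by blast
  qed
  define G where "G s k = (\<Sum>b\<in>Basis. norm (frechet_derivative (F s) (at (x s + k)) b
      - frechet_derivative (F s) (at (x s)) b))" for s k
  have cD: "continuous_on ({0..1} \<times> X) (\<lambda>p. frechet_derivative (F (fst p)) (at (snd p)) b)" for b
    using F by (simp del: split_paired_All)
  have cx: "continuous_on ({0..1} \<times> ball 0 r) (\<lambda>p. x (fst p))"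
    by (rule continuous_on_compose2[OF x(1)]) (auto intro: continuous_intros)
  have "continuous_on ({0..1} \<times> ball 0 r) (\<lambda>p. G (fst p) (snd p))"
    unfolding G_def
  proof (intro continuous_on_sum continuous_on_norm continuous_on_diff)
    fix b :: 'a
    show "continuous_on ({0..1} \<times> ball 0 r)
        (\<lambda>p. frechet_derivative (F (fst p)) (at (x (fst p) + snd p)) b)"
      by (rule continuous_on_compose_pair[OF cD, where a = fst and b = "\<lambda>p. x (fst p) + snd p"])
         (use rX in \<open>auto intro!: continuous_intros cx\<close>)
    show "continuous_on ({0..1} \<times> ball 0 r)
        (\<lambda>p. frechet_derivative (F (fst p)) (at (x (fst p))) b)"
      by (rule continuous_on_compose_pair[OF cD, where a = fst and b = "\<lambda>p. x (fst p)"])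
         (use x in \<open>auto intro!: continuous_intros cx\<close>)
  qed
  moreover have "0 \<in> ball 0 r" using r(1) by simp
  ultimately have "\<exists>d>0. \<forall>h. norm h < d \<longrightarrow> 0 + h \<in> ball 0 r \<and> (\<forall>s\<in>{0..1}. dist (G s (0 + h)) (G s 0) < e)"
    by (rule uniformly_close_in_parameter[OF _ open_ball _ e])
  then obtain d where d: "d > 0"
    and d': "\<forall>h. norm h < d \<longrightarrow> 0 + h \<in> ball 0 r \<and> (\<forall>s\<in>{0..1}. dist (G s (0 + h)) (G s 0) < e)"
    by (elim exE conjE)
  have Gd: "G s h \<le> e" if "s \<in> {0..1}" "norm h < d" for s h
  proof -
    have "dist (G s (0 + h)) (G s 0) < e" using d' that by blast
    then show ?thesis by (simp add: G_def dist_norm)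
  qed
  show ?thesis
  proof (intro exI[of _ d] conjI ballI allI impI d)
    fix s :: real and k :: 'a assume s: "s \<in> {0..1}" and k: "norm k < d"
    let ?L = "frechet_derivative (F s) (at (x s))"
    have Ls: "bounded_linear ?L"
      using Ck_family_deriv[OF F s x(2)[OF s]] by (rule has_derivative_bounded_linear)
    have "norm ((\<lambda>k. F s (x s + k) - ?L k) k - (\<lambda>k. F s (x s + k) - ?L k) 0) \<le> e * norm (k - 0)"
    proof (rule differentiable_bound[of "ball 0 d"])
      fix h :: 'a assume h: "h \<in> ball 0 d"
      then have hX: "x s + h \<in> X" using d'[rule_format, of h] rX[OF s] by simp
      note D = Ck_family_deriv[OF F s hX]
      have "((F s \<circ> (\<lambda>k. x s + k)) has_derivative frechet_derivative (F s) (at (x s + h)) \<circ> (\<lambda>v. v)) (at h)"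
        by (rule diff_chain_at) (auto intro!: derivative_eq_intros D)
      then have "((\<lambda>k. F s (x s + k)) has_derivative frechet_derivative (F s) (at (x s + h))) (at h)"
        by (simp add: o_def)
      then show "((\<lambda>k. F s (x s + k) - ?L k) has_derivative
          (\<lambda>v. frechet_derivative (F s) (at (x s + h)) v - ?L v)) (at h within ball 0 d)"
        by (intro has_derivative_at_withinI[OF has_derivative_diff] bounded_linear_imp_has_derivative Ls)
      have lin: "linear (\<lambda>v. frechet_derivative (F s) (at (x s + h)) v - ?L v)"
        using has_derivative_linear[OF D] Ls by (intro linear_compose_sub) (simp_all add: bounded_linear.linear)
      show "onorm (\<lambda>v. frechet_derivative (F s) (at (x s + h)) v - ?L v) \<le> e"
      proof (rule onorm_bound)
        fix v
        have "norm (frechet_derivative (F s) (at (x s + h)) v - ?L v) \<le> G s h * norm v"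
          unfolding G_def by (rule linear_norm_le_Basis[OF lin])
        also have "\<dots> \<le> e * norm v" using Gd[OF s, of h] h by (intro mult_right_mono) simp_all
        finally show "norm (frechet_derivative (F s) (at (x s + h)) v - ?L v) \<le> e * norm v" .
      qed (use e in simp)
    qed (use k d in simp_all)
    moreover have "?L 0 = 0" using Ls by (simp add: linear_0 bounded_linear.linear)
    ultimately show "norm (F s (x s + k) - F s (x s) - ?L k) \<le> e * norm k"
      by (simp add: algebra_simps)
  qed
qed

lemma has_derivative_norm_le:
  fixes f :: "'a::real_normed_vector \<Rightarrow> 'b::real_normed_vector"
  assumes D: "(f has_derivative D) (at x)" and d: "d > 0"
    and B: "\<And>\<tau>. 0 < \<tau> \<Longrightarrow> \<tau> < d \<Longrightarrow> norm (f (x + \<tau> *\<^sub>R v) - f x) \<le> B * \<tau>"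
  shows "norm (D v) \<le> B"
proof (rule field_le_epsilon)
  fix e :: real assume e: "e > 0"
  define e' where "e' = e / (norm v + 1)"
  have nv: "norm v + 1 > 0" using norm_ge_zero[of v] by linarith
  have e': "e' > 0" using e nv by (simp add: e'_def)
  obtain r where r: "r > 0" "\<And>y. norm (y - x) < r \<Longrightarrow> norm (f y - f x - D (y - x)) \<le> e' * norm (y - x)"
    using D e' unfolding has_derivative_at_alt by metis
  define \<tau> where "\<tau> = min (d / 2) (r / (2 * (norm v + 1)))"
  have \<tau>: "0 < \<tau>" "\<tau> < d" proof -
    show "0 < \<tau>" using d r(1) nv by (simp add: \<tau>_def)
    have "\<tau> \<le> d / 2" unfolding \<tau>_def by (rule min.cobounded1)
    then show "\<tau> < d" using d by linarith
  qed
  have "\<tau> * norm v \<le> r / (2 * (norm v + 1)) * norm v"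
    by (intro mult_right_mono) (simp_all add: \<tau>_def)
  also have "\<dots> < r" using r(1) nv by (simp add: field_simps) (smt (verit, best) mult_nonneg_nonneg norm_ge_zero)
  finally have "norm ((x + \<tau> *\<^sub>R v) - x) < r" using \<tau> by simp
  from r(2)[OF this] have "norm (f (x + \<tau> *\<^sub>R v) - f x - \<tau> *\<^sub>R D v) \<le> e' * (\<tau> * norm v)"
    using \<tau> linear_cmul[OF has_derivative_linear[OF D]] by simp
  then have "norm (\<tau> *\<^sub>R D v) \<le> B * \<tau> + e' * (\<tau> * norm v)"
    using B[OF \<tau>] norm_triangle_sub[of "\<tau> *\<^sub>R D v" "f (x + \<tau> *\<^sub>R v) - f x"]
    by (simp add: norm_minus_commute)
  then have "\<tau> * norm (D v) \<le> \<tau> * (B + e' * norm v)" using \<tau> by (simp add: algebra_simps)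
  then have "norm (D v) \<le> B + e' * norm v" using \<tau>(1) mult_le_cancel_left_pos by blast
  also have "e' * norm v \<le> e' * (norm v + 1)" using e' by simp
  also have "\<dots> = e" using nv by (simp add: e'_def)
  finally show "norm (D v) \<le> B + e" by simp
qed

lemma continuous_on_rescale:
  "continuous_on {0..1} g \<Longrightarrow> t \<in> {0..1::real} \<Longrightarrow> continuous_on {0..1} (\<lambda>s. g (t * s))"
  by (rule continuous_on_compose2[of "{0..1}" g]) (auto intro!: continuous_intros intro: mult_le_one)

text \<open>The candidate \<open>\<psi> h\<close> for the derivative of the solution in direction \<open>h\<close> is the solution of the
  linearized equation.  The error \<open>\<phi> t (z + h) - \<phi> t z - \<psi> h t z\<close> satisfies an integral inequality with
  a constant below \<open>1\<close>, and \<open>sup_contraction\<close> turns it into \<open>o(norm h)\<close>.\<close>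

lemma picard_variation:
  fixes F :: "real \<Rightarrow> 'z::euclidean_space \<times> 'b::euclidean_space \<Rightarrow> 'b"
  assumes W: "open W" and Y: "open Y" and F: "Ck_family {0..1} (Suc 0) (W \<times> Y) F"
    and a: "Ck_family {0::real} (Suc 0) W (\<lambda>_. a)"
    and Lip: "\<And>s z y y'. s \<in> {0..1} \<Longrightarrow> z \<in> W \<Longrightarrow> y \<in> Y \<Longrightarrow> y' \<in> Y \<Longrightarrow>
      norm (F s (z, y) - F s (z, y')) \<le> 1/2 * norm (y - y')"
    and c\<phi>: "continuous_on ({0..1} \<times> W) (\<lambda>p. \<phi> (fst p) (snd p))"
    and \<phi>Y: "\<And>s z. s \<in> {0..1} \<Longrightarrow> z \<in> W \<Longrightarrow> \<phi> s z \<in> Y"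
    and \<phi>: "\<And>t z. t \<in> {0..1} \<Longrightarrow> z \<in> W \<Longrightarrow>
       \<phi> t z = a z + t *\<^sub>R integral {0..1} (\<lambda>s. F (t * s) (z, \<phi> (t * s) z))"
  shows "\<exists>\<psi>. (\<forall>h. continuous_on ({0..1} \<times> W) (\<lambda>p. \<psi> h (fst p) (snd p))) \<and>
    (\<forall>h. \<forall>t\<in>{0..1}. \<forall>z\<in>W. \<psi> h t z = frechet_derivative a (at z) h +
       t *\<^sub>R integral {0..1} (\<lambda>s. frechet_derivative (F (t * s)) (at (z, \<phi> (t * s) z)) (h, \<psi> h (t * s) z))) \<and>
    (\<forall>t\<in>{0..1}. \<forall>z\<in>W. (\<phi> t has_derivative (\<lambda>h. \<psi> h t z)) (at z)) \<and>
    (\<forall>s\<in>{0..1}. \<forall>z\<in>W. \<forall>k. norm (frechet_derivative (F s) (at (z, \<phi> s z)) (0, k)) \<le> 1/2 * norm k)"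
proof -
  define L where "L s z = frechet_derivative (F s) (at (z, \<phi> s z))" for s z
  have WY: "open (W \<times> Y)" using W Y by (rule open_Times)
  have in_WY: "(z, \<phi> s z) \<in> W \<times> Y" if "s \<in> {0..1}" "z \<in> W" for s z using that \<phi>Y by simp
  have FD: "(F s has_derivative L s z) (at (z, \<phi> s z))" if "s \<in> {0..1}" "z \<in> W" for s z
    unfolding L_def by (rule Ck_family_deriv[OF F that(1) in_WY[OF that]])
  have linL: "linear (L s z)" if "s \<in> {0..1}" "z \<in> W" for s z
    using FD[OF that] by (rule has_derivative_linear)
  have Lk: "norm (L s z (0, k)) \<le> 1/2 * norm k" if s: "s \<in> {0..1}" and z: "z \<in> W" for s z k
  proof -
    obtain r where r: "r > 0" "ball (\<phi> s z) r \<subseteq> Y" using Y \<phi>Y[OF s z] openE by blast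
    have nk: "norm k + 1 > 0" using norm_ge_zero[of k] by linarith
    show ?thesis
    proof (rule has_derivative_norm_le[OF FD[OF s z]])
      show "0 < r / (norm k + 1)" using r(1) nk by simp
      fix \<tau> :: real assume \<tau>: "0 < \<tau>" "\<tau> < r / (norm k + 1)"
      have "\<tau> * norm k \<le> \<tau> * (norm k + 1)" using \<tau> by simp
      also have "\<dots> < r" using \<tau> nk by (simp add: pos_less_divide_eq)
      finally have "\<phi> s z + \<tau> *\<^sub>R k \<in> ball (\<phi> s z) r" using \<tau> by (simp add: dist_norm)
      then have "\<phi> s z + \<tau> *\<^sub>R k \<in> Y" using r(2) by blast
      from Lip[OF s z this \<phi>Y[OF s z]]
      show "norm (F s ((z, \<phi> s z) + \<tau> *\<^sub>R (0, k)) - F s (z, \<phi> s z)) \<le> 1/2 * norm k * \<tau>"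
        using \<tau> by (simp add: mult.commute)
    qed
  qed
  have cL: "continuous_on ({0..1} \<times> W) (\<lambda>p. L (fst p) (snd p) b)" for b
    unfolding L_def
  proof (rule continuous_on_compose_pair[where a = fst and b = "\<lambda>p. (snd p, \<phi> (fst p) (snd p))"])
    show "continuous_on ({0..1} \<times> (W \<times> Y)) (\<lambda>p. frechet_derivative (F (fst p)) (at (snd p)) b)"
      using F by (simp del: split_paired_All)
    show "continuous_on ({0..1} \<times> W) (\<lambda>p. (snd p, \<phi> (fst p) (snd p)))"
      by (intro continuous_intros c\<phi>)
  qed (use in_WY in \<open>auto intro: continuous_intros\<close>)
  define Ft where "Ft h s z y = (\<Sum>b\<in>Basis. ((h, y) \<bullet> b) *\<^sub>R L s z b)" for h s z and y :: 'b
  have Ft: "Ft h s z y = L s z (h, y)" if "s \<in> {0..1}" "z \<in> W" for h s z y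
    unfolding Ft_def by (rule linear_sum_Basis[OF linL[OF that], symmetric])
  have cFt: "continuous_on (({0..1} \<times> W) \<times> UNIV) (\<lambda>p. Ft h (fst (fst p)) (snd (fst p)) (snd p))" for h
    unfolding Ft_def
  proof (intro continuous_on_sum continuous_on_scaleR)
    fix b :: "'z \<times> 'b"
    show "continuous_on (({0..1} \<times> W) \<times> UNIV) (\<lambda>p. (h, snd p) \<bullet> b)"
      by (intro continuous_intros)
    show "continuous_on (({0..1} \<times> W) \<times> UNIV) (\<lambda>p. L (fst (fst p)) (snd (fst p)) b)"
      by (rule continuous_on_compose2[OF cL, of _ fst]) (auto intro: continuous_intros)
  qed
  have ca': "continuous_on W (\<lambda>z. frechet_derivative a (at z) h)" for h
    using a continuous_on_snd_iff[of W "\<lambda>z. frechet_derivative a (at z) h"] by simp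
  have LipFt: "norm (Ft h s z y - Ft h s z y') \<le> 1/2 * norm (y - y')"
    if "s \<in> {0..1}" "z \<in> W" for h s z y y'
    using Lk[OF that, of "y - y'"] linear_diff[OF linL[OF that], of "(h, y)" "(h, y')"]
    by (simp add: Ft[OF that])
  have "\<forall>h. \<exists>\<psi>. continuous_on ({0..1} \<times> W) (\<lambda>p. \<psi> (fst p) (snd p)) \<and> (\<forall>t\<in>{0..1}. \<forall>z\<in>W.
       \<psi> t z = frechet_derivative a (at z) h + t *\<^sub>R integral {0..1} (\<lambda>s. Ft h (t * s) z (\<psi> (t * s) z)))"
    by (intro allI picard_existence[OF W cFt ca' LipFt])
  from choice[OF this] obtain \<psi> where \<psi>0: "\<forall>h. continuous_on ({0..1} \<times> W) (\<lambda>p. \<psi> h (fst p) (snd p)) \<and>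
      (\<forall>t\<in>{0..1}. \<forall>z\<in>W. \<psi> h t z = frechet_derivative a (at z) h
        + t *\<^sub>R integral {0..1} (\<lambda>s. Ft h (t * s) z (\<psi> h (t * s) z)))"
    by (elim exE) (rule that)
  have c\<psi>: "continuous_on ({0..1} \<times> W) (\<lambda>p. \<psi> h (fst p) (snd p))" for h
    using \<psi>0 by blast
  have \<psi>Ft: "\<psi> h t z = frechet_derivative a (at z) h + t *\<^sub>R integral {0..1} (\<lambda>s. Ft h (t * s) z (\<psi> h (t * s) z))"
    if "t \<in> {0..1}" "z \<in> W" for h t z
    using \<psi>0[rule_format, of h] that by (elim conjE) (drule bspec, assumption, drule bspec, assumption)
  have \<psi>: "\<psi> h t z = frechet_derivative a (at z) h + t *\<^sub>R integral {0..1} (\<lambda>s. L (t * s) z (h, \<psi> h (t * s) z))"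
    if "t \<in> {0..1}" "z \<in> W" for h t z
  proof -
    have "integral {0..1} (\<lambda>s. Ft h (t * s) z (\<psi> h (t * s) z)) = integral {0..1} (\<lambda>s. L (t * s) z (h, \<psi> h (t * s) z))"
      by (rule integral_cong) (rule Ft[OF mult_unit_interval[OF that(1)] that(2)])
    then show ?thesis using \<psi>Ft[OF that, of h] by simp
  qed
  have c\<psi>1: "continuous_on {0..1} (\<lambda>s. \<psi> h s z)" if "z \<in> W" for h z
    by (rule continuous_on_compose_pair[OF c\<psi>]) (use that in \<open>auto intro: continuous_intros\<close>)
  have c\<phi>1: "continuous_on {0..1} (\<lambda>s. \<phi> s z)" if "z \<in> W" for z
    by (rule continuous_on_compose_pair[OF c\<phi>]) (use that in \<open>auto intro: continuous_intros\<close>)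
  have cLu: "continuous_on {0..1} (\<lambda>s. L s z (u s))" if z: "z \<in> W" and u: "continuous_on {0..1} u" for z u
  proof (rule continuous_on_eq)
    have "continuous_on {0..1} (\<lambda>s. L s z b)" for b
      by (rule continuous_on_compose_pair[OF cL]) (use z in \<open>auto intro: continuous_intros\<close>)
    then show "continuous_on {0..1} (\<lambda>s. \<Sum>b\<in>Basis. (u s \<bullet> b) *\<^sub>R L s z b)"
      by (intro continuous_intros u)
  qed (rule linear_sum_Basis[OF linL[OF _ z], symmetric])
  have lin\<psi>: "linear (\<lambda>h. \<psi> h t z)" if t: "t \<in> {0..1}" and z: "z \<in> W" for t z
  proof -
    have lina: "linear (frechet_derivative a (at z))"
      using Ck_family_deriv[OF a, of 0 z] z by (simp add: has_derivative_linear)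
    have comb: "\<psi> (c *\<^sub>R h1 + h2) t z = c *\<^sub>R \<psi> h1 t z + \<psi> h2 t z" if t: "t \<in> {0..1}" for c h1 h2 t
    proof -
      define g where "g t = \<psi> (c *\<^sub>R h1 + h2) t z - (c *\<^sub>R \<psi> h1 t z + \<psi> h2 t z)" for t
      have cg: "continuous_on {0..1} g" unfolding g_def by (intro continuous_intros c\<psi>1 z)
      have geq: "g t = t *\<^sub>R integral {0..1} (\<lambda>s. L (t * s) z (0, g (t * s)))" if t: "t \<in> {0..1}" for t
      proof -
        have c: "(\<lambda>s. L (t * s) z (h, \<psi> h (t * s) z)) integrable_on {0..1}" for h
          by (intro integrable_continuous_interval continuous_on_rescale[where g = "\<lambda>s. L s z (h, \<psi> h s z)", OF _ t]
              cLu z continuous_on_Pair continuous_on_const c\<psi>1)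
        have "L (t * s) z (0, g (t * s)) = L (t * s) z (c *\<^sub>R h1 + h2, \<psi> (c *\<^sub>R h1 + h2) (t * s) z)
            - (c *\<^sub>R L (t * s) z (h1, \<psi> h1 (t * s) z) + L (t * s) z (h2, \<psi> h2 (t * s) z))"
          if "s \<in> {0..1}" for s
        proof -
          note l = linL[OF mult_unit_interval[OF t that] z]
          have "(0, g (t * s)) = (c *\<^sub>R h1 + h2, \<psi> (c *\<^sub>R h1 + h2) (t * s) z)
            - (c *\<^sub>R (h1, \<psi> h1 (t * s) z) + (h2, \<psi> h2 (t * s) z))" by (simp add: g_def)
          then show ?thesis by (simp only: linear_diff[OF l] linear_add[OF l] linear_cmul[OF l])
        qed
        then have "integral {0..1} (\<lambda>s. L (t * s) z (0, g (t * s)))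
          = integral {0..1} (\<lambda>s. L (t * s) z (c *\<^sub>R h1 + h2, \<psi> (c *\<^sub>R h1 + h2) (t * s) z)
            - (c *\<^sub>R L (t * s) z (h1, \<psi> h1 (t * s) z) + L (t * s) z (h2, \<psi> h2 (t * s) z)))"
          by (rule integral_cong)
        also have "\<dots> = integral {0..1} (\<lambda>s. L (t * s) z (c *\<^sub>R h1 + h2, \<psi> (c *\<^sub>R h1 + h2) (t * s) z))
            - (c *\<^sub>R integral {0..1} (\<lambda>s. L (t * s) z (h1, \<psi> h1 (t * s) z))
              + integral {0..1} (\<lambda>s. L (t * s) z (h2, \<psi> h2 (t * s) z)))"
          by (simp add: integral_diff integral_add integrable_add integrable_cmul c)
        finally have E: "integral {0..1} (\<lambda>s. L (t * s) z (0, g (t * s))) = \<dots>" .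
        show ?thesis
          unfolding E g_def[of t] \<psi>[OF t z]
          by (simp add: linear_add[OF lina] linear_cmul[OF lina] algebra_simps)
      qed
      have "norm (g t) \<le> 0 / (1 - 1/2)"
      proof (rule sup_contraction[OF cg _ _ t])
        fix t B :: real assume t: "t \<in> {0..1}" and B: "\<And>s. s \<in> {0..1} \<Longrightarrow> norm (g s) \<le> B"
        have "norm (t *\<^sub>R integral {0..1} (\<lambda>s. L (t * s) z (0, g (t * s)))) \<le> 1/2 * B"
        proof (rule scaled_integral_bound[where h = "\<lambda>s. L s z (0, g s)", OF t])
          show "continuous_on {0..1} (\<lambda>s. L (t * s) z (0, g (t * s)))"
            by (rule continuous_on_rescale[where g = "\<lambda>s. L s z (0, g s)", OF _ t])
               (intro cLu z continuous_intros cg)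
          show "norm (L s z (0, g s)) \<le> 1/2 * B" if "s \<in> {0..1}" for s
            using Lk[OF that z, of "g s"] B[OF that] by linarith
        qed
        then show "norm (g t) \<le> 0 + 1/2 * B" using geq[OF t] by simp
      qed simp
      then show ?thesis by (simp add: g_def)
    qed
    show ?thesis
    proof (rule linearI)
      show "\<psi> (h1 + h2) t z = \<psi> h1 t z + \<psi> h2 t z" for h1 h2 using comb[OF t, of 1 h1 h2] by simp
      have "\<psi> 0 t z = 0" using comb[OF t, of 1 0 0] by simp
      then show "\<psi> (c *\<^sub>R h) t z = c *\<^sub>R \<psi> h t z" for c h using comb[OF t, of c h 0] by simp
    qed
  qed
  have der: "(\<phi> t has_derivative (\<lambda>h. \<psi> h t z)) (at z)" if t: "t \<in> {0..1}" and z: "z \<in> W" for t z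
    unfolding has_derivative_at_alt
  proof (intro conjI allI impI)
    show "bounded_linear (\<lambda>h. \<psi> h t z)" using lin\<psi>[OF t z] by (simp add: linear_conv_bounded_linear)
    fix \<epsilon>0 :: real assume \<epsilon>0: "\<epsilon>0 > 0"
    \<comment> \<open>a bound for the variation, uniform in time\<close>
    have "\<exists>B. \<forall>s\<in>{0..1}. norm (\<psi> b s z) \<le> B" for b
    proof -
      have "bounded ((\<lambda>s. \<psi> b s z) ` {0..1})"
        by (intro compact_imp_bounded compact_continuous_image c\<psi>1 z) simp
      then show ?thesis unfolding bounded_iff by blast
    qed
    then obtain Cb where Cb: "\<And>b s. s \<in> {0..1} \<Longrightarrow> norm (\<psi> b s z) \<le> Cb b" by metis
    define C where "C = (\<Sum>b\<in>Basis. Cb b)"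
    have C: "norm (\<psi> h s z) \<le> C * norm h" if "s \<in> {0..1}" for h s
    proof -
      have "norm (\<psi> h s z) \<le> (\<Sum>b\<in>Basis. norm (\<psi> b s z)) * norm h"
        by (rule linear_norm_le_Basis[OF lin\<psi>[OF that z]])
      also have "\<dots> \<le> C * norm h"
        unfolding C_def by (intro mult_right_mono sum_mono Cb that) simp
      finally show ?thesis .
    qed
    have C0: "C \<ge> 0" unfolding C_def 
  proof (rule sum_nonneg)
    show "0 \<le> Cb b" for b using order_trans[OF norm_ge_zero Cb[of 0 b]] by simp
  qed
    define \<epsilon> where "\<epsilon> = min (1/4) (\<epsilon>0 / (4 * (2 + C)))"
    have \<epsilon>: "\<epsilon> > 0" "\<epsilon> \<le> 1/4" "4 * (\<epsilon> * (2 + C)) \<le> \<epsilon>0"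
    proof -
      show "\<epsilon> > 0" using \<epsilon>0 C0 by (simp add: \<epsilon>_def)
      show "\<epsilon> \<le> 1/4" unfolding \<epsilon>_def by (rule min.cobounded1)
      have "\<epsilon> \<le> \<epsilon>0 / (4 * (2 + C))" unfolding \<epsilon>_def by (rule min.cobounded2)
      then show "4 * (\<epsilon> * (2 + C)) \<le> \<epsilon>0" using C0 by (simp add: pos_le_divide_eq mult.assoc mult.left_commute)
    qed
    have "continuous_on {0..1} (\<lambda>s. (z, \<phi> s z))" by (intro continuous_intros c\<phi>1 z)
    then have "\<exists>d>0. \<forall>s\<in>{0..1}. \<forall>k. norm k < d \<longrightarrow>
      norm (F s ((z, \<phi> s z) + k) - F s (z, \<phi> s z) - frechet_derivative (F s) (at (z, \<phi> s z)) k) \<le> \<epsilon> * norm k"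
      by (rule uniform_remainder[OF WY F _ in_WY[OF _ z] \<epsilon>(1)])
    then obtain d where d1: "d > 0" and d0: "\<forall>s\<in>{0..1}. \<forall>k. norm k < d \<longrightarrow>
      norm (F s ((z, \<phi> s z) + k) - F s (z, \<phi> s z) - frechet_derivative (F s) (at (z, \<phi> s z)) k) \<le> \<epsilon> * norm k"
      by (elim exE conjE)
    note d = d1 d0[rule_format]
    obtain d1 where d1: "d1 > 0" "\<And>h. norm h < d1 \<Longrightarrow> z + h \<in> W"
      "\<And>s h. s \<in> {0..1} \<Longrightarrow> norm h < d1 \<Longrightarrow> dist (\<phi> s (z + h)) (\<phi> s z) < d / 2"
      using uniformly_close_in_parameter[OF c\<phi> W z half_gt_zero[OF d(1)]] by blast
    have ad: "(a has_derivative frechet_derivative a (at z)) (at z)"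
      using Ck_family_deriv[OF a, of 0 z] z by simp
    obtain d2 where d2: "d2 > 0" "\<And>y. norm (y - z) < d2 \<Longrightarrow>
        norm (a y - a z - frechet_derivative a (at z) (y - z)) \<le> \<epsilon> * norm (y - z)"
      using ad \<epsilon>(1) unfolding has_derivative_at_alt by metis
    define \<delta> where "\<delta> = min (min d1 d2) (d / 2)"
    have \<delta>: "\<delta> > 0" using d(1) d1(1) d2(1) by (simp add: \<delta>_def)
    have main: "norm (\<phi> t (z + h) - \<phi> t z - \<psi> h t z) \<le> \<epsilon>0 * norm h" if h: "norm h < \<delta>" for h
    proof -
      have h': "norm h < d1" "norm h < d2" "norm h < d/2" using h by (simp_all add: \<delta>_def)
      have zh: "z + h \<in> W" by (rule d1(2)[OF h'(1)])
      define e where "e s = \<phi> s (z + h) - \<phi> s z - \<psi> h s z" for s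
      define K where "K s = F s (z + h, \<phi> s (z + h)) - F s (z, \<phi> s z) - L s z (h, \<psi> h s z)" for s
      have ce: "continuous_on {0..1} e" unfolding e_def by (intro continuous_intros c\<phi>1 c\<psi>1 z zh)
      have cF1: "continuous_on {0..1} (\<lambda>s. F s (y, \<phi> s y))" if "y \<in> W" for y
        by (rule continuous_on_compose_pair[OF Ck_family_continuous[OF F]])
           (use that in_WY in \<open>auto intro!: continuous_intros c\<phi>1\<close>)
      have cL1: "continuous_on {0..1} (\<lambda>s. L s z (h, \<psi> h s z))"
        by (intro cLu z continuous_intros c\<psi>1)
      have cK: "continuous_on {0..1} K" unfolding K_def by (intro continuous_intros cF1 cL1 z zh)
      have Kb: "norm (K s) \<le> \<epsilon> * ((1 + C) * norm h) + (\<epsilon> + 1/2) * norm (e s)" if s: "s \<in> {0..1}" for s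
      proof -
        let ?k = "(h, \<phi> s (z + h) - \<phi> s z)"
        have k1: "norm (\<phi> s (z + h) - \<phi> s z) < d / 2" using d1(3)[OF s h'(1)] by (simp add: dist_norm)
        have nk: "norm ?k \<le> norm h + norm (\<phi> s (z + h) - \<phi> s z)" by (rule norm_Pair_le)
        then have "norm ?k < d" using k1 h'(3) by simp
        from d(2)[OF s this]
        have 1: "norm (F s (z + h, \<phi> s (z + h)) - F s (z, \<phi> s z) - L s z ?k) \<le> \<epsilon> * norm ?k"
          by (simp add: L_def)
        have "?k = (h, \<psi> h s z) + (0, e s)" by (simp add: e_def)
        then have "L s z ?k = L s z (h, \<psi> h s z) + L s z (0, e s)"
          using linear_add[OF linL[OF s z]] by metis
        then have K: "K s = (F s (z + h, \<phi> s (z + h)) - F s (z, \<phi> s z) - L s z ?k) + L s z (0, e s)"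
          by (simp add: K_def)
        have "norm (\<phi> s (z + h) - \<phi> s z) = norm (e s + \<psi> h s z)" by (simp add: e_def)
        also have "\<dots> \<le> norm (e s) + C * norm h" using norm_triangle_ineq C[OF s, of h] by (rule order_trans[OF _ add_left_mono])
        finally have "norm ?k \<le> (1 + C) * norm h + norm (e s)" using nk by (simp add: algebra_simps)
        then have "\<epsilon> * norm ?k \<le> \<epsilon> * ((1 + C) * norm h + norm (e s))" using \<epsilon>(1) by simp
        then have "norm (K s) \<le> \<epsilon> * ((1 + C) * norm h + norm (e s)) + 1/2 * norm (e s)"
          unfolding K using 1 Lk[OF s z, of "e s"] by (intro norm_triangle_le add_mono) linarith+
        then show ?thesis by (simp add: algebra_simps)
      qed
      have eeq: "e t = (a (z + h) - a z - frechet_derivative a (at z) h) + t *\<^sub>R integral {0..1} (\<lambda>s. K (t * s))"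
        if t: "t \<in> {0..1}" for t
      proof -
        note i1 = continuous_on_rescale[OF cF1[OF zh] t, THEN integrable_continuous_interval]
          and i2 = continuous_on_rescale[OF cF1[OF z] t, THEN integrable_continuous_interval]
          and i3 = continuous_on_rescale[OF cL1 t, THEN integrable_continuous_interval]
        have E: "integral {0..1} (\<lambda>s. K (t * s)) = integral {0..1} (\<lambda>s. F (t * s) (z + h, \<phi> (t * s) (z + h)))
           - integral {0..1} (\<lambda>s. F (t * s) (z, \<phi> (t * s) z)) - integral {0..1} (\<lambda>s. L (t * s) z (h, \<psi> h (t * s) z))"
          unfolding K_def by (simp add: integral_diff integrable_diff i1 i2 i3)
        show ?thesis
          unfolding e_def E \<phi>[OF t zh] \<phi>[OF t z] \<psi>[OF t z] by (simp add: algebra_simps)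
      qed
      have "norm (e t) \<le> (\<epsilon> * ((2 + C) * norm h)) / (1 - 3/4)"
      proof (rule sup_contraction[OF ce _ _ t])
        fix t B :: real assume t: "t \<in> {0..1}" and B: "\<And>s. s \<in> {0..1} \<Longrightarrow> norm (e s) \<le> B"
        have "norm (t *\<^sub>R integral {0..1} (\<lambda>s. K (t * s))) \<le> \<epsilon> * ((1 + C) * norm h) + 3/4 * B"
        proof (rule scaled_integral_bound[OF t continuous_on_rescale[OF cK t]])
          fix s :: real assume s: "s \<in> {0..1}"
          have "(\<epsilon> + 1/2) * norm (e s) \<le> 3/4 * B" using \<epsilon> B[OF s] by (intro mult_mono) simp_all
          then show "norm (K s) \<le> \<epsilon> * ((1 + C) * norm h) + 3/4 * B" using Kb[OF s] by linarith
        qed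
        moreover have "norm (a (z + h) - a z - frechet_derivative a (at z) h) \<le> \<epsilon> * norm h"
          using d2(2)[of "z + h"] h'(2) by simp
        ultimately have "norm (e t) \<le> \<epsilon> * norm h + (\<epsilon> * ((1 + C) * norm h) + 3/4 * B)"
          unfolding eeq[OF t] by (intro norm_triangle_le add_mono)
        then show "norm (e t) \<le> \<epsilon> * ((2 + C) * norm h) + 3/4 * B" by (simp add: algebra_simps)
      qed simp
      also have "\<dots> = 4 * (\<epsilon> * (2 + C)) * norm h" by simp
      also have "\<dots> \<le> \<epsilon>0 * norm h" using \<epsilon>(3) by (rule mult_right_mono) simp
      finally show ?thesis by (simp add: e_def)
    qed
    show "\<exists>d>0. \<forall>y. norm (y - z) < d \<longrightarrow> norm (\<phi> t y - \<phi> t z - \<psi> (y - z) t z) \<le> \<epsilon>0 * norm (y - z)"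
    proof (intro exI[of _ \<delta>] conjI allI impI \<delta>)
      fix y assume "norm (y - z) < \<delta>"
      from main[OF this] show "norm (\<phi> t y - \<phi> t z - \<psi> (y - z) t z) \<le> \<epsilon>0 * norm (y - z)" by simp
    qed
  qed
  show ?thesis
    by (intro exI[of _ \<psi>] conjI ballI allI c\<psi> \<psi>[unfolded L_def] der Lk[unfolded L_def])
qed

text \<open>The derivative \<open>\<psi> h\<close> of the solution solves an equation of the same kind, whose data have one order
  of differentiability less.  For the induction the equation therefore has to be arbitrary.  The domain
  \<open>Y\<close> is all of the space in the linearized equation, but not in the given one.\<close>

lemma picard_Ck:
  fixes F :: "real \<Rightarrow> 'z::euclidean_space \<times> 'b::euclidean_space \<Rightarrow> 'b"
  assumes W: "open W"
  shows "open Y \<Longrightarrow> Ck_family {0..1} j (W \<times> Y) F \<Longrightarrow> Ck_family {0::real} j W (\<lambda>_. a) \<Longrightarrow>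
    (\<And>s z y y'. s \<in> {0..1} \<Longrightarrow> z \<in> W \<Longrightarrow> y \<in> Y \<Longrightarrow> y' \<in> Y \<Longrightarrow>
      norm (F s (z, y) - F s (z, y')) \<le> 1/2 * norm (y - y')) \<Longrightarrow>
    continuous_on ({0..1} \<times> W) (\<lambda>p. \<phi> (fst p) (snd p)) \<Longrightarrow>
    (\<And>s z. s \<in> {0..1} \<Longrightarrow> z \<in> W \<Longrightarrow> \<phi> s z \<in> Y) \<Longrightarrow>
    (\<And>t z. t \<in> {0..1} \<Longrightarrow> z \<in> W \<Longrightarrow>
       \<phi> t z = a z + t *\<^sub>R integral {0..1} (\<lambda>s. F (t * s) (z, \<phi> (t * s) z))) \<Longrightarrow>
    Ck_family {0..1} j W \<phi>"
proof (induction j arbitrary: Y F a \<phi>)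
  case 0
  then show ?case by simp
next
  case (Suc j)
  note Y = Suc.prems(1) and F = Suc.prems(2) and a = Suc.prems(3) and Lip = Suc.prems(4)
    and c\<phi> = Suc.prems(5) and \<phi>Y = Suc.prems(6) and \<phi> = Suc.prems(7)
  have WY: "open (W \<times> Y)" using W Y by (rule open_Times)
  have to1: "Ck_family T (Suc j) S f \<Longrightarrow> Ck_family T (Suc 0) S f" for T :: "real set" and S f
  proof (induction j)
    case (Suc i)
    from Suc.IH[OF Ck_family_Suc_mono[OF Suc.prems]] show ?case .
  qed
  have IH: "Ck_family {0..1} j W \<phi>"
    by (rule Suc.IH[OF Y Ck_family_Suc_mono[OF F] Ck_family_Suc_mono[OF a] Lip c\<phi> \<phi>Y \<phi>])
  have V: "\<exists>\<psi>. (\<forall>h. continuous_on ({0..1} \<times> W) (\<lambda>p. \<psi> h (fst p) (snd p))) \<and>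
    (\<forall>h. \<forall>t\<in>{0..1}. \<forall>z\<in>W. \<psi> h t z = frechet_derivative a (at z) h +
       t *\<^sub>R integral {0..1} (\<lambda>s. frechet_derivative (F (t * s)) (at (z, \<phi> (t * s) z)) (h, \<psi> h (t * s) z))) \<and>
    (\<forall>t\<in>{0..1}. \<forall>z\<in>W. (\<phi> t has_derivative (\<lambda>h. \<psi> h t z)) (at z)) \<and>
    (\<forall>s\<in>{0..1}. \<forall>z\<in>W. \<forall>k. norm (frechet_derivative (F s) (at (z, \<phi> s z)) (0, k)) \<le> 1/2 * norm k)"
    by (rule picard_variation[OF W Y to1[OF F] to1[OF a] Lip c\<phi> \<phi>Y \<phi>])
  then obtain \<psi> where \<psi>0: "\<forall>h. continuous_on ({0..1} \<times> W) (\<lambda>p. \<psi> h (fst p) (snd p))"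
    "\<forall>h. \<forall>t\<in>{0..1}. \<forall>z\<in>W. \<psi> h t z = frechet_derivative a (at z) h +
       t *\<^sub>R integral {0..1} (\<lambda>s. frechet_derivative (F (t * s)) (at (z, \<phi> (t * s) z)) (h, \<psi> h (t * s) z))"
    "\<forall>t\<in>{0..1}. \<forall>z\<in>W. (\<phi> t has_derivative (\<lambda>h. \<psi> h t z)) (at z)"
    "\<forall>s\<in>{0..1}. \<forall>z\<in>W. \<forall>k. norm (frechet_derivative (F s) (at (z, \<phi> s z)) (0, k)) \<le> 1/2 * norm k"
    by (elim exE conjE)
  note c\<psi> = \<psi>0(1)[rule_format] and \<psi> = \<psi>0(2)[rule_format] and der = \<psi>0(3)[rule_format]
    and Lk = \<psi>0(4)[rule_format]
  define L where "L s z = frechet_derivative (F s) (at (z, \<phi> s z))" for s z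
  have linL: "linear (L s z)" if "s \<in> {0..1}" "z \<in> W" for s z
    unfolding L_def using Ck_family_deriv[OF F that(1), of "(z, \<phi> s z)"] \<phi>Y[OF that] that
    by (intro has_derivative_linear) simp
  show ?case
  proof (rule Ck_family_SucI[OF W c\<phi> der])
    fix h
    define Ft where "Ft s q = (\<Sum>b\<in>Basis. ((h, snd q) \<bullet> b) *\<^sub>R L s (fst q) b)" for s and q :: "'z \<times> 'b"
    have Ft: "Ft s (z, y) = L s z (h, y)" if "s \<in> {0..1}" "z \<in> W" for s z y
      unfolding Ft_def using linear_sum_Basis[OF linL[OF that], symmetric] by simp
    have WU: "open (W \<times> (UNIV :: 'b set))" using W by (intro open_Times) simp_all
    have fstC: "Ck_family {0..1::real} j (W \<times> (UNIV :: 'b set)) (\<lambda>_ q. fst q)"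
      by (rule Ck_family_bounded_linear[OF WU bounded_linear_fst])
    have CkL: "Ck_family {0..1} j (W \<times> (UNIV :: 'b set)) (\<lambda>s q. L s (fst q) b)" for b
    proof -
      have 1: "Ck_family {0..1} j W (\<lambda>s z. L s z b)"
        unfolding L_def
      proof (rule Ck_family_compose[OF W WY, where f = "\<lambda>s z. (z, \<phi> s z)"
            and g = "\<lambda>s x. frechet_derivative (F s) (at x) b"])
        have p1: "bounded_linear (\<lambda>z. (z, 0 :: 'b))" and p2: "bounded_linear (\<lambda>y. (0 :: 'z, y))"
          by (intro bounded_linear_Pair bounded_linear_ident bounded_linear_zero)+
        have "Ck_family {0..1} j W (\<lambda>s z. (z, 0) + (0, \<phi> s z))"
          by (rule Ck_family_add[OF W Ck_family_bounded_linear[OF W p1] Ck_family_linear_compose[OF W p2 IH]])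
        then show "Ck_family {0..1} j W (\<lambda>s z. (z, \<phi> s z))" by simp
        show "Ck_family {0..1} j (W \<times> Y) (\<lambda>s x. frechet_derivative (F s) (at x) b)"
          using F unfolding Ck_family.simps by blast
      qed (use \<phi>Y in simp)
      show ?thesis
        by (rule Ck_family_compose[OF WU W _ fstC 1]) auto
    qed
    have CkFt: "Ck_family {0..1} j (W \<times> UNIV) Ft"
      unfolding Ft_def
    proof (intro Ck_family_sum[OF WU] Ck_family_bounded_bilinear[OF bounded_bilinear_scaleR WU] CkL)
      fix b :: "'z \<times> 'b"
      have "Ck_family {0..1::real} j (W \<times> (UNIV :: 'b set)) (\<lambda>_ q. (h, 0) \<bullet> b + (0, snd q) \<bullet> b)"
      proof (intro Ck_family_add[OF WU] Ck_family_const[OF WU] Ck_family_bounded_linear[OF WU])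
        have "bounded_linear (\<lambda>q::'z \<times> 'b. (0 :: 'z, snd q))"
          by (intro bounded_linear_Pair bounded_linear_snd bounded_linear_zero)
        then show "bounded_linear (\<lambda>q::'z \<times> 'b. (0, snd q) \<bullet> b)" by (rule bounded_linear_inner_left_comp)
      qed
      then show "Ck_family {0..1::real} j (W \<times> (UNIV :: 'b set)) (\<lambda>_ q. (h, snd q) \<bullet> b)"
        by (simp add: inner_Pair_0 inner_prod_def)
    qed
    show "Ck_family {0..1} j W (\<lambda>t z. \<psi> h t z)"
    proof (rule Suc.IH[OF open_UNIV CkFt])
      show "Ck_family {0::real} j W (\<lambda>_ z. frechet_derivative a (at z) h)" using a by simp
      show "norm (Ft s (z, y) - Ft s (z, y')) \<le> 1/2 * norm (y - y')" if "s \<in> {0..1}" "z \<in> W" for s z y y'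
        using Lk[OF that, of "y - y'"] linear_diff[OF linL[OF that], of "(h, y)" "(h, y')"]
        by (simp add: Ft[OF that] L_def)
      show "\<psi> h t z = frechet_derivative a (at z) h + t *\<^sub>R integral {0..1} (\<lambda>s. Ft (t * s) (z, \<psi> h (t * s) z))"
        if "t \<in> {0..1}" "z \<in> W" for t z
      proof -
        have "integral {0..1} (\<lambda>s. Ft (t * s) (z, \<psi> h (t * s) z))
            = integral {0..1} (\<lambda>s. L (t * s) z (h, \<psi> h (t * s) z))"
          by (rule integral_cong) (rule Ft[OF mult_unit_interval[OF that(1)] that(2)])
        then show ?thesis using \<psi>[OF that, of h] by (simp add: L_def)
      qed
    qed (use c\<psi> in simp_all)
  qed
qed

section \<open>The Frobenius theorem\<close>

lemma smooth_family_at: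
  assumes "open S" "smooth_family T S f" "t \<in> T"
  shows "smooth_on S (f t)"
proof -
  have "Ck_on j S (f t)" if "Ck_family T j S f" for j f
    using that
  proof (induction j arbitrary: f)
    case 0
    have "continuous_on S (\<lambda>x. f t x)"
      by (rule continuous_on_compose_pair[OF Ck_family_continuous[OF 0]])
         (use assms(3) in \<open>auto intro: continuous_intros\<close>)
    then show ?case by simp
  next
    case (Suc j)
    show ?case
      using Suc.prems Suc.IH[of "\<lambda>t x. frechet_derivative (f t) (at x) v" for v] assms(3) by simp
  qed
  then show ?thesis using assms(2) unfolding smooth_on_def smooth_family_def by blast
qed

lemma smooth_on_lipschitz:
  fixes f :: "'a::euclidean_space \<Rightarrow> 'b::euclidean_space"
  assumes f: "smooth_on U f" and U: "cball p r \<subseteq> U"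
  shows "\<exists>C\<ge>0. \<forall>y\<in>cball p r. \<forall>y'\<in>cball p r. norm (f y - f y') \<le> C * norm (y - y')"
proof -
  define B where "B x = (\<Sum>b\<in>Basis. norm (frechet_derivative f (at x) b))" for x
  have "continuous_on U (\<lambda>x. frechet_derivative f (at x) b)" for b
    by (intro smooth_on_continuous smooth_on_deriv f)
  then have "continuous_on (cball p r) B"
    unfolding B_def by (intro continuous_on_sum continuous_on_norm) (rule continuous_on_subset[OF _ U])
  then have "bounded (B ` cball p r)"
    by (intro compact_imp_bounded compact_continuous_image compact_cball)
  then obtain C where C: "\<forall>x\<in>cball p r. norm (B x) \<le> C" unfolding bounded_iff by blast
  show ?thesis
  proof (intro exI[of _ "\<bar>C\<bar>"] conjI ballI)
    fix y y' assume y: "y \<in> cball p r" "y' \<in> cball p r"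
    show "norm (f y - f y') \<le> \<bar>C\<bar> * norm (y - y')"
    proof (rule differentiable_bound[OF convex_cball[of p r] _ _ y])
      fix x assume x: "x \<in> cball p r"
      then have xU: "x \<in> U" using U by blast
      show "(f has_derivative frechet_derivative f (at x)) (at x within cball p r)"
        by (rule has_derivative_at_withinI) (rule smooth_on_has_derivative[OF f xU])
      show "onorm (frechet_derivative f (at x)) \<le> \<bar>C\<bar>"
      proof (rule onorm_bound)
        fix v
        have "norm (frechet_derivative f (at x) v) \<le> B x * norm v"
          unfolding B_def by (rule linear_norm_le_Basis[OF smooth_on_linear_derivative[OF f xU]])
        also have "\<dots> \<le> \<bar>C\<bar> * norm v"
        proof (rule mult_right_mono)
          show "B x \<le> \<bar>C\<bar>" using bspec[OF C x] by simp
        qed simp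
        finally show "norm (frechet_derivative f (at x) v) \<le> \<bar>C\<bar> * norm v" .
      qed simp
    qed
  qed simp
qed

lemma scaled_FTC:
  fixes \<xi> :: "real \<Rightarrow> 'b::euclidean_space"
  assumes d: "\<And>s. s \<in> {0..1} \<Longrightarrow> (\<xi> has_vector_derivative f s) (at s within {0..1})"
    and t: "t \<in> {0..1}"
  shows "t *\<^sub>R integral {0..1} (\<lambda>s. f (t * s)) = \<xi> t - \<xi> 0"
proof -
  have "((\<lambda>s. t *\<^sub>R f (t * s)) has_integral ((\<xi> \<circ> (\<lambda>s. t * s)) 1 - (\<xi> \<circ> (\<lambda>s. t * s)) 0)) {0..1}"
  proof (rule fundamental_theorem_of_calculus)
    fix s :: real assume s: "s \<in> {0..1}"
    have sub: "(\<lambda>s. t * s) ` {0..1} \<subseteq> {0..1}" using mult_unit_interval[OF t] by blast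
    have "((\<lambda>s. t * s) has_vector_derivative t) (at s within {0..1})"
      by (auto intro!: derivative_eq_intros)
    moreover have "(\<xi> has_vector_derivative f (t * s)) (at (t * s) within (\<lambda>s. t * s) ` {0..1})"
      by (rule has_vector_derivative_within_subset[OF d[OF mult_unit_interval[OF t s]] sub])
    ultimately show "(\<xi> \<circ> (\<lambda>s. t * s) has_vector_derivative t *\<^sub>R f (t * s)) (at s within {0..1})"
      by (rule vector_diff_chain_within)
  qed simp
  from integral_unique[OF this] show ?thesis by simp
qed

lemma scaled_integral_has_vector_derivative:
  fixes f :: "real \<Rightarrow> 'b::euclidean_space"
  assumes f: "continuous_on {0..1} f" and s: "s \<in> {0..1}"
    and \<phi>: "\<And>t. t \<in> {0..1} \<Longrightarrow> \<phi> t = a + t *\<^sub>R integral {0..1} (\<lambda>s. f (t * s))"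
  shows "(\<phi> has_vector_derivative f s) (at s within {0..1})"
proof -
  define G where "G t = integral {0..t} f" for t
  have G: "(G has_vector_derivative f s) (at s within {0..1})" if "s \<in> {0..1}" for s
    unfolding G_def by (rule integral_has_vector_derivative[OF f that])
  have eq: "\<phi> t = a + G t" if "t \<in> {0..1}" for t
    using scaled_FTC[OF G that] \<phi>[OF that] by (simp add: G_def)
  have "((\<lambda>t. a + G t) has_vector_derivative 0 + f s) (at s within {0..1})"
    by (intro has_vector_derivative_add has_vector_derivative_const G s)
  then show ?thesis
    using has_vector_derivative_transform[OF s, of "\<phi>" "\<lambda>t. a + G t"] eq by simp
qed

text \<open>The curves \<open>t \<mapsto> \<phi> t z\<close> start at \<open>p + z - \<pi> z\<close> and follow the vector field \<open>q \<mapsto> A q z\<close>, which is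
  small together with \<open>z\<close>.  This is why they exist up to time \<open>1\<close>, and why the constant
  \<open>1/2\<close> that the fixed point argument needs is available.\<close>

lemma radial_flow:
  fixes A :: "'a::euclidean_space \<Rightarrow> 'a \<Rightarrow> 'a"
  assumes U: "open U" and p: "p \<in> U" and \<pi>: "linear \<pi>"
    and linA': "\<forall>q\<in>U. linear (A q)" and smA: "\<And>v. smooth_on U (\<lambda>q. A q v)"
  shows "\<exists>\<rho>>0. \<exists>\<phi> \<psi>. smooth_on (ball 0 \<rho>) (\<phi> 1) \<and>
    (\<forall>z\<in>ball 0 \<rho>. \<forall>t\<in>{0..1}. \<phi> t z \<in> U \<and>
       \<phi> t z = p + z - \<pi> z + t *\<^sub>R integral {0..1} (\<lambda>s. A (\<phi> (t * s) z) z) \<and>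
       (\<phi> t has_derivative (\<lambda>h. \<psi> h t z)) (at z) \<and>
       (\<forall>h. \<psi> h t z = h - \<pi> h + t *\<^sub>R integral {0..1} (\<lambda>s. A (\<phi> (t * s) z) h
            + frechet_derivative (\<lambda>y. A y z) (at (\<phi> (t * s) z)) (\<psi> h (t * s) z))) \<and>
       (\<forall>k. norm (frechet_derivative (\<lambda>y. A y z) (at (\<phi> t z)) k) \<le> 1/2 * norm k)) \<and>
    (\<forall>z\<in>ball 0 \<rho>. continuous_on {0..1} (\<lambda>t. \<phi> t z) \<and> (\<forall>h. continuous_on {0..1} (\<lambda>t. \<psi> h t z)))"
proof -
  have linA: "linear (A q)" if "q \<in> U" for q using linA' that by blast
  obtain r where r: "r > 0" "cball p r \<subseteq> U" using U p open_contains_cball by blast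
  have "\<forall>b. \<exists>C\<ge>0. \<forall>y\<in>cball p r. \<forall>y'\<in>cball p r. norm (A y b - A y' b) \<le> C * norm (y - y')"
    using smooth_on_lipschitz[OF smA r(2)] by blast
  then obtain Cb where Cb: "\<And>b. Cb b \<ge> 0"
    "\<And>b y y'. y \<in> cball p r \<Longrightarrow> y' \<in> cball p r \<Longrightarrow> norm (A y b - A y' b) \<le> Cb b * norm (y - y')"
    by metis
  define C where "C = (\<Sum>b\<in>Basis. Cb b)"
  have C0: "C \<ge> 0" unfolding C_def by (rule sum_nonneg) (rule Cb(1))
  have pr: "p \<in> cball p r" using r(1) by simp
  have AC: "norm (A y z - A y' z) \<le> C * norm (y - y') * norm z"
    if y: "y \<in> cball p r" "y' \<in> cball p r" for y y' z
  proof -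
    have l: "linear (A y)" "linear (A y')" using linA r(2) y by blast+
    have "norm (A y z - A y' z) \<le> (\<Sum>b\<in>Basis. norm (A y b - A y' b)) * norm z"
      by (rule linear_norm_le_Basis[OF linear_compose_sub[OF l]])
    also have "\<dots> \<le> (\<Sum>b\<in>Basis. Cb b * norm (y - y')) * norm z"
      by (intro mult_right_mono sum_mono Cb(2) y norm_ge_zero)
    finally show ?thesis by (simp add: C_def sum_distrib_right)
  qed
  obtain K0 where K0: "K0 > 0" "\<And>z. norm (A p z) \<le> K0 * norm z"
    using linear_bounded_pos[OF linA[OF p]] by blast
  define K where "K = K0 + C * r"
  have K: "norm (A y z) \<le> K * norm z" if "y \<in> cball p r" for y z
  proof -
    have "norm (A y z - A p z) \<le> C * norm (y - p) * norm z" by (rule AC[OF that pr])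
    also have "\<dots> \<le> C * r * norm z"
      using that C0 by (intro mult_right_mono mult_left_mono) (simp_all add: dist_norm norm_minus_commute)
    finally show ?thesis
      using K0(2)[of z] norm_triangle_sub[of "A y z" "A p z"] by (simp add: K_def algebra_simps)
  qed
  have K_pos: "K > 0" using K0(1) C0 r(1) by (simp add: K_def add_pos_nonneg)
  have lin\<sigma>: "linear (\<lambda>z. z - \<pi> z)" by (intro linear_compose_sub \<pi> linear_id[unfolded id_def])
  obtain c where c: "c > 0" "\<And>z. norm (z - \<pi> z) \<le> c * norm z"
    using linear_bounded_pos[OF lin\<sigma>] by blast
  \<comment> \<open>The first bound makes the Lipschitz constant at most \<open>1/2\<close>, the second keeps the curves in the ball.\<close>
  define \<rho> where "\<rho> = min (1 / (2 * (C + 1))) (r / (c + K))"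
  have \<rho>: "\<rho> > 0" using C0 c(1) K_pos r(1) by (simp add: \<rho>_def)
  have \<rho>C: "C * norm z \<le> 1/2" if "z \<in> ball 0 \<rho>" for z
  proof -
    have "norm z \<le> 1 / (2 * (C + 1))"
      using that min.cobounded1[of "1 / (2 * (C + 1))" "r / (c + K)"] by (simp add: \<rho>_def)
    then have "C * norm z \<le> C * (1 / (2 * (C + 1)))" using C0 by (rule mult_left_mono)
    also have "\<dots> \<le> 1/2" using C0 by (simp add: field_simps)
    finally show ?thesis .
  qed
  have \<rho>r: "c * norm z + K * norm z < r" if "z \<in> ball 0 \<rho>" for z
  proof -
    have "norm z < r / (c + K)"
      using that min.cobounded2[of "1 / (2 * (C + 1))" "r / (c + K)"] by (simp add: \<rho>_def)
    then have "norm z * (c + K) < r" using c(1) K_pos by (simp add: pos_less_divide_eq)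
    then show ?thesis by (simp add: algebra_simps)
  qed
  let ?W = "ball (0::'a) \<rho>" and ?Y = "ball p r"
  \<comment> \<open>The fields live on \<open>U\<close> only.  The projection to the closed ball makes them globally Lipschitz and does
    not affect curves that stay in the ball.\<close>
  define cp where "cp = closest_point (cball p r)"
  have ne: "cball p r \<noteq> {}" using r(1) by simp
  have cpK: "cp y \<in> cball p r" for y unfolding cp_def by (rule closest_point_in_set[OF closed_cball ne])
  have cp_id: "cp y = y" if "y \<in> ?Y" for y
    unfolding cp_def by (rule closest_point_self) (use that in simp)
  have ccp: "continuous_on UNIV cp"
    unfolding cp_def by (rule continuous_on_closest_point[OF convex_cball closed_cball ne])
  have Lip1: "norm (A y z - A y' z) \<le> 1/2 * norm (y - y')"
    if "y \<in> cball p r" "y' \<in> cball p r" "z \<in> ?W" for y y' z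
  proof -
    have "norm (A y z - A y' z) \<le> (C * norm z) * norm (y - y')"
      using AC[OF that(1,2), of z] by (simp add: mult_ac)
    also have "\<dots> \<le> 1/2 * norm (y - y')" by (intro mult_right_mono \<rho>C that(3)) simp
    finally show ?thesis .
  qed
  have Lip: "norm (A (cp y) z - A (cp y') z) \<le> 1/2 * norm (y - y')" if "z \<in> ?W" for y y' z
  proof -
    have "norm (A (cp y) z - A (cp y') z) \<le> 1/2 * norm (cp y - cp y')"
      by (rule Lip1[OF cpK cpK that])
    also have "norm (cp y - cp y') \<le> norm (y - y')"
      unfolding cp_def using closest_point_lipschitz[OF convex_cball closed_cball ne, of y y']
      by (simp add: dist_norm)
    finally show ?thesis by simp
  qed
  define a where "a z = p + z - \<pi> z" for z
  have bl\<pi>: "bounded_linear \<pi>" using \<pi> by (simp add: linear_conv_bounded_linear)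
  have ca: "continuous_on ?W a"
    unfolding a_def by (intro continuous_intros bounded_linear.continuous_on[OF bl\<pi>])
  have cA: "continuous_on (cball p r) (\<lambda>q. A q b)" for b
    by (rule continuous_on_subset[OF smooth_on_continuous[OF smA] r(2)])
  have cF: "continuous_on (({0..1::real} \<times> ?W) \<times> UNIV) (\<lambda>q. A (cp (snd q)) (snd (fst q)))"
  proof (rule continuous_on_eq)
    have "continuous_on (({0..1::real} \<times> ?W) \<times> UNIV) (\<lambda>q. cp (snd q))"
      by (rule continuous_on_compose2[OF ccp]) (auto intro: continuous_intros)
    then have "continuous_on (({0..1::real} \<times> ?W) \<times> UNIV) (\<lambda>q. A (cp (snd q)) b)" for b
      by (rule continuous_on_compose2[OF cA]) (use cpK in blast)
    then show "continuous_on (({0..1::real} \<times> ?W) \<times> UNIV) (\<lambda>q. \<Sum>b\<in>Basis. (snd (fst q) \<bullet> b) *\<^sub>R A (cp (snd q)) b)"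
      by (intro continuous_intros)
    show "(\<Sum>b\<in>Basis. (snd (fst q) \<bullet> b) *\<^sub>R A (cp (snd q)) b) = A (cp (snd q)) (snd (fst q))"
      for q :: "(real \<times> 'a) \<times> 'a"
    proof -
      have "linear (A (cp (snd q)))" using linA cpK r(2) by blast
      from linear_sum_Basis[OF this] show ?thesis by metis
    qed
  qed
  have "\<exists>\<phi>. continuous_on ({0..1} \<times> ?W) (\<lambda>q. \<phi> (fst q) (snd q)) \<and> (\<forall>t\<in>{0..1}. \<forall>z\<in>?W.
       \<phi> t z = a z + t *\<^sub>R integral {0..1} (\<lambda>s. A (cp (\<phi> (t * s) z)) z))"
    by (rule picard_existence[OF open_ball cF ca Lip])
  then obtain \<phi> where c\<phi>: "continuous_on ({0..1} \<times> ?W) (\<lambda>q. \<phi> (fst q) (snd q))"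
    and \<phi>cp: "\<forall>t\<in>{0..1}. \<forall>z\<in>?W. \<phi> t z = a z + t *\<^sub>R integral {0..1} (\<lambda>s. A (cp (\<phi> (t * s) z)) z)"
    by (elim exE conjE)
  have c\<phi>1: "continuous_on {0..1} (\<lambda>s. \<phi> s z)" if "z \<in> ?W" for z
    by (rule continuous_on_compose_pair[OF c\<phi>]) (use that in \<open>auto intro: continuous_intros\<close>)
  have \<phi>Y: "\<phi> t z \<in> ?Y" if t: "t \<in> {0..1}" and z: "z \<in> ?W" for t z
  proof -
    have "continuous_on {0..1} (\<lambda>s. cp (\<phi> s z))"
      by (rule continuous_on_compose2[OF ccp c\<phi>1[OF z]]) simp
    then have "continuous_on {0..1} (\<lambda>s. A (cp (\<phi> s z)) b)" for b
      by (rule continuous_on_compose2[OF cA]) (use cpK in blast)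
    then have "continuous_on {0..1} (\<lambda>s. \<Sum>b\<in>Basis. (z \<bullet> b) *\<^sub>R A (cp (\<phi> s z)) b)"
      by (intro continuous_intros)
    moreover have "(\<Sum>b\<in>Basis. (z \<bullet> b) *\<^sub>R A (cp (\<phi> s z)) b) = A (cp (\<phi> s z)) z" for s
    proof -
      have "linear (A (cp (\<phi> s z)))" using linA cpK r(2) by blast
      from linear_sum_Basis[OF this] show ?thesis by metis
    qed
    ultimately have "continuous_on {0..1} (\<lambda>s. A (cp (\<phi> s z)) z)" by simp
    from continuous_on_rescale[OF this t]
    have "norm (t *\<^sub>R integral {0..1} (\<lambda>s. A (cp (\<phi> (t * s) z)) z)) \<le> K * norm z"
      by (rule scaled_integral_bound[where h = "\<lambda>s. A (cp (\<phi> s z)) z", OF t]) (rule K[OF cpK])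
    moreover have "\<phi> t z - p = (z - \<pi> z) + t *\<^sub>R integral {0..1} (\<lambda>s. A (cp (\<phi> (t * s) z)) z)"
      unfolding \<phi>cp[rule_format, OF t z] a_def by simp
    ultimately have "norm (\<phi> t z - p) \<le> c * norm z + K * norm z"
      using norm_triangle_mono[OF c(2)] by metis
    then show ?thesis using \<rho>r[OF z] by (simp add: dist_norm norm_minus_commute)
  qed
  have \<phi>: "\<phi> t z = a z + t *\<^sub>R integral {0..1} (\<lambda>s. A (\<phi> (t * s) z) z)"
    if t: "t \<in> {0..1}" and z: "z \<in> ?W" for t z
  proof -
    have "integral {0..1} (\<lambda>s. A (cp (\<phi> (t * s) z)) z) = integral {0..1} (\<lambda>s. A (\<phi> (t * s) z) z)"
      by (rule integral_cong) (simp only: cp_id[OF \<phi>Y[OF mult_unit_interval[OF t] z]])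
    then show ?thesis using \<phi>cp t z by simp
  qed
  define F where "F q = (\<Sum>b\<in>Basis. (fst q \<bullet> b) *\<^sub>R A (snd q) b)" for q :: "'a \<times> 'a"
  have YU: "?Y \<subseteq> U" using r(2) ball_subset_cball by blast
  have F: "F (z, y) = A y z" if "y \<in> U" for z y
    unfolding F_def fst_conv snd_conv by (rule linear_sum_Basis[OF linA[OF that], symmetric])
  have WY: "open (?W \<times> ?Y)" by (intro open_Times open_ball)
  have smF: "smooth_on (?W \<times> ?Y) F"
    unfolding F_def
  proof (intro smooth_on_sum[OF WY] smooth_on_scaleR[OF WY])
    fix b :: 'a
    show "smooth_on (?W \<times> ?Y) (\<lambda>q. fst q \<bullet> b)"
      by (intro smooth_on_bounded_linear[OF WY] bounded_linear_inner_left_comp bounded_linear_fst)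
    show "smooth_on (?W \<times> ?Y) (\<lambda>q. A (snd q) b)"
      by (rule smooth_on_compose[OF WY U smooth_on_bounded_linear[OF WY bounded_linear_snd] smA])
         (use YU in auto)
  qed
  have F_fam: "Ck_family {0..1} j (?W \<times> ?Y) (\<lambda>_. F)" for j
    using smooth_on_imp_family[OF WY smF] unfolding smooth_family_def by blast
  have sma: "smooth_on ?W a"
    unfolding a_def
    by (intro smooth_on_diff smooth_on_add smooth_on_const smooth_on_id smooth_on_bounded_linear bl\<pi> open_ball)
  have a_fam: "Ck_family {0::real} j ?W (\<lambda>_. a)" for j
    using sma unfolding smooth_on_iff_family[OF open_ball] smooth_family_def by blast
  have LipF: "norm (F (z, y) - F (z, y')) \<le> 1/2 * norm (y - y')"
    if "s \<in> {0..1}" "z \<in> ?W" "y \<in> ?Y" "y' \<in> ?Y" for s :: real and z y y'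
    using Lip1[of y y' z] that YU by (simp add: F subset_eq)
  have \<phi>F: "\<phi> t z = a z + t *\<^sub>R integral {0..1} (\<lambda>s. F (z, \<phi> (t * s) z))"
    if t: "t \<in> {0..1}" and z: "z \<in> ?W" for t z
  proof -
    have "F (z, \<phi> (t * s) z) = A (\<phi> (t * s) z) z" if "s \<in> {0..1}" for s
      using \<phi>Y[OF mult_unit_interval[OF t that] z] YU by (intro F) blast
    then have "integral {0..1} (\<lambda>s. F (z, \<phi> (t * s) z)) = integral {0..1} (\<lambda>s. A (\<phi> (t * s) z) z)"
      by (rule integral_cong)
    then show ?thesis using \<phi>[OF t z] by simp
  qed
  have "Ck_family {0..1} j ?W \<phi>" for j
    by (rule picard_Ck[OF open_ball open_ball F_fam a_fam LipF c\<phi> \<phi>Y \<phi>F])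
  then have sm\<phi>: "smooth_on ?W (\<phi> 1)"
    by (intro smooth_family_at[of _ "{0..1}"]) (simp_all add: smooth_family_def)
  have DA: "frechet_derivative (\<lambda>y. A y z) (at y) k = (\<Sum>b\<in>Basis. (z \<bullet> b) *\<^sub>R frechet_derivative (\<lambda>y. A y b) (at y) k)"
    if y: "y \<in> U" for y z k
  proof -
    have "((\<lambda>y. \<Sum>b\<in>Basis. (z \<bullet> b) *\<^sub>R A y b) has_derivative
        (\<lambda>k. \<Sum>b\<in>Basis. (z \<bullet> b) *\<^sub>R frechet_derivative (\<lambda>y. A y b) (at y) k)) (at y)"
      by (intro has_derivative_sum has_derivative_scaleR_right smooth_on_has_derivative[OF smA y])
    then have "((\<lambda>y. A y z) has_derivative
        (\<lambda>k. \<Sum>b\<in>Basis. (z \<bullet> b) *\<^sub>R frechet_derivative (\<lambda>y. A y b) (at y) k)) (at y)"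
      by (rule has_derivative_transform_within_open[OF _ U y])
         (rule linear_sum_Basis[OF linA, symmetric])
    then show ?thesis by (simp add: frechet_derivative_at[symmetric])
  qed
  have DF: "frechet_derivative F (at (z, y)) (h, k) = A y h + frechet_derivative (\<lambda>y. A y z) (at y) k"
    if z: "z \<in> ?W" and y: "y \<in> ?Y" for z y h k
  proof -
    have yU: "y \<in> U" using y YU by blast
    have "((\<lambda>q. A (snd q) b) has_derivative (\<lambda>v. frechet_derivative (\<lambda>y. A y b) (at y) (snd v))) (at (z, y))" for b
    proof -
      have "((\<lambda>y. A y b) has_derivative frechet_derivative (\<lambda>y. A y b) (at y)) (at (snd (z, y)))"
        using smooth_on_has_derivative[OF smA yU] by simp
      from diff_chain_at[OF bounded_linear_imp_has_derivative[OF bounded_linear_snd] this]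
      show ?thesis by (simp add: o_def)
    qed
    moreover have "((\<lambda>q. fst q \<bullet> b) has_derivative (\<lambda>v. fst v \<bullet> b)) (at (z, y))" for b :: 'a
      by (intro bounded_linear_imp_has_derivative bounded_linear_inner_left_comp bounded_linear_fst)
    ultimately have "((\<lambda>q. (fst q \<bullet> b) *\<^sub>R A (snd q) b) has_derivative
        (\<lambda>v. (fst (z, y) \<bullet> b) *\<^sub>R frechet_derivative (\<lambda>y. A y b) (at y) (snd v)
           + (fst v \<bullet> b) *\<^sub>R A (snd (z, y)) b)) (at (z, y))" for b
      by (intro has_derivative_scaleR)
    then have "(F has_derivative (\<lambda>v. \<Sum>b\<in>Basis. (fst (z, y) \<bullet> b) *\<^sub>R frechet_derivative (\<lambda>y. A y b) (at y) (snd v)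
           + (fst v \<bullet> b) *\<^sub>R A (snd (z, y)) b)) (at (z, y))"
      unfolding F_def by (rule has_derivative_sum)
    then show ?thesis
      using linear_sum_Basis[OF linA[OF yU], of h] DA[OF yU, of z k]
      by (simp add: frechet_derivative_at[symmetric] sum.distrib add.commute)
  qed
  have V: "\<exists>\<psi>. (\<forall>h. continuous_on ({0..1} \<times> ?W) (\<lambda>p. \<psi> h (fst p) (snd p))) \<and>
    (\<forall>h. \<forall>t\<in>{0..1}. \<forall>z\<in>?W. \<psi> h t z = frechet_derivative a (at z) h +
       t *\<^sub>R integral {0..1} (\<lambda>s. frechet_derivative F (at (z, \<phi> (t * s) z)) (h, \<psi> h (t * s) z))) \<and>
    (\<forall>t\<in>{0..1}. \<forall>z\<in>?W. (\<phi> t has_derivative (\<lambda>h. \<psi> h t z)) (at z)) \<and>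
    (\<forall>s\<in>{0..1::real}. \<forall>z\<in>?W. \<forall>k. norm (frechet_derivative F (at (z, \<phi> s z)) (0, k)) \<le> 1/2 * norm k)"
    by (rule picard_variation[OF open_ball open_ball F_fam a_fam LipF c\<phi> \<phi>Y \<phi>F])
  then obtain \<psi> where c\<psi>: "\<forall>h. continuous_on ({0..1} \<times> ?W) (\<lambda>p. \<psi> h (fst p) (snd p))"
    and \<psi>: "\<forall>h. \<forall>t\<in>{0..1}. \<forall>z\<in>?W. \<psi> h t z = frechet_derivative a (at z) h +
       t *\<^sub>R integral {0..1} (\<lambda>s. frechet_derivative F (at (z, \<phi> (t * s) z)) (h, \<psi> h (t * s) z))"
    and d\<phi>: "\<forall>t\<in>{0..1}. \<forall>z\<in>?W. (\<phi> t has_derivative (\<lambda>h. \<psi> h t z)) (at z)"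
    and half: "\<forall>s\<in>{0..1::real}. \<forall>z\<in>?W. \<forall>k. norm (frechet_derivative F (at (z, \<phi> s z)) (0, k)) \<le> 1/2 * norm k"
    by (elim exE conjE)
  have Da: "frechet_derivative a (at z) h = h - \<pi> h" for z h
  proof -
    have "(a has_derivative (\<lambda>h. 0 + h - \<pi> h)) (at z)"
      unfolding a_def
      by (intro has_derivative_diff has_derivative_add has_derivative_const has_derivative_ident
          bounded_linear_imp_has_derivative bl\<pi>)
    then show ?thesis by (simp add: frechet_derivative_at[symmetric])
  qed
  show ?thesis
  proof (rule exI[of _ \<rho>], rule conjI[OF \<rho>], rule exI[of _ \<phi>], rule exI[of _ \<psi>], intro conjI ballI allI sm\<phi>)
    fix z h and t :: real assume z: "z \<in> ?W" and t: "t \<in> {0..1}"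
    show "\<phi> t z \<in> U" using \<phi>Y[OF t z] YU by blast
    show "\<phi> t z = p + z - \<pi> z + t *\<^sub>R integral {0..1} (\<lambda>s. A (\<phi> (t * s) z) z)"
      using \<phi>[OF t z] by (simp add: a_def)
    show "(\<phi> t has_derivative (\<lambda>h. \<psi> h t z)) (at z)" using d\<phi> t z by blast
    have "integral {0..1} (\<lambda>s. frechet_derivative F (at (z, \<phi> (t * s) z)) (h, \<psi> h (t * s) z))
        = integral {0..1} (\<lambda>s. A (\<phi> (t * s) z) h
            + frechet_derivative (\<lambda>y. A y z) (at (\<phi> (t * s) z)) (\<psi> h (t * s) z))"
      by (rule integral_cong) (rule DF[OF z \<phi>Y[OF mult_unit_interval[OF t] z]])
    then show "\<psi> h t z = h - \<pi> h + t *\<^sub>R integral {0..1} (\<lambda>s. A (\<phi> (t * s) z) h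
            + frechet_derivative (\<lambda>y. A y z) (at (\<phi> (t * s) z)) (\<psi> h (t * s) z))"
      using \<psi>[rule_format, OF t z, of h] by (simp add: Da)
  next
    fix z k and t :: real assume z: "z \<in> ?W" and t: "t \<in> {0..1}"
    have "A (\<phi> t z) 0 = 0" using linA \<phi>Y[OF t z] YU linear_0 by blast
    then show "norm (frechet_derivative (\<lambda>y. A y z) (at (\<phi> t z)) k) \<le> 1/2 * norm k"
      using half[rule_format, OF t z, of k] DF[OF z \<phi>Y[OF t z], of 0 k] by simp
  next
    fix z assume z: "z \<in> ?W"
    show "continuous_on {0..1} (\<lambda>t. \<phi> t z)" by (rule c\<phi>1[OF z])
    show "continuous_on {0..1} (\<lambda>t. \<psi> h t z)" for h
      by (rule continuous_on_compose_pair[OF c\<psi>[rule_format]]) (use z in \<open>auto intro: continuous_intros\<close>)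
  qed
qed

text \<open>If the fields \<open>q \<mapsto> A q u\<close> commute, then the time-one map \<open>G\<close> of the radial flow is the exponential map
  of these fields, transversally parametrized by the kernel of \<open>\<pi>\<close>, and it carries the constant field
  \<open>u\<close> to \<open>A q u\<close>.  Using the one family of radial curves avoids compositions of several flows.\<close>

lemma frobenius_commuting:
  fixes A :: "'a::euclidean_space \<Rightarrow> 'a \<Rightarrow> 'a"
  assumes U: "open U" and p: "p \<in> U" and \<pi>: "linear \<pi>"
    and linA: "\<And>q. q \<in> U \<Longrightarrow> linear (A q)" and smA: "\<And>v. smooth_on U (\<lambda>q. A q v)"
    and Ap: "\<And>v. A p v = \<pi> v"
    and comm: "\<And>q u v. q \<in> U \<Longrightarrow>
      frechet_derivative (\<lambda>q. A q v) (at q) (A q u) = frechet_derivative (\<lambda>q. A q u) (at q) (A q v)"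
  shows "\<exists>B W G H. diffeo B W G H \<and> 0 \<in> B \<and> W \<subseteq> U \<and> G 0 = p \<and>
    (\<forall>z\<in>B. \<forall>u. \<pi> u = u \<longrightarrow> frechet_derivative G (at z) u = A (G z) u)"
proof -
  obtain \<rho> \<phi> \<psi> where \<rho>: "\<rho> > 0" and sm: "smooth_on (ball 0 \<rho>) (\<phi> 1)"
    and main: "\<forall>z\<in>ball 0 \<rho>. \<forall>t\<in>{0..1}. \<phi> t z \<in> U \<and>
       \<phi> t z = p + z - \<pi> z + t *\<^sub>R integral {0..1} (\<lambda>s. A (\<phi> (t * s) z) z) \<and>
       (\<phi> t has_derivative (\<lambda>h. \<psi> h t z)) (at z) \<and>
       (\<forall>h. \<psi> h t z = h - \<pi> h + t *\<^sub>R integral {0..1} (\<lambda>s. A (\<phi> (t * s) z) h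
            + frechet_derivative (\<lambda>y. A y z) (at (\<phi> (t * s) z)) (\<psi> h (t * s) z))) \<and>
       (\<forall>k. norm (frechet_derivative (\<lambda>y. A y z) (at (\<phi> t z)) k) \<le> 1/2 * norm k)"
    and cont: "\<forall>z\<in>ball 0 \<rho>. continuous_on {0..1} (\<lambda>t. \<phi> t z) \<and> (\<forall>h. continuous_on {0..1} (\<lambda>t. \<psi> h t z))"
  proof -
    have "\<forall>q\<in>U. linear (A q)" using linA by blast
    from radial_flow[OF U p \<pi> this smA] show thesis
      by (elim exE conjE) (rule that, assumption+)
  qed
  let ?B = "ball (0::'a) \<rho>"
  have \<phi>U: "\<phi> t z \<in> U" if "z \<in> ?B" "t \<in> {0..1}" for t z using main that by blast
  have \<phi>: "\<phi> t z = p + z - \<pi> z + t *\<^sub>R integral {0..1} (\<lambda>s. A (\<phi> (t * s) z) z)"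
    if "z \<in> ?B" "t \<in> {0..1}" for t z using main[rule_format, OF that] by (elim conjE)
  have d\<phi>: "(\<phi> t has_derivative (\<lambda>h. \<psi> h t z)) (at z)" if "z \<in> ?B" "t \<in> {0..1}" for t z
    using main that by blast
  have \<psi>: "\<psi> h t z = h - \<pi> h + t *\<^sub>R integral {0..1} (\<lambda>s. A (\<phi> (t * s) z) h
            + frechet_derivative (\<lambda>y. A y z) (at (\<phi> (t * s) z)) (\<psi> h (t * s) z))"
    if "z \<in> ?B" "t \<in> {0..1}" for h t z using main[rule_format, OF that] by blast
  have half: "norm (frechet_derivative (\<lambda>y. A y z) (at (\<phi> t z)) k) \<le> 1/2 * norm k"
    if "z \<in> ?B" "t \<in> {0..1}" for t z k using main that by blast
  have c\<phi>: "continuous_on {0..1} (\<lambda>t. \<phi> t z)" and c\<psi>: "continuous_on {0..1} (\<lambda>t. \<psi> h t z)"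
    if "z \<in> ?B" for z h using cont that by blast+
  have linD: "linear (frechet_derivative (\<lambda>y. A y v) (at q))" if "q \<in> U" for q v
    by (rule smooth_on_linear_derivative[OF smA that])
  have cA: "continuous_on {0..1} (\<lambda>s. A (\<phi> s z) v)" if "z \<in> ?B" for z v
    by (rule continuous_on_compose2[OF smooth_on_continuous[OF smA] c\<phi>[OF that]]) (use \<phi>U[OF that] in blast)
  have cD: "continuous_on {0..1} (\<lambda>s. frechet_derivative (\<lambda>y. A y z) (at (\<phi> s z)) (g s))"
    if z: "z \<in> ?B" and g: "continuous_on {0..1} g" for z g
  proof (rule continuous_on_eq)
    have "continuous_on {0..1} (\<lambda>s. frechet_derivative (\<lambda>y. A y z) (at (\<phi> s z)) b)" for b
      by (rule continuous_on_compose2[OF smooth_on_continuous[OF smooth_on_deriv[OF smA]] c\<phi>[OF z]])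
         (use \<phi>U[OF z] in blast)
    then show "continuous_on {0..1} (\<lambda>s. \<Sum>b\<in>Basis. (g s \<bullet> b) *\<^sub>R frechet_derivative (\<lambda>y. A y z) (at (\<phi> s z)) b)"
      by (intro continuous_intros g)
  qed (rule linear_sum_Basis[OF linD[OF \<phi>U[OF z]], symmetric])
  \<comment> \<open>Both sides solve the same linear equation; commutativity is used for the right-hand side.\<close>
  have key: "\<psi> u t z = t *\<^sub>R A (\<phi> t z) u" if z: "z \<in> ?B" and t: "t \<in> {0..1}" and u: "\<pi> u = u" for z u t
  proof -
    define x where "x t = t *\<^sub>R A (\<phi> t z) u" for t
    define D where "D s k = frechet_derivative (\<lambda>y. A y z) (at (\<phi> s z)) k" for s k
    have cx: "continuous_on {0..1} x" unfolding x_def by (intro continuous_intros cA z)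
    have vd: "(x has_vector_derivative (A (\<phi> s z) u + D s (x s))) (at s within {0..1})"
      if s: "s \<in> {0..1}" for s
    proof -
      have v\<phi>: "((\<lambda>t. \<phi> t z) has_vector_derivative A (\<phi> s z) z) (at s within {0..1})"
        by (rule scaled_integral_has_vector_derivative[OF cA[OF z] s]) (rule \<phi>[OF z])
      have "((\<lambda>y. A y u) \<circ> (\<lambda>t. \<phi> t z) has_vector_derivative
          frechet_derivative (\<lambda>y. A y u) (at (\<phi> s z)) (A (\<phi> s z) z)) (at s within {0..1})"
        by (rule vector_derivative_diff_chain_within[OF v\<phi>])
           (rule has_derivative_at_withinI[OF smooth_on_has_derivative[OF smA \<phi>U[OF z s]]])
      then have "((\<lambda>t. A (\<phi> t z) u) has_vector_derivative D s (A (\<phi> s z) u)) (at s within {0..1})"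
        by (simp only: o_def D_def comm[OF \<phi>U[OF z s], of u z])
      then have "(x has_vector_derivative s *\<^sub>R D s (A (\<phi> s z) u) + 1 *\<^sub>R A (\<phi> s z) u) (at s within {0..1})"
        unfolding x_def by (intro has_vector_derivative_scaleR DERIV_ident)
      moreover have "s *\<^sub>R D s (A (\<phi> s z) u) = D s (x s)"
        unfolding x_def D_def by (simp add: linear_cmul[OF linD[OF \<phi>U[OF z s]]])
      ultimately show ?thesis by (simp add: add.commute)
    qed
    have xeq: "x t = t *\<^sub>R integral {0..1} (\<lambda>s. A (\<phi> (t * s) z) u + D (t * s) (x (t * s)))"
      if "t \<in> {0..1}" for t
    proof -
      have x0: "x 0 = 0" by (simp add: x_def)
      have "t *\<^sub>R integral {0..1} (\<lambda>s. A (\<phi> (t * s) z) u + D (t * s) (x (t * s))) = x t - x 0"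
        by (rule scaled_FTC[OF vd that])
      then show ?thesis unfolding x0 diff_zero by (rule sym)
    qed
    define g where "g t = \<psi> u t z - x t" for t
    have cg: "continuous_on {0..1} g" unfolding g_def by (intro continuous_intros c\<psi> z cx)
    have geq: "g t = t *\<^sub>R integral {0..1} (\<lambda>s. D (t * s) (g (t * s)))" if t: "t \<in> {0..1}" for t
    proof -
      have i: "(\<lambda>s. A (\<phi> (t * s) z) u + D (t * s) (f (t * s))) integrable_on {0..1}"
        if "continuous_on {0..1} f" for f
        unfolding D_def
        by (intro integrable_continuous_interval continuous_on_add
            continuous_on_rescale[OF cA[OF z] t] continuous_on_rescale[OF cD[OF z that] t])
      have "D (t * s) (g (t * s)) = (A (\<phi> (t * s) z) u + D (t * s) (\<psi> u (t * s) z))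
          - (A (\<phi> (t * s) z) u + D (t * s) (x (t * s)))" if "s \<in> {0..1}" for s
        unfolding D_def g_def by (simp add: linear_diff[OF linD[OF \<phi>U[OF z mult_unit_interval[OF t that]]]])
      then have "integral {0..1} (\<lambda>s. D (t * s) (g (t * s)))
          = integral {0..1} (\<lambda>s. (A (\<phi> (t * s) z) u + D (t * s) (\<psi> u (t * s) z))
          - (A (\<phi> (t * s) z) u + D (t * s) (x (t * s))))"
        by (rule integral_cong)
      also have "\<dots> = integral {0..1} (\<lambda>s. A (\<phi> (t * s) z) u + D (t * s) (\<psi> u (t * s) z))
          - integral {0..1} (\<lambda>s. A (\<phi> (t * s) z) u + D (t * s) (x (t * s)))"
        by (rule integral_diff[OF i[OF c\<psi>[OF z]] i[OF cx]])
      finally have E: "integral {0..1} (\<lambda>s. D (t * s) (g (t * s))) = \<dots>" .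
      have "\<psi> u t z = t *\<^sub>R integral {0..1} (\<lambda>s. A (\<phi> (t * s) z) u + D (t * s) (\<psi> u (t * s) z))"
        using \<psi>[OF z t, of u] u by (simp add: D_def)
      then show ?thesis
        unfolding E scaleR_diff_right xeq[OF t, symmetric] by (simp only: g_def)
    qed
    have "norm (g t) \<le> 0 / (1 - 1/2)"
    proof (rule sup_contraction[OF cg _ _ t])
      fix t B :: real assume t: "t \<in> {0..1}" and B: "\<And>s. s \<in> {0..1} \<Longrightarrow> norm (g s) \<le> B"
      have "norm (t *\<^sub>R integral {0..1} (\<lambda>s. D (t * s) (g (t * s)))) \<le> 1/2 * B"
      proof (rule scaled_integral_bound[where h = "\<lambda>s. D s (g s)", OF t])
        show "continuous_on {0..1} (\<lambda>s. D (t * s) (g (t * s)))"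
          unfolding D_def by (rule continuous_on_rescale[OF cD[OF z cg] t])
        show "norm (D s (g s)) \<le> 1/2 * B" if "s \<in> {0..1}" for s
          using half[OF z that, of "g s"] B[OF that] unfolding D_def by linarith
      qed
      then show "norm (g t) \<le> 0 + 1/2 * B" using geq[OF t] by simp
    qed simp
    then show ?thesis by (simp add: g_def x_def)
  qed
  have B0: "0 \<in> ?B" using \<rho> by simp
  have \<phi>0: "\<phi> t 0 = p" if "t \<in> {0..1}" for t
  proof -
    have "A (\<phi> (t * s) 0) 0 = 0" if "s \<in> {0..1}" for s
      by (rule linear_0[OF linA[OF \<phi>U[OF B0 mult_unit_interval[OF \<open>t \<in> {0..1}\<close> that]]]])
    then have "integral {0..1} (\<lambda>s. A (\<phi> (t * s) 0) 0) = integral {0..1::real} (\<lambda>s. 0)"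
      by (rule integral_cong[of "{0..1}" "\<lambda>s. A (\<phi> (t * s) 0) 0" "\<lambda>s. 0"])
    then show ?thesis using \<phi>[OF B0 that] by (simp add: linear_0[OF \<pi>])
  qed
  have one: "(1::real) \<in> {0..1}" by simp
  define G where "G = \<phi> 1"
  have smG: "smooth_on ?B G" using sm by (simp add: G_def)
  have dG: "frechet_derivative G (at z) h = \<psi> h 1 z" if "z \<in> ?B" for z h
    using d\<phi>[OF that one] by (simp add: G_def frechet_derivative_at[symmetric])
  have dG0: "frechet_derivative G (at 0) h = h" for h
  proof -
    have z0: "frechet_derivative (\<lambda>y. A y 0) (at p) k = 0" for k
    proof -
      have "frechet_derivative (\<lambda>y. A y 0) (at p) = frechet_derivative (\<lambda>y. 0) (at p)"
        by (rule frechet_derivative_cong_open[OF U p]) (rule linear_0[OF linA])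
      then show ?thesis by (simp add: frechet_derivative_const)
    qed
    have "integral {0..1} (\<lambda>s. A (\<phi> (1 * s) 0) h + frechet_derivative (\<lambda>y. A y 0) (at (\<phi> (1 * s) 0)) (\<psi> h (1 * s) 0))
        = integral {0..1::real} (\<lambda>s. \<pi> h)"
      by (rule integral_cong) (simp add: \<phi>0 z0 Ap)
    then show ?thesis using \<psi>[OF B0 one, of h] dG[OF B0] by simp
  qed
  obtain B W H where D: "diffeo B W G H" and B: "B \<subseteq> ?B" "0 \<in> B"
    by (rule smooth_inverse_function[OF open_ball smG B0]) (simp_all add: dG0)
  show ?thesis
  proof (intro exI conjI ballI allI impI)
    show "diffeo B W G H" "0 \<in> B" by fact+
    show "G 0 = p" using \<phi>0[OF one] by (simp add: G_def)
    show "W \<subseteq> U" using diffeoD(9)[OF D] B \<phi>U[OF _ one] unfolding G_def by blast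
    show "frechet_derivative G (at z) u = A (G z) u" if "z \<in> B" "\<pi> u = u" for z u
      using key[OF _ one that(2), of z] dG[of z u] that(1) B(1) by (auto simp: G_def)
  qed
qed

text \<open>Linear independence of an indexed family, so that a repeated vector counts as a dependence.\<close>

definition lin_indep :: "'i set \<Rightarrow> ('i \<Rightarrow> 'b::real_vector) \<Rightarrow> bool" where
  "lin_indep I v \<longleftrightarrow> (\<forall>c. (\<Sum>i\<in>I. c i *\<^sub>R v i) = 0 \<longrightarrow> (\<forall>i\<in>I. c i = 0))"

lemma lin_indep_imp_independent:
  assumes "finite I" "lin_indep I v"
  shows "inj_on v I" "independent (v ` I)"
proof -
  show inj: "inj_on v I"
  proof (rule inj_onI, rule ccontr)
    fix i j assume ij: "i \<in> I" "j \<in> I" "v i = v j" "i \<noteq> j"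
    define c where "c l = (if l = i then 1 else if l = j then -1 else 0 :: real)" for l
    have "(\<Sum>l\<in>I. c l *\<^sub>R v l) = (\<Sum>l\<in>{i, j}. c l *\<^sub>R v l)"
      by (rule sum.mono_neutral_right) (use assms(1) ij in \<open>auto simp: c_def\<close>)
    also have "\<dots> = 0" using ij(3,4) by (simp add: c_def)
    finally have "c i = 0" using assms(2) ij(1) unfolding lin_indep_def by blast
    then show False by (simp add: c_def)
  qed
  show "independent (v ` I)"
  proof
    assume "dependent (v ` I)"
    then obtain u where u: "\<exists>w\<in>v ` I. u w \<noteq> 0" "(\<Sum>w\<in>v ` I. u w *\<^sub>R w) = 0"
      using assms(1) by (auto simp: real_vector.dependent_finite)
    have "(\<Sum>i\<in>I. u (v i) *\<^sub>R v i) = 0" using u(2) by (simp add: sum.reindex[OF inj])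
    then have "u (v i) = 0" if "i \<in> I" for i
      using assms(2)[unfolded lin_indep_def, rule_format, of "\<lambda>i. u (v i)" i] that by blast
    then show False using u(1) by blast
  qed
qed

lemma lin_indep_dual:
  fixes v :: "'i \<Rightarrow> 'b::real_vector"
  assumes "finite I" "lin_indep I v"
  obtains \<kappa> :: "'i \<Rightarrow> 'b \<Rightarrow> real" where "\<And>i. linear (\<kappa> i)"
    "\<And>i j. i \<in> I \<Longrightarrow> j \<in> I \<Longrightarrow> \<kappa> i (v j) = (if i = j then 1 else 0)"
proof -
  note vi = lin_indep_imp_independent[OF assms]
  have "\<exists>g :: 'b \<Rightarrow> real. linear g \<and> (\<forall>w\<in>v ` I. g w = (if w = v i then 1 else 0))" for i
    by (rule linear_independent_extend[OF vi(2)])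
  then obtain \<kappa> :: "'i \<Rightarrow> 'b \<Rightarrow> real" where \<kappa>: "\<And>i. linear (\<kappa> i)"
    "\<And>i w. w \<in> v ` I \<Longrightarrow> \<kappa> i w = (if w = v i then 1 else 0)" by metis
  show thesis
  proof (rule that[OF \<kappa>(1)])
    fix i j assume "i \<in> I" "j \<in> I"
    then show "\<kappa> i (v j) = (if i = j then 1 else 0)"
      using \<kappa>(2)[of "v j" i] vi(1) by (auto dest: inj_onD)
  qed
qed

lemma span_image_finite:
  assumes "finite I"
  shows "x \<in> span (v ` I) \<longleftrightarrow> (\<exists>c. x = (\<Sum>i\<in>I. c i *\<^sub>R v i))"
proof
  assume "x \<in> span (v ` I)"
  then show "\<exists>c. x = (\<Sum>i\<in>I. c i *\<^sub>R v i)"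
  proof (induction rule: span_induct_alt)
    case base
    show ?case by (rule exI[of _ "\<lambda>_. 0"]) simp
  next
    case (step a w y)
    then obtain i c where i: "i \<in> I" "w = v i" and c: "y = (\<Sum>i\<in>I. c i *\<^sub>R v i)" by blast
    have "(\<Sum>j\<in>I. (if j = i then a else 0) *\<^sub>R v j) = a *\<^sub>R v i"
      using assms i(1) by (simp add: if_distrib[of "\<lambda>c. c *\<^sub>R _"] sum.delta cong: if_cong)
    then have "a *\<^sub>R w + y = (\<Sum>j\<in>I. ((if j = i then a else 0) + c j) *\<^sub>R v j)"
      by (simp add: i(2) c scaleR_add_left sum.distrib)
    then show ?case by (rule exI[of _ "\<lambda>j. (if j = i then a else 0) + c j"])
  qed
next
  assume "\<exists>c. x = (\<Sum>i\<in>I. c i *\<^sub>R v i)"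
  then obtain c where "x = (\<Sum>i\<in>I. c i *\<^sub>R v i)" by blast
  then show "x \<in> span (v ` I)" by (simp add: span_sum span_scale span_base)
qed

definition bracket :: "('a::euclidean_space \<Rightarrow> 'a) \<Rightarrow> ('a \<Rightarrow> 'a) \<Rightarrow> 'a \<Rightarrow> 'a" where
  "bracket X Y q = frechet_derivative Y (at q) (X q) - frechet_derivative X (at q) (Y q)"

lemma frechet_derivative_combination:
  fixes X :: "'i \<Rightarrow> 'a::euclidean_space \<Rightarrow> 'b::euclidean_space"
  assumes "\<And>i. i \<in> I \<Longrightarrow> smooth_on U (X i)" "\<And>i. i \<in> I \<Longrightarrow> smooth_on U (f i)" "q \<in> U"
  shows "frechet_derivative (\<lambda>q. \<Sum>i\<in>I. f i q *\<^sub>R X i q) (at q) v =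
    (\<Sum>i\<in>I. f i q *\<^sub>R frechet_derivative (X i) (at q) v + frechet_derivative (f i) (at q) v *\<^sub>R X i q)"
proof -
  have "((\<lambda>q. \<Sum>i\<in>I. f i q *\<^sub>R X i q) has_derivative (\<lambda>v. \<Sum>i\<in>I.
      f i q *\<^sub>R frechet_derivative (X i) (at q) v + frechet_derivative (f i) (at q) v *\<^sub>R X i q)) (at q)"
    by (intro has_derivative_sum has_derivative_scaleR smooth_on_has_derivative[of U] assms)
  then show ?thesis by (simp add: frechet_derivative_at[symmetric])
qed

lemma bracket_combination_in_span:
  assumes X: "\<And>i. i \<in> I \<Longrightarrow> smooth_on U (X i)" and f: "\<And>i. i \<in> I \<Longrightarrow> smooth_on U (f i)"
    and g: "\<And>i. i \<in> I \<Longrightarrow> smooth_on U (g i)" and q: "q \<in> U"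
    and inv: "\<And>i j. i \<in> I \<Longrightarrow> j \<in> I \<Longrightarrow> bracket (X i) (X j) q \<in> span ((\<lambda>i. X i q) ` I)"
  shows "bracket (\<lambda>q. \<Sum>i\<in>I. f i q *\<^sub>R X i q) (\<lambda>q. \<Sum>i\<in>I. g i q *\<^sub>R X i q) q \<in> span ((\<lambda>i. X i q) ` I)"
    (is "bracket ?F ?G q \<in> ?S")
proof -
  let ?DX = "\<lambda>i. frechet_derivative (X i) (at q)"
  have lin: "linear (?DX i)" if "i \<in> I" for i by (rule smooth_on_linear_derivative[OF X[OF that] q])
  have s1: "(\<Sum>i\<in>I. g i q *\<^sub>R ?DX i (?F q)) = (\<Sum>i\<in>I. \<Sum>j\<in>I. (f j q * g i q) *\<^sub>R ?DX i (X j q))"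
    by (rule sum.cong) (simp_all add: linear_sum[OF lin] linear_cmul[OF lin] scaleR_sum_right mult.commute)
  have s2: "(\<Sum>i\<in>I. f i q *\<^sub>R ?DX i (?G q)) = (\<Sum>i\<in>I. \<Sum>j\<in>I. (f i q * g j q) *\<^sub>R ?DX i (X j q))"
    by (rule sum.cong) (simp_all add: linear_sum[OF lin] linear_cmul[OF lin] scaleR_sum_right)
  also have "\<dots> = (\<Sum>i\<in>I. \<Sum>j\<in>I. (f j q * g i q) *\<^sub>R ?DX j (X i q))" by (rule sum.swap)
  finally have s2: "(\<Sum>i\<in>I. f i q *\<^sub>R ?DX i (?G q)) = \<dots>" .
  have DG: "frechet_derivative ?G (at q) v =
      (\<Sum>i\<in>I. g i q *\<^sub>R ?DX i v + frechet_derivative (g i) (at q) v *\<^sub>R X i q)" for v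
    by (rule frechet_derivative_combination[OF X g q])
  have DF: "frechet_derivative ?F (at q) v =
      (\<Sum>i\<in>I. f i q *\<^sub>R ?DX i v + frechet_derivative (f i) (at q) v *\<^sub>R X i q)" for v
    by (rule frechet_derivative_combination[OF X f q])
  have "bracket ?F ?G q = (\<Sum>i\<in>I. g i q *\<^sub>R ?DX i (?F q)) - (\<Sum>i\<in>I. f i q *\<^sub>R ?DX i (?G q))
      + ((\<Sum>i\<in>I. frechet_derivative (g i) (at q) (?F q) *\<^sub>R X i q)
        - (\<Sum>i\<in>I. frechet_derivative (f i) (at q) (?G q) *\<^sub>R X i q))"
    unfolding bracket_def DF DG by (simp add: sum.distrib)
  also have "(\<Sum>i\<in>I. g i q *\<^sub>R ?DX i (?F q)) - (\<Sum>i\<in>I. f i q *\<^sub>R ?DX i (?G q))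
      = (\<Sum>i\<in>I. \<Sum>j\<in>I. (f j q * g i q) *\<^sub>R bracket (X j) (X i) q)"
    unfolding s1 s2 bracket_def by (simp add: sum_subtractf scaleR_diff_right)
  finally show ?thesis
    by (simp add: span_add span_diff span_sum span_scale inv span_base)
qed

text \<open>Near \<open>p\<close>, a vector of the distribution is determined by its image under the projection \<open>\<pi>\<close> onto the
  distribution at \<open>p\<close>; let \<open>A q v\<close> be the one with \<open>\<pi> (A q v) = \<pi> v\<close>.  The bracket of \<open>A q u\<close> and \<open>A q v\<close> lies
  in the distribution by involutivity, and its projection vanishes because the projections of
  the fields are constant.  Hence these fields commute.\<close>

theorem frobenius:
  fixes X :: "'i \<Rightarrow> 'a::euclidean_space \<Rightarrow> 'a"
  assumes U: "open U" and p: "p \<in> U" and fin: "finite I"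
    and X: "\<And>i. i \<in> I \<Longrightarrow> smooth_on U (X i)" and ind: "lin_indep I (\<lambda>i. X i p)"
    and inv: "\<And>q i j. q \<in> U \<Longrightarrow> i \<in> I \<Longrightarrow> j \<in> I \<Longrightarrow> bracket (X i) (X j) q \<in> span ((\<lambda>i. X i q) ` I)"
  shows "\<exists>B W G H. diffeo B W G H \<and> 0 \<in> B \<and> W \<subseteq> U \<and> G 0 = p \<and>
    (\<forall>z\<in>B. \<forall>v. frechet_derivative G (at z) v \<in> span ((\<lambda>i. X i (G z)) ` I)
        \<longleftrightarrow> v \<in> span ((\<lambda>i. X i p) ` I))"
proof -
  obtain \<kappa> :: "'i \<Rightarrow> 'a \<Rightarrow> real" where lin\<kappa>: "\<And>i. linear (\<kappa> i)"
    and \<kappa>: "\<And>i j. i \<in> I \<Longrightarrow> j \<in> I \<Longrightarrow> \<kappa> i (X j p) = (if i = j then 1 else 0)"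
    using lin_indep_dual[OF fin ind] by metis
  define M where "M q v = (\<Sum>i\<in>I. \<kappa> i v *\<^sub>R X i q)" for q v
  define \<pi> where "\<pi> = M p"
  have linM: "linear (M q)" for q
    by (rule linearI)
      (simp_all add: M_def linear_add[OF lin\<kappa>] linear_cmul[OF lin\<kappa>] scaleR_add_left sum.distrib scaleR_sum_right)
  have lin\<pi>: "linear \<pi>" by (simp add: \<pi>_def linM)
  have MX: "M q (X j p) = X j q" if "j \<in> I" for q j
  proof -
    have "M q (X j p) = (\<Sum>i\<in>I. if i = j then X i q else 0)"
      unfolding M_def by (rule sum.cong) (simp_all add: \<kappa> that)
    then show ?thesis using fin that by simp
  qed
  have M\<pi>: "M q (\<pi> v) = M q v" for q v
  proof -
    have "M q (\<pi> v) = (\<Sum>i\<in>I. \<kappa> i v *\<^sub>R M q (X i p))"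
      unfolding \<pi>_def M_def[of p] by (simp add: linear_sum[OF linM] linear_cmul[OF linM])
    also have "\<dots> = (\<Sum>i\<in>I. \<kappa> i v *\<^sub>R X i q)" by (rule sum.cong) (simp_all add: MX)
    finally show ?thesis unfolding M_def[of q v] .
  qed
  have \<pi>\<pi>: "\<pi> (\<pi> v) = \<pi> v" for v using M\<pi>[of p v] by (simp add: \<pi>_def)
  have Mspan: "M q v \<in> span ((\<lambda>i. X i q) ` I)" for q v
    unfolding M_def by (simp add: span_sum span_scale span_base)
  have smM: "smooth_on U (\<lambda>q. M q v)" for v
    unfolding M_def by (intro smooth_on_sum[OF U] smooth_on_scaleR[OF U] smooth_on_const[OF U] X)
  \<comment> \<open>The map \<open>\<pi> \<circ> M q\<close> on the range of \<open>\<pi>\<close>, extended to all of the space by the identity on the kernel.\<close>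
  define N where "N q v = \<pi> (M q v) + v - \<pi> v" for q v
  have linN: "linear (N q)" for q
    unfolding N_def
    by (intro linear_compose_sub linear_compose_add linear_id[unfolded id_def] lin\<pi>
        linear_compose[OF linM lin\<pi>, unfolded o_def])
  have bl\<pi>: "bounded_linear \<pi>" using lin\<pi> by (simp add: linear_conv_bounded_linear)
  have smN: "smooth_on U (\<lambda>q. N q v)" for v
    unfolding N_def
    by (intro smooth_on_diff[OF U] smooth_on_add[OF U] smooth_on_const[OF U] smooth_on_linear_compose[OF U bl\<pi> smM])
  have Np: "N p v = v" for v unfolding N_def by (simp add: \<pi>\<pi> flip: \<pi>_def)
  \<comment> \<open>As \<open>N p\<close> is the identity, \<open>N q\<close> is invertible near \<open>p\<close>, namely where it differs from the identity by less than \<open>1\<close>.\<close>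
  define m where "m q = (\<Sum>b\<in>Basis. norm (N q b - b))" for q
  have "continuous_on U m"
    unfolding m_def by (intro continuous_intros smooth_on_continuous[OF smN])
  then have "open (U \<inter> m -` {..<1})" using U by (rule continuous_open_preimage) simp
  define U' where "U' = U \<inter> m -` {..<1}"
  have U': "open U'" "U' \<subseteq> U" "p \<in> U'"
    using \<open>open (U \<inter> m -` {..<1})\<close> p by (auto simp: U'_def m_def Np)
  have injN: "v = 0" if q: "q \<in> U'" and v: "N q v = 0" for q v
  proof (rule ccontr)
    assume "v \<noteq> 0"
    have "norm (N q v - v) \<le> m q * norm v"
      using linear_norm_le_Basis[OF linear_compose_sub[OF linN linear_id[unfolded id_def]], of q v]
      by (simp add: m_def)
    also have "\<dots> < norm v" using q \<open>v \<noteq> 0\<close> by (simp add: U'_def)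
    finally show False using v by simp
  qed
  have "\<exists>g. linear g \<and> (\<forall>v. g (N q v) = v) \<and> (\<forall>v. N q (g v) = v)" if "q \<in> U'" for q
    using linear_injective_inverse[OF linN injN[OF that]] by metis
  then obtain N' where N': "\<And>q. q \<in> U' \<Longrightarrow> linear (N' q)" "\<And>q v. q \<in> U' \<Longrightarrow> N' q (N q v) = v"
    "\<And>q v. q \<in> U' \<Longrightarrow> N q (N' q v) = v" by metis
  have smN': "smooth_on U' (\<lambda>q. N' q v)" for v
    by (rule smooth_on_linear_inverse[OF U'(1) linN N'(1,3,2)]) (auto intro: smooth_on_subset[OF smN U'(2)])
  define A where "A q v = M q (N' q (\<pi> v))" for q v
  have linA: "linear (A q)" if "q \<in> U'" for q
    using linear_compose[OF linear_compose[OF lin\<pi> N'(1)[OF that]] linM[of q]]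
    by (simp add: o_def A_def[abs_def])
  have smA: "smooth_on U' (\<lambda>q. A q v)" for v
    unfolding A_def by (rule smooth_on_linear_apply[OF U'(1) linM smooth_on_subset[OF smM U'(2)] smN'])
  have \<pi>A: "\<pi> (A q v) = \<pi> v" if "q \<in> U'" for q v
  proof -
    define w where "w = N' q (\<pi> v)"
    have "\<pi> (N q w) = \<pi> (M q w)"
      unfolding N_def by (simp add: linear_diff[OF lin\<pi>] linear_add[OF lin\<pi>] \<pi>\<pi>)
    then show ?thesis using N'(3)[OF that, of "\<pi> v"] by (simp add: w_def A_def \<pi>\<pi>)
  qed
  have zero: "b = 0" if q: "q \<in> U'" and b: "b \<in> span ((\<lambda>i. X i q) ` I)" "\<pi> b = 0" for q b
  proof -
    obtain c where c: "b = (\<Sum>i\<in>I. c i *\<^sub>R X i q)" using b(1) span_image_finite[OF fin] by metis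
    define w where "w = (\<Sum>i\<in>I. c i *\<^sub>R X i p)"
    have Mw: "M q' w = (\<Sum>i\<in>I. c i *\<^sub>R X i q')" for q'
      unfolding w_def by (simp add: linear_sum[OF linM] linear_cmul[OF linM] MX)
    have "\<pi> w = w" using Mw[of p] by (simp add: \<pi>_def w_def)
    then have "N q w = 0" using b(2) Mw[of q] c by (simp add: N_def)
    then have "w = 0" by (rule injN[OF q])
    then show ?thesis using Mw[of q] c linear_0[OF linM] by simp
  qed
  have AX: "A q v = v" if q: "q \<in> U'" and v: "v \<in> span ((\<lambda>i. X i q) ` I)" for q v
  proof -
    have "A q v - v = 0"
      by (rule zero[OF q]) (simp_all add: A_def Mspan span_diff v linear_diff[OF lin\<pi>] \<pi>A[OF q, unfolded A_def])
    then show ?thesis by simp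
  qed
  have Ap: "A p v = \<pi> v" for v
    using N'(2)[OF U'(3), of "\<pi> v"] by (simp add: A_def Np M\<pi> flip: \<pi>_def) (simp add: \<pi>\<pi>)
  have A_comb: "A q u = (\<Sum>i\<in>I. \<kappa> i (N' q (\<pi> u)) *\<^sub>R X i q)" for q u by (simp add: A_def M_def)
  have sm\<kappa>: "smooth_on U' (\<lambda>q. \<kappa> i (N' q (\<pi> u)))" for i u
    by (rule smooth_on_linear_compose[OF U'(1) _ smN']) (simp add: lin\<kappa> linear_conv_bounded_linear[symmetric])
  have comm: "frechet_derivative (\<lambda>q. A q v) (at q) (A q u) = frechet_derivative (\<lambda>q. A q u) (at q) (A q v)"
    if q: "q \<in> U'" for q u v
  proof -
    have D\<pi>: "\<pi> (frechet_derivative (\<lambda>q. A q v) (at q) k) = 0" for v k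
    proof -
      have "((\<lambda>q. \<pi> (A q v)) has_derivative (\<lambda>k. \<pi> (frechet_derivative (\<lambda>q. A q v) (at q) k))) (at q)"
        by (rule bounded_linear.has_derivative[OF bl\<pi> smooth_on_has_derivative[OF smA q]])
      moreover have "((\<lambda>q. \<pi> (A q v)) has_derivative (\<lambda>k. 0)) (at q)"
        by (rule has_derivative_transform_within_open[OF has_derivative_const[of "\<pi> v"] U'(1) q])
           (simp add: \<pi>A)
      ultimately have "(\<lambda>k. \<pi> (frechet_derivative (\<lambda>q. A q v) (at q) k)) = (\<lambda>k. 0)"
        by (rule has_derivative_unique)
      then show ?thesis by metis
    qed
    have "bracket (\<lambda>q. A q u) (\<lambda>q. A q v) q \<in> span ((\<lambda>i. X i q) ` I)"
      unfolding A_comb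
      by (rule bracket_combination_in_span[OF smooth_on_subset[OF X U'(2)] sm\<kappa> sm\<kappa> q inv])
         (use q U'(2) in auto)
    moreover have "\<pi> (bracket (\<lambda>q. A q u) (\<lambda>q. A q v) q) = 0"
      unfolding bracket_def by (simp add: linear_diff[OF lin\<pi>] D\<pi>)
    ultimately have "bracket (\<lambda>q. A q u) (\<lambda>q. A q v) q = 0" by (rule zero[OF q])
    then show ?thesis by (simp add: bracket_def)
  qed
  have "\<exists>B W G H. diffeo B W G H \<and> 0 \<in> B \<and> W \<subseteq> U' \<and> G 0 = p \<and>
    (\<forall>z\<in>B. \<forall>u. \<pi> u = u \<longrightarrow> frechet_derivative G (at z) u = A (G z) u)"
    by (rule frobenius_commuting[OF U'(1,3) lin\<pi> linA smA Ap comm])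
  then obtain B W G H where D: "diffeo B W G H" and B: "0 \<in> B" "W \<subseteq> U'" "G 0 = p"
    and DG: "\<forall>z\<in>B. \<forall>u. \<pi> u = u \<longrightarrow> frechet_derivative G (at z) u = A (G z) u"
    by (elim exE conjE)
  have "frechet_derivative G (at z) v \<in> span ((\<lambda>i. X i (G z)) ` I) \<longleftrightarrow> v \<in> span ((\<lambda>i. X i p) ` I)"
    if z: "z \<in> B" for z v
  proof
    have Gz: "G z \<in> U'" using diffeoD(5)[OF D z] B(2) by blast
    assume v: "v \<in> span ((\<lambda>i. X i p) ` I)"
    have "\<pi> v = v" using AX[OF U'(3) v] by (simp add: Ap)
    then show "frechet_derivative G (at z) v \<in> span ((\<lambda>i. X i (G z)) ` I)"
      using DG z Mspan by (simp add: A_def)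
  next
    have Gz: "G z \<in> U'" using diffeoD(5)[OF D z] B(2) by blast
    assume v: "frechet_derivative G (at z) v \<in> span ((\<lambda>i. X i (G z)) ` I)"
    let ?w = "frechet_derivative G (at z) v"
    have "frechet_derivative G (at z) (\<pi> ?w) = A (G z) (\<pi> ?w)" using DG z \<pi>\<pi> by simp
    also have "\<dots> = ?w" using AX[OF Gz v] by (simp add: A_def \<pi>\<pi>)
    finally have "v = M p ?w" unfolding \<pi>_def using diffeo_derivative_inverse[OF D z] by metis
    then show "v \<in> span ((\<lambda>i. X i p) ` I)" using Mspan[of p ?w] by metis
  qed
  then show ?thesis using D B U'(2) by blast
qed

text \<open>In coordinates in which the distribution is constant, a linear function has the required properties.\<close>

corollary first_integral:
  fixes X :: "'i \<Rightarrow> 'a::euclidean_space \<Rightarrow> 'a"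
  assumes U: "open U" and p: "p \<in> U" and fin: "finite I"
    and X: "\<And>i. i \<in> I \<Longrightarrow> smooth_on U (X i)" and ind: "lin_indep I (\<lambda>i. X i p)"
    and inv: "\<And>q i j. q \<in> U \<Longrightarrow> i \<in> I \<Longrightarrow> j \<in> I \<Longrightarrow> bracket (X i) (X j) q \<in> span ((\<lambda>i. X i q) ` I)"
    and \<mu>: "linear (\<mu> :: 'a \<Rightarrow> real)" "\<And>i. i \<in> I \<Longrightarrow> \<mu> (X i p) = 0"
  shows "\<exists>W f. open W \<and> p \<in> W \<and> W \<subseteq> U \<and> smooth_on W f \<and>
    (\<forall>q\<in>W. \<forall>i\<in>I. frechet_derivative f (at q) (X i q) = 0) \<and>
    (\<forall>v. frechet_derivative f (at p) v = \<mu> v)"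
proof -
  have "\<exists>B W G H. diffeo B W G H \<and> 0 \<in> B \<and> W \<subseteq> U \<and> G 0 = p \<and>
    (\<forall>z\<in>B. \<forall>v. frechet_derivative G (at z) v \<in> span ((\<lambda>i. X i (G z)) ` I)
        \<longleftrightarrow> v \<in> span ((\<lambda>i. X i p) ` I))"
    by (rule frobenius[OF U p fin X ind inv])
  then obtain B W G H where D: "diffeo B W G H" and B: "0 \<in> B" "W \<subseteq> U" "G 0 = p"
    and DG: "\<forall>z\<in>B. \<forall>v. frechet_derivative G (at z) v \<in> span ((\<lambda>i. X i (G z)) ` I)
        \<longleftrightarrow> v \<in> span ((\<lambda>i. X i p) ` I)"
    by (elim exE conjE)
  note d = diffeoD[OF D]
  let ?D = "frechet_derivative G (at 0)"
  have linD: "linear ?D" by (rule smooth_on_linear_derivative[OF d(3) B(1)])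
  have bl: "bounded_linear (\<lambda>v. \<mu> (?D v))"
    using linear_compose[OF linD \<mu>(1)] by (simp add: o_def linear_conv_bounded_linear[symmetric])
  define f where "f q = \<mu> (?D (H q))" for q
  have f: "smooth_on W f" unfolding f_def by (rule smooth_on_linear_compose[OF d(2) bl d(4)])
  have df: "frechet_derivative f (at q) v = \<mu> (?D (frechet_derivative H (at q) v))" if "q \<in> W" for q v
    unfolding f_def
    using bounded_linear.has_derivative[OF bl smooth_on_has_derivative[OF d(4) that]]
    by (simp add: frechet_derivative_at[symmetric])
  have pW: "p \<in> W" using d(5)[OF B(1)] B(3) by simp
  have \<mu>0: "\<mu> v = 0" if v: "v \<in> span ((\<lambda>i. X i p) ` I)" for v
  proof -
    obtain c where "v = (\<Sum>i\<in>I. c i *\<^sub>R X i p)"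
      using v span_image_finite[OF fin, of v "\<lambda>i. X i p"] by blast
    then show ?thesis by (simp add: linear_sum[OF \<mu>(1)] linear_cmul[OF \<mu>(1)] \<mu>(2))
  qed
  have inv_D: "frechet_derivative G (at (H q)) (frechet_derivative H (at q) v) = v" if "q \<in> W" for q v
    using diffeo_derivative_inverse[OF diffeo_sym[OF D] that] .
  show ?thesis
  proof (intro exI[of _ W] exI[of _ f] conjI ballI allI d(2) pW B(2) f)
    fix q i assume q: "q \<in> W" and i: "i \<in> I"
    have "frechet_derivative G (at (H q)) (frechet_derivative H (at q) (X i q)) \<in> span ((\<lambda>i. X i (G (H q))) ` I)"
      unfolding inv_D[OF q] d(8)[OF q] using i by (auto intro: span_base)
    then have "frechet_derivative H (at q) (X i q) \<in> span ((\<lambda>i. X i p) ` I)"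
      using DG[rule_format, OF d(6)[OF q]] by blast
    then have "?D (frechet_derivative H (at q) (X i q)) \<in> span ((\<lambda>i. X i p) ` I)"
      using DG[rule_format, OF B(1)] B(3) by simp
    then show "frechet_derivative f (at q) (X i q) = 0" using \<mu>0 by (simp add: df[OF q])
  next
    fix v
    have "H p = 0" using d(7)[OF B(1)] B(3) by simp
    then show "frechet_derivative f (at p) v = \<mu> v" using inv_D[OF pW, of v] by (simp add: df[OF pW])
  qed
qed

section \<open>Closed forms on open subsets of Euclidean space\<close>

lemma has_derivative_shift:
  assumes "(f has_derivative D) (at (x + c))"
  shows "((\<lambda>x. f (x + c)) has_derivative D) (at x)"
proof -
  have "((\<lambda>x. x + c) has_derivative (\<lambda>h. h)) (at x)" by (auto intro!: derivative_eq_intros)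
  from diff_chain_at[OF this assms] show ?thesis by (simp add: o_def)
qed

lemma smooth_on_line_integral:
  fixes f :: "'a::euclidean_space \<Rightarrow> 'b::euclidean_space"
  assumes f: "smooth_on U f" and U: "open U" and seg: "\<And>t. t \<in> {0..1} \<Longrightarrow> y + t *\<^sub>R w \<in> U"
  shows "f (y + w) - f y = integral {0..1} (\<lambda>t. frechet_derivative f (at (y + t *\<^sub>R w)) w)"
proof -
  have "((\<lambda>t. frechet_derivative f (at (y + t *\<^sub>R w)) w) has_integral
      (f (y + 1 *\<^sub>R w) - f (y + 0 *\<^sub>R w))) {0..1::real}"
  proof (rule fundamental_theorem_of_calculus)
    fix t :: real assume t: "t \<in> {0..1}"
    have "((\<lambda>t. y + t *\<^sub>R w) has_derivative (\<lambda>h. h *\<^sub>R w)) (at t)"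
      by (auto intro!: derivative_eq_intros)
    from diff_chain_at[OF this smooth_on_has_derivative[OF f seg[OF t]]]
    have "((\<lambda>t. f (y + t *\<^sub>R w)) has_derivative (\<lambda>h. h *\<^sub>R frechet_derivative f (at (y + t *\<^sub>R w)) w)) (at t)"
      by (simp add: o_def linear_cmul[OF smooth_on_linear_derivative[OF f seg[OF t]]])
    then show "((\<lambda>t. f (y + t *\<^sub>R w)) has_vector_derivative frechet_derivative f (at (y + t *\<^sub>R w)) w) (at t within {0..1})"
      unfolding has_vector_derivative_def by (rule has_derivative_at_withinI)
  qed simp
  from integral_unique[OF this] show ?thesis by simp
qed

text \<open>Directional derivatives are all that \<open>smooth_on\<close> talks about, so the difference quotient in direction
  \<open>u\<close> is written as an integral, which can be differentiated in direction \<open>v\<close> under the integral sign.\<close>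

lemma second_derivative_symmetric:
  fixes f :: "'a::euclidean_space \<Rightarrow> 'b::euclidean_space"
  assumes U: "open U" and f: "smooth_on U f" and x: "x \<in> U"
  shows "frechet_derivative (\<lambda>y. frechet_derivative f (at y) u) (at x) v
       = frechet_derivative (\<lambda>y. frechet_derivative f (at y) v) (at x) u"
proof -
  define g where "g y = frechet_derivative f (at y) u" for y
  define Dg where "Dg y = frechet_derivative g (at y) v" for y
  have g: "smooth_on U g" unfolding g_def by (rule smooth_on_deriv[OF f])
  have cDg: "continuous_on U Dg" unfolding Dg_def by (rule smooth_on_continuous[OF smooth_on_deriv[OF g]])
  obtain r where r: "r > 0" "ball x r \<subseteq> U" using U x openE by blast
  have nu: "norm u + 1 > 0" using norm_ge_zero[of u] by linarith
  have in_ball: "y + (t * s) *\<^sub>R u \<in> ball x r" "(t * s) *\<^sub>R u \<in> ball 0 (r/2)"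
    if y: "y \<in> ball x (r/2)" and t: "t \<in> {0..1}" and s: "\<bar>s\<bar> * (norm u + 1) < r/2" for y t s
  proof -
    have "\<bar>t * s\<bar> * norm u \<le> 1 * \<bar>s\<bar> * (norm u + 1)"
      using t by (intro mult_mono) (simp_all add: abs_mult mult_left_le_one_le)
    then have n: "norm ((t * s) *\<^sub>R u) < r/2" using s by simp
    then show "(t * s) *\<^sub>R u \<in> ball 0 (r/2)" by simp
    have "norm (y - x + (t * s) *\<^sub>R u) \<le> norm (y - x) + norm ((t * s) *\<^sub>R u)" by (rule norm_triangle_ineq)
    also have "\<dots> < r" using n y by (simp add: dist_norm norm_minus_commute)
    finally show "y + (t * s) *\<^sub>R u \<in> ball x r" by (simp add: dist_norm norm_minus_commute algebra_simps)
  qed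
  let ?S = "ball x (r/2)"
  have xS: "x \<in> ?S" using r by simp
  have diff_eq: "frechet_derivative f (at (x + s *\<^sub>R u)) v - frechet_derivative f (at x) v
      = s *\<^sub>R integral {0..1} (\<lambda>t. Dg (x + (t * s) *\<^sub>R u))" if s: "\<bar>s\<bar> * (norm u + 1) < r/2" for s
  proof -
    have inU: "y + (t * s) *\<^sub>R u \<in> U" if "y \<in> ?S" "t \<in> {0..1}" for y t
      using in_ball(1)[OF that s] r by blast
    have eq: "f (y + s *\<^sub>R u) - f y = s *\<^sub>R integral {0..1} (\<lambda>t. g (y + (t * s) *\<^sub>R u))" if y: "y \<in> ?S" for y
    proof -
      have "f (y + s *\<^sub>R u) - f y = integral {0..1} (\<lambda>t. frechet_derivative f (at (y + t *\<^sub>R (s *\<^sub>R u))) (s *\<^sub>R u))"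
        by (rule smooth_on_line_integral[OF f U]) (use inU[OF y] in simp)
      also have "\<dots> = integral {0..1} (\<lambda>t. s *\<^sub>R g (y + (t * s) *\<^sub>R u))"
        unfolding g_def
        by (rule integral_cong) (simp add: linear_cmul[OF smooth_on_linear_derivative[OF f inU[OF y]]])
      finally show ?thesis by simp
    qed
    have fam: "smooth_family {0..1} ?S (\<lambda>t y. g (y + (t * s) *\<^sub>R u))"
    proof (rule smooth_family_compose_on[OF open_ball U _ _ g])
      show "smooth_family {0..1} ?S (\<lambda>t y. y + (t * s) *\<^sub>R u)"
        by (intro smooth_family_add smooth_family_bounded_linear smooth_family_param open_ball
            bounded_linear_ident continuous_intros)
    qed (rule inU)
    have d1: "((\<lambda>y. f (y + s *\<^sub>R u) - f y) has_derivative
        (\<lambda>h. frechet_derivative f (at (x + s *\<^sub>R u)) h - frechet_derivative f (at x) h)) (at x)"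
      using inU[OF xS, of 1] x by (intro has_derivative_diff has_derivative_shift smooth_on_has_derivative[OF f]) simp_all
    have "smooth_on ?S (\<lambda>y. integral {0..1} (\<lambda>t. g (y + (t * s) *\<^sub>R u)))"
      by (rule smooth_on_integral[OF open_ball fam])
    from has_derivative_scaleR_right[OF smooth_on_has_derivative[OF this xS], of s]
    have "((\<lambda>y. f (y + s *\<^sub>R u) - f y) has_derivative (\<lambda>h. s *\<^sub>R
        frechet_derivative (\<lambda>y. integral {0..1} (\<lambda>t. g (y + (t * s) *\<^sub>R u))) (at x) h)) (at x)"
      by (rule has_derivative_transform_within_open[OF _ open_ball xS]) (simp only: eq)
    from has_derivative_unique[OF d1 this]
    have "frechet_derivative f (at (x + s *\<^sub>R u)) v - frechet_derivative f (at x) v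
      = s *\<^sub>R frechet_derivative (\<lambda>y. integral {0..1} (\<lambda>t. g (y + (t * s) *\<^sub>R u))) (at x) v" by metis
    also have "frechet_derivative (\<lambda>y. integral {0..1} (\<lambda>t. g (y + (t * s) *\<^sub>R u))) (at x) v
      = integral {0..1} (\<lambda>t. frechet_derivative (\<lambda>y. g (y + (t * s) *\<^sub>R u)) (at x) v)"
      by (rule frechet_derivative_integral[OF open_ball fam xS])
    also have "\<dots> = integral {0..1} (\<lambda>t. Dg (x + (t * s) *\<^sub>R u))"
    proof (rule integral_cong)
      fix t :: real assume t: "t \<in> {0..1}"
      from has_derivative_shift[OF smooth_on_has_derivative[OF g inU[OF xS t]]]
      show "frechet_derivative (\<lambda>y. g (y + (t * s) *\<^sub>R u)) (at x) v = Dg (x + (t * s) *\<^sub>R u)"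
        by (simp add: frechet_derivative_at[symmetric] Dg_def)
    qed
    finally show ?thesis .
  qed
  define h where "h s = frechet_derivative f (at (x + s *\<^sub>R u)) v" for s :: real
  have "(h has_derivative (\<lambda>s. s *\<^sub>R Dg x)) (at 0)"
    unfolding has_derivative_at_alt
  proof (intro conjI allI impI)
    show "bounded_linear (\<lambda>s. s *\<^sub>R Dg x)" by (rule bounded_linear_scaleR_left)
    fix e :: real assume e: "e > 0"
    have "isCont Dg x" using cDg U x by (simp add: continuous_on_eq_continuous_at)
    then obtain d where d: "d > 0" "\<And>y. dist y x < d \<Longrightarrow> dist (Dg y) (Dg x) < e"
      using e unfolding continuous_at_eps_delta by blast
    define d' where "d' = min (r/2) d / (norm u + 1)"
    show "\<exists>d>0. \<forall>s. norm (s - 0) < d \<longrightarrow> norm (h s - h 0 - (s - 0) *\<^sub>R Dg x) \<le> e * norm (s - 0)"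
    proof (intro exI[of _ d'] conjI allI impI)
      show "d' > 0" using r d nu by (simp add: d'_def)
      fix s :: real assume "norm (s - 0) < d'"
      then have s2: "\<bar>s\<bar> * (norm u + 1) < min (r/2) d" using nu by (simp add: d'_def pos_less_divide_eq)
      then have s: "\<bar>s\<bar> * (norm u + 1) < r/2" by simp
      have cts: "continuous_on {0..1} (\<lambda>t. Dg (x + (t * s) *\<^sub>R u))"
        by (rule continuous_on_compose2[OF cDg])
           (use in_ball(1)[OF xS _ s] r in \<open>auto intro!: continuous_intros\<close>)
      have "norm (integral {0..1} (\<lambda>t. Dg (x + (t * s) *\<^sub>R u) - Dg x)) \<le> e * (1 - 0)"
      proof (rule integral_bound[OF zero_le_one])
        show "continuous_on {0..1} (\<lambda>t. Dg (x + (t * s) *\<^sub>R u) - Dg x)" by (intro continuous_intros cts)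
        fix t :: real assume t: "t \<in> {0..1}"
        have "\<bar>t * s\<bar> * norm u \<le> 1 * \<bar>s\<bar> * (norm u + 1)"
          using t by (intro mult_mono) (simp_all add: abs_mult mult_left_le_one_le)
        then have "dist (x + (t * s) *\<^sub>R u) x < d" using s2 by (simp add: dist_norm)
        from d(2)[OF this] show "norm (Dg (x + (t * s) *\<^sub>R u) - Dg x) \<le> e" by (simp add: dist_norm)
      qed
      moreover have "integral {0..1} (\<lambda>t. Dg (x + (t * s) *\<^sub>R u) - Dg x)
          = integral {0..1} (\<lambda>t. Dg (x + (t * s) *\<^sub>R u)) - Dg x"
        using integral_diff[OF integrable_continuous_interval[OF cts]
            integrable_continuous_interval[OF continuous_on_const[of _ "Dg x"]]] by simp
      ultimately have "norm (integral {0..1} (\<lambda>t. Dg (x + (t * s) *\<^sub>R u)) - Dg x) \<le> e" by simp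
      then have "\<bar>s\<bar> * norm (integral {0..1} (\<lambda>t. Dg (x + (t * s) *\<^sub>R u)) - Dg x) \<le> \<bar>s\<bar> * e"
        by (rule mult_left_mono) simp
      moreover have "h s - h 0 - (s - 0) *\<^sub>R Dg x = s *\<^sub>R (integral {0..1} (\<lambda>t. Dg (x + (t * s) *\<^sub>R u)) - Dg x)"
        using diff_eq[OF s] by (simp add: h_def scaleR_diff_right)
      ultimately show "norm (h s - h 0 - (s - 0) *\<^sub>R Dg x) \<le> e * norm (s - 0)"
        by (simp add: mult.commute)
    qed
  qed
  moreover have "(h has_derivative (\<lambda>s. frechet_derivative (\<lambda>y. frechet_derivative f (at y) v) (at x) (s *\<^sub>R u))) (at 0)"
  proof -
    have a: "((\<lambda>s. x + s *\<^sub>R u) has_derivative (\<lambda>s. s *\<^sub>R u)) (at 0)" by (auto intro!: derivative_eq_intros)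
    have b: "((\<lambda>y. frechet_derivative f (at y) v) has_derivative
        frechet_derivative (\<lambda>y. frechet_derivative f (at y) v) (at x)) (at (x + 0 *\<^sub>R u))"
      using smooth_on_has_derivative[OF smooth_on_deriv[OF f] x] by simp
    from diff_chain_at[OF a b] show ?thesis by (simp add: o_def h_def[abs_def])
  qed
  ultimately have "(\<lambda>s. s *\<^sub>R Dg x) = (\<lambda>s. frechet_derivative (\<lambda>y. frechet_derivative f (at y) v) (at x) (s *\<^sub>R u))"
    by (rule has_derivative_unique)
  from fun_cong[OF this, of 1] show ?thesis by (simp add: Dg_def g_def[abs_def])
qed

lemma frechet_derivative_linear_apply:
  fixes L :: "'b::euclidean_space \<Rightarrow> 'c::euclidean_space \<Rightarrow> 'd::euclidean_space"
    and g :: "'a::euclidean_space \<Rightarrow> 'b"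
  assumes S: "open S" and U: "open U" and g: "smooth_on S g" and gU: "\<forall>z\<in>S. g z \<in> U"
    and linL: "\<forall>q\<in>U. linear (L q)" and L2: "\<And>v. smooth_on U (\<lambda>q. L q v)"
    and X: "smooth_on S X" and z: "z \<in> S"
  shows "frechet_derivative (\<lambda>z. L (g z) (X z)) (at z) h =
    frechet_derivative (\<lambda>q. L q (X z)) (at (g z)) (frechet_derivative g (at z) h)
    + L (g z) (frechet_derivative X (at z) h)"
proof -
  have L1: "linear (L q)" if "q \<in> U" for q using linL that by blast
  let ?k = "frechet_derivative g (at z)"
  have gz: "g z \<in> U" using gU z by blast
  have Lb: "((\<lambda>z. L (g z) b) has_derivative (\<lambda>h. frechet_derivative (\<lambda>q. L q b) (at (g z)) (?k h))) (at z)" for b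
    using diff_chain_at[OF smooth_on_has_derivative[OF g z] smooth_on_has_derivative[OF L2 gz]]
    by (simp add: o_def)
  have "((\<lambda>z. \<Sum>b\<in>Basis. (X z \<bullet> b) *\<^sub>R L (g z) b) has_derivative
      (\<lambda>h. \<Sum>b\<in>Basis. (X z \<bullet> b) *\<^sub>R frechet_derivative (\<lambda>q. L q b) (at (g z)) (?k h)
        + (frechet_derivative X (at z) h \<bullet> b) *\<^sub>R L (g z) b)) (at z)"
    by (intro has_derivative_sum has_derivative_scaleR Lb has_derivative_inner_left smooth_on_has_derivative[OF X z])
  then have 1: "((\<lambda>z. L (g z) (X z)) has_derivative
      (\<lambda>h. \<Sum>b\<in>Basis. (X z \<bullet> b) *\<^sub>R frechet_derivative (\<lambda>q. L q b) (at (g z)) (?k h)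
        + (frechet_derivative X (at z) h \<bullet> b) *\<^sub>R L (g z) b)) (at z)"
    by (rule has_derivative_transform_within_open[OF _ S z])
       (rule linear_sum_Basis[OF L1[OF bspec[OF gU]], symmetric])
  have "((\<lambda>q. \<Sum>b\<in>Basis. (X z \<bullet> b) *\<^sub>R L q b) has_derivative
        (\<lambda>k. \<Sum>b\<in>Basis. (X z \<bullet> b) *\<^sub>R frechet_derivative (\<lambda>q. L q b) (at (g z)) k)) (at (g z))"
    by (intro has_derivative_sum has_derivative_scaleR_right smooth_on_has_derivative[OF L2 gz])
  then have "((\<lambda>q. L q (X z)) has_derivative
        (\<lambda>k. \<Sum>b\<in>Basis. (X z \<bullet> b) *\<^sub>R frechet_derivative (\<lambda>q. L q b) (at (g z)) k)) (at (g z))"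
    by (rule has_derivative_transform_within_open[OF _ U gz]) (rule linear_sum_Basis[OF L1, symmetric])
  then have 2: "frechet_derivative (\<lambda>q. L q (X z)) (at (g z)) k
      = (\<Sum>b\<in>Basis. (X z \<bullet> b) *\<^sub>R frechet_derivative (\<lambda>q. L q b) (at (g z)) k)" for k
    by (simp add: frechet_derivative_at[symmetric])
  have 3: "L (g z) (frechet_derivative X (at z) h)
      = (\<Sum>b\<in>Basis. (frechet_derivative X (at z) h \<bullet> b) *\<^sub>R L (g z) b)"
    by (rule linear_sum_Basis[OF L1[OF gz]])
  show ?thesis unfolding 2 3 frechet_derivative_at[OF 1, symmetric] by (simp add: sum.distrib)
qed

lemma smooth_on_linear_apply_compose:
  fixes L :: "'b::euclidean_space \<Rightarrow> 'c::euclidean_space \<Rightarrow> 'd::euclidean_space"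
  assumes S: "open S" and U: "open U" and g: "smooth_on S g" and gU: "\<forall>z\<in>S. g z \<in> U"
    and linL: "\<forall>q\<in>U. linear (L q)" and L: "\<And>v. smooth_on U (\<lambda>q. L q v)"
    and X: "smooth_on S X"
  shows "smooth_on S (\<lambda>z. L (g z) (X z))"
proof (rule smooth_on_linear_apply[OF S _ _ X])
  show "linear (L (g z))" if "z \<in> S" for z using linL gU that by blast
  show "smooth_on S (\<lambda>z. L (g z) v)" for v
    by (rule smooth_on_compose[OF S U g L]) (use gU in blast)
qed

definition closed1 :: "'a::euclidean_space set \<Rightarrow> ('a \<Rightarrow> 'a \<Rightarrow> real) \<Rightarrow> bool" where
  "closed1 U \<eta> \<longleftrightarrow> (\<forall>z\<in>U. linear (\<eta> z)) \<and> (\<forall>u. smooth_on U (\<lambda>z. \<eta> z u)) \<and>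
     (\<forall>z\<in>U. \<forall>u v. frechet_derivative (\<lambda>z. \<eta> z v) (at z) u = frechet_derivative (\<lambda>z. \<eta> z u) (at z) v)"

definition closed2 :: "'a::euclidean_space set \<Rightarrow> ('a \<Rightarrow> 'a \<Rightarrow> 'a \<Rightarrow> real) \<Rightarrow> bool" where
  "closed2 U \<omega> \<longleftrightarrow>
     (\<forall>z\<in>U. (\<forall>v. linear (\<lambda>u. \<omega> z u v)) \<and> (\<forall>u. linear (\<omega> z u)) \<and> (\<forall>v. \<omega> z v v = 0)) \<and>
     (\<forall>u v. smooth_on U (\<lambda>z. \<omega> z u v)) \<and>
     (\<forall>z\<in>U. \<forall>u v w. frechet_derivative (\<lambda>z. \<omega> z v w) (at z) u
        - frechet_derivative (\<lambda>z. \<omega> z u w) (at z) v + frechet_derivative (\<lambda>z. \<omega> z u v) (at z) w = 0)"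

lemma closed1D:
  assumes "closed1 U \<eta>"
  shows "\<And>z. z \<in> U \<Longrightarrow> linear (\<eta> z)" "\<And>u. smooth_on U (\<lambda>z. \<eta> z u)"
    "\<And>z u v. z \<in> U \<Longrightarrow> frechet_derivative (\<lambda>z. \<eta> z v) (at z) u = frechet_derivative (\<lambda>z. \<eta> z u) (at z) v"
  using assms unfolding closed1_def by blast+

lemma closed2D:
  assumes "closed2 U \<omega>"
  shows "\<And>z v. z \<in> U \<Longrightarrow> linear (\<lambda>u. \<omega> z u v)" "\<And>z u. z \<in> U \<Longrightarrow> linear (\<omega> z u)"
    "\<And>z v. z \<in> U \<Longrightarrow> \<omega> z v v = 0" "\<And>u v. smooth_on U (\<lambda>z. \<omega> z u v)"
    "\<And>z u v w. z \<in> U \<Longrightarrow> frechet_derivative (\<lambda>z. \<omega> z v w) (at z) u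
        - frechet_derivative (\<lambda>z. \<omega> z u w) (at z) v + frechet_derivative (\<lambda>z. \<omega> z u v) (at z) w = 0"
  using assms unfolding closed2_def by blast+

lemma closed2_skew:
  assumes "closed2 U \<omega>" "z \<in> U"
  shows "\<omega> z u v = - \<omega> z v u"
proof -
  note c = closed2D[OF assms(1)]
  have "\<omega> z (u + v) (u + v) = \<omega> z u u + \<omega> z v u + (\<omega> z u v + \<omega> z v v)"
    by (simp add: linear_add[OF c(1)[OF assms(2)]] linear_add[OF c(2)[OF assms(2)]])
  then show ?thesis by (simp add: c(3)[OF assms(2)])
qed

lemma closed2_linear:
  assumes "closed2 U \<omega>"
  shows "\<forall>z\<in>U. linear (\<lambda>u. \<omega> z u v)" "\<forall>z\<in>U. linear (\<omega> z u)"
  using closed2D(1,2)[OF assms] by blast+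

lemma closed1_linear: "closed1 U \<eta> \<Longrightarrow> \<forall>z\<in>U. linear (\<eta> z)"
  unfolding closed1_def by blast

lemma closed2_derivative:
  fixes g :: "'b::euclidean_space \<Rightarrow> 'a::euclidean_space"
  assumes S: "open S" and U: "open U" and g: "smooth_on S g" and gU: "\<forall>z\<in>S. g z \<in> U"
    and \<omega>: "closed2 U \<omega>" and X: "smooth_on S X" and Y: "smooth_on S Y"
  shows "smooth_on S (\<lambda>z. \<omega> (g z) (X z) (Y z))"
    "\<And>z h. z \<in> S \<Longrightarrow> frechet_derivative (\<lambda>z. \<omega> (g z) (X z) (Y z)) (at z) h =
      frechet_derivative (\<lambda>q. \<omega> q (X z) (Y z)) (at (g z)) (frechet_derivative g (at z) h)
      + \<omega> (g z) (frechet_derivative X (at z) h) (Y z) + \<omega> (g z) (X z) (frechet_derivative Y (at z) h)"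
proof -
  note c = closed2D[OF \<omega>] and l = closed2_linear[OF \<omega>]
  have sY: "smooth_on S (\<lambda>z. \<omega> (g z) v (Y z))" for v
    by (rule smooth_on_linear_apply_compose[OF S U g gU l(2) c(4) Y])
  have lin: "\<forall>z\<in>S. linear (\<lambda>v. \<omega> (g z) v (Y z))" using c(1) gU by blast
  have id: "\<forall>z\<in>S. z \<in> S" by blast
  show "smooth_on S (\<lambda>z. \<omega> (g z) (X z) (Y z))"
    by (rule smooth_on_linear_apply_compose[where L = "\<lambda>z v. \<omega> (g z) v (Y z)" and g = "\<lambda>z. z",
          OF S S smooth_on_id[OF S] id lin sY X])
  fix z h assume z: "z \<in> S"
  have "frechet_derivative (\<lambda>z. \<omega> (g z) (X z) (Y z)) (at z) h =
     frechet_derivative (\<lambda>q. \<omega> (g q) (X z) (Y q)) (at z) (frechet_derivative (\<lambda>z. z) (at z) h)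
     + \<omega> (g z) (frechet_derivative X (at z) h) (Y z)"
    by (rule frechet_derivative_linear_apply[where L = "\<lambda>z v. \<omega> (g z) v (Y z)" and g = "\<lambda>z. z",
          OF S S smooth_on_id[OF S] id lin sY X z])
  also have "frechet_derivative (\<lambda>q. \<omega> (g q) (X z) (Y q)) (at z) h'
      = frechet_derivative (\<lambda>q. \<omega> q (X z) (Y z)) (at (g z)) (frechet_derivative g (at z) h')
        + \<omega> (g z) (X z) (frechet_derivative Y (at z) h')" for h'
    by (rule frechet_derivative_linear_apply[where L = "\<lambda>q. \<omega> q (X z)", OF S U g gU l(2) c(4) Y z])
  finally show "frechet_derivative (\<lambda>z. \<omega> (g z) (X z) (Y z)) (at z) h =
      frechet_derivative (\<lambda>q. \<omega> q (X z) (Y z)) (at (g z)) (frechet_derivative g (at z) h)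
      + \<omega> (g z) (frechet_derivative X (at z) h) (Y z) + \<omega> (g z) (X z) (frechet_derivative Y (at z) h)"
    by (simp add: frechet_derivative_ident)
qed

text \<open>In the exterior derivative of the pullback, the second derivatives of \<open>G\<close> cancel by symmetry.\<close>

lemma closed2_pullback:
  assumes B: "open B" and U: "open U" and G: "smooth_on B G" and GU: "\<forall>z\<in>B. G z \<in> U"
    and \<omega>: "closed2 U \<omega>"
  shows "closed2 B (\<lambda>z u v. \<omega> (G z) (frechet_derivative G (at z) u) (frechet_derivative G (at z) v))"
proof -
  note c = closed2D[OF \<omega>]
  let ?D = "\<lambda>u z. frechet_derivative G (at z) u"
  have lG: "linear (frechet_derivative G (at z))" if "z \<in> B" for z
    by (rule smooth_on_linear_derivative[OF G that])
  have sm: "smooth_on B (?D u)" for u by (rule smooth_on_deriv[OF G])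
  note der = closed2_derivative[OF B U G GU \<omega> sm sm]
  show ?thesis
    unfolding closed2_def
  proof (intro conjI ballI allI der(1))
    fix z v assume z: "z \<in> B"
    note Gz = bspec[OF GU z]
    show "linear (\<lambda>u. \<omega> (G z) (?D u z) (?D v z))"
      using linear_compose[OF lG[OF z] c(1)[OF Gz]] by (simp add: o_def)
    show "linear (\<lambda>w. \<omega> (G z) (?D v z) (?D w z))"
      using linear_compose[OF lG[OF z] c(2)[OF Gz]] by (simp add: o_def)
    show "\<omega> (G z) (?D v z) (?D v z) = 0" by (rule c(3)[OF Gz])
  next
    fix z u v w assume z: "z \<in> B"
    note Gz = bspec[OF GU z]
    have sym: "frechet_derivative (?D u) (at z) v = frechet_derivative (?D v) (at z) u" for u v
      by (rule second_derivative_symmetric[OF B G z])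
    show "frechet_derivative (\<lambda>z. \<omega> (G z) (?D v z) (?D w z)) (at z) u
        - frechet_derivative (\<lambda>z. \<omega> (G z) (?D u z) (?D w z)) (at z) v
        + frechet_derivative (\<lambda>z. \<omega> (G z) (?D u z) (?D v z)) (at z) w = 0"
      unfolding der(2)[OF z] sym[of w] sym[of v u]
      using c(5)[OF Gz, of "?D v z" "?D w z" "?D u z"]
        closed2_skew[OF \<omega> Gz, of "?D v z" "frechet_derivative (?D u) (at z) w"]
      by simp
  qed
qed

lemma closed1_pullback:
  assumes B: "open B" and U: "open U" and G: "smooth_on B G" and GU: "\<forall>z\<in>B. G z \<in> U"
    and \<eta>: "closed1 U \<eta>"
  shows "closed1 B (\<lambda>z u. \<eta> (G z) (frechet_derivative G (at z) u))"
proof -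
  note c = closed1D[OF \<eta>] and l = closed1_linear[OF \<eta>]
  let ?D = "\<lambda>u z. frechet_derivative G (at z) u"
  have lG: "linear (frechet_derivative G (at z))" if "z \<in> B" for z
    by (rule smooth_on_linear_derivative[OF G that])
  have sm: "smooth_on B (?D u)" for u by (rule smooth_on_deriv[OF G])
  show ?thesis
    unfolding closed1_def
  proof (intro conjI ballI allI)
    show "linear (\<lambda>u. \<eta> (G z) (?D u z))" if "z \<in> B" for z
      using linear_compose[OF lG[OF that] c(1)[OF bspec[OF GU that]]] by (simp add: o_def)
    show "smooth_on B (\<lambda>z. \<eta> (G z) (?D u z))" for u
      by (rule smooth_on_linear_apply_compose[OF B U G GU l c(2) sm])
    fix z u v assume z: "z \<in> B"
    note Gz = bspec[OF GU z]
    have D: "frechet_derivative (\<lambda>z. \<eta> (G z) (?D v z)) (at z) u =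
        frechet_derivative (\<lambda>q. \<eta> q (?D v z)) (at (G z)) (?D u z) + \<eta> (G z) (frechet_derivative (?D v) (at z) u)" for u v
      by (rule frechet_derivative_linear_apply[where L = \<eta>, OF B U G GU l c(2) sm z])
    show "frechet_derivative (\<lambda>z. \<eta> (G z) (?D v z)) (at z) u = frechet_derivative (\<lambda>z. \<eta> (G z) (?D u z)) (at z) v"
      unfolding D
      using c(3)[OF Gz, of "?D v z" "?D u z"] second_derivative_symmetric[OF B G z, of u v] by simp
  qed
qed

text \<open>Cartan's formula for \<open>d\<omega>(X, Y, Z) = 0\<close>.\<close>

lemma closed2_bracket_identity:
  assumes U: "open U" and \<omega>: "closed2 U \<omega>" and X: "smooth_on U X" and Y: "smooth_on U Y"
    and Z: "smooth_on U Z" and q: "q \<in> U"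
  shows "frechet_derivative (\<lambda>q. \<omega> q (Y q) (Z q)) (at q) (X q)
    - frechet_derivative (\<lambda>q. \<omega> q (X q) (Z q)) (at q) (Y q)
    + frechet_derivative (\<lambda>q. \<omega> q (X q) (Y q)) (at q) (Z q)
    = \<omega> q (bracket X Y q) (Z q) - \<omega> q (bracket X Z q) (Y q) + \<omega> q (bracket Y Z q) (X q)"
proof -
  note c = closed2D[OF \<omega>]
  have id: "\<forall>z\<in>U. z \<in> U" by blast
  have der: "frechet_derivative (\<lambda>z. \<omega> z (X z) (Y z)) (at q) h =
      frechet_derivative (\<lambda>z. \<omega> z (X q) (Y q)) (at q) h
      + \<omega> q (frechet_derivative X (at q) h) (Y q) + \<omega> q (X q) (frechet_derivative Y (at q) h)"
    if "smooth_on U X" "smooth_on U Y" for X Y h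
    using closed2_derivative(2)[OF U U smooth_on_id[OF U] id \<omega> that q, of h] by (simp add: frechet_derivative_ident)
  note lin = linear_diff[OF c(1)[OF q]]
  show ?thesis
    unfolding der[OF Y Z] der[OF X Z] der[OF X Y] bracket_def lin
    using c(5)[OF q, of "Y q" "Z q" "X q"]
      closed2_skew[OF \<omega> q, of "Y q" "frechet_derivative Z (at q) (X q)"]
      closed2_skew[OF \<omega> q, of "X q" "frechet_derivative Z (at q) (Y q)"]
      closed2_skew[OF \<omega> q, of "X q" "frechet_derivative Y (at q) (Z q)"]
    by linarith
qed

text \<open>Cartan's formula for \<open>d\<eta>(X, Y) = 0\<close>.\<close>

lemma closed1_bracket_identity:
  assumes U: "open U" and \<eta>: "closed1 U \<eta>" and X: "smooth_on U X" and Y: "smooth_on U Y" and q: "q \<in> U"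
  shows "frechet_derivative (\<lambda>q. \<eta> q (Y q)) (at q) (X q) - frechet_derivative (\<lambda>q. \<eta> q (X q)) (at q) (Y q)
    = \<eta> q (bracket X Y q)"
proof -
  note c = closed1D[OF \<eta>]
  have id: "\<forall>z\<in>U. z \<in> U" by blast
  have der: "frechet_derivative (\<lambda>z. \<eta> z (X z)) (at q) h =
      frechet_derivative (\<lambda>z. \<eta> z (X q)) (at q) h + \<eta> q (frechet_derivative X (at q) h)"
    if "smooth_on U X" for X h
    using frechet_derivative_linear_apply[where L = \<eta> and g = "\<lambda>z. z",
        OF U U smooth_on_id[OF U] id closed1_linear[OF \<eta>] c(2) that q, of h]
    by (simp add: frechet_derivative_ident)
  show ?thesis
    unfolding der[OF X] der[OF Y] bracket_def linear_diff[OF c(1)[OF q]]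
    using c(3)[OF q, of "Y q" "X q"] by linarith
qed

subsection \<open>The Poincare lemma\<close>

lemma poincare_closed1:
  assumes B: "open B" and star': "\<forall>z\<in>B. \<forall>t\<in>{0..1::real}. t *\<^sub>R z \<in> B" and \<eta>: "closed1 B \<eta>"
  shows "\<exists>x. smooth_on B x \<and> (\<forall>z\<in>B. \<forall>v. frechet_derivative x (at z) v = \<eta> z v)"
proof -
  note c = closed1D[OF \<eta>]
  have star: "t *\<^sub>R z \<in> B" if "z \<in> B" "t \<in> {0..1}" for z t using star' that by blast
  define f where "f t z = \<eta> (t *\<^sub>R z) z" for t :: real and z
  have lin_t: "bounded_linear (\<lambda>z. t *\<^sub>R z)" for t :: real and z :: 'a by (rule bounded_linear_scaleR_right)
  have h: "smooth_family {0..1::real} B (\<lambda>t z. t *\<^sub>R z)"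
    by (intro smooth_family_scaleR smooth_family_param smooth_family_bounded_linear bounded_linear_ident B continuous_on_id)
  have "smooth_family {0..1} B (\<lambda>t z. \<Sum>b\<in>Basis. (z \<bullet> b) *\<^sub>R \<eta> (t *\<^sub>R z) b)"
    by (intro smooth_family_sum smooth_family_scaleR B smooth_family_bounded_linear bounded_linear_inner_left
        smooth_family_compose_on[OF B B _ h c(2)] star)
  then have fam: "smooth_family {0..1} B f"
  proof (rule smooth_family_cong[OF B, rotated])
    show "(\<Sum>b\<in>Basis. (z \<bullet> b) *\<^sub>R \<eta> (t *\<^sub>R z) b) = f t z" if "t \<in> {0..1}" "z \<in> B" for t z
      unfolding f_def by (rule linear_sum_Basis[OF c(1)[OF star[OF that(2,1)]], symmetric])
  qed
  have smt: "smooth_on B (\<lambda>z. t *\<^sub>R z)" for t :: real by (rule smooth_on_bounded_linear[OF B lin_t])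
  have Dt: "frechet_derivative (\<lambda>z. t *\<^sub>R z) (at z) v = t *\<^sub>R v" for t :: real and z v :: 'a
    using bounded_linear_imp_has_derivative[OF lin_t, of t "at z"] by (simp add: frechet_derivative_at[symmetric])
  show ?thesis
  proof (intro exI[of _ "\<lambda>z. integral {0..1} (\<lambda>t. f t z)"] conjI ballI allI)
    show "smooth_on B (\<lambda>z. integral {0..1} (\<lambda>t. f t z))" by (rule smooth_on_integral[OF B fam])
    fix z v assume z: "z \<in> B"
    have Df: "frechet_derivative (f t) (at z) v = t * frechet_derivative (\<lambda>q. \<eta> q v) (at (t *\<^sub>R z)) z + \<eta> (t *\<^sub>R z) v"
      if t: "t \<in> {0..1}" for t
    proof -
      note tz = star[OF z t]
      have "frechet_derivative (f t) (at z) v = frechet_derivative (\<lambda>q. \<eta> q z) (at (t *\<^sub>R z)) (t *\<^sub>R v) + \<eta> (t *\<^sub>R z) v"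
        unfolding f_def[abs_def]
        using frechet_derivative_linear_apply[where L = \<eta>, OF B B smt _ closed1_linear[OF \<eta>] c(2) smooth_on_id[OF B] z, of t v]
          star[OF _ t] by (simp add: Dt frechet_derivative_ident)
      also have "frechet_derivative (\<lambda>q. \<eta> q z) (at (t *\<^sub>R z)) (t *\<^sub>R v) = t *\<^sub>R frechet_derivative (\<lambda>q. \<eta> q v) (at (t *\<^sub>R z)) z"
        by (simp only: linear_cmul[OF smooth_on_linear_derivative[OF c(2) tz]] c(3)[OF tz, of z v])
      finally show ?thesis by simp
    qed
    have "frechet_derivative (\<lambda>z. integral {0..1} (\<lambda>t. f t z)) (at z) v = integral {0..1} (\<lambda>t. frechet_derivative (f t) (at z) v)"
      by (rule frechet_derivative_integral[OF B fam z])
    also have "\<dots> = integral {0..1} (\<lambda>t. t * frechet_derivative (\<lambda>q. \<eta> q v) (at (t *\<^sub>R z)) z + \<eta> (t *\<^sub>R z) v)"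
      by (rule integral_cong) (rule Df)
    also have "((\<lambda>t. t * frechet_derivative (\<lambda>q. \<eta> q v) (at (t *\<^sub>R z)) z + \<eta> (t *\<^sub>R z) v)
        has_integral (1 * \<eta> (1 *\<^sub>R z) v - 0 * \<eta> (0 *\<^sub>R z) v)) {0..1}"
    proof (rule fundamental_theorem_of_calculus)
      fix t :: real assume t: "t \<in> {0..1}"
      note tz = star[OF z t]
      have "((\<lambda>t. t *\<^sub>R z) has_derivative (\<lambda>h. h *\<^sub>R z)) (at t)" by (auto intro!: derivative_eq_intros)
      from diff_chain_at[OF this smooth_on_has_derivative[OF c(2) tz]]
      have "((\<lambda>t. \<eta> (t *\<^sub>R z) v) has_derivative (\<lambda>h. h *\<^sub>R frechet_derivative (\<lambda>q. \<eta> q v) (at (t *\<^sub>R z)) z)) (at t)"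
        by (simp add: o_def linear_cmul[OF smooth_on_linear_derivative[OF c(2) tz]])
      from has_derivative_at_withinI[OF has_derivative_mult[OF has_derivative_ident this]]
      show "((\<lambda>t. t * \<eta> (t *\<^sub>R z) v) has_vector_derivative
          t * frechet_derivative (\<lambda>q. \<eta> q v) (at (t *\<^sub>R z)) z + \<eta> (t *\<^sub>R z) v) (at t within {0..1})"
        unfolding has_vector_derivative_def
        by (simp add: algebra_simps)
    qed simp
    from integral_unique[OF this]
    have "integral {0..1} (\<lambda>t. t * frechet_derivative (\<lambda>q. \<eta> q v) (at (t *\<^sub>R z)) z + \<eta> (t *\<^sub>R z) v) = \<eta> z v" by simp
    finally show "frechet_derivative (\<lambda>z. integral {0..1} (\<lambda>t. f t z)) (at z) v = \<eta> z v" .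
  qed
qed

text \<open>The homotopy formula for \<open>h\<^sub>t = P + t Q\<close>: the form \<open>\<theta>\<close> is the integral over \<open>t\<close> of the pullback along
  \<open>h\<^sub>t\<close> of \<open>\<omega>\<close> contracted with the velocity \<open>Q z\<close>, so \<open>d\<theta>\<close> is the difference of the pullbacks of \<open>\<omega>\<close> along
  \<open>h\<^sub>1\<close> and \<open>h\<^sub>0\<close>.\<close>

lemma poincare_homotopy2:
  fixes P Q :: "'a::euclidean_space \<Rightarrow> 'a"
  assumes B: "open B" and \<omega>: "closed2 B \<omega>" and P: "linear P" and Q: "linear Q"
    and star: "\<forall>z\<in>B. \<forall>t\<in>{0..1::real}. P z + t *\<^sub>R Q z \<in> B"
    and \<theta>: "\<theta> = (\<lambda>z w. integral {0..1} (\<lambda>t. \<omega> (P z + t *\<^sub>R Q z) (Q z) (P w + t *\<^sub>R Q w)))"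
  shows "\<And>w. smooth_on B (\<lambda>z. \<theta> z w)" "\<And>z. z \<in> B \<Longrightarrow> linear (\<theta> z)"
    "\<And>z v w. z \<in> B \<Longrightarrow> frechet_derivative (\<lambda>z. \<theta> z w) (at z) v - frechet_derivative (\<lambda>z. \<theta> z v) (at z) w
        = \<omega> (P z + Q z) (P v + Q v) (P w + Q w) - \<omega> (P z) (P v) (P w)"
proof -
  note c = closed2D[OF \<omega>]
  have blP: "bounded_linear P" and blQ: "bounded_linear Q"
    using P Q by (simp_all add: linear_conv_bounded_linear)
  define h where "h t z = P z + t *\<^sub>R Q z" for t :: real and z
  have linh: "linear (h t)" for t
    unfolding h_def[abs_def] by (intro linear_compose_add P linear_compose_scale_right Q)
  have blh: "bounded_linear (h t)" for t using linh by (simp add: linear_conv_bounded_linear)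
  have hB: "h t z \<in> B" if "z \<in> B" "t \<in> {0..1}" for t z using star that by (simp add: h_def)
  define f where "f w t z = \<omega> (h t z) (Q z) (h t w)" for w t z
  have famh: "smooth_family {0..1::real} B h"
    unfolding h_def[abs_def]
    by (intro smooth_family_add smooth_family_scaleR smooth_family_param smooth_family_bounded_linear B blP blQ continuous_on_id)
  have fam: "smooth_family {0..1} B (f w)" for w
  proof (rule smooth_family_cong[OF B])
    show "smooth_family {0..1} B (\<lambda>t z. \<Sum>b\<in>Basis. (Q z \<bullet> b) *\<^sub>R (\<Sum>d\<in>Basis. (h t w \<bullet> d) *\<^sub>R \<omega> (h t z) b d))"
    proof (intro smooth_family_sum smooth_family_scaleR B)
      show "smooth_family {0..1::real} B (\<lambda>t z. Q z \<bullet> b)" for b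
        by (intro smooth_family_bounded_linear B bounded_linear_inner_left_comp blQ)
      show "smooth_family {0..1::real} B (\<lambda>t z. h t w \<bullet> d)" for d
        unfolding h_def by (intro smooth_family_param B continuous_intros)
      show "smooth_family {0..1} B (\<lambda>t z. \<omega> (h t z) b d)" for b d
        by (rule smooth_family_compose_on[OF B B _ famh c(4)]) (rule hB)
    qed
    fix t :: real and z assume t: "t \<in> {0..1}" and z: "z \<in> B"
    note l = c(1)[OF hB[OF z t]] c(2)[OF hB[OF z t]]
    have "f w t z = (\<Sum>b\<in>Basis. (Q z \<bullet> b) *\<^sub>R \<omega> (h t z) b (h t w))"
      unfolding f_def by (rule linear_sum_Basis[OF l(1)])
    also have "\<dots> = (\<Sum>b\<in>Basis. (Q z \<bullet> b) *\<^sub>R (\<Sum>d\<in>Basis. (h t w \<bullet> d) *\<^sub>R \<omega> (h t z) b d))"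
      by (intro sum.cong refl arg_cong[where f = "scaleR _"] linear_sum_Basis[OF l(2)])
    finally show "(\<Sum>b\<in>Basis. (Q z \<bullet> b) *\<^sub>R (\<Sum>d\<in>Basis. (h t w \<bullet> d) *\<^sub>R \<omega> (h t z) b d)) = f w t z" ..
  qed
  have \<theta>f: "\<theta> z w = integral {0..1} (\<lambda>t. f w t z)" for z w by (simp add: \<theta> f_def h_def)
  show "smooth_on B (\<lambda>z. \<theta> z w)" for w unfolding \<theta>f by (rule smooth_on_integral[OF B fam])
  have cf: "continuous_on {0..1} (\<lambda>t. f w t z)" if "z \<in> B" for w z
  proof -
    have "Ck_family {0..1} 0 B (f w)" using fam unfolding smooth_family_def by blast
    from continuous_on_compose_pair[OF Ck_family_continuous[OF this], of "{0..1}" "\<lambda>t. t" "\<lambda>_. z"]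
    show ?thesis using that by (simp add: continuous_on_id)
  qed
  show "linear (\<theta> z)" if z: "z \<in> B" for z
  proof (rule linearI)
    fix u v :: 'a and r :: real
    note i = integrable_continuous_interval[OF cf[OF z]]
    have "\<theta> z (u + v) = integral {0..1} (\<lambda>t. f u t z + f v t z)"
      unfolding \<theta>f
      by (rule integral_cong) (simp add: f_def linear_add[OF linh] linear_add[OF c(2)[OF hB[OF z]]])
    then show "\<theta> z (u + v) = \<theta> z u + \<theta> z v" unfolding \<theta>f by (simp add: integral_add[OF i i])
    have "\<theta> z (r *\<^sub>R u) = integral {0..1} (\<lambda>t. r *\<^sub>R f u t z)"
      unfolding \<theta>f
      by (rule integral_cong) (simp add: f_def linear_cmul[OF linh] linear_cmul[OF c(2)[OF hB[OF z]]])
    then show "\<theta> z (r *\<^sub>R u) = r *\<^sub>R \<theta> z u" unfolding \<theta>f by simp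
  qed
  fix z v w assume z: "z \<in> B"
  have Dh: "frechet_derivative (h t) (at x) k = h t k" for t x k
    using bounded_linear_imp_has_derivative[OF blh, of t "at x"] by (simp add: frechet_derivative_at[symmetric])
  have DQ: "frechet_derivative Q (at x) k = Q k" for x k
    using bounded_linear_imp_has_derivative[OF blQ, of "at x"] by (simp add: frechet_derivative_at[symmetric])
  have Df: "frechet_derivative (f w t) (at z) v =
      frechet_derivative (\<lambda>q. \<omega> q (Q z) (h t w)) (at (h t z)) (h t v) + \<omega> (h t z) (Q v) (h t w)"
    if t: "t \<in> {0..1}" for t v w
    unfolding f_def[abs_def]
    using closed2_derivative(2)[OF B B smooth_on_bounded_linear[OF B blh] _ \<omega>
        smooth_on_bounded_linear[OF B blQ] smooth_on_const[OF B] z, of t "h t w" v] hB[OF _ t]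
    by (simp add: Dh DQ frechet_derivative_const linear_0[OF c(2)[OF hB[OF z t]]])
  define F where "F t = \<omega> (h t z) (h t v) (h t w)" for t
  have F: "((\<lambda>t. frechet_derivative (f w t) (at z) v - frechet_derivative (f v t) (at z) w) has_integral (F 1 - F 0)) {0..1}"
  proof (rule fundamental_theorem_of_calculus)
    fix t :: real assume t: "t \<in> {0..1}"
    note tz = hB[OF z t]
    define S where "S = {t. h t z \<in> B}"
    have ch: "continuous_on UNIV (\<lambda>t. h t z)" unfolding h_def by (intro continuous_intros)
    have S: "open S" using continuous_open_preimage[OF ch open_UNIV B] by (simp add: S_def vimage_def)
    have smh: "smooth_on S (\<lambda>t. h t z)" for z
      unfolding h_def by (intro smooth_on_add smooth_on_const smooth_on_scaleR smooth_on_id S)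
    have Dht: "frechet_derivative (\<lambda>t. h t x) (at t) 1 = Q x" for x
    proof -
      have "((\<lambda>t. h t x) has_derivative (\<lambda>k. k *\<^sub>R Q x)) (at t)"
        unfolding h_def by (auto intro!: derivative_eq_intros)
      then show ?thesis by (simp add: frechet_derivative_at[symmetric])
    qed
    have hS: "\<forall>t\<in>S. h t z \<in> B" by (simp add: S_def)
    have tS: "t \<in> S" using tz by (simp add: S_def)
    note cd = closed2_derivative[OF S B smh hS \<omega> smh smh]
    have smF: "smooth_on S F" unfolding F_def by (rule cd(1))
    have "frechet_derivative F (at t) 1 = frechet_derivative (\<lambda>q. \<omega> q (h t v) (h t w)) (at (h t z)) (Q z)
       + \<omega> (h t z) (Q v) (h t w) + \<omega> (h t z) (h t v) (Q w)"
      unfolding F_def[abs_def] cd(2)[OF tS] Dht ..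
    also have "\<dots> = frechet_derivative (f w t) (at z) v - frechet_derivative (f v t) (at z) w"
      unfolding Df[OF t]
      using c(5)[OF tz, of "h t v" "h t w" "Q z"] closed2_skew[OF \<omega> tz, of "h t v" "Q w"] by simp
    finally have D1: "frechet_derivative F (at t) 1 = frechet_derivative (f w t) (at z) v - frechet_derivative (f v t) (at z) w" .
    have "frechet_derivative F (at t) (r *\<^sub>R 1) = r *\<^sub>R frechet_derivative F (at t) 1" for r :: real
      by (rule linear_cmul[OF smooth_on_linear_derivative[OF smF tS]])
    then have DF: "frechet_derivative F (at t)
        = (\<lambda>r. r *\<^sub>R (frechet_derivative (f w t) (at z) v - frechet_derivative (f v t) (at z) w))"
      unfolding D1 by (intro ext) simp
    have "(F has_derivative (\<lambda>r. r *\<^sub>R (frechet_derivative (f w t) (at z) v - frechet_derivative (f v t) (at z) w))) (at t)"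
      using smooth_on_has_derivative[OF smF tS] by (simp only: DF)
    then show "(F has_vector_derivative frechet_derivative (f w t) (at z) v - frechet_derivative (f v t) (at z) w) (at t within {0..1})"
      unfolding has_vector_derivative_def by (rule has_derivative_at_withinI)
  qed simp
  have "Ck_family {0..1} (Suc 0) B (f w)" for w using fam unfolding smooth_family_def by blast
  then have cDf: "continuous_on {0..1} (\<lambda>t. frechet_derivative (f w t) (at z) v)" for v w
    using continuous_on_compose_pair[of "{0..1}" B "\<lambda>t z. frechet_derivative (f w t) (at z) v" "{0..1}" "\<lambda>t. t" "\<lambda>_. z"] z
    by (simp add: continuous_on_id)
  have "frechet_derivative (\<lambda>z. \<theta> z w) (at z) v - frechet_derivative (\<lambda>z. \<theta> z v) (at z) w
      = integral {0..1} (\<lambda>t. frechet_derivative (f w t) (at z) v) - integral {0..1} (\<lambda>t. frechet_derivative (f v t) (at z) w)"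
    unfolding \<theta>f by (simp only: frechet_derivative_integral[OF B fam z])
  also have "\<dots> = integral {0..1} (\<lambda>t. frechet_derivative (f w t) (at z) v - frechet_derivative (f v t) (at z) w)"
    by (rule integral_diff[symmetric]) (intro integrable_continuous_interval cDf)+
  also have "\<dots> = F 1 - F 0" by (rule integral_unique[OF F])
  finally show "frechet_derivative (\<lambda>z. \<theta> z w) (at z) v - frechet_derivative (\<lambda>z. \<theta> z v) (at z) w
        = \<omega> (P z + Q z) (P v + Q v) (P w + Q w) - \<omega> (P z) (P v) (P w)"
    by (simp add: F_def h_def)
qed

section \<open>Darboux coordinates from an involutive isotropic frame\<close>

lemma finite_coord_names: "finite (coord_names k n)"
proof -
  have "{CP \<alpha> i | \<alpha> i. \<alpha> \<in> {1..k} \<and> i \<in> {1..n}} = (\<lambda>(\<alpha>, i). CP \<alpha> i) ` ({1..k} \<times> {1..n})" by auto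
  then show ?thesis by (simp add: coord_names_def)
qed

lemma card_coord_names: "card (coord_names k n) = n * (k + 1) + k"
proof -
  have CP: "{CP \<alpha> i | \<alpha> i. \<alpha> \<in> {1..k} \<and> i \<in> {1..n}} = (\<lambda>(\<alpha>, i). CP \<alpha> i) ` ({1..k} \<times> {1..n})" by auto
  have 1: "card ((\<lambda>(\<alpha>, i). CP \<alpha> i) ` ({1..k} \<times> {1..n})) = k * n"
    by (subst card_image) (auto simp: inj_on_def)
  have 2: "card (CX ` {1..k}) = k" "card (CY ` {1..n}) = n"
    by (simp_all add: card_image inj_on_def)
  have "card (CX ` {1..k} \<union> CY ` {1..n}) = k + n"
    using 2 by (subst card_Un_disjoint) auto
  then have "card ((CX ` {1..k} \<union> CY ` {1..n}) \<union> (\<lambda>(\<alpha>, i). CP \<alpha> i) ` ({1..k} \<times> {1..n})) = k + n + k * n"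
    using 1 by (subst card_Un_disjoint) auto
  then show ?thesis unfolding coord_names_def CP by (simp add: algebra_simps)
qed

lemma coord_names_cases:
  assumes "c \<in> coord_names k n"
  obtains \<alpha> where "\<alpha> \<in> {1..k}" "c = CX \<alpha>" | i where "i \<in> {1..n}" "c = CY i"
    | \<alpha> i where "\<alpha> \<in> {1..k}" "i \<in> {1..n}" "c = CP \<alpha> i"
  using assms unfolding coord_names_def by blast

text \<open>The linear functions \<open>v \<mapsto> v \<bullet> s i\<close> are the coordinates transversal to \<open>L\<close>.\<close>

lemma orthonormal_complement:
  fixes L :: "'a::euclidean_space set"
  assumes L: "subspace L" and d: "dim L + n = DIM('a)"
  obtains s :: "nat \<Rightarrow> 'a" where "\<And>i j. i \<in> {1..n} \<Longrightarrow> j \<in> {1..n} \<Longrightarrow> s i \<bullet> s j = (if i = j then 1 else 0)"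
    "\<And>i v. i \<in> {1..n} \<Longrightarrow> v \<in> L \<Longrightarrow> v \<bullet> s i = 0"
    "\<And>v. v - (\<Sum>i=1..n. (v \<bullet> s i) *\<^sub>R s i) \<in> L"
proof -
  define S where "S = {y. \<forall>x\<in>L. orthogonal x y}"
  have sS: "subspace S" unfolding S_def by (rule subspace_orthogonal_to_vectors)
  have "dim S + dim L = DIM('a)"
    using dim_subspace_orthogonal_to_vectors[OF L subspace_UNIV] by (simp add: S_def)
  then have dS: "dim S = n" using d by simp
  obtain B where B: "B \<subseteq> S" "pairwise orthogonal B" "\<And>x. x \<in> B \<Longrightarrow> norm x = 1" "independent B"
    "card B = dim S" "span B = S"
    using orthonormal_basis_subspace[OF sS] by metis
  have fB: "finite B" using B(4) by (rule independent_imp_finite)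
  then obtain s where s: "bij_betw s {1..n} B" using ex_bij_betw_nat_finite_1 B(5) dS by metis
  have sB: "s i \<in> B" if "i \<in> {1..n}" for i using bij_betwE[OF s] that by blast
  have on: "s i \<bullet> s j = (if i = j then 1 else 0)" if ij: "i \<in> {1..n}" "j \<in> {1..n}" for i j
  proof (cases "i = j")
    case True
    then show ?thesis using B(3)[OF sB[OF ij(1)]] by (simp add: norm_eq_1)
  next
    case False
    then have "s i \<noteq> s j" using s ij unfolding bij_betw_def by (meson inj_onD)
    then have "orthogonal (s i) (s j)" using B(2) sB ij unfolding pairwise_def by blast
    then show ?thesis using False by (simp add: orthogonal_def)
  qed
  have sL: "v \<bullet> s i = 0" if "i \<in> {1..n}" "v \<in> L" for i v
    using sB[OF that(1)] B(1) that(2) unfolding S_def orthogonal_def by blast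
  have "v - (\<Sum>i=1..n. (v \<bullet> s i) *\<^sub>R s i) \<in> L" for v
  proof -
    obtain y z where yz: "y \<in> span L" "\<And>w. w \<in> span L \<Longrightarrow> orthogonal z w" "v = y + z"
      using orthogonal_subspace_decomp_exists[of L v] by metis
    have spL: "span L = L" using L by simp
    have "z \<in> S" using yz(2) unfolding S_def spL by (simp add: orthogonal_commute)
    then have "z \<in> span (s ` {1..n})" using B(6) s by (simp add: bij_betw_def)
    then obtain c where c: "z = (\<Sum>i\<in>{1..n}. c i *\<^sub>R s i)" using span_image_finite[of "{1..n}" z s] by auto
    have "v \<bullet> s j = c j" if j: "j \<in> {1..n}" for j
    proof -
      have "v \<bullet> s j = z \<bullet> s j" using sL[OF j, of y] yz(1,3) spL by (simp add: inner_add_left)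
      also have "\<dots> = (\<Sum>i\<in>{1..n}. c i * (if i = j then 1 else 0))"
        unfolding c inner_sum_left inner_scaleR_left by (rule sum.cong[OF refl]) (simp only: on[OF _ j])
      also have "\<dots> = c j" using j by (simp add: if_distrib[of "\<lambda>x. _ * x"] cong: if_cong)
      finally show ?thesis .
    qed
    then have "(\<Sum>i=1..n. (v \<bullet> s i) *\<^sub>R s i) = z" unfolding c by (intro sum.cong) simp_all
    then show ?thesis using yz(1,3) spL by simp
  qed
  with on sL show thesis by (rule that)
qed

text \<open>In coordinates in which the involutive distribution spanned by the frame is a constant
  subspace \<open>L\<close>, the homotopy that first contracts along \<open>L\<close> and then along the complement of \<open>L\<close>
  produces a primitive of \<open>\<omega>\<close> that vanishes on \<open>L\<close>.  Such a primitive is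
  \<open>- (\<Sum>i. f i * ds i)\<close>, where the \<open>s i\<close> are linear coordinates that vanish on \<open>L\<close>.\<close>

lemma isotropic_primitive:
  fixes s :: "nat \<Rightarrow> 'a::euclidean_space"
  assumes \<omega>: "closed2 (ball 0 \<rho>) \<omega>"
    and on: "\<And>i j. i \<in> {1..n} \<Longrightarrow> j \<in> {1..n} \<Longrightarrow> s i \<bullet> s j = (if i = j then 1 else 0)"
    and sL: "\<And>i v. i \<in> {1..n} \<Longrightarrow> v \<in> L \<Longrightarrow> v \<bullet> s i = 0"
    and dec: "\<And>v. v - (\<Sum>i=1..n. (v \<bullet> s i) *\<^sub>R s i) \<in> L"
    and iso: "\<And>z u v. z \<in> ball 0 \<rho> \<Longrightarrow> u \<in> L \<Longrightarrow> v \<in> L \<Longrightarrow> \<omega> z u v = 0"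
  shows "\<exists>f :: nat \<Rightarrow> 'a \<Rightarrow> real. (\<forall>i\<in>{1..n}. smooth_on (ball 0 \<rho>) (f i)) \<and> (\<forall>z\<in>ball 0 \<rho>. \<forall>v w.
    \<omega> z v w = (\<Sum>i=1..n. (v \<bullet> s i) * frechet_derivative (f i) (at z) w
                        - (w \<bullet> s i) * frechet_derivative (f i) (at z) v))"
proof -
  let ?B = "ball (0::'a) \<rho>"
  define P where "P v = (\<Sum>i=1..n. (v \<bullet> s i) *\<^sub>R s i)" for v
  define Q where "Q v = v - P v" for v
  have P: "linear P"
    by (rule linearI) (simp_all add: P_def inner_add_left scaleR_add_left sum.distrib scaleR_sum_right)
  have Q: "linear Q" unfolding Q_def[abs_def] by (intro linear_compose_sub linear_id[unfolded id_def] P)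
  have QL: "Q v \<in> L" for v using dec by (simp add: Q_def P_def)
  have P_L: "P v = 0" if "v \<in> L" for v unfolding P_def by (rule sum.neutral) (simp add: sL that)
  have PP: "P (P v) = P v" for v
    using P_L[OF QL, of v] by (simp add: Q_def linear_diff[OF P])
  have PQ: "P (Q v) = 0" for v by (rule P_L[OF QL])
  have orth: "P v \<bullet> Q w = 0" for v w
    unfolding P_def inner_sum_left using sL[OF _ QL, of _ w] by (simp add: inner_commute)
  have n2: "(norm (P z + t *\<^sub>R Q z))\<^sup>2 = (norm (P z))\<^sup>2 + t\<^sup>2 * (norm (Q z))\<^sup>2" for z t
    using norm_add_Pythagorean[of "P z" "t *\<^sub>R Q z"] orth[of z z]
    by (simp add: orthogonal_def power_mult_distrib)
  have n1: "norm (P z + t *\<^sub>R Q z) \<le> norm z" if "t \<in> {0..1}" for z t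
  proof -
    have "t\<^sup>2 \<le> 1" using that by (simp add: power_le_one)
    then have "(norm (P z + t *\<^sub>R Q z))\<^sup>2 \<le> (norm (P z + 1 *\<^sub>R Q z))\<^sup>2"
      unfolding n2 by (simp add: mult_left_le_one_le)
    then show ?thesis by (simp add: Q_def)
  qed
  have nP: "norm (t *\<^sub>R P z) \<le> norm z" if "t \<in> {0..1}" for z t
  proof -
    have "norm (t *\<^sub>R P z) \<le> 1 * norm (P z)" using that by (simp add: mult_left_le_one_le)
    also have "\<dots> \<le> norm z" using n1[of 0 z] by simp
    finally show ?thesis .
  qed
  have star1: "\<forall>z\<in>?B. \<forall>t\<in>{0..1::real}. P z + t *\<^sub>R Q z \<in> ?B"
  proof (intro ballI)
    fix z and t :: real assume z: "z \<in> ?B" and t: "t \<in> {0..1}"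
    show "P z + t *\<^sub>R Q z \<in> ?B" using le_less_trans[OF n1[OF t, of z]] z by simp
  qed
  have star2: "\<forall>z\<in>?B. \<forall>t\<in>{0..1::real}. 0 + t *\<^sub>R P z \<in> ?B"
  proof (intro ballI)
    fix z and t :: real assume z: "z \<in> ?B" and t: "t \<in> {0..1}"
    show "0 + t *\<^sub>R P z \<in> ?B" using le_less_trans[OF nP[OF t, of z]] z by simp
  qed
  define \<theta>1 where "\<theta>1 = (\<lambda>z w. integral {0..1} (\<lambda>t. \<omega> (P z + t *\<^sub>R Q z) (Q z) (P w + t *\<^sub>R Q w)))"
  define \<theta>2 where "\<theta>2 = (\<lambda>z w. integral {0..1} (\<lambda>t. \<omega> (0 + t *\<^sub>R P z) (P z) (0 + t *\<^sub>R P w)))"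
  note T1 = poincare_homotopy2[OF open_ball \<omega> P Q star1 \<theta>1_def]
  note T2 = poincare_homotopy2[where P = "\<lambda>_. 0", OF open_ball \<omega> linear_zero P star2 \<theta>2_def]
  define \<theta> where "\<theta> z w = \<theta>1 z w + \<theta>2 z w" for z w
  have sm\<theta>: "smooth_on ?B (\<lambda>z. \<theta> z w)" for w
    unfolding \<theta>_def by (intro smooth_on_add open_ball T1(1) T2(1))
  have lin\<theta>: "linear (\<theta> z)" if "z \<in> ?B" for z
    unfolding \<theta>_def[abs_def] by (intro linear_compose_add T1(2)[OF that] T2(2)[OF that])
  have d\<theta>: "frechet_derivative (\<lambda>z. \<theta> z w) (at z) v - frechet_derivative (\<lambda>z. \<theta> z v) (at z) w = \<omega> z v w"
    if z: "z \<in> ?B" for z v w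
  proof -
    have D: "frechet_derivative (\<lambda>z. \<theta> z w) (at z) v
        = frechet_derivative (\<lambda>z. \<theta>1 z w) (at z) v + frechet_derivative (\<lambda>z. \<theta>2 z w) (at z) v" for v w
      unfolding \<theta>_def
      using has_derivative_add[OF smooth_on_has_derivative[OF T1(1)[of w] z] smooth_on_has_derivative[OF T2(1)[of w] z]]
      by (simp add: frechet_derivative_at[symmetric])
    have B0: "(0::'a) \<in> ?B" using z by (auto intro: le_less_trans[OF norm_ge_zero])
    have "\<omega> 0 0 0 = 0" by (rule closed2D(3)[OF \<omega> B0])
    then show ?thesis
      unfolding D using T1(3)[OF z, of w v] T2(3)[OF z, of w v] by (simp add: Q_def)
  qed
  have \<theta>L: "\<theta> z w = 0" if z: "z \<in> ?B" and w: "w \<in> L" for z w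
  proof -
    have Pw: "P w = 0" "Q w = w" using P_L[OF w] by (simp_all add: Q_def)
    have "\<omega> (P z + t *\<^sub>R Q z) (Q z) (P w + t *\<^sub>R Q w) = 0" if t: "t \<in> {0..1}" for t
    proof -
      have "\<omega> (P z + t *\<^sub>R Q z) (Q z) (t *\<^sub>R w) = t *\<^sub>R \<omega> (P z + t *\<^sub>R Q z) (Q z) w"
        by (rule linear_cmul[OF closed2D(2)[OF \<omega>]]) (use star1 z t in blast)
      moreover have "\<omega> (P z + t *\<^sub>R Q z) (Q z) w = 0"
        by (rule iso[OF _ QL w]) (use star1 z t in blast)
      ultimately show ?thesis by (simp add: Pw)
    qed
    then have 1: "\<theta>1 z w = integral {0..1::real} (\<lambda>t. 0)" unfolding \<theta>1_def by (rule integral_cong)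
    have "\<omega> (0 + t *\<^sub>R P z) (P z) (0 + t *\<^sub>R P w) = 0" if t: "t \<in> {0..1}" for t
      using linear_0[OF closed2D(2)[OF \<omega>, of "0 + t *\<^sub>R P z" "P z"]] star2 z t by (simp add: Pw)
    then have 2: "\<theta>2 z w = integral {0..1::real} (\<lambda>t. 0)" unfolding \<theta>2_def by (rule integral_cong)
    show ?thesis by (simp add: \<theta>_def 1 2)
  qed
  define f where "f i z = - \<theta> z (s i)" for i z
  have smf: "smooth_on ?B (f i)" for i
    unfolding f_def[abs_def] by (intro smooth_on_minus open_ball sm\<theta>)
  have \<theta>s: "\<theta> z w = (\<Sum>i=1..n. (w \<bullet> s i) *\<^sub>R \<theta> z (s i))" if z: "z \<in> ?B" for z w
  proof -
    have "\<theta> z w = \<theta> z (P w) + \<theta> z (Q w)" by (simp add: linear_add[OF lin\<theta>[OF z], symmetric] Q_def)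
    also have "\<dots> = \<theta> z (P w)" by (simp add: \<theta>L[OF z QL])
    finally show ?thesis
      unfolding P_def by (simp add: linear_sum[OF lin\<theta>[OF z]] linear_cmul[OF lin\<theta>[OF z]])
  qed
  have Df: "frechet_derivative (\<lambda>z. \<theta> z w) (at z) v = - (\<Sum>i=1..n. (w \<bullet> s i) * frechet_derivative (f i) (at z) v)"
    if z: "z \<in> ?B" for z v w
  proof -
    have "((\<lambda>z. \<Sum>i=1..n. (w \<bullet> s i) *\<^sub>R - f i z) has_derivative
        (\<lambda>v. \<Sum>i=1..n. (w \<bullet> s i) *\<^sub>R - frechet_derivative (f i) (at z) v)) (at z)"
      by (intro has_derivative_sum has_derivative_scaleR_right has_derivative_minus smooth_on_has_derivative[OF smf z])
    then have "((\<lambda>z. \<theta> z w) has_derivative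
        (\<lambda>v. \<Sum>i=1..n. (w \<bullet> s i) *\<^sub>R - frechet_derivative (f i) (at z) v)) (at z)"
    proof (rule has_derivative_transform_within_open[OF _ open_ball z])
      show "(\<Sum>i=1..n. (w \<bullet> s i) *\<^sub>R - f i y) = \<theta> y w" if "y \<in> ?B" for y
        unfolding \<theta>s[OF that, of w] f_def by simp
    qed
    then show ?thesis by (simp add: frechet_derivative_at[symmetric] sum_negf)
  qed
  show ?thesis
  proof (intro exI[of _ f] conjI ballI allI smf)
    fix z v w assume z: "z \<in> ?B"
    show "\<omega> z v w = (\<Sum>i=1..n. (v \<bullet> s i) * frechet_derivative (f i) (at z) w
                        - (w \<bullet> s i) * frechet_derivative (f i) (at z) v)"
      unfolding d\<theta>[OF z, symmetric] Df[OF z] by (simp add: sum_subtractf)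
  qed
qed

lemma dim_span_lin_indep:
  assumes "finite I" "lin_indep I v"
  shows "dim (span (v ` I)) = card I"
  using lin_indep_imp_independent[OF assms] by (simp add: dim_eq_card_independent card_image)

lemma frechet_derivative_sum_scaleR_const:
  assumes "\<And>c. c \<in> C \<Longrightarrow> smooth_on U (f c)" "z \<in> U"
  shows "frechet_derivative (\<lambda>z. \<Sum>c\<in>C. f c z *\<^sub>R e c) (at z) v
    = (\<Sum>c\<in>C. frechet_derivative (f c) (at z) v *\<^sub>R e c)"
proof -
  have "((\<lambda>z. \<Sum>c\<in>C. f c z *\<^sub>R e c) has_derivative
      (\<lambda>v. \<Sum>c\<in>C. frechet_derivative (f c) (at z) v *\<^sub>R e c)) (at z)"
    by (intro has_derivative_sum has_derivative_scaleR_left smooth_on_has_derivative[of U] assms)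
  then show ?thesis by (simp add: frechet_derivative_at[symmetric])
qed

text \<open>The normal form at one point \<open>q\<close>, where \<open>T\<close> is the derivative at \<open>q\<close> of a coordinate map whose
  coordinates are named by \<open>b\<close>.\<close>

abbreviation darboux_at :: "nat \<Rightarrow> nat \<Rightarrow> (coord_name \<Rightarrow> 'a) \<Rightarrow> (nat \<Rightarrow> 'a::euclidean_space \<Rightarrow> 'a \<Rightarrow> real)
    \<Rightarrow> (nat \<Rightarrow> 'a \<Rightarrow> 'a \<Rightarrow> 'a \<Rightarrow> real) \<Rightarrow> (nat \<Rightarrow> 'a \<Rightarrow> 'a) \<Rightarrow> 'a \<Rightarrow> ('a \<Rightarrow> 'a) \<Rightarrow> bool" where
  "darboux_at k n b \<eta> \<omega> R q T \<equiv>
    (\<forall>\<alpha>\<in>{1..k}. \<forall>v. \<eta> \<alpha> q v = T v \<bullet> b (CX \<alpha>)) \<and>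
    (\<forall>\<alpha>\<in>{1..k}. \<forall>v w. \<omega> \<alpha> q v w =
      (\<Sum>i=1..n. (T v \<bullet> b (CY i)) * (T w \<bullet> b (CP \<alpha> i)) - (T w \<bullet> b (CY i)) * (T v \<bullet> b (CP \<alpha> i)))) \<and>
    (\<forall>\<alpha>\<in>{1..k}. T (R \<alpha> q) = b (CX \<alpha>))"

text \<open>The coordinates are primitives of the \<open>\<eta> \<alpha>\<close>, linear functions that vanish on the straightened span of
  the \<open>Z i\<close>, and the coefficients from \<open>isotropic_primitive\<close>.  Their independence is the nondegeneracy
  assumption: the formulas for \<open>\<eta> \<alpha>\<close> and \<open>\<omega> \<alpha>\<close> show that a vector annihilated by all differentials is in
  all kernels.\<close>

theorem darboux_from_frame:
  fixes \<eta> :: "nat \<Rightarrow> 'a::euclidean_space \<Rightarrow> 'a \<Rightarrow> real" and \<omega> :: "nat \<Rightarrow> 'a \<Rightarrow> 'a \<Rightarrow> 'a \<Rightarrow> real"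
    and R :: "nat \<Rightarrow> 'a \<Rightarrow> 'a" and Z :: "'i \<Rightarrow> 'a \<Rightarrow> 'a"
  assumes U: "open U" and p: "p \<in> U" and dim: "DIM('a) = n * (k + 1) + k"
    and \<eta>: "\<And>\<alpha>. \<alpha> \<in> {1..k} \<Longrightarrow> closed1 U (\<eta> \<alpha>)" and \<omega>: "\<And>\<alpha>. \<alpha> \<in> {1..k} \<Longrightarrow> closed2 U (\<omega> \<alpha>)"
    and nondeg: "\<And>q v. q \<in> U \<Longrightarrow> \<forall>\<alpha>\<in>{1..k}. \<eta> \<alpha> q v = 0 \<and> (\<forall>w. \<omega> \<alpha> q v w = 0) \<Longrightarrow> v = 0"
    and R\<eta>: "\<And>\<alpha> \<beta> q. q \<in> U \<Longrightarrow> \<alpha> \<in> {1..k} \<Longrightarrow> \<beta> \<in> {1..k} \<Longrightarrow> \<eta> \<beta> q (R \<alpha> q) = (if \<alpha> = \<beta> then 1 else 0)"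
    and R\<omega>: "\<And>\<alpha> \<beta> q w. q \<in> U \<Longrightarrow> \<alpha> \<in> {1..k} \<Longrightarrow> \<beta> \<in> {1..k} \<Longrightarrow> \<omega> \<beta> q (R \<alpha> q) w = 0"
    and fin: "finite I" and card: "card I = n * k + k"
    and Z: "\<And>i. i \<in> I \<Longrightarrow> smooth_on U (Z i)" and ind: "lin_indep I (\<lambda>i. Z i p)"
    and inv: "\<And>q i j. q \<in> U \<Longrightarrow> i \<in> I \<Longrightarrow> j \<in> I \<Longrightarrow> bracket (Z i) (Z j) q \<in> span ((\<lambda>i. Z i q) ` I)"
    and iso: "\<And>\<alpha> q i j. \<alpha> \<in> {1..k} \<Longrightarrow> q \<in> U \<Longrightarrow> i \<in> I \<Longrightarrow> j \<in> I \<Longrightarrow> \<omega> \<alpha> q (Z i q) (Z j q) = 0"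
    and RZ: "\<And>\<alpha> q. \<alpha> \<in> {1..k} \<Longrightarrow> q \<in> U \<Longrightarrow> R \<alpha> q \<in> span ((\<lambda>i. Z i q) ` I)"
  shows "\<exists>W Y \<Phi> \<Psi> b. diffeo W Y \<Phi> \<Psi> \<and> p \<in> W \<and> W \<subseteq> U \<and> bij_betw b (coord_names k n) (Basis :: 'a set) \<and>
    (\<forall>q\<in>W. darboux_at k n b \<eta> \<omega> R q (frechet_derivative \<Phi> (at q)) \<and>
      (\<forall>i\<in>I. \<forall>j\<in>{1..n}. frechet_derivative \<Phi> (at q) (Z i q) \<bullet> b (CY j) = 0))"
proof -
  have "\<exists>B W G H. diffeo B W G H \<and> 0 \<in> B \<and> W \<subseteq> U \<and> G 0 = p \<and>
    (\<forall>z\<in>B. \<forall>v. frechet_derivative G (at z) v \<in> span ((\<lambda>i. Z i (G z)) ` I)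
        \<longleftrightarrow> v \<in> span ((\<lambda>i. Z i p) ` I))"
    by (rule frobenius[OF U p fin Z ind inv])
  then obtain B0 W0 G H where D0: "diffeo B0 W0 G H" and B0: "0 \<in> B0" "W0 \<subseteq> U" "G 0 = p"
    and DG0: "\<forall>z\<in>B0. \<forall>v. frechet_derivative G (at z) v \<in> span ((\<lambda>i. Z i (G z)) ` I)
        \<longleftrightarrow> v \<in> span ((\<lambda>i. Z i p) ` I)"
    by (elim exE conjE)
  obtain \<rho> where \<rho>: "\<rho> > 0" "ball 0 \<rho> \<subseteq> B0" using diffeoD(1)[OF D0] B0(1) openE by blast
  let ?B = "ball (0::'a) \<rho>" and ?DG = "\<lambda>z. frechet_derivative G (at z)"
  have D: "diffeo ?B (G ` ?B) G H" by (rule diffeo_subset[OF D0 open_ball \<rho>(2)])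
  note d = diffeoD[OF D]
  have zero: "0 \<in> ?B" using \<rho>(1) by simp
  have GU: "\<forall>z\<in>?B. G z \<in> U" using diffeoD(5)[OF D0] \<rho>(2) B0(2) by blast
  define L where "L = span ((\<lambda>i. Z i p) ` I)"
  have DG: "?DG z v \<in> span ((\<lambda>i. Z i (G z)) ` I) \<longleftrightarrow> v \<in> L" if "z \<in> ?B" for z v
    using DG0 \<rho>(2) that unfolding L_def by blast
  have linDG: "linear (?DG z)" if "z \<in> ?B" for z by (rule smooth_on_linear_derivative[OF d(3) that])
  have dL: "dim L + n = DIM('a)" unfolding L_def dim_span_lin_indep[OF fin ind] card dim by (simp add: algebra_simps)
  have sub: "subspace L" by (simp add: L_def)
  obtain s where on: "\<And>i j. i \<in> {1..n} \<Longrightarrow> j \<in> {1..n} \<Longrightarrow> s i \<bullet> s j = (if i = j then 1 else 0)"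
    and sL: "\<And>i v. i \<in> {1..n} \<Longrightarrow> v \<in> L \<Longrightarrow> v \<bullet> s i = 0"
    and dec: "\<And>v. v - (\<Sum>i=1..n. (v \<bullet> s i) *\<^sub>R s i) \<in> L"
    using orthonormal_complement[OF sub dL] by blast
  define \<omega>' where "\<omega>' \<alpha> z u v = \<omega> \<alpha> (G z) (?DG z u) (?DG z v)" for \<alpha> z u v
  define \<eta>' where "\<eta>' \<alpha> z u = \<eta> \<alpha> (G z) (?DG z u)" for \<alpha> z u
  have \<omega>': "closed2 ?B (\<omega>' \<alpha>)" if "\<alpha> \<in> {1..k}" for \<alpha>
    unfolding \<omega>'_def[abs_def] by (rule closed2_pullback[OF open_ball U d(3) GU \<omega>[OF that]])
  have \<eta>': "closed1 ?B (\<eta>' \<alpha>)" if "\<alpha> \<in> {1..k}" for \<alpha>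
    unfolding \<eta>'_def[abs_def] by (rule closed1_pullback[OF open_ball U d(3) GU \<eta>[OF that]])
  have iso': "\<omega>' \<alpha> z u v = 0" if \<alpha>: "\<alpha> \<in> {1..k}" and z: "z \<in> ?B" and u: "u \<in> L" and v: "v \<in> L" for \<alpha> z u v
  proof -
    have Gz: "G z \<in> U" using GU z by blast
    note l1 = closed2D(1)[OF \<omega>[OF \<alpha>] Gz] and l2 = closed2D(2)[OF \<omega>[OF \<alpha>] Gz]
    obtain c where c: "?DG z u = (\<Sum>i\<in>I. c i *\<^sub>R Z i (G z))"
      using DG[OF z] u span_image_finite[OF fin, of "?DG z u" "\<lambda>i. Z i (G z)"] by blast
    obtain e where e: "?DG z v = (\<Sum>i\<in>I. e i *\<^sub>R Z i (G z))"
      using DG[OF z] v span_image_finite[OF fin, of "?DG z v" "\<lambda>i. Z i (G z)"] by blast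
    show ?thesis
      unfolding \<omega>'_def c e
      by (simp add: linear_sum[OF l1] linear_cmul[OF l1] linear_sum[OF l2] linear_cmul[OF l2] iso[OF \<alpha> Gz])
  qed
  have star: "\<forall>z\<in>?B. \<forall>t\<in>{0..1::real}. t *\<^sub>R z \<in> ?B"
  proof (intro ballI)
    fix z :: 'a and t :: real assume "z \<in> ?B" "t \<in> {0..1}"
    moreover have "\<bar>t\<bar> * norm z \<le> 1 * norm z" using \<open>t \<in> {0..1}\<close> by (intro mult_right_mono) simp_all
    ultimately show "t *\<^sub>R z \<in> ?B" by simp
  qed
  have "\<forall>\<alpha>. \<exists>x. \<alpha> \<in> {1..k} \<longrightarrow> smooth_on ?B x \<and> (\<forall>z\<in>?B. \<forall>v. frechet_derivative x (at z) v = \<eta>' \<alpha> z v)"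
    using poincare_closed1[OF open_ball star \<eta>'] by blast
  from choice[OF this] obtain x where x: "\<And>\<alpha>. \<alpha> \<in> {1..k} \<Longrightarrow> smooth_on ?B (x \<alpha>)"
    and dx: "\<And>\<alpha> z v. \<alpha> \<in> {1..k} \<Longrightarrow> z \<in> ?B \<Longrightarrow> frechet_derivative (x \<alpha>) (at z) v = \<eta>' \<alpha> z v"
    by blast
  have "\<exists>f :: nat \<Rightarrow> 'a \<Rightarrow> real. (\<forall>i\<in>{1..n}. smooth_on ?B (f i)) \<and> (\<forall>z\<in>?B. \<forall>v w.
    \<omega>' \<alpha> z v w = (\<Sum>i=1..n. (v \<bullet> s i) * frechet_derivative (f i) (at z) w
                        - (w \<bullet> s i) * frechet_derivative (f i) (at z) v))" if "\<alpha> \<in> {1..k}" for \<alpha>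
    by (rule isotropic_primitive[OF \<omega>'[OF that] on sL dec iso'[OF that]])
  then have "\<forall>\<alpha>. \<exists>f :: nat \<Rightarrow> 'a \<Rightarrow> real. \<alpha> \<in> {1..k} \<longrightarrow> (\<forall>i\<in>{1..n}. smooth_on ?B (f i)) \<and> (\<forall>z\<in>?B. \<forall>v w.
    \<omega>' \<alpha> z v w = (\<Sum>i=1..n. (v \<bullet> s i) * frechet_derivative (f i) (at z) w
                        - (w \<bullet> s i) * frechet_derivative (f i) (at z) v))" by blast
  from choice[OF this] obtain y where y0: "\<forall>\<alpha>. \<alpha> \<in> {1..k} \<longrightarrow> (\<forall>i\<in>{1..n}. smooth_on ?B (y \<alpha> i)) \<and> (\<forall>z\<in>?B. \<forall>v w.
    \<omega>' \<alpha> z v w = (\<Sum>i=1..n. (v \<bullet> s i) * frechet_derivative (y \<alpha> i) (at z) w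
                        - (w \<bullet> s i) * frechet_derivative (y \<alpha> i) (at z) v))" by (elim exE) (rule that)
  have y: "smooth_on ?B (y \<alpha> i)" if "\<alpha> \<in> {1..k}" "i \<in> {1..n}" for \<alpha> i using y0 that by blast
  have dy: "\<omega>' \<alpha> z v w = (\<Sum>i=1..n. (v \<bullet> s i) * frechet_derivative (y \<alpha> i) (at z) w
                        - (w \<bullet> s i) * frechet_derivative (y \<alpha> i) (at z) v)"
    if "\<alpha> \<in> {1..k}" "z \<in> ?B" for \<alpha> z v w using y0 that by blast
  obtain b where b: "bij_betw b (coord_names k n) (Basis :: 'a set)"
    using finite_same_card_bij[OF finite_coord_names finite_Basis] card_coord_names[of k n] dim by metis
  define val where "val c = (case c of CX \<alpha> \<Rightarrow> x \<alpha> | CY i \<Rightarrow> (\<lambda>z. z \<bullet> s i) | CP \<alpha> i \<Rightarrow> y \<alpha> i)" for c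
  have smval: "smooth_on ?B (val c)" if "c \<in> coord_names k n" for c
    using that
  proof (cases rule: coord_names_cases)
    case (2 i)
    then show ?thesis
      using smooth_on_bounded_linear[OF open_ball bounded_linear_inner_left] by (simp add: val_def)
  qed (simp_all add: val_def x y)
  have dCY: "frechet_derivative (val (CY i)) (at z) v = v \<bullet> s i" for i z v
    using bounded_linear_imp_has_derivative[OF bounded_linear_inner_left[of "s i"], of "at z"]
    by (simp add: val_def frechet_derivative_at[symmetric])
  define \<Phi>' where "\<Phi>' z = (\<Sum>c\<in>coord_names k n. val c z *\<^sub>R b c)" for z
  have sm\<Phi>': "smooth_on ?B \<Phi>'"
    unfolding \<Phi>'_def[abs_def] by (intro smooth_on_sum smooth_on_scaleR smooth_on_const open_ball smval)
  have inn: "frechet_derivative \<Phi>' (at z) v \<bullet> b c = frechet_derivative (val c) (at z) v"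
    if z: "z \<in> ?B" and c: "c \<in> coord_names k n" for z v c
  proof -
    have bb: "b c' \<bullet> b c = (if c' = c then 1 else 0)" if c': "c' \<in> coord_names k n" for c'
    proof -
      have "b c' \<in> Basis" "b c \<in> Basis" using bij_betwE[OF b] c c' by blast+
      moreover have "b c' = b c \<longleftrightarrow> c' = c" using b c c' unfolding bij_betw_def by (meson inj_on_eq_iff)
      ultimately show ?thesis by (simp add: inner_Basis)
    qed
    have D\<Phi>': "frechet_derivative \<Phi>' (at z) v = (\<Sum>c'\<in>coord_names k n. frechet_derivative (val c') (at z) v *\<^sub>R b c')"
      unfolding \<Phi>'_def[abs_def] by (rule frechet_derivative_sum_scaleR_const[OF smval z])
    have "frechet_derivative \<Phi>' (at z) v \<bullet> b c
        = (\<Sum>c'\<in>coord_names k n. frechet_derivative (val c') (at z) v * (b c' \<bullet> b c))"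
      unfolding D\<Phi>' by (simp add: inner_sum_left)
    also have "\<dots> = (\<Sum>c'\<in>coord_names k n. if c' = c then frechet_derivative (val c') (at z) v else 0)"
      by (rule sum.cong[OF refl]) (simp add: bb)
    also have "\<dots> = frechet_derivative (val c) (at z) v" using c by (simp add: finite_coord_names)
    finally show ?thesis .
  qed
  have names: "CX \<alpha> \<in> coord_names k n" "CY i \<in> coord_names k n" "CP \<alpha> i \<in> coord_names k n"
    if "\<alpha> \<in> {1..k}" "i \<in> {1..n}" for \<alpha> i using that by (auto simp: coord_names_def)
  have nameX: "CX \<alpha> \<in> coord_names k n" if "\<alpha> \<in> {1..k}" for \<alpha> using that by (auto simp: coord_names_def)
  have nameY: "CY i \<in> coord_names k n" if "i \<in> {1..n}" for i using that by (auto simp: coord_names_def)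
  have \<omega>\<Phi>: "\<omega>' \<alpha> z v w = (\<Sum>i=1..n.
        (frechet_derivative \<Phi>' (at z) v \<bullet> b (CY i)) * (frechet_derivative \<Phi>' (at z) w \<bullet> b (CP \<alpha> i))
        - (frechet_derivative \<Phi>' (at z) w \<bullet> b (CY i)) * (frechet_derivative \<Phi>' (at z) v \<bullet> b (CP \<alpha> i)))"
    if \<alpha>: "\<alpha> \<in> {1..k}" and z: "z \<in> ?B" for \<alpha> z v w
    unfolding dy[OF that]
  proof (rule sum.cong[OF refl])
    fix i assume i: "i \<in> {1..n}"
    have CP: "val (CP \<alpha> i) = y \<alpha> i" by (simp add: val_def)
    show "(v \<bullet> s i) * frechet_derivative (y \<alpha> i) (at z) w - (w \<bullet> s i) * frechet_derivative (y \<alpha> i) (at z) v =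
        (frechet_derivative \<Phi>' (at z) v \<bullet> b (CY i)) * (frechet_derivative \<Phi>' (at z) w \<bullet> b (CP \<alpha> i))
        - (frechet_derivative \<Phi>' (at z) w \<bullet> b (CY i)) * (frechet_derivative \<Phi>' (at z) v \<bullet> b (CP \<alpha> i))"
      unfolding inn[OF z nameY[OF i]] inn[OF z names(3)[OF \<alpha> i]] dCY CP ..
  qed
  have \<eta>\<Phi>: "\<eta>' \<alpha> z v = frechet_derivative \<Phi>' (at z) v \<bullet> b (CX \<alpha>)" if "\<alpha> \<in> {1..k}" "z \<in> ?B" for \<alpha> z v
    unfolding inn[OF that(2) nameX[OF that(1)]] using dx[OF that] by (simp add: val_def)
  have inj: "v = 0" if z: "z \<in> ?B" and v: "frechet_derivative \<Phi>' (at z) v = 0" for z v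
  proof -
    have Gz: "G z \<in> U" using GU z by blast
    have "?DG z v = 0"
    proof (rule nondeg[OF Gz], intro ballI conjI allI)
      fix \<alpha> w assume \<alpha>: "\<alpha> \<in> {1..k}"
      show "\<eta> \<alpha> (G z) (?DG z v) = 0" using \<eta>\<Phi>[OF \<alpha> z, of v] v by (simp add: \<eta>'_def)
      have "\<omega>' \<alpha> z v w' = 0" for w' unfolding \<omega>\<Phi>[OF \<alpha> z] v by simp
      from this[of "frechet_derivative H (at (G z)) w"] show "\<omega> \<alpha> (G z) (?DG z v) w = 0"
        unfolding \<omega>'_def diffeo_derivative_inverse'[OF D z] .
    qed
    then show ?thesis
      using diffeo_derivative_inverse[OF D z, of v]
        linear_0[OF smooth_on_linear_derivative[OF d(4) d(5)[OF z]]] by simp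
  qed
  obtain B1 Y \<Psi>' where D1: "diffeo B1 Y \<Phi>' \<Psi>'" and B1: "B1 \<subseteq> ?B" "0 \<in> B1"
    by (rule smooth_inverse_function[OF open_ball sm\<Phi>' zero inj[OF zero]]) (assumption, rule that)
  define W where "W = G ` B1"
  have D2: "diffeo B1 W G H" unfolding W_def by (rule diffeo_subset[OF D diffeoD(1)[OF D1] B1(1)])
  note d2 = diffeoD[OF D2]
  define \<Phi> where "\<Phi> q = \<Phi>' (H q)" for q
  define \<Psi> where "\<Psi> z = G (\<Psi>' z)" for z
  have D3: "diffeo W Y \<Phi> \<Psi>"
    unfolding \<Phi>_def[abs_def] \<Psi>_def[abs_def] by (rule diffeo_compose[OF diffeo_sym[OF D2] D1])
  have HB: "H q \<in> ?B" if "q \<in> W" for q using d2(6)[OF that] B1(1) by blast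
  have D\<Phi>: "frechet_derivative \<Phi> (at q) v = frechet_derivative \<Phi>' (at (H q)) (frechet_derivative H (at q) v)"
    if "q \<in> W" for q v
    unfolding \<Phi>_def[abs_def]
    by (rule frechet_derivative_compose_smooth[OF d2(4) that sm\<Phi>' HB[OF that]])
  have GH: "?DG (H q) (frechet_derivative H (at q) v) = v" if "q \<in> W" for q v
    by (rule diffeo_derivative_inverse[OF diffeo_sym[OF D2] that])
  have WU: "W \<subseteq> U" using GU B1(1) unfolding W_def by blast
  have \<omega>W: "\<omega> \<alpha> q v w = (\<Sum>i=1..n.
          (frechet_derivative \<Phi> (at q) v \<bullet> b (CY i)) * (frechet_derivative \<Phi> (at q) w \<bullet> b (CP \<alpha> i))
        - (frechet_derivative \<Phi> (at q) w \<bullet> b (CY i)) * (frechet_derivative \<Phi> (at q) v \<bullet> b (CP \<alpha> i)))"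
    if \<alpha>: "\<alpha> \<in> {1..k}" and q: "q \<in> W" for \<alpha> q v w
    using \<omega>\<Phi>[OF \<alpha> HB[OF q], of "frechet_derivative H (at q) v" "frechet_derivative H (at q) w"]
    unfolding \<omega>'_def D\<Phi>[OF q, symmetric] GH[OF q] d2(8)[OF q] .
  have \<eta>W: "\<eta> \<alpha> q v = frechet_derivative \<Phi> (at q) v \<bullet> b (CX \<alpha>)" if \<alpha>: "\<alpha> \<in> {1..k}" and q: "q \<in> W" for \<alpha> q v
    using \<eta>\<Phi>[OF \<alpha> HB[OF q], of "frechet_derivative H (at q) v"]
    unfolding \<eta>'_def D\<Phi>[OF q, symmetric] GH[OF q] d2(8)[OF q] .
  have EY: "frechet_derivative \<Phi> (at q) v \<bullet> b (CY j) = 0"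
    if q: "q \<in> W" and v: "v \<in> span ((\<lambda>i. Z i q) ` I)" and j: "j \<in> {1..n}" for q v j
  proof -
    have "frechet_derivative H (at q) v \<in> L"
      using DG[OF HB[OF q], of "frechet_derivative H (at q) v"] v unfolding GH[OF q] d2(8)[OF q] by blast
    then show ?thesis unfolding D\<Phi>[OF q] inn[OF HB[OF q] nameY[OF j]] dCY by (rule sL[OF j])
  qed
  have RW: "frechet_derivative \<Phi> (at q) (R \<beta> q) = b (CX \<beta>)" if \<beta>: "\<beta> \<in> {1..k}" and q: "q \<in> W" for \<beta> q
  proof -
    have qU: "q \<in> U" using q WU by blast
    have RWb: "frechet_derivative \<Phi> (at q) (R \<beta> q) \<bullet> b c = b (CX \<beta>) \<bullet> b c" if c: "c \<in> coord_names k n" for c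
    proof -
      have bb: "b (CX \<beta>) \<bullet> b c = (if c = CX \<beta> then 1 else 0)"
      proof -
        have "b (CX \<beta>) \<in> Basis" "b c \<in> Basis" using bij_betwE[OF b] c nameX[OF \<beta>] by blast+
        moreover have "b (CX \<beta>) = b c \<longleftrightarrow> CX \<beta> = c"
          using b c nameX[OF \<beta>] unfolding bij_betw_def by (meson inj_on_eq_iff)
        ultimately show ?thesis by (auto simp: inner_Basis)
      qed
      from c show ?thesis
      proof (cases rule: coord_names_cases)
        case (1 \<alpha>)
        then show ?thesis using \<eta>W[OF 1(1) q, of "R \<beta> q"] R\<eta>[OF qU \<beta> 1(1)] bb by auto
      next
        case (2 i)
        then show ?thesis using EY[OF q RZ[OF \<beta> qU] 2(1)] bb by simp
      next
        case (3 \<alpha> i)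
        define w where "w = frechet_derivative \<Psi> (at (\<Phi> q)) (b (CY i))"
        have w: "frechet_derivative \<Phi> (at q) w = b (CY i)"
          unfolding w_def by (rule diffeo_derivative_inverse'[OF D3 q])
        have CYb: "b (CY i) \<bullet> b (CY j) = (if j = i then 1 else 0)" if j: "j \<in> {1..n}" for j
        proof -
          have "b (CY i) \<in> Basis" "b (CY j) \<in> Basis" using bij_betwE[OF b] nameY 3(2) j by blast+
          moreover have "b (CY i) = b (CY j) \<longleftrightarrow> CY i = CY j"
            by (rule inj_on_eq_iff[OF bij_betw_imp_inj_on[OF b] nameY[OF 3(2)] nameY[OF j]])
          ultimately show ?thesis by (auto simp: inner_Basis)
        qed
        have "0 = \<omega> \<alpha> q (R \<beta> q) w" using R\<omega>[OF qU \<beta> 3(1)] by simp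
        also have "\<dots> = (\<Sum>j=1..n. if j = i then - (frechet_derivative \<Phi> (at q) (R \<beta> q) \<bullet> b (CP \<alpha> j)) else 0)"
          unfolding \<omega>W[OF 3(1) q] w
          by (rule sum.cong[OF refl]) (simp only: EY[OF q RZ[OF \<beta> qU]] CYb, simp)
        also have "\<dots> = - (frechet_derivative \<Phi> (at q) (R \<beta> q) \<bullet> b c)" using 3 by simp
        finally show ?thesis using bb 3(3) by simp
      qed
    qed
    show ?thesis
    proof (rule euclidean_eqI)
      fix e :: 'a assume "e \<in> Basis"
      then have "e \<in> b ` coord_names k n" using bij_betw_imp_surj_on[OF b] by simp
      then obtain c where "e = b c" "c \<in> coord_names k n" by (rule imageE)
      then show "frechet_derivative \<Phi> (at q) (R \<beta> q) \<bullet> e = b (CX \<beta>) \<bullet> e" using RWb by simp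
    qed
  qed
  have pW: "p \<in> W" using B1(2) B0(3) unfolding W_def by blast
  show ?thesis
    by (intro exI[of _ W] exI[of _ Y] exI[of _ \<Phi>] exI[of _ \<Psi>] exI[of _ b] conjI ballI allI D3 pW WU b
        \<eta>W \<omega>W RW EY) (auto intro: span_base)
qed

section \<open>Involutive isotropic frames\<close>

lemma bracket_skew: "bracket X Y q = - bracket Y X q"
  by (simp add: bracket_def)

lemma linear_functional_inner:
  fixes f :: "'a::euclidean_space \<Rightarrow> real"
  assumes "linear f"
  shows "f v = v \<bullet> (\<Sum>b\<in>Basis. f b *\<^sub>R b)"
  using linear_sum_Basis[OF assms, of v] by (simp add: inner_sum_right mult.commute)

lemma closed1_subset:
  assumes "closed1 U \<eta>" "W \<subseteq> U"
  shows "closed1 W \<eta>"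
  unfolding closed1_def using closed1D[OF assms(1)] assms(2) smooth_on_subset[OF _ assms(2)]
  by (intro conjI ballI allI) blast+

lemma closed2_subset:
  assumes "closed2 U \<omega>" "W \<subseteq> U"
  shows "closed2 W \<omega>"
proof -
  note c = closed2D[OF assms(1)] and sub = subsetD[OF assms(2)]
  show ?thesis
    unfolding closed2_def
    by (intro conjI ballI allI c(1)[OF sub] c(2)[OF sub] c(3)[OF sub] c(5)[OF sub] smooth_on_subset[OF c(4) assms(2)])
qed

text \<open>The Hamiltonian vector fields of functions in involution have a bracket in the kernel of \<open>\<omega>\<close>.\<close>

lemma closed2_bracket_in_kernel:
  assumes U: "open U" and \<omega>: "closed2 U \<omega>" and X: "smooth_on U X" and Y: "smooth_on U Y"
    and f: "smooth_on U f" and g: "smooth_on U g"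
    and Xf: "\<And>q v. q \<in> U \<Longrightarrow> \<omega> q (X q) v = frechet_derivative f (at q) v"
    and Yg: "\<And>q v. q \<in> U \<Longrightarrow> \<omega> q (Y q) v = frechet_derivative g (at q) v"
    and XY: "\<And>q. q \<in> U \<Longrightarrow> \<omega> q (X q) (Y q) = 0" and q: "q \<in> U"
  shows "\<omega> q (bracket X Y q) w = 0"
proof -
  have id: "\<forall>z\<in>U. z \<in> U" by blast
  have sk: "\<omega> q u v = - \<omega> q v u" if "q \<in> U" for q u v by (rule closed2_skew[OF \<omega> that])
  let ?DX = "frechet_derivative X (at q) w" and ?DY = "frechet_derivative Y (at q) w"
  have bZ: "bracket T (\<lambda>_. w) q = - frechet_derivative T (at q) w" for T
    by (simp add: bracket_def frechet_derivative_const)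
  have neg: "\<omega> q (- u) v = - \<omega> q u v" for u v by (rule linear_neg[OF closed2D(1)[OF \<omega> q]])
  have zero: "frechet_derivative (\<lambda>y. frechet_derivative h (at y) (T q)) (at q) w
      = - frechet_derivative h (at q) (frechet_derivative T (at q) w)"
    if h: "smooth_on U h" and T: "smooth_on U T" and z: "\<And>q. q \<in> U \<Longrightarrow> frechet_derivative h (at q) (T q) = 0"
    for h :: "'a \<Rightarrow> real" and T
  proof -
    have "\<forall>q\<in>U. linear (\<lambda>v. frechet_derivative h (at q) v)"
      using smooth_on_linear_derivative[OF h] by blast
    from frechet_derivative_linear_apply[where L = "\<lambda>q. frechet_derivative h (at q)" and g = "\<lambda>z. z",
        OF U U smooth_on_id[OF U] id this smooth_on_deriv[OF h] T q, of w]
    have "frechet_derivative (\<lambda>z. frechet_derivative h (at z) (T z)) (at q) w =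
        frechet_derivative (\<lambda>y. frechet_derivative h (at y) (T q)) (at q) w
        + frechet_derivative h (at q) (frechet_derivative T (at q) w)"
      by (simp add: frechet_derivative_ident)
    moreover have "frechet_derivative (\<lambda>z. frechet_derivative h (at z) (T z)) (at q) = frechet_derivative (\<lambda>z. 0) (at q)"
      by (rule frechet_derivative_cong_open[OF U q]) (rule z)
    ultimately show ?thesis by (simp add: frechet_derivative_const)
  qed
  have gX: "frechet_derivative g (at q) (X q) = 0" if "q \<in> U" for q
    using Yg[OF that, of "X q"] sk[OF that, of "Y q" "X q"] XY[OF that] by simp
  have fY: "frechet_derivative f (at q) (Y q) = 0" if "q \<in> U" for q
    using Xf[OF that, of "Y q"] XY[OF that] by simp
  have 1: "frechet_derivative (\<lambda>q. \<omega> q (Y q) w) (at q) = frechet_derivative (\<lambda>q. frechet_derivative g (at q) w) (at q)"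
    by (rule frechet_derivative_cong_open[OF U q]) (rule Yg)
  have 2: "frechet_derivative (\<lambda>q. \<omega> q (X q) w) (at q) = frechet_derivative (\<lambda>q. frechet_derivative f (at q) w) (at q)"
    by (rule frechet_derivative_cong_open[OF U q]) (rule Xf)
  have 3: "frechet_derivative (\<lambda>q. \<omega> q (X q) (Y q)) (at q) = frechet_derivative (\<lambda>q. 0) (at q)"
    by (rule frechet_derivative_cong_open[OF U q]) (rule XY)
  have "frechet_derivative (\<lambda>q. frechet_derivative g (at q) w) (at q) (X q)
      = - frechet_derivative g (at q) ?DX"
    using zero[OF g X gX] second_derivative_symmetric[OF U g q, of w "X q"] by simp
  moreover have "frechet_derivative (\<lambda>q. frechet_derivative f (at q) w) (at q) (Y q)
      = - frechet_derivative f (at q) ?DY"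
    using zero[OF f Y fY] second_derivative_symmetric[OF U f q, of w "Y q"] by simp
  moreover note closed2_bracket_identity[OF U \<omega> X Y smooth_on_const[OF U, of w] q]
  moreover have "\<omega> q ?DX (Y q) = - frechet_derivative g (at q) ?DX"
    using sk[OF q, of ?DX "Y q"] Yg[OF q] by simp
  moreover have "\<omega> q ?DY (X q) = - frechet_derivative f (at q) ?DY"
    using sk[OF q, of ?DY "X q"] Xf[OF q] by simp
  ultimately show ?thesis unfolding 1 2 3 bZ neg by (simp add: frechet_derivative_const)
qed

text \<open>A vector field in the kernel is Hamiltonian with a constant function, so that \<open>closed2_bracket_in_kernel\<close>
  applies to it.\<close>

lemma smooth_on_zero_form:
  assumes "open U" "\<And>q v. q \<in> U \<Longrightarrow> \<omega> q (R q) v = (0::real)"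
  shows "\<And>q v. q \<in> U \<Longrightarrow> \<omega> q (R q) v = frechet_derivative (\<lambda>_. 0) (at q) v"
  by (simp add: assms frechet_derivative_const)

subsection \<open>Lagrangian frames of a cosymplectic structure\<close>

lemma lin_indep_Suc:
  fixes Z :: "nat \<Rightarrow> 'a::real_vector"
  assumes "lin_indep {0..m} Z" "Z (Suc m) \<notin> span (Z ` {0..m})"
  shows "lin_indep {0..Suc m} Z"
  unfolding lin_indep_def
proof (intro allI impI)
  fix c assume c: "(\<Sum>i\<in>{0..Suc m}. c i *\<^sub>R Z i) = 0"
  have s: "(\<Sum>i\<in>{0..m}. c i *\<^sub>R Z i) + c (Suc m) *\<^sub>R Z (Suc m) = 0" using c by simp
  have c0: "c (Suc m) = 0"
  proof (rule ccontr)
    assume n: "c (Suc m) \<noteq> 0"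
    have "c (Suc m) *\<^sub>R Z (Suc m) = - (\<Sum>i\<in>{0..m}. c i *\<^sub>R Z i)" using s by (simp add: eq_neg_iff_add_eq_0 add.commute)
    then have "(1 / c (Suc m)) *\<^sub>R (c (Suc m) *\<^sub>R Z (Suc m)) = (1 / c (Suc m)) *\<^sub>R - (\<Sum>i\<in>{0..m}. c i *\<^sub>R Z i)" by simp
    then have "Z (Suc m) = (1 / c (Suc m)) *\<^sub>R - (\<Sum>i\<in>{0..m}. c i *\<^sub>R Z i)" using n by simp
    moreover have "(1 / c (Suc m)) *\<^sub>R - (\<Sum>i\<in>{0..m}. c i *\<^sub>R Z i) \<in> span (Z ` {0..m})"
      by (intro span_scale span_neg span_sum span_base imageI)
    ultimately show False using assms(2) by simp
  qed
  then have "\<forall>i\<in>{0..m}. c i = 0" using s assms(1) unfolding lin_indep_def by simp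
  then show "\<forall>i\<in>{0..Suc m}. c i = 0" using c0 by (auto simp: atLeastAtMostSuc_conv le_Suc_eq)
qed

text \<open>Induction on the number \<open>m\<close> of Hamiltonian fields.  The vectors annihilated by \<open>\<eta>\<close> and by the forms
  \<open>\<omega>(Z i, \<cdot>)\<close> form a space of dimension at least \<open>2 n - m > m\<close> at \<open>p\<close>, so one of them, \<open>v\<close>, is
  independent of the frame.  The covector \<open>\<omega>(v, \<cdot>)\<close> extends to the differential of a first integral of the
  frame, and the Hamiltonian field of that function is the next member.  Brackets of
  the extended frame lie in the kernel of \<open>\<omega>\<close>, which is spanned by \<open>R = Z 0\<close>.\<close>

lemma lagrangian_frame:
  fixes \<omega> :: "'a::euclidean_space \<Rightarrow> 'a \<Rightarrow> 'a \<Rightarrow> real"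
  assumes U: "open U" and p: "p \<in> U" and dim: "DIM('a) = 2 * n + 1"
    and \<eta>: "closed1 U \<eta>" and \<omega>: "closed2 U \<omega>" and R: "smooth_on U R"
    and nondeg: "\<And>q v. q \<in> U \<Longrightarrow> \<eta> q v = 0 \<Longrightarrow> (\<And>w. \<omega> q v w = 0) \<Longrightarrow> v = 0"
    and R\<eta>: "\<And>q. q \<in> U \<Longrightarrow> \<eta> q (R q) = 1" and R\<omega>: "\<And>q w. q \<in> U \<Longrightarrow> \<omega> q (R q) w = 0"
  shows "m \<le> n \<Longrightarrow> \<exists>W Z. open W \<and> p \<in> W \<and> W \<subseteq> U \<and> Z 0 = R \<and> lin_indep {0..m} (\<lambda>i. Z i p) \<and>
    (\<forall>i\<in>{0..m}. smooth_on W (Z i)) \<and> (\<forall>i\<in>{1..m}. \<forall>q\<in>W. \<eta> q (Z i q) = 0) \<and>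
    (\<forall>i\<in>{0..m}. \<forall>j\<in>{0..m}. \<forall>q\<in>W. \<omega> q (Z i q) (Z j q) = 0 \<and> bracket (Z i) (Z j) q \<in> span ((\<lambda>i. Z i q) ` {0..m})) \<and>
    (\<forall>i\<in>{0..m}. \<exists>f. smooth_on W f \<and> (\<forall>q\<in>W. \<forall>v. \<omega> q (Z i q) v = frechet_derivative f (at q) v))"
proof (induction m)
  case 0
  have Rp: "R p \<noteq> 0" using R\<eta>[OF p] linear_0[OF closed1D(1)[OF \<eta> p]] by auto
  have "lin_indep {0..0::nat} (\<lambda>i. R p)" using Rp by (simp add: lin_indep_def)
  moreover have "\<exists>f. smooth_on U f \<and> (\<forall>q\<in>U. \<forall>v. \<omega> q (R q) v = frechet_derivative f (at q) v)"
    by (rule exI[of _ "\<lambda>_. 0"]) (simp add: smooth_on_const[OF U] R\<omega> frechet_derivative_const)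
  ultimately show ?case
    by (intro exI[of _ U] exI[of _ "\<lambda>_. R"]) (simp add: U p R R\<omega> bracket_def span_0)
next
  case (Suc m)
  have "m \<le> n" using Suc.prems by simp
  from Suc.IH[OF this] obtain W Z where W: "open W" "p \<in> W" "W \<subseteq> U" and Z0: "Z 0 = R"
    and ind: "lin_indep {0..m} (\<lambda>i. Z i p)"
    and Z: "\<forall>i\<in>{0..m}. smooth_on W (Z i)" and Z\<eta>: "\<forall>i\<in>{1..m}. \<forall>q\<in>W. \<eta> q (Z i q) = 0"
    and ZZ: "\<forall>i\<in>{0..m}. \<forall>j\<in>{0..m}. \<forall>q\<in>W. \<omega> q (Z i q) (Z j q) = 0 \<and> bracket (Z i) (Z j) q \<in> span ((\<lambda>i. Z i q) ` {0..m})"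
    and Zf: "\<forall>i\<in>{0..m}. \<exists>f. smooth_on W f \<and> (\<forall>q\<in>W. \<forall>v. \<omega> q (Z i q) v = frechet_derivative f (at q) v)"
    by (elim exE conjE)
  have pU: "p \<in> U" using W by blast
  note l1 = closed2D(1)[OF \<omega> pU] and l2 = closed2D(2)[OF \<omega> pU] and l\<eta> = closed1D(1)[OF \<eta> pU]
  \<comment> \<open>The vector \<open>a i\<close> represents \<open>\<omega>(Z i, \<cdot>)\<close>; as this form vanishes for \<open>Z 0 = R\<close>, the index \<open>0\<close> is
    used for \<open>\<eta>\<close>.\<close>
  define a where "a i = (if i = 0 then \<Sum>b\<in>Basis. \<eta> p b *\<^sub>R b else \<Sum>b\<in>Basis. \<omega> p (Z i p) b *\<^sub>R b)" for i :: nat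
  define T where "T = {v. \<forall>x\<in>span (a ` {0..m}). orthogonal x v}"
  have aT: "v \<bullet> a i = 0" if "v \<in> T" "i \<in> {0..m}" for v i
  proof -
    have "a i \<in> span (a ` {0..m})" by (intro span_base imageI that(2))
    then show ?thesis using that(1) unfolding T_def orthogonal_def inner_commute[of v "a i"] by blast
  qed
  have T\<eta>: "\<eta> p v = 0" if "v \<in> T" for v
    using aT[OF that, of 0] linear_functional_inner[OF l\<eta>, of v] by (simp add: a_def)
  have T\<omega>: "\<omega> p (Z i p) v = 0" if "v \<in> T" "i \<in> {0..m}" for v i
  proof (cases "i = 0")
    case True
    then show ?thesis using R\<omega>[OF pU] Z0 by simp
  next
    case False
    then show ?thesis using aT[OF that] linear_functional_inner[OF l2, of "Z i p" v] by (simp add: a_def)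
  qed
  have "dim T + dim (span (a ` {0..m})) = DIM('a)"
    using dim_subspace_orthogonal_to_vectors[OF subspace_span subspace_UNIV, of "a ` {0..m}"]
    by (simp add: T_def)
  moreover have "dim (span (a ` {0..m})) \<le> m + 1"
    using dim_le_card'[of "a ` {0..m}"] card_image_le[of "{0..m}" a] by simp
  ultimately have dT: "dim T \<ge> 2 * n - m" using dim by linarith
  define S where "S = span ((\<lambda>i. Z i p) ` {1..m})"
  have "dim S \<le> m"
    using dim_le_card'[of "(\<lambda>i. Z i p) ` {1..m}"] card_image_le[of "{1..m}" "\<lambda>i. Z i p"] by (simp add: S_def)
  then have "dim S < dim T" using dT Suc.prems by linarith
  then have "\<not> T \<subseteq> S" using dim_subset[of T S] by linarith
  then obtain v where v: "v \<in> T" "v \<notin> S" by blast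
  have vspan: "v \<notin> span ((\<lambda>i. Z i p) ` {0..m})"
  proof
    assume "v \<in> span ((\<lambda>i. Z i p) ` {0..m})"
    then obtain c where c: "v = (\<Sum>i\<in>{0..m}. c i *\<^sub>R Z i p)"
      using span_image_finite[of "{0..m}" v "\<lambda>i. Z i p"] by auto
    then have c': "v = c 0 *\<^sub>R R p + (\<Sum>i\<in>{1..m}. c i *\<^sub>R Z i p)"
      by (simp add: sum.atLeast_Suc_atMost Z0)
    have "0 = \<eta> p v" using T\<eta>[OF v(1)] by simp
    also have "\<dots> = c 0 + (\<Sum>i\<in>{1..m}. c i * \<eta> p (Z i p))"
      unfolding c' by (simp add: linear_add[OF l\<eta>] linear_sum[OF l\<eta>] linear_cmul[OF l\<eta>] R\<eta>[OF pU])
    also have "(\<Sum>i\<in>{1..m}. c i * \<eta> p (Z i p)) = 0" using Z\<eta> W(2) by (intro sum.neutral) simp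
    finally have "c 0 = 0" by simp
    moreover have "(\<Sum>i\<in>{1..m}. c i *\<^sub>R Z i p) \<in> S"
      unfolding S_def by (intro span_sum span_scale span_base imageI)
    ultimately have "v \<in> S" using c' by simp
    then show False using v(2) by blast
  qed
  have \<mu>0: "\<omega> p v (Z i p) = 0" if "i \<in> {0..m}" for i
    using T\<omega>[OF v(1) that] closed2_skew[OF \<omega> pU, of v "Z i p"] by simp
  have "\<exists>W' f. open W' \<and> p \<in> W' \<and> W' \<subseteq> W \<and> smooth_on W' f \<and>
    (\<forall>q\<in>W'. \<forall>i\<in>{0..m}. frechet_derivative f (at q) (Z i q) = 0) \<and>
    (\<forall>w. frechet_derivative f (at p) w = \<omega> p v w)"
    by (rule first_integral[where X = Z and \<mu> = "\<omega> p v", OF W(1,2) _ _ ind _ l2 \<mu>0]) (use Z ZZ in \<open>simp_all\<close>)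
  then obtain W' f where W': "open W'" "p \<in> W'" "W' \<subseteq> W" and f: "smooth_on W' f"
    and dfZ: "\<forall>q\<in>W'. \<forall>i\<in>{0..m}. frechet_derivative f (at q) (Z i q) = 0"
    and dfp: "\<forall>w. frechet_derivative f (at p) w = \<omega> p v w"
    by (elim exE conjE)
  have W'U: "q \<in> U" if "q \<in> W'" for q using that W'(3) W(3) by blast
  \<comment> \<open>the vector field dual to \<open>df\<close> under the isomorphism \<open>v \<mapsto> \<omega>(v, \<cdot>) + \<eta>(v) \<eta>\<close>\<close>
  define M where "M q v = (\<Sum>b\<in>Basis. (\<omega> q v b + \<eta> q v * \<eta> q b) *\<^sub>R b)" for q v
  have Mw: "M q u \<bullet> w = \<omega> q u w + \<eta> q u * \<eta> q w" if "q \<in> U" for q u w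
  proof -
    have "linear (\<lambda>w. \<omega> q u w + \<eta> q u * \<eta> q w)"
      using linear_add[OF closed2D(2)[OF \<omega> that]] linear_cmul[OF closed2D(2)[OF \<omega> that]]
        linear_add[OF closed1D(1)[OF \<eta> that]] linear_cmul[OF closed1D(1)[OF \<eta> that]]
      by (intro linearI) (simp_all add: algebra_simps)
    from linear_functional_inner[OF this, of w] show ?thesis by (simp add: M_def inner_commute)
  qed
  have linM: "linear (M q)" if "q \<in> U" for q
    unfolding M_def[abs_def]
    using linear_add[OF closed2D(1)[OF \<omega> that]] linear_cmul[OF closed2D(1)[OF \<omega> that]]
      linear_add[OF closed1D(1)[OF \<eta> that]] linear_cmul[OF closed1D(1)[OF \<eta> that]]
    by (intro linearI) (simp_all add: algebra_simps sum.distrib scaleR_sum_right)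
  have injM: "u = 0" if q: "q \<in> U" and u: "M q u = 0" for q u
  proof -
    have z: "\<omega> q u w + \<eta> q u * \<eta> q w = 0" for w using Mw[OF q, of u w] u by simp
    have \<eta>0: "\<eta> q u = 0"
      using z[of "R q"] R\<eta>[OF q] R\<omega>[OF q, of u] closed2_skew[OF \<omega> q, of u "R q"] by simp
    show ?thesis by (rule nondeg[OF q \<eta>0]) (use z \<eta>0 in simp)
  qed
  have "\<exists>g. linear g \<and> (\<forall>v. g (M q v) = v) \<and> (\<forall>v. M q (g v) = v)" if "q \<in> U" for q
    using linear_injective_inverse[OF linM[OF that] injM[OF that]] by metis
  then obtain N where N: "\<And>q. q \<in> U \<Longrightarrow> linear (N q)" "\<And>q v. q \<in> U \<Longrightarrow> N q (M q v) = v"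
    "\<And>q v. q \<in> U \<Longrightarrow> M q (N q v) = v" by metis
  have smM: "smooth_on U (\<lambda>q. M q v)" for v
    unfolding M_def
    by (intro smooth_on_sum smooth_on_scaleR smooth_on_add smooth_on_mult smooth_on_const U closed2D(4)[OF \<omega>] closed1D(2)[OF \<eta>])
  have smN: "smooth_on U (\<lambda>q. N q v)" for v
    by (rule smooth_on_linear_inverse[OF U linM N(1,3,2) smM])
  define grad where "grad q = (\<Sum>b\<in>Basis. frechet_derivative f (at q) b *\<^sub>R b)" for q
  have gradw: "grad q \<bullet> w = frechet_derivative f (at q) w" if "q \<in> W'" for q w
    using linear_functional_inner[OF smooth_on_linear_derivative[OF f that], of w] by (simp add: grad_def inner_commute)
  have smgrad: "smooth_on W' grad"
    unfolding grad_def[abs_def] by (intro smooth_on_sum smooth_on_scaleR smooth_on_const smooth_on_deriv f W'(1))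
  define H where "H q = N q (grad q)" for q
  have smH: "smooth_on W' H"
    unfolding H_def[abs_def]
    by (rule smooth_on_linear_apply[OF W'(1) N(1)[OF W'U] smooth_on_subset[OF smN] smgrad]) (use W'U in auto)
  have H: "\<omega> q (H q) w + \<eta> q (H q) * \<eta> q w = frechet_derivative f (at q) w" if q: "q \<in> W'" for q w
    using Mw[OF W'U[OF q], of "H q" w] gradw[OF q, of w] N(3)[OF W'U[OF q]] by (simp add: H_def)
  have H\<eta>: "\<eta> q (H q) = 0" if q: "q \<in> W'" for q
  proof -
    have "frechet_derivative f (at q) (R q) = 0" using dfZ q Z0 by force
    then show ?thesis
      using H[OF q, of "R q"] R\<eta>[OF W'U[OF q]] R\<omega>[OF W'U[OF q], of "H q"] closed2_skew[OF \<omega> W'U[OF q], of "H q" "R q"]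
      by simp
  qed
  have H\<omega>: "\<omega> q (H q) w = frechet_derivative f (at q) w" if q: "q \<in> W'" for q w
    using H[OF q, of w] H\<eta>[OF q] by simp
  have Hp: "H p = v"
  proof -
    have "H p - v = 0"
    proof (rule nondeg[OF pU])
      show "\<eta> p (H p - v) = 0" using H\<eta>[OF W'(2)] T\<eta>[OF v(1)] by (simp add: linear_diff[OF l\<eta>])
      show "\<omega> p (H p - v) w = 0" for w using H\<omega>[OF W'(2), of w] dfp by (simp add: linear_diff[OF l1])
    qed
    then show ?thesis by simp
  qed
  define Z' where "Z' i = (if i = Suc m then H else Z i)" for i
  have Z'_old: "Z' i = Z i" if "i \<in> {0..m}" for i using that by (simp add: Z'_def)
  have Z'_new: "Z' (Suc m) = H" by (simp add: Z'_def)
  have split: "i \<in> {0..m} \<or> i = Suc m" if "i \<in> {0..Suc m}" for i using that by auto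
  have smZ': "smooth_on W' (Z' i)" if "i \<in> {0..Suc m}" for i
    using split[OF that]
  proof
    assume i: "i \<in> {0..m}"
    then have "smooth_on W (Z i)" using Z by blast
    then show ?thesis unfolding Z'_old[OF i] using W'(3) by (rule smooth_on_subset)
  qed (simp add: Z'_new smH)
  have HZ: "\<omega> q (H q) (Z i q) = 0" if "q \<in> W'" "i \<in> {0..m}" for q i
    using H\<omega>[OF that(1)] dfZ that by simp
  have iso: "\<omega> q (Z' i q) (Z' j q) = 0" if ij: "i \<in> {0..Suc m}" "j \<in> {0..Suc m}" and q: "q \<in> W'" for i j q
  proof -
    have qW: "q \<in> W" using q W'(3) by blast
    show ?thesis
      using split[OF ij(1)] split[OF ij(2)]
    proof (elim disjE)
      assume "i \<in> {0..m}" "j \<in> {0..m}"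
      then show ?thesis using ZZ qW by (simp add: Z'_old)
    next
      assume "i \<in> {0..m}" "j = Suc m"
      then show ?thesis using HZ[OF q, of i] closed2_skew[OF \<omega> W'U[OF q], of "Z i q" "H q"]
        by (simp add: Z'_old Z'_new)
    next
      assume "i = Suc m" "j \<in> {0..m}"
      then show ?thesis using HZ[OF q, of j] by (simp add: Z'_old Z'_new)
    next
      assume "i = Suc m" "j = Suc m"
      then show ?thesis using closed2D(3)[OF \<omega> W'U[OF q]] by simp
    qed
  qed
  have pot: "\<exists>f. smooth_on W' f \<and> (\<forall>q\<in>W'. \<forall>v. \<omega> q (Z' i q) v = frechet_derivative f (at q) v)"
    if "i \<in> {0..Suc m}" for i
    using split[OF that]
  proof
    assume i: "i \<in> {0..m}"
    then obtain g where "smooth_on W g" "\<forall>q\<in>W. \<forall>v. \<omega> q (Z i q) v = frechet_derivative g (at q) v"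
      using Zf by blast
    then show ?thesis using smooth_on_subset[OF _ W'(3)] W'(3) i by (intro exI[of _ g]) (auto simp: Z'_old)
  next
    assume "i = Suc m"
    then show ?thesis using f H\<omega> by (auto simp: Z'_new)
  qed
  have \<omega>W': "closed2 W' \<omega>"
    using closed2_subset[OF \<omega>] W'U by blast
  have inv: "bracket (Z' i) (Z' j) q \<in> span ((\<lambda>i. Z' i q) ` {0..Suc m})"
    if ij: "i \<in> {0..Suc m}" "j \<in> {0..Suc m}" and q: "q \<in> W'" for i j q
  proof -
    obtain fi where fi: "smooth_on W' fi" "\<And>q v. q \<in> W' \<Longrightarrow> \<omega> q (Z' i q) v = frechet_derivative fi (at q) v"
      using pot[OF ij(1)] by blast
    obtain fj where fj: "smooth_on W' fj" "\<And>q v. q \<in> W' \<Longrightarrow> \<omega> q (Z' j q) v = frechet_derivative fj (at q) v"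
      using pot[OF ij(2)] by blast
    let ?u = "bracket (Z' i) (Z' j) q"
    have ker: "\<omega> q ?u w = 0" for w
      by (rule closed2_bracket_in_kernel[OF W'(1) \<omega>W' smZ'[OF ij(1)] smZ'[OF ij(2)] fi(1) fj(1) fi(2) fj(2) iso[OF ij] q])
    have qU: "q \<in> U" by (rule W'U[OF q])
    note l = closed1D(1)[OF \<eta> qU] and l' = closed2D(1)[OF \<omega> qU]
    have "?u - \<eta> q ?u *\<^sub>R R q = 0"
    proof (rule nondeg[OF qU])
      show "\<eta> q (?u - \<eta> q ?u *\<^sub>R R q) = 0"
        by (simp add: linear_diff[OF l] linear_cmul[OF l] R\<eta>[OF qU])
      show "\<omega> q (?u - \<eta> q ?u *\<^sub>R R q) w = 0" for w
        by (simp add: linear_diff[OF l'] linear_cmul[OF l'] R\<omega>[OF qU] ker)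
    qed
    then have u: "?u = \<eta> q ?u *\<^sub>R R q" by simp
    have "Z' 0 = R" using Z'_old[of 0] Z0 by simp
    then have "R q \<in> (\<lambda>i. Z' i q) ` {0..Suc m}" by (intro image_eqI[of _ _ 0]) simp_all
    then have "\<eta> q ?u *\<^sub>R R q \<in> span ((\<lambda>i. Z' i q) ` {0..Suc m})" by (intro span_scale span_base)
    then show ?thesis using u by simp
  qed
  have indp: "lin_indep {0..Suc m} (\<lambda>i. Z' i p)"
  proof (rule lin_indep_Suc)
    show "lin_indep {0..m} (\<lambda>i. Z' i p)"
    proof -
      have "(\<Sum>i\<in>{0..m}. c i *\<^sub>R Z' i p) = (\<Sum>i\<in>{0..m}. c i *\<^sub>R Z i p)" for c
        by (rule sum.cong[OF refl]) (simp only: Z'_old)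
      then show ?thesis using ind unfolding lin_indep_def by presburger
    qed
    have "(\<lambda>i. Z' i p) ` {0..m} = (\<lambda>i. Z i p) ` {0..m}" by (rule image_cong) (simp_all add: Z'_old)
    then show "Z' (Suc m) p \<notin> span ((\<lambda>i. Z' i p) ` {0..m})" using vspan by (simp add: Z'_new Hp)
  qed
  have Z'\<eta>: "\<eta> q (Z' i q) = 0" if "i \<in> {1..Suc m}" "q \<in> W'" for i q
  proof (cases "i = Suc m")
    case True
    then show ?thesis using H\<eta>[OF that(2)] by (simp add: Z'_new)
  next
    case False
    then have "i \<in> {1..m}" using that by auto
    then show ?thesis using Z\<eta> W'(3) that(2) Z'_old[of i] by auto
  qed
  have Z'0: "Z' 0 = R" using Z'_old[of 0] Z0 by simp
  show ?case
    by (intro exI[of _ W'] exI[of _ Z'] conjI ballI W'(1,2) Z'0 indp smZ' Z'\<eta> iso inv pot)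
       (use W'U in auto)
qed

subsection \<open>Reeb invariance of the polarization\<close>

text \<open>The \<open>\<omega> \<beta>\<close> pair \<open>S\<close> with the complement of \<open>E\<close> spanned by the \<open>s i\<close>.  The resulting map from \<open>S\<close> to \<open>n * k\<close>
  numbers is injective by nondegeneracy, hence surjective for dimension reasons.\<close>

lemma dual_vectors:
  fixes \<omega> :: "nat \<Rightarrow> 'a::euclidean_space \<Rightarrow> 'a \<Rightarrow> real"
  assumes l1: "\<And>\<alpha> v. \<alpha> \<in> {1..k} \<Longrightarrow> linear (\<lambda>u. \<omega> \<alpha> u v)" and l2: "\<And>\<alpha> u. \<alpha> \<in> {1..k} \<Longrightarrow> linear (\<omega> \<alpha> u)"
    and S: "subspace S" "dim S = n * k"
    and s: "\<And>v. v - (\<Sum>i=1..n. (v \<bullet> s i) *\<^sub>R s i) \<in> E"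
    and SE: "\<And>\<alpha> u v. \<alpha> \<in> {1..k} \<Longrightarrow> u \<in> S \<Longrightarrow> v \<in> E \<Longrightarrow> \<omega> \<alpha> u v = 0"
    and nondeg: "\<And>v. v \<in> S \<Longrightarrow> (\<And>\<alpha> w. \<alpha> \<in> {1..k} \<Longrightarrow> \<omega> \<alpha> v w = 0) \<Longrightarrow> v = 0"
    and \<alpha>: "\<alpha> \<in> {1..k}" and i: "i \<in> {1..n}"
  shows "\<exists>v\<in>S. \<forall>\<beta>\<in>{1..k}. \<forall>w. \<omega> \<beta> v w = (if \<beta> = \<alpha> then w \<bullet> s i else 0)"
proof -
  let ?K = "{1..k} \<times> {1..n}"
  have ex: "\<omega> \<beta> v w = (\<Sum>j=1..n. (w \<bullet> s j) * \<omega> \<beta> v (s j))" if "\<beta> \<in> {1..k}" "v \<in> S" for \<beta> v w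
  proof -
    note l = l2[OF that(1), of v]
    have "\<omega> \<beta> v (w - (\<Sum>i=1..n. (w \<bullet> s i) *\<^sub>R s i)) = 0" by (rule SE[OF that s])
    then show ?thesis by (simp add: linear_diff[OF l] linear_sum[OF l] linear_cmul[OF l])
  qed
  have "n * k \<le> DIM('a)" using S(2) dim_subset_UNIV[of S] by simp
  then have "card ?K \<le> card (Basis :: 'a set)" by (simp add: mult.commute)
  \<comment> \<open>The space of \<open>n * k\<close> numbers is realized inside \<open>'a\<close>.\<close>
  then obtain g :: "nat \<times> nat \<Rightarrow> 'a" where g: "g ` ?K \<subseteq> Basis" "inj_on g ?K"
    using card_le_inj[of ?K "Basis :: 'a set"] by auto
  have gg: "g x \<bullet> g y = (if x = y then 1 else 0)" if "x \<in> ?K" "y \<in> ?K" for x y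
  proof -
    have "g x \<in> Basis" "g y \<in> Basis" using g(1) that by blast+
    then show ?thesis using inj_on_eq_iff[OF g(2) that] by (simp add: inner_Basis)
  qed
  define T where "T v = (\<Sum>x\<in>?K. \<omega> (fst x) v (s (snd x)) *\<^sub>R g x)" for v
  have linT: "linear T"
  proof (rule linearI)
    show "T (u + v) = T u + T v" for u v
      unfolding T_def sum.distrib[symmetric]
      by (rule sum.cong[OF refl]) (auto simp: linear_add[OF l1] scaleR_add_left)
    show "T (c *\<^sub>R u) = c *\<^sub>R T u" for c u
      unfolding T_def scaleR_sum_right by (rule sum.cong[OF refl]) (auto simp: linear_cmul[OF l1])
  qed
  have Tg: "T v \<bullet> g x = \<omega> (fst x) v (s (snd x))" if x: "x \<in> ?K" for v x
  proof -
    have "T v \<bullet> g x = (\<Sum>y\<in>?K. if y = x then \<omega> (fst y) v (s (snd y)) else 0)"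
      unfolding T_def inner_sum_left by (rule sum.cong[OF refl]) (simp add: gg[OF _ x])
    also have "\<dots> = \<omega> (fst x) v (s (snd x))" using x by simp
    finally show ?thesis .
  qed
  have T0: "v = 0" if v: "v \<in> S" and z: "T v = 0" for v
  proof (rule nondeg[OF v])
    fix \<beta> w assume \<beta>: "\<beta> \<in> {1..k}"
    have "\<omega> \<beta> v (s j) = 0" if "j \<in> {1..n}" for j using Tg[of "(\<beta>, j)" v] \<beta> that z by simp
    then show "\<omega> \<beta> v w = 0" unfolding ex[OF \<beta> v, of w] by simp
  qed
  have spS: "span S = S" using S(1) by simp
  have "inj_on T S"
  proof (rule inj_onI)
    fix u v assume "u \<in> S" "v \<in> S" "T u = T v"
    then have "u - v \<in> S" "T (u - v) = 0" by (simp_all add: subspace_diff S(1) linear_diff[OF linT])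
    then have "u - v = 0" by (rule T0)
    then show "u = v" by simp
  qed
  then have "dim (T ` S) = n * k" using dim_image_eq[OF linT, of S] spS S(2) by simp
  moreover have "dim (span (g ` ?K)) \<le> n * k"
    using dim_le_card'[of "g ` ?K"] card_image_le[of ?K g] by (simp add: mult.commute)
  moreover have "T ` S \<subseteq> span (g ` ?K)"
    unfolding T_def by (auto intro!: span_sum span_scale intro: span_base)
  ultimately have "T ` S = span (g ` ?K)"
    using subspace_dim_equal[OF linear_subspace_image[OF linT S(1)] subspace_span, of "g ` ?K"] by simp
  moreover have "g (\<alpha>, i) \<in> span (g ` ?K)" using \<alpha> i by (intro span_base imageI) simp
  ultimately obtain v where v: "v \<in> S" "T v = g (\<alpha>, i)" by (metis imageE)
  have vs: "\<omega> \<beta> v (s j) = (if \<beta> = \<alpha> \<and> j = i then 1 else 0)" if "\<beta> \<in> {1..k}" "j \<in> {1..n}" for \<beta> j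
    using Tg[of "(\<beta>, j)" v] gg[of "(\<alpha>, i)" "(\<beta>, j)"] v(2) that \<alpha> i by auto
  show ?thesis
  proof (intro bexI[OF _ v(1)] ballI allI)
    fix \<beta> w assume \<beta>: "\<beta> \<in> {1..k}"
    have "\<omega> \<beta> v w = (\<Sum>j=1..n. if j = i then (if \<beta> = \<alpha> then w \<bullet> s i else 0) else 0)"
      unfolding ex[OF \<beta> v(1), of w] by (rule sum.cong[OF refl]) (simp add: vs[OF \<beta>])
    also have "\<dots> = (if \<beta> = \<alpha> then w \<bullet> s i else 0)" using i by simp
    finally show "\<omega> \<beta> v w = (if \<beta> = \<alpha> then w \<bullet> s i else 0)" .
  qed
qed

text \<open>Let \<open>e\<close> be the vector of \<open>S\<close> that pairs only through \<open>\<omega> \<alpha>\<close>, with value \<open>w \<bullet> s i\<close>.  Symmetry of \<open>\<omega> \<alpha> (a u) v\<close>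
  says that \<open>a v \<bullet> s i = \<omega> \<alpha> v (a e)\<close> for all \<open>v \<in> S\<close>.  With \<open>\<alpha> = 2\<close> and \<open>v\<close> a dual vector for \<open>\<omega> 1\<close>, the
  right-hand side is \<open>0\<close>, so \<open>a\<close> maps the dual vectors for \<open>\<omega> 1\<close> into \<open>E\<close>.  With \<open>\<alpha> = 1\<close> the right-hand side
  is then \<open>0\<close> for every \<open>v\<close>, because \<open>S\<close> and \<open>E\<close> are orthogonal.  Two different indices are
  indispensable: for a single form, \<open>\<omega> (a u) v\<close> can be any symmetric form on \<open>S\<close>.\<close>

lemma symmetric_implies_transverse:
  fixes \<omega> :: "nat \<Rightarrow> 'a::euclidean_space \<Rightarrow> 'a \<Rightarrow> real"
  assumes k: "k \<ge> 2"
    and l1: "\<And>\<alpha> v. \<alpha> \<in> {1..k} \<Longrightarrow> linear (\<lambda>u. \<omega> \<alpha> u v)" and l2: "\<And>\<alpha> u. \<alpha> \<in> {1..k} \<Longrightarrow> linear (\<omega> \<alpha> u)"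
    and sk: "\<And>\<alpha> u v. \<alpha> \<in> {1..k} \<Longrightarrow> \<omega> \<alpha> u v = - \<omega> \<alpha> v u"
    and S: "subspace S" "dim S = n * k"
    and s: "\<And>v. v - (\<Sum>i=1..n. (v \<bullet> s i) *\<^sub>R s i) \<in> E"
    and SE: "\<And>\<alpha> u v. \<alpha> \<in> {1..k} \<Longrightarrow> u \<in> S \<Longrightarrow> v \<in> E \<Longrightarrow> \<omega> \<alpha> u v = 0"
    and nondeg: "\<And>v. v \<in> S \<Longrightarrow> (\<And>\<alpha> w. \<alpha> \<in> {1..k} \<Longrightarrow> \<omega> \<alpha> v w = 0) \<Longrightarrow> v = 0"
    and sym: "\<And>\<alpha> u v. \<alpha> \<in> {1..k} \<Longrightarrow> u \<in> S \<Longrightarrow> v \<in> S \<Longrightarrow> \<omega> \<alpha> (a u) v = \<omega> \<alpha> (a v) u"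
    and u: "u \<in> S"
  shows "a u \<in> E"
proof -
  have inE: "v \<in> E" if "\<And>i. i \<in> {1..n} \<Longrightarrow> v \<bullet> s i = 0" for v
  proof -
    have "(\<Sum>i=1..n. (v \<bullet> s i) *\<^sub>R s i) = 0" using that by (intro sum.neutral) simp
    then show ?thesis using s[of v] by simp
  qed
  have dual: "\<exists>v\<in>S. \<forall>\<beta>\<in>{1..k}. \<forall>w. \<omega> \<beta> v w = (if \<beta> = \<alpha> then w \<bullet> s i else 0)"
    if "\<alpha> \<in> {1..k}" "i \<in> {1..n}" for \<alpha> i
    by (rule dual_vectors[OF l1 l2 S s SE nondeg that])
  have k12: "1 \<in> {1..k}" "2 \<in> {1..k}" using k by auto
  have key: "a v \<bullet> s i = \<omega> \<alpha> v (a e)"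
    if \<alpha>: "\<alpha> \<in> {1..k}" and v: "v \<in> S" and e: "e \<in> S" "\<forall>\<beta>\<in>{1..k}. \<forall>w. \<omega> \<beta> e w = (if \<beta> = \<alpha> then w \<bullet> s i else 0)"
    for \<alpha> v e i
    using e(2)[rule_format, OF \<alpha>, of "a v"] sk[OF \<alpha>, of e "a v"] sym[OF \<alpha> v e(1)] sk[OF \<alpha>, of "a e" v] by simp
  show ?thesis
  proof (rule inE)
    fix j assume j: "j \<in> {1..n}"
    obtain e where e: "e \<in> S" "\<forall>\<beta>\<in>{1..k}. \<forall>w. \<omega> \<beta> e w = (if \<beta> = 1 then w \<bullet> s j else 0)"
      using dual[OF k12(1) j] by blast
    have "a e \<in> E"
    proof (rule inE)
      fix i assume i: "i \<in> {1..n}"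
      obtain e' where e': "e' \<in> S" "\<forall>\<beta>\<in>{1..k}. \<forall>w. \<omega> \<beta> e' w = (if \<beta> = 2 then w \<bullet> s i else 0)"
        using dual[OF k12(2) i] by blast
      show "a e \<bullet> s i = 0" using key[OF k12(2) e(1) e'] e(2)[rule_format, OF k12(2), of "a e'"] by simp
    qed
    then have "\<omega> 1 u (a e) = 0" by (rule SE[OF k12(1) u])
    then show "a u \<bullet> s j = 0" using key[OF k12(1) u e] by simp
  qed
qed

subsection \<open>Local Darboux theorems\<close>

abbreviation joint_frame :: "(nat \<Rightarrow> 'a \<Rightarrow> 'a) \<Rightarrow> (nat \<Rightarrow> 'a \<Rightarrow> 'a) \<Rightarrow> nat + nat \<Rightarrow> 'a \<Rightarrow> 'a" where
  "joint_frame X R \<equiv> case_sum X R"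

context
  fixes \<eta> :: "nat \<Rightarrow> 'a::euclidean_space \<Rightarrow> 'a \<Rightarrow> real" and \<omega> :: "nat \<Rightarrow> 'a \<Rightarrow> 'a \<Rightarrow> 'a \<Rightarrow> real"
    and R X :: "nat \<Rightarrow> 'a \<Rightarrow> 'a" and U :: "'a set" and J :: "nat set" and k n :: nat
  assumes U: "open U" and dim: "DIM('a) = n * (k + 1) + k"
    and \<eta>: "\<And>\<alpha>. \<alpha> \<in> {1..k} \<Longrightarrow> closed1 U (\<eta> \<alpha>)" and \<omega>: "\<And>\<alpha>. \<alpha> \<in> {1..k} \<Longrightarrow> closed2 U (\<omega> \<alpha>)"
    and nondeg: "\<And>q v. q \<in> U \<Longrightarrow> \<forall>\<alpha>\<in>{1..k}. \<eta> \<alpha> q v = 0 \<and> (\<forall>w. \<omega> \<alpha> q v w = 0) \<Longrightarrow> v = 0"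
    and smR: "\<And>\<alpha>. \<alpha> \<in> {1..k} \<Longrightarrow> smooth_on U (R \<alpha>)"
    and R\<eta>: "\<And>\<alpha> \<beta> q. q \<in> U \<Longrightarrow> \<alpha> \<in> {1..k} \<Longrightarrow> \<beta> \<in> {1..k} \<Longrightarrow> \<eta> \<beta> q (R \<alpha> q) = (if \<alpha> = \<beta> then 1 else 0)"
    and R\<omega>: "\<And>\<alpha> \<beta> q w. q \<in> U \<Longrightarrow> \<alpha> \<in> {1..k} \<Longrightarrow> \<beta> \<in> {1..k} \<Longrightarrow> \<omega> \<beta> q (R \<alpha> q) w = 0"
    and fin: "finite J" and card: "card J = n * k"
    and smX: "\<And>i. i \<in> J \<Longrightarrow> smooth_on U (X i)" and indX: "\<And>q. q \<in> U \<Longrightarrow> lin_indep J (\<lambda>i. X i q)"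
    and X\<eta>: "\<And>\<alpha> i q. \<alpha> \<in> {1..k} \<Longrightarrow> i \<in> J \<Longrightarrow> q \<in> U \<Longrightarrow> \<eta> \<alpha> q (X i q) = 0"
    and X\<omega>: "\<And>\<alpha> i j q. \<alpha> \<in> {1..k} \<Longrightarrow> i \<in> J \<Longrightarrow> j \<in> J \<Longrightarrow> q \<in> U \<Longrightarrow> \<omega> \<alpha> q (X i q) (X j q) = 0"
begin

lemma joint_span_X: "span ((\<lambda>i. X i q) ` J) \<subseteq> span ((\<lambda>i. joint_frame X R i q) ` (J <+> {1..k}))"
proof (rule span_mono)
  show "(\<lambda>i. X i q) ` J \<subseteq> (\<lambda>i. joint_frame X R i q) ` (J <+> {1..k})"
    by (auto intro!: image_eqI[where x = "Inl _"])
qed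

lemma joint_span_R: "\<alpha> \<in> {1..k} \<Longrightarrow> R \<alpha> q \<in> span ((\<lambda>i. joint_frame X R i q) ` (J <+> {1..k}))"
  by (rule span_base) (auto intro!: image_eqI[where x = "Inr _"])

lemma joint_lin_indep:
  assumes q: "q \<in> U"
  shows "lin_indep (J <+> {1..k}) (\<lambda>i. joint_frame X R i q)"
  unfolding lin_indep_def
proof (intro allI impI)
  fix c assume "(\<Sum>i\<in>J <+> {1..k}. c i *\<^sub>R joint_frame X R i q) = 0"
  then have s: "(\<Sum>i\<in>J. c (Inl i) *\<^sub>R X i q) + (\<Sum>\<alpha>\<in>{1..k}. c (Inr \<alpha>) *\<^sub>R R \<alpha> q) = 0"
    by (simp add: sum.Plus fin)
  have cR: "c (Inr \<beta>) = 0" if \<beta>: "\<beta> \<in> {1..k}" for \<beta>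
  proof -
    note l = closed1D(1)[OF \<eta>[OF \<beta>] q]
    have "0 = \<eta> \<beta> q ((\<Sum>i\<in>J. c (Inl i) *\<^sub>R X i q) + (\<Sum>\<alpha>\<in>{1..k}. c (Inr \<alpha>) *\<^sub>R R \<alpha> q))"
      unfolding s by (simp add: linear_0[OF l])
    also have "\<dots> = (\<Sum>i\<in>J. c (Inl i) * \<eta> \<beta> q (X i q)) + (\<Sum>\<alpha>\<in>{1..k}. c (Inr \<alpha>) * \<eta> \<beta> q (R \<alpha> q))"
      by (simp add: linear_add[OF l] linear_sum[OF l] linear_cmul[OF l])
    also have "(\<Sum>i\<in>J. c (Inl i) * \<eta> \<beta> q (X i q)) = 0" by (rule sum.neutral) (simp add: X\<eta>[OF \<beta> _ q])
    also have "(\<Sum>\<alpha>\<in>{1..k}. c (Inr \<alpha>) * \<eta> \<beta> q (R \<alpha> q)) = (\<Sum>\<alpha>\<in>{1..k}. if \<alpha> = \<beta> then c (Inr \<alpha>) else 0)"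
      by (rule sum.cong[OF refl]) (simp only: R\<eta>[OF q _ \<beta>], simp)
    also have "0 + \<dots> = c (Inr \<beta>)" using \<beta> by simp
    finally show ?thesis by simp
  qed
  then have "(\<Sum>i\<in>J. c (Inl i) *\<^sub>R X i q) = 0" using s by simp
  then have "\<forall>i\<in>J. c (Inl i) = 0"
    using indX[OF q, unfolded lin_indep_def, rule_format, of "\<lambda>i. c (Inl i)"] by blast
  then show "\<forall>i\<in>J <+> {1..k}. c i = 0" using cR by blast
qed

lemma joint_isotropic:
  assumes \<alpha>: "\<alpha> \<in> {1..k}" and q: "q \<in> U" and i: "i \<in> J <+> {1..k}" and j: "j \<in> J <+> {1..k}"
  shows "\<omega> \<alpha> q (joint_frame X R i q) (joint_frame X R j q) = 0"
proof -
  have RZ: "\<omega> \<alpha> q (R \<beta> q) v = 0" and ZR: "\<omega> \<alpha> q v (R \<beta> q) = 0" if "\<beta> \<in> {1..k}" for \<beta> v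
    using R\<omega>[OF q that \<alpha>] closed2_skew[OF \<omega>[OF \<alpha>] q, of v "R \<beta> q"] by simp_all
  from i show ?thesis
  proof (rule PlusE)
    fix i' assume i': "i' \<in> J" "i = Inl i'"
    from j show ?thesis by (rule PlusE) (simp_all add: i' X\<omega>[OF \<alpha> _ _ q] ZR)
  next
    fix \<beta> assume "\<beta> \<in> {1..k}" "i = Inr \<beta>"
    then show ?thesis using RZ[of \<beta>] by simp
  qed
qed

text \<open>By Cartan's formulas the bracket is in the kernels of all the \<open>\<eta> \<gamma>\<close> and all the \<open>\<omega> \<gamma>\<close>.\<close>

lemma reeb_fields_commute:
  assumes \<alpha>: "\<alpha> \<in> {1..k}" and \<beta>: "\<beta> \<in> {1..k}" and q: "q \<in> U"
  shows "bracket (R \<alpha>) (R \<beta>) q = 0"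
proof (rule nondeg[OF q], intro ballI conjI allI)
  fix \<gamma> w assume \<gamma>: "\<gamma> \<in> {1..k}"
  note z = smooth_on_zero_form[where \<omega> = "\<omega> \<gamma>", OF U R\<omega>[OF _ _ \<gamma>]]
  show "\<omega> \<gamma> q (bracket (R \<alpha>) (R \<beta>) q) w = 0"
    by (rule closed2_bracket_in_kernel[OF U \<omega>[OF \<gamma>] smR[OF \<alpha>] smR[OF \<beta>] smooth_on_const[OF U] smooth_on_const[OF U]
          z[OF _ \<alpha>] z[OF _ \<beta>] R\<omega>[OF _ \<alpha> \<gamma>] q])
  have const: "frechet_derivative (\<lambda>q. \<eta> \<gamma> q (R \<delta> q)) (at q) = frechet_derivative (\<lambda>q. if \<delta> = \<gamma> then 1 else 0) (at q)"
    if "\<delta> \<in> {1..k}" for \<delta>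
    by (rule frechet_derivative_cong_open[OF U q]) (rule R\<eta>[OF _ that \<gamma>])
  show "\<eta> \<gamma> q (bracket (R \<alpha>) (R \<beta>) q) = 0"
    using closed1_bracket_identity[OF U \<eta>[OF \<gamma>] smR[OF \<alpha>] smR[OF \<beta>] q]
    unfolding const[OF \<alpha>] const[OF \<beta>] by (simp add: frechet_derivative_const)
qed

lemma darboux_polarized:
  assumes p: "p \<in> U"
    and XX: "\<And>i j q. i \<in> J \<Longrightarrow> j \<in> J \<Longrightarrow> q \<in> U \<Longrightarrow> bracket (X i) (X j) q \<in> span ((\<lambda>i. X i q) ` J)"
    and RX: "\<And>\<alpha> i q. \<alpha> \<in> {1..k} \<Longrightarrow> i \<in> J \<Longrightarrow> q \<in> U \<Longrightarrow>
      bracket (R \<alpha>) (X i) q \<in> span ((\<lambda>i. joint_frame X R i q) ` (J <+> {1..k}))"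
  shows "\<exists>W Y \<Phi> \<Psi> b. diffeo W Y \<Phi> \<Psi> \<and> p \<in> W \<and> W \<subseteq> U \<and> bij_betw b (coord_names k n) (Basis :: 'a set) \<and>
    (\<forall>q\<in>W. darboux_at k n b \<eta> \<omega> R q (frechet_derivative \<Phi> (at q)) \<and>
      (\<forall>i\<in>J. \<forall>j\<in>{1..n}. frechet_derivative \<Phi> (at q) (X i q) \<bullet> b (CY j) = 0))"
proof -
  let ?Z = "joint_frame X R" and ?I = "J <+> {1..k}"
  have Z: "smooth_on U (?Z i)" if "i \<in> ?I" for i using that smX smR by auto
  have inv: "bracket (?Z i) (?Z j) q \<in> span ((\<lambda>i. ?Z i q) ` ?I)"
    if q: "q \<in> U" and i: "i \<in> ?I" and j: "j \<in> ?I" for q i j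
    using i
  proof (rule PlusE)
    fix i' assume i': "i' \<in> J" "i = Inl i'"
    from j show ?thesis
    proof (rule PlusE)
      fix j' assume "j' \<in> J" "j = Inl j'"
      then show ?thesis using XX[OF i'(1) _ q, of j'] joint_span_X i' by auto
    next
      fix \<beta> assume \<beta>: "\<beta> \<in> {1..k}" "j = Inr \<beta>"
      show ?thesis
        using span_neg[OF RX[OF \<beta>(1) i'(1) q]] bracket_skew[of "X i'" "R \<beta>" q] i' \<beta> by simp
    qed
  next
    fix \<alpha> assume \<alpha>: "\<alpha> \<in> {1..k}" "i = Inr \<alpha>"
    from j show ?thesis
    proof (rule PlusE)
      fix j' assume "j' \<in> J" "j = Inl j'"
      then show ?thesis using RX[OF \<alpha>(1) _ q, of j'] \<alpha> by simp
    next
      fix \<beta> assume "\<beta> \<in> {1..k}" "j = Inr \<beta>"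
      then show ?thesis using reeb_fields_commute[OF \<alpha>(1) _ q, of \<beta>] \<alpha> by (simp add: span_0)
    qed
  qed
  have cI: "card ?I = n * k + k" by (simp add: card_Plus fin card)
  have "\<exists>W Y \<Phi> \<Psi> b. diffeo W Y \<Phi> \<Psi> \<and> p \<in> W \<and> W \<subseteq> U \<and> bij_betw b (coord_names k n) (Basis :: 'a set) \<and>
    (\<forall>q\<in>W. darboux_at k n b \<eta> \<omega> R q (frechet_derivative \<Phi> (at q)) \<and>
      (\<forall>i\<in>?I. \<forall>j\<in>{1..n}. frechet_derivative \<Phi> (at q) (?Z i q) \<bullet> b (CY j) = 0))"
    by (rule darboux_from_frame[OF U p dim \<eta> \<omega> nondeg R\<eta> R\<omega> _ cI Z joint_lin_indep[OF p] inv joint_isotropic joint_span_R])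
       (simp_all add: fin)
  then obtain W Y \<Phi> \<Psi> b where A: "diffeo W Y \<Phi> \<Psi>" "p \<in> W" "W \<subseteq> U" "bij_betw b (coord_names k n) (Basis :: 'a set)"
    and B: "\<forall>q\<in>W. darboux_at k n b \<eta> \<omega> R q (frechet_derivative \<Phi> (at q)) \<and>
      (\<forall>i\<in>?I. \<forall>j\<in>{1..n}. frechet_derivative \<Phi> (at q) (?Z i q) \<bullet> b (CY j) = 0)"
    by (elim exE conjE)
  have C: "frechet_derivative \<Phi> (at q) (X i q) \<bullet> b (CY j) = 0" if "q \<in> W" "i \<in> J" "j \<in> {1..n}" for q i j
  proof -
    have "Inl i \<in> ?I" using that(2) by blast
    then have "frechet_derivative \<Phi> (at q) (?Z (Inl i) q) \<bullet> b (CY j) = 0" using B that(1,3) by blast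
    then show ?thesis by simp
  qed
  show ?thesis
    by (intro exI[of _ W] exI[of _ Y] exI[of _ \<Phi>] exI[of _ \<Psi>] exI[of _ b] conjI ballI A) (use B C in blast)+
qed

text \<open>Bracketing with \<open>R \<alpha>\<close> defines, on the frame, a linear map \<open>a\<close> on the span of the \<open>X i\<close>.  In Cartan's
  formula for the fields \<open>R \<alpha>\<close>, \<open>X i\<close>, \<open>X j\<close> all terms but two vanish, and these say that
  \<open>\<omega> \<beta> (a (X i)) (X j)\<close> is symmetric in \<open>i\<close> and \<open>j\<close>.\<close>

lemma reeb_invariance:
  assumes k: "k \<ge> 2" and \<alpha>: "\<alpha> \<in> {1..k}" and i: "i \<in> J" and q: "q \<in> U"
  shows "bracket (R \<alpha>) (X i) q \<in> span ((\<lambda>i. joint_frame X R i q) ` (J <+> {1..k}))"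
proof -
  let ?E = "span ((\<lambda>i. joint_frame X R i q) ` (J <+> {1..k}))" and ?S = "span ((\<lambda>i. X i q) ` J)"
  have "dim ?E = n * k + k"
    using dim_span_lin_indep[OF _ joint_lin_indep[OF q]] fin by (simp add: card_Plus card)
  then have "dim ?E + n = DIM('a)" using dim by (simp add: algebra_simps)
  then obtain s where s: "\<And>v. v - (\<Sum>i=1..n. (v \<bullet> s i) *\<^sub>R s i) \<in> ?E"
    using orthonormal_complement[OF subspace_span] by metis
  have l1: "linear (\<lambda>u. \<omega> \<beta> q u v)" and l2: "linear (\<omega> \<beta> q u)" if "\<beta> \<in> {1..k}" for \<beta> u v
    using closed2D(1,2)[OF \<omega>[OF that] q] by blast+
  have sk: "\<omega> \<beta> q u v = - \<omega> \<beta> q v u" if "\<beta> \<in> {1..k}" for \<beta> u v by (rule closed2_skew[OF \<omega>[OF that] q])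
  have dS: "dim ?S = n * k" using dim_span_lin_indep[OF fin indX[OF q]] card by simp
  have SE: "\<omega> \<beta> q u v = 0" if \<beta>: "\<beta> \<in> {1..k}" and u: "u \<in> ?S" and v: "v \<in> ?E" for \<beta> u v
  proof -
    have "u \<in> ?E" using u joint_span_X by blast
    then obtain c where c: "u = (\<Sum>i\<in>J <+> {1..k}. c i *\<^sub>R joint_frame X R i q)"
      using span_image_finite[of "J <+> {1..k}" u "\<lambda>i. joint_frame X R i q"] fin by auto
    obtain e where e: "v = (\<Sum>i\<in>J <+> {1..k}. e i *\<^sub>R joint_frame X R i q)"
      using v span_image_finite[of "J <+> {1..k}" v "\<lambda>i. joint_frame X R i q"] fin by auto
    show ?thesis
      unfolding c e
      by (simp add: linear_sum[OF l1[OF \<beta>]] linear_cmul[OF l1[OF \<beta>]] linear_sum[OF l2[OF \<beta>]] linear_cmul[OF l2[OF \<beta>]]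
          joint_isotropic[OF \<beta> q] sum.neutral)
  qed
  have nd: "v = 0" if v: "v \<in> ?S" and w: "\<And>\<beta> w. \<beta> \<in> {1..k} \<Longrightarrow> \<omega> \<beta> q v w = 0" for v
  proof (rule nondeg[OF q], intro ballI conjI allI)
    fix \<beta> w assume \<beta>: "\<beta> \<in> {1..k}"
    show "\<omega> \<beta> q v w = 0" by (rule w[OF \<beta>])
    obtain c where c: "v = (\<Sum>i\<in>J. c i *\<^sub>R X i q)" using v span_image_finite[OF fin, of v "\<lambda>i. X i q"] by auto
    note l = closed1D(1)[OF \<eta>[OF \<beta>] q]
    show "\<eta> \<beta> q v = 0" unfolding c by (simp add: linear_sum[OF l] linear_cmul[OF l] X\<eta>[OF \<beta> _ q])
  qed
  obtain a where a: "linear a" "\<And>w. w \<in> (\<lambda>i. X i q) ` J \<Longrightarrow>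
      a w = bracket (R \<alpha>) (X (inv_into J (\<lambda>i. X i q) w)) q"
    using linear_independent_extend[OF lin_indep_imp_independent(2)[OF fin indX[OF q]],
        of "\<lambda>w. bracket (R \<alpha>) (X (inv_into J (\<lambda>i. X i q) w)) q"] by metis
  have aX: "a (X i q) = bracket (R \<alpha>) (X i) q" if "i \<in> J" for i
    using a(2)[of "X i q"] inv_into_f_f[OF lin_indep_imp_independent(1)[OF fin indX[OF q]] that] that by simp
  have symX: "\<omega> \<beta> q (a (X i q)) (X j q) = \<omega> \<beta> q (a (X j q)) (X i q)"
    if \<beta>: "\<beta> \<in> {1..k}" and ij: "i \<in> J" "j \<in> J" for \<beta> i j
  proof -
    have z1: "frechet_derivative (\<lambda>q. \<omega> \<beta> q (X i q) (X j q)) (at q) = frechet_derivative (\<lambda>q. 0) (at q)"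
      by (rule frechet_derivative_cong_open[OF U q]) (rule X\<omega>[OF \<beta> ij])
    have z2: "frechet_derivative (\<lambda>q. \<omega> \<beta> q (R \<alpha> q) (X j q)) (at q) = frechet_derivative (\<lambda>q. 0) (at q)" for j
      by (rule frechet_derivative_cong_open[OF U q]) (rule R\<omega>[OF _ \<alpha> \<beta>])
    have "\<omega> \<beta> q (bracket (X i) (X j) q) (R \<alpha> q) = 0"
      using sk[OF \<beta>, of "bracket (X i) (X j) q" "R \<alpha> q"] R\<omega>[OF q \<alpha> \<beta>] by simp
    then show ?thesis
      using closed2_bracket_identity[OF U \<omega>[OF \<beta>] smR[OF \<alpha>] smX[OF ij(1)] smX[OF ij(2)] q]
      unfolding z1 z2 aX[OF ij(1)] aX[OF ij(2)] by (simp add: frechet_derivative_const)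
  qed
  have sym: "\<omega> \<beta> q (a u) v = \<omega> \<beta> q (a v) u" if \<beta>: "\<beta> \<in> {1..k}" and u: "u \<in> ?S" and v: "v \<in> ?S" for \<beta> u v
  proof -
    obtain c where c: "u = (\<Sum>i\<in>J. c i *\<^sub>R X i q)" using u span_image_finite[OF fin, of u "\<lambda>i. X i q"] by auto
    obtain e where e: "v = (\<Sum>i\<in>J. e i *\<^sub>R X i q)" using v span_image_finite[OF fin, of v "\<lambda>i. X i q"] by auto
    have ex: "\<omega> \<beta> q (a (\<Sum>i\<in>J. c i *\<^sub>R X i q)) (\<Sum>j\<in>J. e j *\<^sub>R X j q)
        = (\<Sum>i\<in>J. \<Sum>j\<in>J. c i * e j * \<omega> \<beta> q (a (X i q)) (X j q))" for c e
    proof -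
      have E: "\<omega> \<beta> q (a (\<Sum>i\<in>J. c i *\<^sub>R X i q)) v = (\<Sum>i\<in>J. c i * \<omega> \<beta> q (a (X i q)) v)" for v
        by (simp add: linear_sum[OF a(1)] linear_cmul[OF a(1)] linear_sum[OF l1[OF \<beta>]] linear_cmul[OF l1[OF \<beta>]])
      show ?thesis
        unfolding E by (simp add: linear_sum[OF l2[OF \<beta>]] linear_cmul[OF l2[OF \<beta>]] sum_distrib_left mult.assoc)
    qed
    have "\<omega> \<beta> q (a u) v = (\<Sum>i\<in>J. \<Sum>j\<in>J. c i * e j * \<omega> \<beta> q (a (X i q)) (X j q))" unfolding c e ex ..
    also have "\<dots> = (\<Sum>i\<in>J. \<Sum>j\<in>J. e j * c i * \<omega> \<beta> q (a (X j q)) (X i q))"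
      by (intro sum.cong refl) (simp add: symX[OF \<beta>])
    also have "\<dots> = (\<Sum>j\<in>J. \<Sum>i\<in>J. e j * c i * \<omega> \<beta> q (a (X j q)) (X i q))" by (rule sum.swap)
    also have "\<dots> = \<omega> \<beta> q (a v) u" unfolding c e ex ..
    finally show ?thesis .
  qed
  have Xi: "X i q \<in> ?S" using i by (intro span_base imageI)
  have "a (X i q) \<in> ?E"
    by (rule symmetric_implies_transverse[where \<omega> = "\<lambda>\<alpha>. \<omega> \<alpha> q", OF k l1 l2 sk subspace_span dS s SE nd sym Xi])
  then show ?thesis using aX[OF i] by simp
qed

end

text \<open>A maximal frame from \<open>lagrangian_frame\<close> takes the place of a given polarization.\<close>

lemma darboux_cosymplectic:
  fixes \<omega> :: "'a::euclidean_space \<Rightarrow> 'a \<Rightarrow> 'a \<Rightarrow> real"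
  assumes U: "open U" and p: "p \<in> U" and dim: "DIM('a) = n * (1 + 1) + 1"
    and \<eta>: "closed1 U \<eta>" and \<omega>: "closed2 U \<omega>" and R: "smooth_on U R"
    and nondeg: "\<And>q v. q \<in> U \<Longrightarrow> \<eta> q v = 0 \<Longrightarrow> (\<And>w. \<omega> q v w = 0) \<Longrightarrow> v = 0"
    and R\<eta>: "\<And>q. q \<in> U \<Longrightarrow> \<eta> q (R q) = 1" and R\<omega>: "\<And>q w. q \<in> U \<Longrightarrow> \<omega> q (R q) w = 0"
  shows "\<exists>W Y \<Phi> \<Psi> b. diffeo W Y \<Phi> \<Psi> \<and> p \<in> W \<and> W \<subseteq> U \<and> bij_betw b (coord_names 1 n) (Basis :: 'a set) \<and>
    (\<forall>q\<in>W. darboux_at 1 n b (\<lambda>\<alpha>. \<eta>) (\<lambda>\<alpha>. \<omega>) (\<lambda>\<alpha>. R) q (frechet_derivative \<Phi> (at q)))"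
proof -
  have dim': "DIM('a) = 2 * n + 1" using dim by simp
  have "\<exists>W Z. open W \<and> p \<in> W \<and> W \<subseteq> U \<and> Z 0 = R \<and> lin_indep {0..n} (\<lambda>i. Z i p) \<and>
    (\<forall>i\<in>{0..n}. smooth_on W (Z i)) \<and> (\<forall>i\<in>{1..n}. \<forall>q\<in>W. \<eta> q (Z i q) = 0) \<and>
    (\<forall>i\<in>{0..n}. \<forall>j\<in>{0..n}. \<forall>q\<in>W. \<omega> q (Z i q) (Z j q) = 0 \<and> bracket (Z i) (Z j) q \<in> span ((\<lambda>i. Z i q) ` {0..n})) \<and>
    (\<forall>i\<in>{0..n}. \<exists>f. smooth_on W f \<and> (\<forall>q\<in>W. \<forall>v. \<omega> q (Z i q) v = frechet_derivative f (at q) v))"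
    by (rule lagrangian_frame[OF U p dim' \<eta> \<omega> R nondeg R\<eta> R\<omega>]) simp_all
  then obtain W Z where W: "open W" "p \<in> W" "W \<subseteq> U" and Z0: "Z 0 = R" and ind: "lin_indep {0..n} (\<lambda>i. Z i p)"
    and Z: "\<forall>i\<in>{0..n}. smooth_on W (Z i)"
    and ZZ: "\<forall>i\<in>{0..n}. \<forall>j\<in>{0..n}. \<forall>q\<in>W. \<omega> q (Z i q) (Z j q) = 0 \<and> bracket (Z i) (Z j) q \<in> span ((\<lambda>i. Z i q) ` {0..n})"
    by (elim exE conjE)
  have WU: "q \<in> U" if "q \<in> W" for q using that W(3) by blast
  have \<omega>W: "closed2 W \<omega>" by (rule closed2_subset[OF \<omega> W(3)])
  have \<eta>W: "closed1 W \<eta>" by (rule closed1_subset[OF \<eta> W(3)])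
  have RZ: "R q \<in> span ((\<lambda>i. Z i q) ` {0..n})" for q
    unfolding Z0[symmetric] by (intro span_base imageI) simp
  have "\<exists>W' Y \<Phi> \<Psi> b. diffeo W' Y \<Phi> \<Psi> \<and> p \<in> W' \<and> W' \<subseteq> W \<and> bij_betw b (coord_names 1 n) (Basis :: 'a set) \<and>
    (\<forall>q\<in>W'. darboux_at 1 n b (\<lambda>\<alpha>. \<eta>) (\<lambda>\<alpha>. \<omega>) (\<lambda>\<alpha>. R) q (frechet_derivative \<Phi> (at q)) \<and>
      (\<forall>i\<in>{0..n}. \<forall>j\<in>{1..n}. frechet_derivative \<Phi> (at q) (Z i q) \<bullet> b (CY j) = 0))"
  proof (rule darboux_from_frame[where \<eta> = "\<lambda>_. \<eta>" and \<omega> = "\<lambda>_. \<omega>" and R = "\<lambda>_. R" and Z = Z and I = "{0..n}"])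
    show "v = 0" if "q \<in> W" "\<forall>\<alpha>\<in>{1..1::nat}. \<eta> q v = 0 \<and> (\<forall>w. \<omega> q v w = 0)" for q v
      by (rule nondeg[OF WU[OF that(1)]]) (use that(2) in auto)
  qed (use W dim \<eta>W \<omega>W WU R\<eta> R\<omega> Z ind ZZ RZ in \<open>simp_all\<close>)
  then show ?thesis using W(3) by (elim exE conjE) (intro exI conjI, assumption+, blast, assumption, blast)
qed

section \<open>Charts and tangent vectors\<close>

lemma is_chartD:
  assumes "is_chart c"
  shows "open (fst c)" "open (snd c ` fst c)" "continuous_on (fst c) (snd c)"
    "continuous_on (snd c ` fst c) (chart_inv c)"
    "\<And>q. q \<in> fst c \<Longrightarrow> chart_inv c (snd c q) = q"
    "\<And>z. z \<in> snd c ` fst c \<Longrightarrow> snd c (chart_inv c z) = z"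
    "\<And>z. z \<in> snd c ` fst c \<Longrightarrow> chart_inv c z \<in> fst c"
  using assms unfolding is_chart_def homeomorphism_def by auto

lemma chart_image_mem:
  assumes c: "is_chart c" and x: "x \<in> fst c" "snd c x \<in> snd c ` (N \<inter> fst c)"
  shows "x \<in> N"
proof -
  obtain y where y: "snd c x = snd c y" "y \<in> N" "y \<in> fst c" using x(2) by blast
  have "x = y" using is_chartD(5)[OF c x(1)] is_chartD(5)[OF c y(3)] y(1) by argo
  then show ?thesis using y(2) by simp
qed

lemma open_chart_image:
  assumes c: "is_chart c" and Q: "open Q"
  shows "open (snd c ` (fst c \<inter> Q))"
proof -
  note d = is_chartD[OF c]
  have "snd c ` (fst c \<inter> Q) = snd c ` fst c \<inter> chart_inv c -` Q"
    using d(5-7) by force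
  then show ?thesis using continuous_open_preimage[OF d(4,2) Q] by simp
qed

text \<open>The second derivatives of \<open>t\<close> cancel by symmetry.\<close>

lemma bracket_natural:
  assumes N: "open N" and N': "open N'" and t: "smooth_on N t" "\<forall>z\<in>N. t z \<in> N'"
    and X: "smooth_on N X" "smooth_on N' X'" "\<And>z. z \<in> N \<Longrightarrow> X' (t z) = frechet_derivative t (at z) (X z)"
    and Y: "smooth_on N Y" "smooth_on N' Y'" "\<And>z. z \<in> N \<Longrightarrow> Y' (t z) = frechet_derivative t (at z) (Y z)"
    and z: "z \<in> N"
  shows "bracket X' Y' (t z) = frechet_derivative t (at z) (bracket X Y z)"
proof -
  let ?Dt = "\<lambda>z. frechet_derivative t (at z)"
  have id: "\<forall>z\<in>N. z \<in> N" by blast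
  have lin: "\<forall>z\<in>N. linear (?Dt z)" using smooth_on_linear_derivative[OF t(1)] by blast
  have D: "frechet_derivative Y' (at (t z)) (?Dt z h) =
      frechet_derivative (\<lambda>q. ?Dt q (Y z)) (at z) h + ?Dt z (frechet_derivative Y (at z) h)"
    if Y: "smooth_on N Y" "smooth_on N' Y'" "\<And>z. z \<in> N \<Longrightarrow> Y' (t z) = ?Dt z (Y z)" for Y Y' h
  proof -
    have "frechet_derivative Y' (at (t z)) (?Dt z h) = frechet_derivative (\<lambda>z. Y' (t z)) (at z) h"
      by (rule frechet_derivative_compose_smooth[OF t(1) z Y(2), symmetric]) (use t(2) z in blast)
    also have "frechet_derivative (\<lambda>z. Y' (t z)) (at z) = frechet_derivative (\<lambda>z. ?Dt z (Y z)) (at z)"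
      by (rule frechet_derivative_cong_open[OF N z]) (rule Y(3))
    also have "\<dots> h = frechet_derivative (\<lambda>q. ?Dt q (Y z)) (at z) h + ?Dt z (frechet_derivative Y (at z) h)"
      using frechet_derivative_linear_apply[where L = ?Dt and g = "\<lambda>z. z",
          OF N N smooth_on_id[OF N] id lin smooth_on_deriv[OF t(1)] Y(1) z, of h]
      by (simp add: frechet_derivative_ident)
    finally show ?thesis .
  qed
  have l: "linear (?Dt z)" using lin z by blast
  have "frechet_derivative Y' (at (t z)) (?Dt z (X z)) =
      frechet_derivative (\<lambda>q. ?Dt q (Y z)) (at z) (X z) + ?Dt z (frechet_derivative Y (at z) (X z))"
    by (rule D[OF Y(1,2)]) (rule Y(3))
  moreover have "frechet_derivative X' (at (t z)) (?Dt z (Y z)) =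
      frechet_derivative (\<lambda>q. ?Dt q (X z)) (at z) (Y z) + ?Dt z (frechet_derivative X (at z) (Y z))"
    by (rule D[OF X(1,2)]) (rule X(3))
  ultimately show ?thesis
    using second_derivative_symmetric[OF N t(1) z, of "Y z" "X z"]
    by (simp add: bracket_def X(3)[OF z] Y(3)[OF z] linear_diff[OF l])
qed

lemma derivative_in_subspace:
  fixes f :: "'a::euclidean_space \<Rightarrow> 'b::euclidean_space"
  assumes f: "(f has_derivative f') (at z)" and S: "subspace S" and d: "d > 0"
    and fS: "\<And>t::real. \<bar>t\<bar> < d \<Longrightarrow> f (z + t *\<^sub>R w) - y \<in> S"
  shows "f' w \<in> S"
proof -
  have lin: "linear f'" using f by (rule has_derivative_linear)
  have spS: "span S = S" using S by simp
  obtain u x where ux: "u \<in> S" "\<And>v. v \<in> S \<Longrightarrow> orthogonal x v" "f' w = u + x"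
    using orthogonal_subspace_decomp_exists[of S "f' w"] unfolding spS by metis
  have "((\<lambda>t. z + t *\<^sub>R w) has_derivative (\<lambda>t. t *\<^sub>R w)) (at 0)" by (auto intro!: derivative_eq_intros)
  moreover have "(f has_derivative f') (at (z + 0 *\<^sub>R w))" using f by simp
  ultimately have "(f \<circ> (\<lambda>t. z + t *\<^sub>R w) has_derivative f' \<circ> (\<lambda>t. t *\<^sub>R w)) (at 0)" by (rule diff_chain_at)
  then have "((\<lambda>t. f (z + t *\<^sub>R w) \<bullet> x) has_derivative (\<lambda>t. f' (t *\<^sub>R w) \<bullet> x)) (at 0)"
    unfolding o_def by (rule has_derivative_inner_left)
  moreover have "((\<lambda>t. f (z + t *\<^sub>R w) \<bullet> x) has_derivative (\<lambda>t. 0)) (at 0)"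
  proof (rule has_derivative_transform_within_open[OF has_derivative_const[of "y \<bullet> x"]])
    show "open (ball (0::real) d)" "0 \<in> ball (0::real) d" using d by simp_all
    fix t :: real assume "t \<in> ball 0 d"
    then have "orthogonal x (f (z + t *\<^sub>R w) - y)" by (intro ux(2) fS) simp
    then show "y \<bullet> x = f (z + t *\<^sub>R w) \<bullet> x" by (simp add: orthogonal_def inner_diff_right inner_commute)
  qed
  ultimately have "(\<lambda>t. f' (t *\<^sub>R w) \<bullet> x) = (\<lambda>t. 0)" by (rule has_derivative_unique)
  from fun_cong[OF this, of 1] have "(u + x) \<bullet> x = 0" using ux(3) by simp
  moreover have "u \<bullet> x = 0" using ux(2)[OF ux(1)] by (simp add: orthogonal_def inner_commute)
  ultimately show ?thesis using ux by (simp add: inner_add_left)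
qed

lemma dim_span_imp_lin_indep:
  fixes v :: "'i \<Rightarrow> 'b::real_vector"
  assumes fin: "finite I" and d: "dim (span (v ` I)) = card I"
  shows "lin_indep I v"
  unfolding lin_indep_def
proof (intro allI impI ballI, rule ccontr)
  fix c j assume c: "(\<Sum>i\<in>I. c i *\<^sub>R v i) = 0" and j: "j \<in> I" and cj: "c j \<noteq> 0"
  let ?S = "span (v ` (I - {j}))"
  have "c j *\<^sub>R v j = - (\<Sum>i\<in>I - {j}. c i *\<^sub>R v i)"
    using c sum.remove[OF fin j, of "\<lambda>i. c i *\<^sub>R v i"] by (simp add: eq_neg_iff_add_eq_0)
  also have "\<dots> \<in> ?S" by (intro span_neg span_sum span_scale span_base imageI)
  finally have "(1 / c j) *\<^sub>R (c j *\<^sub>R v j) \<in> ?S" by (rule span_scale)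
  then have vj: "v j \<in> ?S" using cj by simp
  have "v ` I \<subseteq> ?S"
  proof
    fix x assume "x \<in> v ` I"
    then obtain i where "i \<in> I" "x = v i" by blast
    then show "x \<in> ?S" using vj by (cases "i = j") (auto intro: span_base)
  qed
  then have "span (v ` I) \<subseteq> ?S" using span_minimal subspace_span by blast
  then have "dim (span (v ` I)) \<le> card (v ` (I - {j}))" using fin by (intro dim_le_card) simp_all
  also have "\<dots> \<le> card (I - {j})" using fin by (intro card_image_le) simp
  also have "\<dots> < card I" using fin j by (intro card_Diff1_less)
  finally show False using d by simp
qed

definition vf_rep :: "('m, 'e) chart \<Rightarrow> ('m \<Rightarrow> ('m, 'e) tvec) \<Rightarrow> 'e \<Rightarrow> 'e" where
  "vf_rep c X z = X (chart_inv c z) c"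

context
  fixes A :: "('m::{t2_space, second_countable_topology}, 'e::euclidean_space) chart set"
  assumes M: "smooth_manifold A"
begin

lemma atlas_chart: "c \<in> A \<Longrightarrow> is_chart c"
  using M unfolding smooth_manifold_def by blast

lemma smooth_transition:
  assumes "c \<in> A" "d \<in> A"
  shows "open (snd c ` (fst c \<inter> fst d))" "smooth_on (snd c ` (fst c \<inter> fst d)) (snd d \<circ> chart_inv c)"
proof -
  show "open (snd c ` (fst c \<inter> fst d))"
    by (rule open_chart_image[OF atlas_chart[OF assms(1)] is_chartD(1)[OF atlas_chart[OF assms(2)]]])
  show "smooth_on (snd c ` (fst c \<inter> fst d)) (snd d \<circ> chart_inv c)"
    using M assms unfolding smooth_manifold_def smoothly_compatible_def by blast
qed

text \<open>This is what makes coordinate vectors tangent vectors.\<close>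

lemma transition_chain:
  assumes cde: "c \<in> A" "d \<in> A" "e \<in> A" and q: "q \<in> fst c" "q \<in> fst d" "q \<in> fst e"
  shows "frechet_derivative (snd e \<circ> chart_inv d) (at (snd d q)) (frechet_derivative (snd d \<circ> chart_inv c) (at (snd c q)) v)
    = frechet_derivative (snd e \<circ> chart_inv c) (at (snd c q)) v"
proof -
  note c = is_chartD[OF atlas_chart[OF cde(1)]] and d = is_chartD[OF atlas_chart[OF cde(2)]]
  let ?N = "snd c ` (fst c \<inter> fst d) \<inter> snd c ` (fst c \<inter> fst e)"
  have "snd c q \<in> snd c ` (fst c \<inter> fst d)" "snd d q \<in> snd d ` (fst d \<inter> fst e)" using q by blast+
  then have "frechet_derivative (\<lambda>x. (snd e \<circ> chart_inv d) ((snd d \<circ> chart_inv c) x)) (at (snd c q)) v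
    = frechet_derivative (snd e \<circ> chart_inv d) (at ((snd d \<circ> chart_inv c) (snd c q)))
        (frechet_derivative (snd d \<circ> chart_inv c) (at (snd c q)) v)"
    by (intro frechet_derivative_compose_smooth[OF smooth_transition(2)[OF cde(1,2)] _ smooth_transition(2)[OF cde(2,3)]])
       (simp_all add: c(5)[OF q(1)])
  moreover have "frechet_derivative (\<lambda>x. (snd e \<circ> chart_inv d) ((snd d \<circ> chart_inv c) x)) (at (snd c q))
      = frechet_derivative (snd e \<circ> chart_inv c) (at (snd c q))"
  proof (rule frechet_derivative_cong_open[of ?N])
    show "open ?N" by (intro open_Int smooth_transition(1) cde)
    show "snd c q \<in> ?N" using q by blast
    fix y assume "y \<in> ?N"
    then obtain x where "y = snd c x" "x \<in> fst c" "x \<in> fst d" by blast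
    then have "chart_inv c y \<in> fst d" using c(5) by simp
    then show "(snd e \<circ> chart_inv d) ((snd d \<circ> chart_inv c) y) = (snd e \<circ> chart_inv c) y" using d(5) by simp
  qed
  ultimately show ?thesis by (simp add: c(5)[OF q(1)])
qed

lemma transition_self:
  assumes c: "c \<in> A" and q: "q \<in> fst c"
  shows "frechet_derivative (snd c \<circ> chart_inv c) (at (snd c q)) v = v"
proof -
  note d = is_chartD[OF atlas_chart[OF c]]
  have "frechet_derivative (snd c \<circ> chart_inv c) (at (snd c q)) = frechet_derivative (\<lambda>x. x) (at (snd c q))"
    by (rule frechet_derivative_cong_open[OF d(2)]) (use q d(6) in auto)
  then show ?thesis by (simp add: frechet_derivative_ident)
qed

lemma tangent_transform:
  assumes "v \<in> tangent_space A q" "c \<in> A" "d \<in> A" "q \<in> fst c" "q \<in> fst d"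
  shows "v d = frechet_derivative (snd d \<circ> chart_inv c) (at (snd c q)) (v c)"
  using assms unfolding tangent_space_def by blast

lemma coord_vec_tangent:
  assumes "c \<in> A" "q \<in> fst c"
  shows "coord_vec A c e q \<in> tangent_space A q"
  unfolding tangent_space_def coord_vec_def
  using transition_chain[OF assms(1) _ _ assms(2)] by auto

lemma coord_vec_self: "c \<in> A \<Longrightarrow> q \<in> fst c \<Longrightarrow> coord_vec A c e q c = e"
  by (simp add: coord_vec_def transition_self)

lemma tangent_coord_vec:
  assumes "v \<in> tangent_space A q" "c \<in> A" "q \<in> fst c"
  shows "coord_vec A c (v c) q = v"
proof
  fix d
  show "coord_vec A c (v c) q d = v d"
  proof (cases "d \<in> A \<and> q \<in> fst d")
    case True
    then show ?thesis using tangent_transform[OF assms(1,2) _ assms(3)] by (simp add: coord_vec_def)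
  next
    case False
    moreover from this have "v d = 0" using assms(1) unfolding tangent_space_def by blast
    ultimately show ?thesis unfolding coord_vec_def by argo
  qed
qed

lemma tangent_eqI:
  assumes "u \<in> tangent_space A q" "v \<in> tangent_space A q" "c \<in> A" "q \<in> fst c" "u c = v c"
  shows "u = v"
  using tangent_coord_vec[OF assms(1,3,4)] tangent_coord_vec[OF assms(2,3,4)] assms(5) by metis

lemma subspace_tangent_space: "subspace (tangent_space A q)"
proof -
  have l: "linear (frechet_derivative (snd d \<circ> chart_inv c) (at (snd c q)))"
    if "c \<in> A" "d \<in> A" "q \<in> fst c" "q \<in> fst d" for c d
    by (rule smooth_on_linear_derivative[OF smooth_transition(2)[OF that(1,2)]]) (use that in blast)
  show ?thesis
  proof (rule subspaceI)
    show "0 \<in> tangent_space A q"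
      unfolding tangent_space_def by (intro CollectI conjI allI impI ballI) (simp_all add: zero_fun_def linear_0[OF l])
  next
    fix u v assume uv: "u \<in> tangent_space A q" "v \<in> tangent_space A q"
    show "u + v \<in> tangent_space A q"
      unfolding tangent_space_def
    proof (intro CollectI conjI allI impI ballI)
      fix c assume "\<not> (c \<in> A \<and> q \<in> fst c)"
      then have "u c = 0" "v c = 0" using uv unfolding tangent_space_def by blast+
      then show "(u + v) c = 0" by (simp add: plus_fun_def)
    next
      fix c d assume c: "c \<in> A" and d: "d \<in> A" and q: "q \<in> fst c \<and> q \<in> fst d"
      then show "(u + v) d = frechet_derivative (snd d \<circ> chart_inv c) (at (snd c q)) ((u + v) c)"
        using tangent_transform[OF uv(1) c d] tangent_transform[OF uv(2) c d] linear_add[OF l[OF c d]]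
        unfolding plus_fun_def by presburger
    qed
  next
    fix r v assume v: "v \<in> tangent_space A q"
    show "r *\<^sub>R v \<in> tangent_space A q"
      unfolding tangent_space_def
    proof (intro CollectI conjI allI impI ballI)
      fix c assume "\<not> (c \<in> A \<and> q \<in> fst c)"
      then have "v c = 0" using v unfolding tangent_space_def by blast
      then show "(r *\<^sub>R v) c = 0" by (simp add: scaleR_fun_def)
    next
      fix c d assume c: "c \<in> A" and d: "d \<in> A" and q: "q \<in> fst c \<and> q \<in> fst d"
      then show "(r *\<^sub>R v) d = frechet_derivative (snd d \<circ> chart_inv c) (at (snd c q)) ((r *\<^sub>R v) c)"
        using tangent_transform[OF v c d] linear_scale[OF l[OF c d]]
        unfolding scaleR_fun_def by presburger
    qed
  qed
qed

lemma coord_vec_add: 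
  assumes "c \<in> A" "q \<in> fst c"
  shows "coord_vec A c (u + v) q = coord_vec A c u q + coord_vec A c v q"
  by (rule tangent_eqI[OF _ _ assms])
     (simp_all add: coord_vec_tangent assms coord_vec_self plus_fun_def subspace_add[OF subspace_tangent_space, unfolded plus_fun_def])

lemma coord_vec_scaleR:
  assumes "c \<in> A" "q \<in> fst c"
  shows "coord_vec A c (r *\<^sub>R u) q = r *\<^sub>R coord_vec A c u q"
  by (rule tangent_eqI[OF _ _ assms])
     (simp_all add: coord_vec_tangent assms coord_vec_self scaleR_fun_def subspace_scale[OF subspace_tangent_space, unfolded scaleR_fun_def])

lemma linear_coord_vec: "c \<in> A \<Longrightarrow> q \<in> fst c \<Longrightarrow> linear (\<lambda>u. coord_vec A c u q)"
  by (rule linearI) (simp_all add: coord_vec_add coord_vec_scaleR)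

lemma linear_component: "linear (\<lambda>v :: ('m, 'e) tvec. v c)"
  by (rule linearI) (simp_all add: plus_fun_def scaleR_fun_def)

lemma linear_form_on_linear:
  assumes f: "linear_form_on (tangent_space A q) f" and c: "c \<in> A" "q \<in> fst c"
  shows "linear (\<lambda>u. f (coord_vec A c u q))"
proof (rule linearI)
  note t = coord_vec_tangent[OF c]
  show "f (coord_vec A c (u + v) q) = f (coord_vec A c u q) + f (coord_vec A c v q)" for u v
    using f t[of u] t[of v] unfolding linear_form_on_def coord_vec_add[OF c] by (metis mult_1 scaleR_one)
  show "f (coord_vec A c (r *\<^sub>R u) q) = r *\<^sub>R f (coord_vec A c u q)" for r u
  proof -
    have "f (r *\<^sub>R coord_vec A c u q + 0 *\<^sub>R coord_vec A c u q) = r * f (coord_vec A c u q) + 0 * f (coord_vec A c u q)"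
      using f t[of u] unfolding linear_form_on_def by blast
    then show ?thesis by (simp add: coord_vec_scaleR[OF c])
  qed
qed

lemma closed_one_form_rep:
  assumes \<eta>: "closed_one_form A \<eta>" and c: "c \<in> A"
  shows "closed1 (snd c ` fst c) (rep1 A c \<eta>)"
proof -
  note d = is_chartD[OF atlas_chart[OF c]]
  have "linear (rep1 A c \<eta> z)" if "z \<in> snd c ` fst c" for z
    unfolding rep1_def[abs_def]
    by (rule linear_form_on_linear[OF _ c d(7)[OF that]]) (use \<eta> in \<open>simp add: closed_one_form_def one_form_def\<close>)
  then show ?thesis
    using \<eta> c unfolding closed1_def closed_one_form_def one_form_def ext_deriv1_def by simp
qed

lemma closed_two_form_rep:
  assumes \<omega>: "closed_two_form A \<omega>" and c: "c \<in> A"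
  shows "closed2 (snd c ` fst c) (rep2 A c \<omega>)"
proof -
  note d = is_chartD[OF atlas_chart[OF c]]
  have t: "two_form A \<omega>" using \<omega> by (simp add: closed_two_form_def)
  have l: "linear (\<lambda>u. rep2 A c \<omega> z u v)" "linear (rep2 A c \<omega> z v)" "rep2 A c \<omega> z v v = 0"
    if z: "z \<in> snd c ` fst c" for z v
  proof -
    note q = d(7)[OF z]
    have "linear_form_on (tangent_space A (chart_inv c z)) (\<lambda>u. \<omega> (chart_inv c z) u (coord_vec A c v (chart_inv c z)))"
      "linear_form_on (tangent_space A (chart_inv c z)) (\<omega> (chart_inv c z) (coord_vec A c v (chart_inv c z)))"
      "rep2 A c \<omega> z v v = 0"
      using t coord_vec_tangent[OF c q, of v] unfolding two_form_def rep2_def by blast+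
    then show "linear (\<lambda>u. rep2 A c \<omega> z u v)" "linear (rep2 A c \<omega> z v)" "rep2 A c \<omega> z v v = 0"
      unfolding rep2_def[abs_def] using linear_form_on_linear[OF _ c q] by blast+
  qed
  have sm: "smooth_on (snd c ` fst c) (\<lambda>z. rep2 A c \<omega> z u v)" for u v
    using t c unfolding two_form_def by blast
  have "\<forall>z\<in>snd c ` fst c. \<forall>u v w. ext_deriv2 A c \<omega> z u v w = 0"
    using \<omega> c unfolding closed_two_form_def by blast
  note dw = this[unfolded ext_deriv2_def, rule_format]
  show ?thesis
    unfolding closed2_def by (intro conjI ballI allI l sm) (assumption | rule dw)+
qed

lemma rep1_apply:
  assumes "v \<in> tangent_space A q" "c \<in> A" "q \<in> fst c"
  shows "rep1 A c \<eta> (snd c q) (v c) = \<eta> q v"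
  by (simp add: rep1_def is_chartD(5)[OF atlas_chart[OF assms(2)] assms(3)] tangent_coord_vec[OF assms])

lemma rep2_apply:
  assumes "v \<in> tangent_space A q" "w \<in> tangent_space A q" "c \<in> A" "q \<in> fst c"
  shows "rep2 A c \<omega> (snd c q) (v c) (w c) = \<omega> q v w"
  by (simp add: rep2_def is_chartD(5)[OF atlas_chart[OF assms(3)] assms(4)]
      tangent_coord_vec[OF assms(1,3,4)] tangent_coord_vec[OF assms(2,3,4)])

subsection \<open>Vector fields and integrable distributions\<close>

lemma vf_rep_smooth: "vector_field_on A U X \<Longrightarrow> c \<in> A \<Longrightarrow> smooth_on (snd c ` (fst c \<inter> U)) (vf_rep c X)"
  unfolding vector_field_on_def vf_rep_def[abs_def] by blast

lemma vf_rep_apply: "c \<in> A \<Longrightarrow> q \<in> fst c \<Longrightarrow> vf_rep c X (snd c q) = X q c"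
  by (simp add: vf_rep_def is_chartD(5)[OF atlas_chart])

lemma lie_bracket_rep:
  assumes "c \<in> A" "q \<in> fst c"
  shows "lie_bracket A X Y q c = bracket (vf_rep c X) (vf_rep c Y) (snd c q)"
  using assms by (simp add: lie_bracket_def bracket_def vf_rep_apply) (simp add: vf_rep_def[abs_def])

lemma lie_bracket_tangent:
  assumes U: "open U" and X: "vector_field_on A U X" and Y: "vector_field_on A U Y" and q: "q \<in> U"
  shows "lie_bracket A X Y q \<in> tangent_space A q"
  unfolding tangent_space_def
proof (intro CollectI conjI allI impI ballI)
  fix c assume "\<not> (c \<in> A \<and> q \<in> fst c)"
  then show "lie_bracket A X Y q c = 0" by (auto simp: lie_bracket_def)
next
  fix c d assume c: "c \<in> A" and d: "d \<in> A" and qcd: "q \<in> fst c \<and> q \<in> fst d"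
  let ?t = "snd d \<circ> chart_inv c"
  note cc = is_chartD[OF atlas_chart[OF c]]
  let ?N = "snd c ` (fst c \<inter> (fst d \<inter> U))" and ?N' = "snd d ` (fst d \<inter> U)"
  have N: "open ?N" by (intro open_chart_image atlas_chart c open_Int is_chartD(1) d U)
  have N': "open ?N'" by (intro open_chart_image atlas_chart d U)
  have nat: "vf_rep d T (?t z) = frechet_derivative ?t (at z) (vf_rep c T z)"
    if T: "vector_field_on A U T" and z: "z \<in> ?N" for T z
  proof -
    obtain x where x: "z = snd c x" "x \<in> fst c" "x \<in> fst d" "x \<in> U" using z by blast
    have "T x \<in> tangent_space A x" using T x(4) unfolding vector_field_on_def by blast
    from tangent_transform[OF this c d x(2,3)] show ?thesis
      by (simp add: x(1) cc(5)[OF x(2)] vf_rep_apply[OF d x(3)] vf_rep_apply[OF c x(2)])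
  qed
  have sub: "?N \<subseteq> snd c ` (fst c \<inter> fst d)" "?N \<subseteq> snd c ` (fst c \<inter> U)" by blast+
  have into: "\<forall>z\<in>?N. ?t z \<in> ?N'" using cc(5) by auto
  have qN: "snd c q \<in> ?N" using qcd q by blast
  have "bracket (vf_rep d X) (vf_rep d Y) (?t (snd c q))
      = frechet_derivative ?t (at (snd c q)) (bracket (vf_rep c X) (vf_rep c Y) (snd c q))"
    by (rule bracket_natural[OF N N' smooth_on_subset[OF smooth_transition(2)[OF c d] sub(1)] into
          smooth_on_subset[OF vf_rep_smooth[OF X c] sub(2)] vf_rep_smooth[OF X d] nat[OF X]
          smooth_on_subset[OF vf_rep_smooth[OF Y c] sub(2)] vf_rep_smooth[OF Y d] nat[OF Y] qN])
  then show "lie_bracket A X Y q d = frechet_derivative ?t (at (snd c q)) (lie_bracket A X Y q c)"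
    using qcd by (simp add: lie_bracket_rep c d cc(5))
qed

text \<open>An integral manifold has a slice chart around each of its points, but the tangent space at \<open>q\<close> is
  described by the slice chart chosen for \<open>q\<close>.  To compare it with the slice chart \<open>c\<close>, move along a
  straight line in the slice of the former: its image in \<open>c\<close> stays in the slice of \<open>c\<close>, hence so
  does its velocity.\<close>

lemma integral_manifold_tangent:
  assumes N: "integral_manifold A r V N" and c: "c \<in> A" and S: "subspace S"
    and slice: "snd c ` (N \<inter> fst c) = {z \<in> snd c ` fst c. z - y \<in> S}"
    and q: "q \<in> N" "q \<in> fst c" and v: "v \<in> V q"
  shows "v c \<in> S"
proof -
  obtain c' S' where c': "c' \<in> A" "q \<in> fst c'" and S': "subspace S'"
    and slice': "snd c' ` (N \<inter> fst c') = {z \<in> snd c' ` fst c'. z - snd c' q \<in> S'}"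
    and V: "V q = {v \<in> tangent_space A q. v c' \<in> S'}"
    using bspec[OF N[unfolded integral_manifold_def] q(1)] by (elim exE conjE bexE) (rule that)
  have vT: "v \<in> tangent_space A q" and vS': "v c' \<in> S'" using v V by blast+
  note d' = is_chartD[OF atlas_chart[OF c'(1)]]
  let ?O = "snd c' ` (fst c' \<inter> fst c)"
  have O: "open ?O" "snd c' q \<in> ?O" using smooth_transition(1)[OF c'(1) c] c'(2) q(2) by blast+
  obtain e where e: "e > 0" "ball (snd c' q) e \<subseteq> ?O" using O openE by blast
  define d where "d = e / (norm (v c') + 1)"
  have n: "norm (v c') + 1 > 0" using norm_ge_zero[of "v c'"] by linarith
  have "frechet_derivative (snd c \<circ> chart_inv c') (at (snd c' q)) (v c') \<in> S"
  proof (rule derivative_in_subspace[OF smooth_on_has_derivative[OF smooth_transition(2)[OF c'(1) c] O(2)] S])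
    show "d > 0" using e n by (simp add: d_def)
    fix t :: real assume t: "\<bar>t\<bar> < d"
    have "\<bar>t\<bar> * norm (v c') \<le> \<bar>t\<bar> * (norm (v c') + 1)" by (intro mult_left_mono) simp_all
    also have "\<dots> < e" using t n by (simp add: d_def pos_less_divide_eq)
    finally have "snd c' q + t *\<^sub>R v c' \<in> ball (snd c' q) e" by (simp add: dist_norm)
    then obtain x where x: "snd c' q + t *\<^sub>R v c' = snd c' x" "x \<in> fst c'" "x \<in> fst c" using e(2) by blast
    have "snd c' x - snd c' q \<in> S'" using x(1)[symmetric] vS' S' by (simp add: subspace_scale)
    moreover have "snd c' x \<in> snd c' ` fst c'" using x(2) by (rule imageI)
    ultimately have "snd c' x \<in> snd c' ` (N \<inter> fst c')" unfolding slice' by (intro CollectI conjI)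
    then have "x \<in> N" using chart_image_mem[OF atlas_chart[OF c'(1)] x(2)] by blast
    then have "snd c x \<in> snd c ` (N \<inter> fst c)" using x(3) by (intro imageI IntI)
    then have "snd c x - y \<in> S" unfolding slice by (elim CollectE conjE)
    then show "(snd c \<circ> chart_inv c') (snd c' q + t *\<^sub>R v c') - y \<in> S" by (simp add: x(1) d'(5)[OF x(2)])
  qed
  then show ?thesis using tangent_transform[OF vT c'(1) c c'(2) q(2)] by simp
qed

text \<open>In a slice chart, \<open>X\<close> and \<open>Y\<close> take values in \<open>S\<close> along the slice.  Their derivatives in directions of
  \<open>S\<close> are again in \<open>S\<close>, and the bracket is the difference of two of these.\<close>

lemma integrable_imp_involutive:
  assumes V: "integrable_distribution A r V" and U: "open U"
    and X: "vector_field_on A U X" "\<And>q. q \<in> U \<Longrightarrow> X q \<in> V q"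
    and Y: "vector_field_on A U Y" "\<And>q. q \<in> U \<Longrightarrow> Y q \<in> V q" and p: "p \<in> U"
  shows "lie_bracket A X Y p \<in> V p"
proof -
  obtain N where N: "p \<in> N" "integral_manifold A r V N"
    using V unfolding integrable_distribution_def by blast
  obtain c S where c: "c \<in> A" "p \<in> fst c" and S: "subspace S"
    and slice: "snd c ` (N \<inter> fst c) = {z \<in> snd c ` fst c. z - snd c p \<in> S}"
    and Vp: "V p = {v \<in> tangent_space A p. v c \<in> S}"
    using bspec[OF N(2)[unfolded integral_manifold_def] N(1)] by (elim exE conjE bexE) (rule that)
  note d = is_chartD[OF atlas_chart[OF c(1)]]
  let ?O = "snd c ` (fst c \<inter> U)"
  have O: "open ?O" "snd c p \<in> ?O" using open_chart_image[OF atlas_chart[OF c(1)] U] c(2) p by blast+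
  obtain e where e: "e > 0" "ball (snd c p) e \<subseteq> ?O" using O openE by blast
  have in_S: "vf_rep c T z \<in> S" if T: "\<And>q. q \<in> U \<Longrightarrow> T q \<in> V q" and z: "z \<in> ?O" "z - snd c p \<in> S" for T z
  proof -
    obtain x where x: "z = snd c x" "x \<in> fst c" "x \<in> U" using z(1) by blast
    have "snd c x \<in> snd c ` (N \<inter> fst c)" unfolding slice using imageI[OF x(2), of "snd c"] z(2) x(1) by simp
    then have "x \<in> N" using chart_image_mem[OF atlas_chart[OF c(1)] x(2)] by blast
    then have "T x c \<in> S" by (rule integral_manifold_tangent[OF N(2) c(1) S slice _ x(2) T[OF x(3)]])
    then show ?thesis by (simp add: x(1) vf_rep_apply[OF c(1) x(2)])
  qed
  have der: "frechet_derivative (vf_rep c T) (at (snd c p)) w \<in> S"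
    if sm: "smooth_on ?O (vf_rep c T)" and T: "\<And>q. q \<in> U \<Longrightarrow> T q \<in> V q" and w: "w \<in> S" for T w
  proof -
    define r where "r = e / (norm w + 1)"
    have n: "norm w + 1 > 0" using norm_ge_zero[of w] by linarith
    show ?thesis
    proof (rule derivative_in_subspace[OF smooth_on_has_derivative[OF sm O(2)] S, where y = 0])
      show "r > 0" using e n by (simp add: r_def)
      fix t :: real assume t: "\<bar>t\<bar> < r"
      have "\<bar>t\<bar> * norm w \<le> \<bar>t\<bar> * (norm w + 1)" by (intro mult_left_mono) simp_all
      also have "\<dots> < e" using t n by (simp add: r_def pos_less_divide_eq)
      finally have "snd c p + t *\<^sub>R w \<in> ?O" using e(2) by (auto simp: dist_norm)
      from in_S[OF T this] show "vf_rep c T (snd c p + t *\<^sub>R w) - 0 \<in> S"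
        using subspace_scale[OF S w] by simp
    qed
  qed
  have z0: "vf_rep c T (snd c p) \<in> S" if "\<And>q. q \<in> U \<Longrightarrow> T q \<in> V q" for T
    by (rule in_S[OF that O(2)]) (use subspace_0[OF S] in simp_all)
  have "bracket (vf_rep c X) (vf_rep c Y) (snd c p) \<in> S"
    unfolding bracket_def
    by (rule subspace_diff[OF S der[OF vf_rep_smooth[OF Y(1) c(1)] Y(2) z0[OF X(2)]]
          der[OF vf_rep_smooth[OF X(1) c(1)] X(2) z0[OF Y(2)]]])
  then have "lie_bracket A X Y p c \<in> S" by (simp add: lie_bracket_rep[OF c])
  then show ?thesis unfolding Vp using lie_bracket_tangent[OF U X(1) Y(1) p] by (intro CollectI conjI)
qed

subsection \<open>Changing the coordinates of a chart\<close>

text \<open>The new chart belongs to the atlas because the atlas is maximal.\<close>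

lemma recoordinatized_chart:
  assumes c: "c \<in> A" and D: "diffeo W Y \<Phi> \<Psi>" and W: "W \<subseteq> snd c ` fst c"
    and c': "c' = (fst c \<inter> snd c -` W, \<Phi> \<circ> snd c)"
  shows "c' \<in> A"
    "\<And>q v. q \<in> fst c' \<Longrightarrow> v \<in> tangent_space A q \<Longrightarrow> v c' = frechet_derivative \<Phi> (at (snd c q)) (v c)"
proof -
  note d = is_chartD[OF atlas_chart[OF c]] and D' = diffeoD[OF D]
  have f: "fst c' = fst c \<inter> snd c -` W" by (simp add: c')
  have s: "snd c' q = \<Phi> (snd c q)" for q by (simp add: c')
  have of: "open (fst c')" unfolding f by (rule continuous_open_preimage[OF d(3,1) D'(1)])
  have im: "snd c ` fst c' = W" using W unfolding f by auto
  have im': "snd c' ` fst c' = Y"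
  proof -
    have "snd c' ` fst c' = \<Phi> ` (snd c ` fst c')" by (simp add: s image_image)
    then show ?thesis using im D'(9) by simp
  qed
  have inv: "chart_inv c' y = chart_inv c (\<Psi> y)" if y: "y \<in> Y" for y
  proof -
    have "\<Psi> y \<in> snd c ` fst c'" unfolding im by (rule D'(6)[OF y])
    then obtain q where q: "q \<in> fst c'" "snd c q = \<Psi> y" by (elim imageE) (rule that, simp_all)
    have inj: "inj_on (snd c') (fst c')"
    proof (rule inj_onI)
      fix a b assume ab: "a \<in> fst c'" "b \<in> fst c'" "snd c' a = snd c' b"
      have in_W: "snd c a \<in> W" "snd c b \<in> W" and in_c: "a \<in> fst c" "b \<in> fst c" using ab(1,2) by (simp_all add: f)
      have "\<Phi> (snd c a) = \<Phi> (snd c b)" using ab(3) by (simp add: s)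
      then have "snd c a = snd c b" using D'(7)[OF in_W(1)] D'(7)[OF in_W(2)] by argo
      then show "a = b" using d(5)[OF in_c(1)] d(5)[OF in_c(2)] by argo
    qed
    have "snd c' q = y" unfolding s q(2) by (rule D'(8)[OF y])
    then have "chart_inv c' y = q" unfolding chart_inv_def by (rule inv_into_f_eq[OF inj q(1)])
    moreover have "chart_inv c (\<Psi> y) = q" using d(5)[of q] q f by auto
    ultimately show ?thesis by simp
  qed
  have hom: "homeomorphism (fst c) (snd c ` fst c) (snd c) (chart_inv c)"
    using atlas_chart[OF c] unfolding is_chart_def by blast
  have "homeomorphism (fst c') W (snd c) (chart_inv c)"
    by (rule homeomorphism_of_subsets[OF hom _ W im]) (simp add: f)
  moreover have "homeomorphism W Y \<Phi> \<Psi>" using D unfolding diffeo_def by blast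
  ultimately have "homeomorphism (fst c') Y (\<Phi> \<circ> snd c) (chart_inv c \<circ> \<Psi>)" by (rule homeomorphism_compose)
  then have "homeomorphism (fst c') Y (snd c') (chart_inv c')"
    by (rule homeomorphism_cong) (simp_all add: s inv)
  then have chart': "is_chart c'" unfolding is_chart_def im' using of D'(2) by simp
  have "smoothly_compatible c' e" if e: "e \<in> A" for e
    unfolding smoothly_compatible_def
  proof
    have o1: "open (snd c' ` (fst c' \<inter> fst e))" by (rule open_chart_image[OF chart' is_chartD(1)[OF atlas_chart[OF e]]])
    have sub: "snd c' ` (fst c' \<inter> fst e) \<subseteq> Y" using im' by blast
    show "smooth_on (snd c' ` (fst c' \<inter> fst e)) (snd e \<circ> chart_inv c')"
    proof (rule smooth_on_cong[OF o1])
      show "smooth_on (snd c' ` (fst c' \<inter> fst e)) (\<lambda>y. (snd e \<circ> chart_inv c) (\<Psi> y))"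
      proof (rule smooth_on_compose[OF o1 smooth_transition(1)[OF c e] smooth_on_subset[OF D'(4) sub] smooth_transition(2)[OF c e]])
        fix y assume "y \<in> snd c' ` (fst c' \<inter> fst e)"
        then obtain q where "q \<in> fst c'" "q \<in> fst e" "y = snd c' q" by blast
        then have "\<Psi> y = snd c q" "q \<in> fst c \<inter> fst e" using D'(7)[of "snd c q"] by (simp_all add: f s)
        then show "\<Psi> y \<in> snd c ` (fst c \<inter> fst e)" by blast
      qed
      show "(snd e \<circ> chart_inv c) (\<Psi> y) = (snd e \<circ> chart_inv c') y" if "y \<in> snd c' ` (fst c' \<inter> fst e)" for y
        using inv[of y] that sub by auto
    qed
    have o2: "open (snd e ` (fst c' \<inter> fst e))"
      using open_chart_image[OF atlas_chart[OF e] of] by (simp add: Int_commute)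
    have sub2: "snd e ` (fst c' \<inter> fst e) \<subseteq> snd e ` (fst e \<inter> fst c)" unfolding f by blast
    note ee = is_chartD[OF atlas_chart[OF e]]
    show "smooth_on (snd e ` (fst c' \<inter> fst e)) (snd c' \<circ> chart_inv e)"
    proof (rule smooth_on_cong[OF o2])
      show "smooth_on (snd e ` (fst c' \<inter> fst e)) (\<lambda>y. \<Phi> ((snd c \<circ> chart_inv e) y))"
      proof (rule smooth_on_compose[OF o2 D'(1) smooth_on_subset[OF smooth_transition(2)[OF e c] sub2] D'(3)])
        fix y assume "y \<in> snd e ` (fst c' \<inter> fst e)"
        then show "(snd c \<circ> chart_inv e) y \<in> W" using ee(5) by (auto simp: f)
      qed
      show "\<Phi> ((snd c \<circ> chart_inv e) y) = (snd c' \<circ> chart_inv e) y" for y by (simp add: s)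
    qed
  qed
  then show c'A: "c' \<in> A" using M chart' unfolding smooth_manifold_def by blast
  fix q v assume q: "q \<in> fst c'" and v: "v \<in> tangent_space A q"
  have qc: "q \<in> fst c" "snd c q \<in> W" using q by (simp_all add: f)
  have "frechet_derivative (snd c' \<circ> chart_inv c) (at (snd c q)) = frechet_derivative \<Phi> (at (snd c q))"
  proof (rule frechet_derivative_cong_open[OF D'(1) qc(2)])
    fix y assume "y \<in> W"
    then show "(snd c' \<circ> chart_inv c) y = \<Phi> y" using d(6)[of y] W by (auto simp: s)
  qed
  then show "v c' = frechet_derivative \<Phi> (at (snd c q)) (v c)"
    using tangent_transform[OF v c c'A qc(1) q] by simp
qed

lemma differential_coord:
  assumes c: "c \<in> A" "q \<in> fst c" and v: "v \<in> tangent_space A q"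
  shows "differential A (coord c e) q v = v c \<bullet> e"
proof -
  define d where "d = (SOME d. d \<in> A \<and> q \<in> fst d)"
  have d: "d \<in> A" "q \<in> fst d" using someI[of "\<lambda>d. d \<in> A \<and> q \<in> fst d" c] c by (simp_all add: d_def)
  have "((snd c \<circ> chart_inv d) has_derivative frechet_derivative (snd c \<circ> chart_inv d) (at (snd d q))) (at (snd d q))"
    by (rule smooth_on_has_derivative[OF smooth_transition(2)[OF d(1) c(1)]]) (use c d in blast)
  from has_derivative_inner_left[OF this, of e]
  have "((coord c e \<circ> chart_inv d) has_derivative
      (\<lambda>v. frechet_derivative (snd c \<circ> chart_inv d) (at (snd d q)) v \<bullet> e)) (at (snd d q))"
    by (simp add: o_def coord_def)
  then have "frechet_derivative (coord c e \<circ> chart_inv d) (at (snd d q)) (v d) = v c \<bullet> e"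
    using tangent_transform[OF v d(1) c(1) d(2) c(2)] by (simp add: frechet_derivative_at[symmetric])
  then show ?thesis by (simp add: differential_def Let_def d_def)
qed

end

section \<open>Smooth cutoff functions\<close>

text \<open>The functions \<open>t\<^sup>-\<^sup>j exp (- 1/t)\<close>, extended by \<open>0\<close>.  The derivative of one of them is a linear combination of
  two others, so they are all smooth by one induction.\<close>

definition flat_power :: "nat \<Rightarrow> real \<Rightarrow> real" where
  "flat_power j t = (if t > 0 then exp (- inverse t) * inverse t ^ j else 0)"

text \<open>A quadratic bound gives derivative \<open>0\<close> at \<open>0\<close>; it comes from the term of order \<open>j + 2\<close> in the
  exponential series of \<open>1/t\<close>.\<close>

lemma flat_power_bound: "\<bar>flat_power j t\<bar> \<le> fact (j + 2) * t\<^sup>2"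
proof (cases "t > 0")
  case True
  define x where "x = inverse t"
  define m where "m = j + 2"
  have x: "x > 0" using True by (simp add: x_def)
  have F: "(fact m :: real) > 0" by simp
  have "(\<Sum>n\<in>{m}. x ^ n /\<^sub>R fact n) \<le> (\<Sum>n. x ^ n /\<^sub>R fact n)"
    using x by (intro sum_le_suminf sums_summable[OF exp_converges]) simp_all
  also have "\<dots> = exp x" using exp_converges[of x] by (rule sums_unique[symmetric])
  finally have "fact m * (x ^ m /\<^sub>R fact m) \<le> fact m * exp x" using F by (intro mult_left_mono) simp_all
  moreover have "fact m * (x ^ m /\<^sub>R fact m) = x ^ m" by (simp add: field_simps)
  ultimately have "x ^ m \<le> fact m * exp x" by argo
  then have "exp (- x) * x ^ m \<le> exp (- x) * (fact m * exp x)" by (intro mult_left_mono) simp_all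
  also have "\<dots> = fact m" by (simp add: exp_minus)
  finally have "exp (- x) * x ^ m * t\<^sup>2 \<le> fact m * t\<^sup>2" by (intro mult_right_mono) simp_all
  moreover have "x ^ m * t\<^sup>2 = x ^ j * (x * t)\<^sup>2" unfolding m_def by (simp only: power_add power_mult_distrib mult.assoc)
  then have "x ^ m * t\<^sup>2 = x ^ j" using True by (simp add: x_def)
  ultimately have "exp (- x) * x ^ j \<le> fact m * t\<^sup>2" by (simp add: mult.assoc)
  then show ?thesis using True x unfolding flat_power_def x_def m_def by (simp add: abs_mult)
qed (simp add: flat_power_def)

lemma flat_power_derivative:
  "(flat_power j has_real_derivative flat_power (j + 2) t - real j * flat_power (j + 1) t) (at t)"
proof -
  consider "t > 0" | "t < 0" | "t = 0" by linarith
  then show ?thesis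
  proof cases
    case 1
    have "((\<lambda>t. exp (- inverse t) * inverse t ^ j) has_real_derivative
        exp (- inverse t) * inverse t ^ (j + 2) - real j * (exp (- inverse t) * inverse t ^ (j + 1))) (at t)"
    proof -
      have t: "t \<noteq> 0" using 1 by simp
      have D: "(inverse has_real_derivative - (inverse t ^ 2)) (at t)"
        using DERIV_inverse[OF t] by (simp add: numeral_2_eq_2)
      have "((\<lambda>t. exp (- inverse t) * inverse t ^ j) has_real_derivative
          exp (- inverse t) * - (- (inverse t ^ 2)) * inverse t ^ j
          + real j * (- (inverse t ^ 2) * inverse t ^ (j - Suc 0)) * exp (- inverse t)) (at t)"
        by (rule DERIV_mult[OF DERIV_fun_exp[OF DERIV_minus[OF D]] DERIV_power[OF D]])
      moreover have "exp (- inverse t) * - (- (inverse t ^ 2)) * inverse t ^ j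
          + real j * (- (inverse t ^ 2) * inverse t ^ (j - Suc 0)) * exp (- inverse t)
          = exp (- inverse t) * inverse t ^ (j + 2) - real j * (exp (- inverse t) * inverse t ^ (j + 1))"
        by (cases j) (simp_all add: power2_eq_square algebra_simps)
      ultimately show ?thesis by (rule back_subst[of "\<lambda>D. (_ has_real_derivative D) _"])
    qed
    from has_field_derivative_transform_within_open[OF this, of "{0<..}" "flat_power j"] show ?thesis
      using 1 by (simp add: flat_power_def)
  next
    case 2
    have "((\<lambda>t. 0) has_real_derivative 0) (at t)" by (rule DERIV_const)
    from has_field_derivative_transform_within_open[OF this, of "{..<0}" "flat_power j"] show ?thesis
      using 2 by (simp add: flat_power_def)
  next
    case 3
    have "((\<lambda>h. (flat_power j (0 + h) - flat_power j 0) / h) \<longlongrightarrow> 0) (at 0)"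
    proof (rule Lim_null_comparison)
      show "\<forall>\<^sub>F h in at 0. norm ((flat_power j (0 + h) - flat_power j 0) / h) \<le> fact (j + 2) * \<bar>h\<bar>"
      proof (rule always_eventually, rule allI)
        fix h :: real
        have "\<bar>flat_power j h\<bar> \<le> fact (j + 2) * \<bar>h\<bar> * \<bar>h\<bar>"
          using flat_power_bound[of j h] by (simp add: power2_eq_square abs_mult_self_eq mult.assoc)
        then show "norm ((flat_power j (0 + h) - flat_power j 0) / h) \<le> fact (j + 2) * \<bar>h\<bar>"
          by (cases "h = 0") (simp_all add: flat_power_def[of j 0] abs_divide divide_le_eq)
      qed
      show "((\<lambda>h::real. fact (j + 2) * \<bar>h\<bar>) \<longlongrightarrow> 0) (at 0)"
        by (intro tendsto_mult_right_zero tendsto_rabs_zero tendsto_ident_at)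
    qed
    then show ?thesis using 3 by (simp add: DERIV_def flat_power_def)
  qed
qed

lemma smooth_flat_power: "smooth_on UNIV (flat_power j)"
proof -
  have cont: "continuous_on ({0::real} \<times> UNIV) (\<lambda>p. flat_power j (snd p))" for j
    by (rule continuous_on_snd) (use flat_power_derivative in \<open>auto intro!: continuous_at_imp_continuous_on DERIV_isCont\<close>)
  have "Ck_family {0::real} i UNIV (\<lambda>_. flat_power j)" for i
  proof (induction i arbitrary: j)
    case 0
    show ?case using cont[of j] by simp
  next
    case (Suc i)
    show ?case
    proof (rule Ck_family_SucI[OF open_UNIV cont])
      show "(flat_power j has_derivative
          (\<lambda>v. v *\<^sub>R flat_power (j + 2) t + (- (real j * v)) *\<^sub>R flat_power (j + 1) t)) (at t)" for t
        using flat_power_derivative[of j t] unfolding has_field_derivative_def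
        by (rule has_derivative_eq_rhs) (simp add: fun_eq_iff algebra_simps)
      show "Ck_family {0::real} i UNIV
          (\<lambda>_ t. v *\<^sub>R flat_power (j + 2) t + (- (real j * v)) *\<^sub>R flat_power (j + 1) t)" for v
        by (intro Ck_family_add open_UNIV Ck_family_linear_compose[OF open_UNIV bounded_linear_scaleR_right] Suc.IH)
    qed
  qed
  then show ?thesis unfolding smooth_on_iff_family[OF open_UNIV] smooth_family_def by blast
qed

lemma smooth_bump:
  fixes z0 :: "'a::euclidean_space"
  assumes r: "r > 0"
  shows "\<exists>f :: 'a \<Rightarrow> real. smooth_on UNIV f \<and> (\<forall>z\<in>ball z0 r. f z > 0) \<and> (\<forall>z. z \<notin> ball z0 r \<longrightarrow> f z = 0)"
proof (intro exI conjI ballI allI impI)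
  let ?f = "\<lambda>z. r\<^sup>2 - (z - z0) \<bullet> (z - z0)"
  have sm: "smooth_on UNIV (\<lambda>z. z - z0)" by (intro smooth_on_diff smooth_on_id smooth_on_const open_UNIV)
  have "smooth_on UNIV ?f"
    by (intro smooth_on_diff smooth_on_const open_UNIV smooth_on_bilinear[OF bounded_bilinear_inner open_UNIV sm sm])
  then show "smooth_on UNIV (\<lambda>z. flat_power 0 (?f z))"
    by (rule smooth_on_compose[OF open_UNIV open_UNIV _ smooth_flat_power]) simp
  have iff: "?f z > 0 \<longleftrightarrow> z \<in> ball z0 r" for z
  proof -
    have "?f z > 0 \<longleftrightarrow> (norm (z - z0))\<^sup>2 < r\<^sup>2" by (simp add: power2_norm_eq_inner)
    also have "\<dots> \<longleftrightarrow> norm (z - z0) < r" using r power_mono_iff[of r "norm (z - z0)" 2] by (simp add: not_le[symmetric])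
    finally show ?thesis by (simp add: dist_norm norm_minus_commute)
  qed
  show "flat_power 0 (?f z) > 0" if "z \<in> ball z0 r" for z using that unfolding iff[symmetric] by (simp add: flat_power_def)
  show "flat_power 0 (?f z) = 0" if "z \<notin> ball z0 r" for z using that unfolding iff[symmetric] by (simp add: flat_power_def)
qed

section \<open>Brackets of local sections under a global bracket condition\<close>

context
  fixes A :: "('m::{t2_space, second_countable_topology}, 'e::euclidean_space) chart set"
  assumes M: "smooth_manifold A"
begin

text \<open>The extension by \<open>0\<close> is smooth because the support is contained in the compact image of a closed ball,
  and a compact subset of a Hausdorff space is closed.\<close>

lemma cutoff_vector_field:
  assumes c: "c \<in> A" and U: "open U" and X: "vector_field_on A U X"
    and sub: "cball z0 r \<subseteq> snd c ` (fst c \<inter> U)"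
    and f: "smooth_on UNIV f" and f0: "\<And>z. z \<notin> ball z0 r \<Longrightarrow> f z = 0"
  shows "vector_field A (\<lambda>q. if q \<in> fst c \<inter> U then f (snd c q) *\<^sub>R X q else 0)" (is "vector_field A ?Y")
  unfolding vector_field_on_def
proof (intro conjI ballI)
  note cc = is_chartD[OF atlas_chart[OF M c]]
  show "?Y q \<in> tangent_space A q" for q
    using X subspace_tangent_space[OF M, of q] unfolding vector_field_on_def
    by (simp add: subspace_scale subspace_0)
  fix d assume d: "d \<in> A"
  note dd = is_chartD[OF atlas_chart[OF M d]]
  define K where "K = chart_inv c ` cball z0 r"
  have "cball z0 r \<subseteq> snd c ` fst c" using sub by blast
  then have "compact K"
    unfolding K_def by (intro compact_continuous_image continuous_on_subset[OF cc(4)] compact_cball)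
  then have K: "open (- K)" using compact_imp_closed by blast
  have KU: "K \<subseteq> fst c \<inter> U"
  proof
    fix x assume "x \<in> K"
    then obtain z where z: "x = chart_inv c z" "z \<in> snd c ` (fst c \<inter> U)" using sub unfolding K_def by blast
    then obtain y where y: "z = snd c y" "y \<in> fst c" "y \<in> U" by blast
    then have "x = y" using z(1) cc(5)[OF y(2)] by simp
    then show "x \<in> fst c \<inter> U" using y by blast
  qed
  have outside: "?Y y = 0" if y: "y \<notin> K" for y
  proof (cases "y \<in> fst c \<inter> U")
    case True
    have "snd c y \<notin> ball z0 r"
    proof
      assume "snd c y \<in> ball z0 r"
      then have "chart_inv c (snd c y) \<in> K" unfolding K_def by (intro imageI) simp
      then show False using y True cc(5)[of y] by simp
    qed
    then show ?thesis using f0 by simp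
  qed (rule if_not_P)
  show "smooth_on (snd d ` (fst d \<inter> UNIV)) (\<lambda>z. ?Y (chart_inv d z) d)"
  proof (rule smooth_on_local)
    fix z assume "z \<in> snd d ` (fst d \<inter> UNIV)"
    then obtain x where x: "z = snd d x" "x \<in> fst d" by blast
    show "\<exists>N. open N \<and> z \<in> N \<and> smooth_on N (\<lambda>z. ?Y (chart_inv d z) d)"
    proof (cases "x \<in> fst c \<inter> U")
      case True
      let ?N = "snd d ` (fst d \<inter> (fst c \<inter> U))"
      have N: "open ?N" by (intro open_chart_image atlas_chart[OF M] d open_Int cc(1) U)
      have "?N \<subseteq> snd d ` (fst d \<inter> fst c)" by blast
      then have "smooth_on ?N (snd c \<circ> chart_inv d)" by (rule smooth_on_subset[OF smooth_transition(2)[OF M d c]])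
      then have "smooth_on ?N (\<lambda>z. f ((snd c \<circ> chart_inv d) z))"
        by (rule smooth_on_compose[OF N open_UNIV _ f]) simp
      moreover have "smooth_on ?N (vf_rep d X)"
        by (rule smooth_on_subset[OF vf_rep_smooth[OF M X d]]) blast
      ultimately have s: "smooth_on ?N (\<lambda>z. f ((snd c \<circ> chart_inv d) z) *\<^sub>R vf_rep d X z)"
        by (rule smooth_on_bilinear[OF bounded_bilinear_scaleR N])
      have "smooth_on ?N (\<lambda>z. ?Y (chart_inv d z) d)"
      proof (rule smooth_on_cong[OF N _ s])
        fix y assume "y \<in> ?N"
        then obtain w where w: "y = snd d w" "w \<in> fst d" "w \<in> fst c \<inter> U" by blast
        then have dw: "chart_inv d y = w" using dd(5) by simp
        show "f ((snd c \<circ> chart_inv d) y) *\<^sub>R vf_rep d X y = ?Y (chart_inv d y) d"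
          unfolding vf_rep_def comp_apply dw using w(3) by (simp add: scaleR_fun_def)
      qed
      then show ?thesis using N x True by blast
    next
      case False
      let ?N = "snd d ` (fst d \<inter> - K)"
      have N: "open ?N" by (intro open_chart_image atlas_chart[OF M] d K)
      have "smooth_on ?N (\<lambda>z. ?Y (chart_inv d z) d)"
      proof (rule smooth_on_cong[OF N _ smooth_on_const[OF N, of 0]])
        fix y assume "y \<in> ?N"
        then obtain w where w: "y = snd d w" "w \<in> fst d" "w \<notin> K" by blast
        then have dw: "chart_inv d y = w" using dd(5) by simp
        show "0 = ?Y (chart_inv d y) d" unfolding dw outside[OF w(3)] by (simp add: zero_fun_def)
      qed
      moreover have "z \<in> ?N" using x False KU by blast
      ultimately show ?thesis using N by blast
    qed
  qed
qed

text \<open>The bracket condition is applied to \<open>f X\<close> with a cutoff function \<open>f\<close>.  Since \<open>[R, f X] = f [R, X] + df(R) X\<close>,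
  it gives the claim for \<open>X\<close> wherever \<open>f > 0\<close>.\<close>

lemma local_bracket_condition:
  assumes br: "bracket_in A K V (distrib_sum K V)" and V: "\<And>q. subspace (V q)"
    and R: "vector_field A R" and RK: "\<And>q. R q \<in> K q"
    and K: "\<And>q u. u \<in> K q \<Longrightarrow> \<exists>t. u = t *\<^sub>R R q"
    and c: "c \<in> A" and U: "open U" and X: "vector_field_on A U X" and XV: "\<And>q. q \<in> U \<Longrightarrow> X q \<in> V q"
    and sub: "cball z0 r \<subseteq> snd c ` (fst c \<inter> U)" and z: "z \<in> ball z0 r"
  shows "\<exists>t. \<exists>v\<in>V (chart_inv c z). bracket (vf_rep c R) (vf_rep c X) z = t *\<^sub>R vf_rep c R z + v c"
proof -
  note cc = is_chartD[OF atlas_chart[OF M c]]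
  have r: "r > 0" using z by (metis ball_eq_empty empty_iff not_le)
  obtain f :: "'e \<Rightarrow> real" where f: "smooth_on UNIV f"
    "\<forall>z\<in>ball z0 r. f z > 0" "\<forall>z. z \<notin> ball z0 r \<longrightarrow> f z = 0"
    using smooth_bump[OF r, of z0] by (elim exE conjE) (rule that, assumption+)
  define Y where "Y = (\<lambda>q. if q \<in> fst c \<inter> U then f (snd c q) *\<^sub>R X q else 0)"
  have Y: "vector_field A Y" unfolding Y_def by (rule cutoff_vector_field[OF c U X sub f(1)]) (use f(3) in blast)
  have YV: "Y q \<in> V q" for q unfolding Y_def using XV V by (simp add: subspace_scale subspace_0)
  let ?O = "snd c ` (fst c \<inter> U)"
  have O: "open ?O" by (rule open_chart_image[OF atlas_chart[OF M c] U])
  have zO: "z \<in> ?O" using sub z by auto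
  then obtain q where q: "z = snd c q" "q \<in> fst c" "q \<in> U" by blast
  have qz: "chart_inv c z = q" using q cc(5) by simp
  have "lie_bracket A R Y q \<in> distrib_sum K V q"
    by (rule br[unfolded bracket_in_def, rule_format]) (intro conjI allI R Y RK YV)
  then obtain u v where uv: "lie_bracket A R Y q = u + v" "u \<in> K q" "v \<in> V q"
    unfolding distrib_sum_def by blast
  obtain t where t: "u = t *\<^sub>R R q" using K[OF uv(2)] by blast
  have eq: "bracket (vf_rep c R) (vf_rep c Y) z = t *\<^sub>R vf_rep c R z + v c"
    using uv(1) lie_bracket_rep[OF M c q(2), of R Y] vf_rep_apply[OF M c q(2), of R]
    by (simp add: t q(1) plus_fun_def scaleR_fun_def)
  have rep: "f y *\<^sub>R vf_rep c X y = vf_rep c Y y" if y: "y \<in> ?O" for y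
  proof -
    obtain w where w: "y = snd c w" "w \<in> fst c" "w \<in> U" using y by blast
    show ?thesis using w by (simp add: vf_rep_def Y_def cc(5)[OF w(2)] scaleR_fun_def)
  qed
  have sX: "smooth_on ?O (vf_rep c X)" by (rule vf_rep_smooth[OF M X c])
  let ?df = "frechet_derivative f (at z)" and ?dX = "frechet_derivative (vf_rep c X) (at z)"
    and ?dR = "frechet_derivative (vf_rep c R) (at z)"
  have "((\<lambda>y. f y *\<^sub>R vf_rep c X y) has_derivative (\<lambda>h. f z *\<^sub>R ?dX h + ?df h *\<^sub>R vf_rep c X z)) (at z)"
    by (intro has_derivative_scaleR smooth_on_has_derivative[OF f(1) UNIV_I] smooth_on_has_derivative[OF sX zO])
  note dfX = frechet_derivative_at[OF this]
  have "frechet_derivative (\<lambda>y. f y *\<^sub>R vf_rep c X y) (at z) = frechet_derivative (vf_rep c Y) (at z)"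
    by (rule frechet_derivative_cong_open[OF O zO rep])
  note dY = trans[OF sym[OF this] sym[OF dfX]]
  have "smooth_on ?O (vf_rep c R)" by (rule smooth_on_subset[OF vf_rep_smooth[OF M R c]]) blast
  then have lin: "linear ?dR" using zO by (rule smooth_on_linear_derivative)
  define a where "a = ?df (vf_rep c R z)"
  have "bracket (vf_rep c R) (vf_rep c Y) z = f z *\<^sub>R bracket (vf_rep c R) (vf_rep c X) z + a *\<^sub>R vf_rep c X z"
    unfolding bracket_def dY rep[OF zO, symmetric] linear_scale[OF lin] a_def by (simp add: algebra_simps)
  then have "f z *\<^sub>R bracket (vf_rep c R) (vf_rep c X) z = t *\<^sub>R vf_rep c R z + (v c - a *\<^sub>R vf_rep c X z)"
    unfolding eq by (simp add: algebra_simps)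
  then have "(1 / f z) *\<^sub>R (f z *\<^sub>R bracket (vf_rep c R) (vf_rep c X) z) =
      (t / f z) *\<^sub>R vf_rep c R z + (1 / f z) *\<^sub>R (v c - a *\<^sub>R vf_rep c X z)"
    by (simp add: scaleR_add_right)
  moreover have "(1 / f z) *\<^sub>R (f z *\<^sub>R bracket (vf_rep c R) (vf_rep c X) z) = bracket (vf_rep c R) (vf_rep c X) z"
    using bspec[OF f(2) z] by simp
  moreover have "(1 / f z) *\<^sub>R (v c - a *\<^sub>R vf_rep c X z) = ((1 / f z) *\<^sub>R (v - a *\<^sub>R X q)) c"
    by (simp add: q(1) vf_rep_apply[OF M c q(2)] scaleR_fun_def fun_diff_def)
  moreover have "(1 / f z) *\<^sub>R (v - a *\<^sub>R X q) \<in> V q"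
    by (intro subspace_scale subspace_diff V uv(3) XV q(3))
  ultimately show ?thesis unfolding qz by metis
qed

end

section \<open>Darboux coordinates on manifolds\<close>

text \<open>The comparison of dimensions is made through cardinalities, as tangent spaces live in an
  infinite-dimensional function space.\<close>

lemma span_eq_of_lin_indep:
  fixes v :: "'i \<Rightarrow> 'b::real_vector"
  assumes I: "finite I" "lin_indep I v" and G: "finite G" "card G \<le> card I" and sub: "v ` I \<subseteq> span G"
  shows "span (v ` I) = span G"
proof
  show "span (v ` I) \<subseteq> span G" by (intro span_minimal sub subspace_span)
  note ind = lin_indep_imp_independent[OF I]
  have "g \<in> span (v ` I)" if g: "g \<in> span G" for g
  proof (rule ccontr)
    assume g': "g \<notin> span (v ` I)"
    then have "independent (insert g (v ` I))" using ind(2) by (rule independent_insertI)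
    moreover have "insert g (v ` I) \<subseteq> span G" using g sub by (simp only: insert_subset)
    ultimately have "card (insert g (v ` I)) \<le> card G" using independent_span_bound[OF G(1)] by (meson)
    moreover have "g \<notin> v ` I" using g' span_base[of g "v ` I"] by argo
    moreover have "card (v ` I) = card I" by (rule card_image[OF ind(1)])
    ultimately show False using G(2) I(1) by simp
  qed
  then show "span G \<subseteq> span (v ` I)" by blast
qed

lemma sum_coord_names:
  fixes u :: "'e::euclidean_space"
  assumes b: "bij_betw b (coord_names k n) (Basis :: 'e set)"
    and X: "\<And>\<alpha>. \<alpha> \<in> {1..k} \<Longrightarrow> u \<bullet> b (CX \<alpha>) = 0" and Y: "\<And>i. i \<in> {1..n} \<Longrightarrow> u \<bullet> b (CY i) = 0"
  shows "u \<in> span {b (CP \<alpha> i) | \<alpha> i. \<alpha> \<in> {1..k} \<and> i \<in> {1..n}}" (is "_ \<in> span ?G")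
proof -
  have "(u \<bullet> e) *\<^sub>R e \<in> span ?G" if "e \<in> Basis" for e
  proof -
    have "e \<in> b ` coord_names k n" using that bij_betw_imp_surj_on[OF b] by simp
    then obtain d where d: "d \<in> coord_names k n" "e = b d" by (elim imageE)
    from d(1) show ?thesis
    proof (cases rule: coord_names_cases)
      case (1 \<alpha>)
      then show ?thesis using X d(2) by (simp add: span_zero)
    next
      case (2 i)
      then show ?thesis using Y d(2) by (simp add: span_zero)
    next
      case (3 \<alpha> i)
      then have "e \<in> ?G" using d(2) by blast
      then show ?thesis by (intro span_scale span_base)
    qed
  qed
  then have "(\<Sum>e\<in>Basis. (u \<bullet> e) *\<^sub>R e) \<in> span ?G" by (rule span_sum)
  then show ?thesis by (simp add: euclidean_representation)
qed

context
  fixes A :: "('m::{t2_space, second_countable_topology}, 'e::euclidean_space) chart set"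
  assumes M: "smooth_manifold A"
begin

lemma span_coord_vec_eq:
  assumes c: "c \<in> A" "q \<in> fst c" and b: "bij_betw b (coord_names k n) (Basis :: 'e set)"
    and I: "finite I" "card I = n * k" "lin_indep I v" and vT: "\<And>i. i \<in> I \<Longrightarrow> v i \<in> tangent_space A q"
    and X: "\<And>i \<alpha>. i \<in> I \<Longrightarrow> \<alpha> \<in> {1..k} \<Longrightarrow> v i c \<bullet> b (CX \<alpha>) = 0"
    and Y: "\<And>i j. i \<in> I \<Longrightarrow> j \<in> {1..n} \<Longrightarrow> v i c \<bullet> b (CY j) = 0"
  shows "span (v ` I) = span {coord_vec A c (b (CP \<alpha> i)) q | \<alpha> i. \<alpha> \<in> {1..k} \<and> i \<in> {1..n}}"
    (is "_ = span ?G")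
proof (rule span_eq_of_lin_indep[OF I(1,3)])
  let ?g = "\<lambda>x. coord_vec A c (b (CP (fst x) (snd x))) q" and ?P = "{1..k} \<times> {1..n}"
  have G: "?G = ?g ` ?P" by force
  show "finite ?G" unfolding G by simp
  have "card (?g ` ?P) \<le> card ?P" by (rule card_image_le) simp
  then show "card ?G \<le> card I" unfolding G I(2) by (simp add: mult.commute)
  show "v ` I \<subseteq> span ?G"
  proof
    fix x assume "x \<in> v ` I"
    then obtain i where i: "i \<in> I" "x = v i" by blast
    have "v i c \<in> span {b (CP \<alpha> i) | \<alpha> i. \<alpha> \<in> {1..k} \<and> i \<in> {1..n}}" (is "_ \<in> span ?B")
      by (rule sum_coord_names[OF b X[OF i(1)] Y[OF i(1)]])
    then have "coord_vec A c (v i c) q \<in> (\<lambda>u. coord_vec A c u q) ` span ?B" by (rule imageI)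
    also have "\<dots> = span ((\<lambda>u. coord_vec A c u q) ` ?B)"
      by (rule linear_span_image[OF linear_coord_vec[OF M c], symmetric])
    also have "(\<lambda>u. coord_vec A c u q) ` ?B = ?G" by blast
    finally show "x \<in> span ?G" using tangent_coord_vec[OF M vT[OF i(1)] c] i(2) by simp
  qed
qed

end

context
  fixes A :: "('m::{t2_space, second_countable_topology}, 'e::euclidean_space) chart set"
    and k n :: nat and \<eta> :: "nat \<Rightarrow> ('m, 'e) form1" and \<omega> :: "nat \<Rightarrow> ('m, 'e) form2"
    and V :: "('m, 'e) distrib" and R :: "nat \<Rightarrow> 'm \<Rightarrow> ('m, 'e) tvec"
  assumes cosymplectic: "k_cosymplectic A k n \<eta> \<omega> V" and reeb: "reeb_fields A k \<eta> \<omega> R"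
begin

lemma k_cosymplecticD:
  shows "smooth_manifold A" "1 \<le> k" "DIM('e) = n * (k + 1) + k"
    "\<And>\<alpha>. \<alpha> \<in> {1..k} \<Longrightarrow> closed_one_form A (\<eta> \<alpha>)" "\<And>\<alpha>. \<alpha> \<in> {1..k} \<Longrightarrow> closed_two_form A (\<omega> \<alpha>)"
    "integrable_distribution A (n * k) V"
    "\<And>\<alpha> p v. \<alpha> \<in> {1..k} \<Longrightarrow> v \<in> V p \<Longrightarrow> \<eta> \<alpha> p v = 0"
    "\<And>\<alpha> p v w. \<alpha> \<in> {1..k} \<Longrightarrow> v \<in> V p \<Longrightarrow> w \<in> V p \<Longrightarrow> \<omega> \<alpha> p v w = 0"
    "\<And>p. (\<Inter>\<alpha>\<in>{1..k}. ker1 A (\<eta> \<alpha>) p \<inter> ker2 A (\<omega> \<alpha>) p) = {0}"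
proof -
  note K = cosymplectic[unfolded k_cosymplectic_def]
  show "smooth_manifold A" using K by (elim conjE)
  show "1 \<le> k" using K by (elim conjE)
  show "DIM('e) = n * (k + 1) + k" using K by (elim conjE)
  show "integrable_distribution A (n * k) V" using K by (elim conjE)
  have K1: "\<forall>\<alpha>\<in>{1..k}. closed_one_form A (\<eta> \<alpha>) \<and> closed_two_form A (\<omega> \<alpha>)" using K by (elim conjE)
  have K2: "\<forall>\<alpha>\<in>{1..k}. \<forall>p. \<forall>v\<in>V p. \<eta> \<alpha> p v = 0" using K by (elim conjE)
  have K3: "\<forall>\<alpha>\<in>{1..k}. \<forall>p. \<forall>v\<in>V p. \<forall>w\<in>V p. \<omega> \<alpha> p v w = 0" using K by (elim conjE)
  have K4: "\<forall>p. (\<Inter>\<alpha>\<in>{1..k}. ker1 A (\<eta> \<alpha>) p \<inter> ker2 A (\<omega> \<alpha>) p) = {0}" using K by (elim conjE)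
  show "\<And>\<alpha>. \<alpha> \<in> {1..k} \<Longrightarrow> closed_one_form A (\<eta> \<alpha>)" "\<And>\<alpha>. \<alpha> \<in> {1..k} \<Longrightarrow> closed_two_form A (\<omega> \<alpha>)"
    using K1 by blast+
  show "\<And>\<alpha> p v. \<alpha> \<in> {1..k} \<Longrightarrow> v \<in> V p \<Longrightarrow> \<eta> \<alpha> p v = 0" using K2 by blast
  show "\<And>\<alpha> p v w. \<alpha> \<in> {1..k} \<Longrightarrow> v \<in> V p \<Longrightarrow> w \<in> V p \<Longrightarrow> \<omega> \<alpha> p v w = 0" using K3 by blast
  show "\<And>p. (\<Inter>\<alpha>\<in>{1..k}. ker1 A (\<eta> \<alpha>) p \<inter> ker2 A (\<omega> \<alpha>) p) = {0}" using K4 by blast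
qed

lemma reeb_fieldsD:
  shows "\<And>\<alpha>. \<alpha> \<in> {1..k} \<Longrightarrow> vector_field A (R \<alpha>)"
    "\<And>\<alpha> \<beta> p. \<alpha> \<in> {1..k} \<Longrightarrow> \<beta> \<in> {1..k} \<Longrightarrow> \<eta> \<beta> p (R \<alpha> p) = (if \<alpha> = \<beta> then 1 else 0)"
    "\<And>\<alpha> \<beta> p w. \<alpha> \<in> {1..k} \<Longrightarrow> \<beta> \<in> {1..k} \<Longrightarrow> w \<in> tangent_space A p \<Longrightarrow> \<omega> \<beta> p (R \<alpha> p) w = 0"
  using reeb unfolding reeb_fields_def by blast+

lemma reeb_field_tangent: "\<alpha> \<in> {1..k} \<Longrightarrow> R \<alpha> p \<in> tangent_space A p"
  using reeb_fieldsD(1)[of \<alpha>] unfolding vector_field_on_def by blast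

lemma cosymplectic_nondegenerate:
  assumes "v \<in> tangent_space A q"
    "\<And>\<alpha>. \<alpha> \<in> {1..k} \<Longrightarrow> \<eta> \<alpha> q v = 0" "\<And>\<alpha> w. \<alpha> \<in> {1..k} \<Longrightarrow> w \<in> tangent_space A q \<Longrightarrow> \<omega> \<alpha> q v w = 0"
  shows "v = 0"
proof -
  have "v \<in> (\<Inter>\<alpha>\<in>{1..k}. ker1 A (\<eta> \<alpha>) q \<inter> ker2 A (\<omega> \<alpha>) q)"
    using assms unfolding ker1_def ker2_def by blast
  then show ?thesis unfolding k_cosymplecticD(9) by simp
qed

text \<open>For \<open>u\<close> in the kernel of \<open>\<omega> 1\<close>, the vector \<open>u - \<eta>(u) R\<close> is in the kernels of both forms.\<close>

lemma kernel_spanned_by_reeb: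
  assumes k: "k = 1" and u: "u \<in> ker2 A (\<omega> 1) q"
  shows "\<exists>t. u = t *\<^sub>R R 1 q"
proof -
  note T = subspace_tangent_space[OF k_cosymplecticD(1), of q]
  have uT: "u \<in> tangent_space A q" and u0: "\<And>w. w \<in> tangent_space A q \<Longrightarrow> \<omega> 1 q u w = 0"
    using u unfolding ker2_def by blast+
  have 1: "(1::nat) \<in> {1..k}" using k by simp
  have one: "\<alpha> = 1" if "\<alpha> \<in> {1..k}" for \<alpha> using that k by simp
  have RT: "R 1 q \<in> tangent_space A q" by (rule reeb_field_tangent[OF 1])
  have l1: "linear_form_on (tangent_space A q) (\<eta> 1 q)"
    using k_cosymplecticD(4)[OF 1] unfolding closed_one_form_def one_form_def by (elim conjE) (rule spec)
  have "two_form A (\<omega> 1)" using k_cosymplecticD(5)[OF 1] unfolding closed_two_form_def by (elim conjE)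
  then have l2: "linear_form_on (tangent_space A q) (\<lambda>u. \<omega> 1 q u w)" if "w \<in> tangent_space A q" for w
    using that unfolding two_form_def by blast
  define t where "t = \<eta> 1 q u"
  have d: "u - t *\<^sub>R R 1 q = 1 *\<^sub>R u + (- t) *\<^sub>R R 1 q" by simp
  have "u - t *\<^sub>R R 1 q = 0"
  proof (rule cosymplectic_nondegenerate)
    show "u - t *\<^sub>R R 1 q \<in> tangent_space A q" by (intro subspace_diff subspace_scale T uT RT)
    fix \<alpha> assume \<alpha>: "\<alpha> \<in> {1..k}"
    have "\<eta> 1 q (1 *\<^sub>R u + (- t) *\<^sub>R R 1 q) = 1 * \<eta> 1 q u + (- t) * \<eta> 1 q (R 1 q)"
      using l1 uT RT unfolding linear_form_on_def by blast
    then show "\<eta> \<alpha> q (u - t *\<^sub>R R 1 q) = 0"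
      unfolding one[OF \<alpha>] d reeb_fieldsD(2)[OF 1 1] by (simp add: t_def)
    fix w assume w: "w \<in> tangent_space A q"
    have "\<omega> 1 q (1 *\<^sub>R u + (- t) *\<^sub>R R 1 q) w = 1 * \<omega> 1 q u w + (- t) * \<omega> 1 q (R 1 q) w"
      using l2[OF w] uT RT unfolding linear_form_on_def by blast
    then show "\<omega> \<alpha> q (u - t *\<^sub>R R 1 q) w = 0"
      unfolding one[OF \<alpha>] d using reeb_fieldsD(3)[OF 1 1 w] u0[OF w] by simp
  qed
  then show ?thesis by (intro exI[of _ t]) simp
qed

lemma distribution_V: "distribution A (n * k) V"
  using k_cosymplecticD(6) unfolding integrable_distribution_def by blast

lemma subspace_V: "subspace (V q)" and dim_V: "dim (V q) = n * k" and V_tangent: "V q \<subseteq> tangent_space A q"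
  using distribution_V unfolding distribution_def by blast+

lemma frame_lin_indep:
  assumes "V q = span ((\<lambda>i. X i q) ` {1..n * k})"
  shows "lin_indep {1..n * k} (\<lambda>i. X i q)"
  using dim_V[of q] by (intro dim_span_imp_lin_indep) (simp_all add: assms)

text \<open>In the chart \<open>c\<close> the structure becomes a structure on a ball of the model space.  The two branches are
  the construction from the polarization \<open>V\<close> and, if \<open>k = 1\<close> and the bracket condition fails, the one from a Lagrangian frame.\<close>

lemma local_darboux:
  assumes c: "c \<in> A" and U: "open U"
    and Xs: "\<forall>i\<in>{1..n * k}. vector_field_on A U (X i)"
    and VXs: "\<forall>q\<in>U. V q = span ((\<lambda>i. X i q) ` {1..n * k})"
    and r: "r > 0" and sub: "cball z0 r \<subseteq> snd c ` (fst c \<inter> U)"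
  shows "\<exists>W Y \<Phi> \<Psi> b. diffeo W Y \<Phi> \<Psi> \<and> z0 \<in> W \<and> W \<subseteq> ball z0 r \<and> bij_betw b (coord_names k n) (Basis :: 'e set) \<and>
    (\<forall>z\<in>W. darboux_at k n b (\<lambda>\<alpha>. rep1 A c (\<eta> \<alpha>)) (\<lambda>\<alpha>. rep2 A c (\<omega> \<alpha>)) (\<lambda>\<alpha>. vf_rep c (R \<alpha>)) z (frechet_derivative \<Phi> (at z)) \<and>
      (k \<noteq> 1 \<or> bracket_in A (ker2 A (\<omega> 1)) V (distrib_sum (ker2 A (\<omega> 1)) V) \<longrightarrow>
        (\<forall>i\<in>{1..n * k}. \<forall>j\<in>{1..n}. frechet_derivative \<Phi> (at z) (vf_rep c (X i) z) \<bullet> b (CY j) = 0)))"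
proof -
  note M = k_cosymplecticD(1) and X = bspec[OF Xs] and VX = bspec[OF VXs]
  note cc = is_chartD[OF atlas_chart[OF M c]]
  let ?B = "ball z0 r" and ?I = "{1..n * k}" and ?\<eta> = "\<lambda>\<alpha>. rep1 A c (\<eta> \<alpha>)" and ?\<omega> = "\<lambda>\<alpha>. rep2 A c (\<omega> \<alpha>)"
    and ?R = "\<lambda>\<alpha>. vf_rep c (R \<alpha>)" and ?X = "\<lambda>i. vf_rep c (X i)"
  have BO: "?B \<subseteq> snd c ` (fst c \<inter> U)" using sub ball_subset_cball by blast
  then have Bc: "?B \<subseteq> snd c ` fst c" by blast
  have pt: "chart_inv c z \<in> fst c" "chart_inv c z \<in> U" "snd c (chart_inv c z) = z" if z: "z \<in> ?B" for z
  proof -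
    obtain q where q: "z = snd c q" "q \<in> fst c" "q \<in> U" using z BO by blast
    have "chart_inv c z = q" unfolding q(1) by (rule cc(5)[OF q(2)])
    then show "chart_inv c z \<in> fst c" "chart_inv c z \<in> U" "snd c (chart_inv c z) = z" using q by simp_all
  qed
  have XV: "X i q \<in> V q" if "i \<in> ?I" "q \<in> U" for i q
    unfolding VX[OF that(2)] using that(1) by (intro span_base imageI)
  have V_rep: "v c \<in> span ((\<lambda>i. ?X i z) ` ?I)" if z: "z \<in> ?B" and v: "v \<in> V (chart_inv c z)" for v z
  proof -
    have "v c \<in> (\<lambda>v. v c) ` span ((\<lambda>i. X i (chart_inv c z)) ` ?I)"
      using v unfolding VX[OF pt(2)[OF z]] by (rule imageI)
    also have "\<dots> = span ((\<lambda>v. v c) ` (\<lambda>i. X i (chart_inv c z)) ` ?I)"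
      by (rule linear_span_image[OF linear_component[OF M], symmetric])
    finally show ?thesis unfolding image_image vf_rep_def .
  qed
  have 1: "DIM('e) = n * (k + 1) + k" by (rule k_cosymplecticD(3))
  have 2: "closed1 ?B (?\<eta> \<alpha>)" if "\<alpha> \<in> {1..k}" for \<alpha>
    by (rule closed1_subset[OF closed_one_form_rep[OF M k_cosymplecticD(4)[OF that] c] Bc])
  have 3: "closed2 ?B (?\<omega> \<alpha>)" if "\<alpha> \<in> {1..k}" for \<alpha>
    by (rule closed2_subset[OF closed_two_form_rep[OF M k_cosymplecticD(5)[OF that] c] Bc])
  have 4: "v = 0" if z: "z \<in> ?B" and v: "\<forall>\<alpha>\<in>{1..k}. ?\<eta> \<alpha> z v = 0 \<and> (\<forall>w. ?\<omega> \<alpha> z v w = 0)" for z v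
  proof -
    let ?q = "chart_inv c z"
    have "coord_vec A c v ?q = 0"
    proof (rule cosymplectic_nondegenerate)
      show "coord_vec A c v ?q \<in> tangent_space A ?q" by (rule coord_vec_tangent[OF M c pt(1)[OF z]])
      show "\<eta> \<alpha> ?q (coord_vec A c v ?q) = 0" if "\<alpha> \<in> {1..k}" for \<alpha>
        using v that unfolding rep1_def by blast
      fix \<alpha> w assume \<alpha>: "\<alpha> \<in> {1..k}" and w: "w \<in> tangent_space A ?q"
      have "\<omega> \<alpha> ?q (coord_vec A c v ?q) (coord_vec A c (w c) ?q) = 0"
        using v \<alpha> unfolding rep2_def by blast
      then show "\<omega> \<alpha> ?q (coord_vec A c v ?q) w = 0"
        unfolding tangent_coord_vec[OF M w c pt(1)[OF z]] .
    qed
    then show ?thesis using coord_vec_self[OF M c pt(1)[OF z], of v] by (simp add: zero_fun_def)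
  qed
  have 5: "smooth_on ?B (?R \<alpha>)" if "\<alpha> \<in> {1..k}" for \<alpha>
    by (rule smooth_on_subset[OF vf_rep_smooth[OF M reeb_fieldsD(1)[OF that] c]]) (use Bc in blast)
  have 6: "?\<eta> \<beta> z (?R \<alpha> z) = (if \<alpha> = \<beta> then 1 else 0)"
    if z: "z \<in> ?B" and "\<alpha> \<in> {1..k}" "\<beta> \<in> {1..k}" for z \<alpha> \<beta>
    unfolding rep1_def vf_rep_def tangent_coord_vec[OF M reeb_field_tangent[OF that(2)] c pt(1)[OF z]]
    by (rule reeb_fieldsD(2)[OF that(2,3)])
  have 7: "?\<omega> \<beta> z (?R \<alpha> z) w = 0" if z: "z \<in> ?B" and "\<alpha> \<in> {1..k}" "\<beta> \<in> {1..k}" for z \<alpha> \<beta> w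
    unfolding rep2_def vf_rep_def tangent_coord_vec[OF M reeb_field_tangent[OF that(2)] c pt(1)[OF z]]
    by (rule reeb_fieldsD(3)[OF that(2,3) coord_vec_tangent[OF M c pt(1)[OF z]]])
  have 8: "finite ?I" "card ?I = n * k" by simp_all
  have 9: "smooth_on ?B (?X i)" if "i \<in> ?I" for i
    by (rule smooth_on_subset[OF vf_rep_smooth[OF M X[OF that] c] BO])
  have XT: "X i q \<in> tangent_space A q" if "i \<in> ?I" "q \<in> U" for i q
    using XV[OF that] V_tangent by blast
  have 10: "lin_indep ?I (\<lambda>i. ?X i z)" if z: "z \<in> ?B" for z
    unfolding lin_indep_def
  proof (rule allI, rule impI)
    let ?q = "chart_inv c z"
    fix a :: "nat \<Rightarrow> real" assume a: "(\<Sum>i\<in>?I. a i *\<^sub>R ?X i z) = 0"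
    have "(\<Sum>i\<in>?I. a i *\<^sub>R X i ?q) = 0"
    proof (rule tangent_eqI[OF M _ subspace_0[OF subspace_tangent_space[OF M]] c pt(1)[OF z]])
      show "(\<Sum>i\<in>?I. a i *\<^sub>R X i ?q) \<in> tangent_space A ?q"
        by (intro subspace_sum subspace_scale subspace_tangent_space[OF M] XT pt(2)[OF z])
      have "(\<Sum>i\<in>?I. a i *\<^sub>R X i ?q) c = (\<Sum>i\<in>?I. (a i *\<^sub>R X i ?q) c)"
        by (rule linear_sum[OF linear_component[OF M]])
      also have "\<dots> = (\<Sum>i\<in>?I. a i *\<^sub>R ?X i z)" by (simp add: scaleR_fun_def vf_rep_def)
      finally show "(\<Sum>i\<in>?I. a i *\<^sub>R X i ?q) c = 0 c" using a by (simp add: zero_fun_def)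
    qed
    then show "\<forall>i\<in>?I. a i = 0"
      using frame_lin_indep[where X = X, OF VX[OF pt(2)[OF z]]] unfolding lin_indep_def by blast
  qed
  have 11: "?\<eta> \<alpha> z (?X i z) = 0" if "\<alpha> \<in> {1..k}" "i \<in> ?I" and z: "z \<in> ?B" for \<alpha> i z
    unfolding rep1_def vf_rep_def tangent_coord_vec[OF M XT[OF that(2) pt(2)[OF z]] c pt(1)[OF z]]
    by (rule k_cosymplecticD(7)[OF that(1) XV[OF that(2) pt(2)[OF z]]])
  have 12: "?\<omega> \<alpha> z (?X i z) (?X j z) = 0" if "\<alpha> \<in> {1..k}" "i \<in> ?I" "j \<in> ?I" and z: "z \<in> ?B" for \<alpha> i j z
    unfolding rep2_def vf_rep_def tangent_coord_vec[OF M XT[OF that(2) pt(2)[OF z]] c pt(1)[OF z]]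
      tangent_coord_vec[OF M XT[OF that(3) pt(2)[OF z]] c pt(1)[OF z]]
    by (rule k_cosymplecticD(8)[OF that(1) XV[OF that(2) pt(2)[OF z]] XV[OF that(3) pt(2)[OF z]]])
  have z0: "z0 \<in> ?B" using r by simp
  show ?thesis
  proof (cases "k \<noteq> 1 \<or> bracket_in A (ker2 A (\<omega> 1)) V (distrib_sum (ker2 A (\<omega> 1)) V)")
    case True
    have 13: "bracket (?X i) (?X j) z \<in> span ((\<lambda>i. ?X i z) ` ?I)"
      if "i \<in> ?I" "j \<in> ?I" and z: "z \<in> ?B" for i j z
    proof -
      let ?q = "chart_inv c z"
      have "lie_bracket A (X i) (X j) ?q \<in> V ?q"
        by (rule integrable_imp_involutive[OF M k_cosymplecticD(6) U])
           (rule X XV that pt(2) | assumption)+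
      from V_rep[OF z this] show ?thesis unfolding lie_bracket_rep[OF M c pt(1)[OF z]] pt(3)[OF z] .
    qed
    have 14: "bracket (?R \<alpha>) (?X i) z \<in> span ((\<lambda>i. case_sum ?X ?R i z) ` (?I <+> {1..k}))"
      if \<alpha>: "\<alpha> \<in> {1..k}" and i: "i \<in> ?I" and z: "z \<in> ?B" for \<alpha> i z
    proof (cases "k = 1")
      case False
      then have k2: "k \<ge> 2" using k_cosymplecticD(2) by simp
      show ?thesis
        by (rule reeb_invariance[where U = ?B and \<eta> = ?\<eta> and \<omega> = ?\<omega> and n = n])
           (assumption | rule open_ball 1 2 3 4 5 6 7 8 9 10 11 12 k2 \<alpha> i z)+
    next
      case k1: True
      then have \<alpha>1: "\<alpha> = 1" using \<alpha> by simp
      have br: "bracket_in A (ker2 A (\<omega> 1)) V (distrib_sum (ker2 A (\<omega> 1)) V)" using True k1 by simp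
      let ?S = "span ((\<lambda>i. case_sum ?X ?R i z) ` (?I <+> {1..k}))"
      have one: "1 \<in> {1..k}" using \<alpha> unfolding \<alpha>1 .
      have Rker: "R 1 q \<in> ker2 A (\<omega> 1) q" for q
        unfolding ker2_def using reeb_field_tangent[OF one] reeb_fieldsD(3)[OF one one] by blast
      have "\<exists>t. \<exists>v\<in>V (chart_inv c z). bracket (?R 1) (?X i) z = t *\<^sub>R ?R 1 z + v c"
        by (rule local_bracket_condition[OF M br subspace_V reeb_fieldsD(1)[OF one] Rker _ c U X[OF i] XV[OF i] sub z])
           (rule kernel_spanned_by_reeb[OF k1])
      then obtain t v where v: "v \<in> V (chart_inv c z)" "bracket (?R 1) (?X i) z = t *\<^sub>R ?R 1 z + v c" by blast
      have "(\<lambda>i. ?X i z) ` ?I \<subseteq> (\<lambda>i. case_sum ?X ?R i z) ` (?I <+> {1..k})" by force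
      then have "v c \<in> ?S" using span_mono V_rep[OF z v(1)] by blast
      moreover have "case_sum ?X ?R (Inr 1) z \<in> ?S" by (intro span_base imageI InrI one)
      ultimately show ?thesis unfolding \<alpha>1 v(2) by (intro span_add span_scale) simp_all
    qed
    have "\<exists>W Y \<Phi> \<Psi> b. diffeo W Y \<Phi> \<Psi> \<and> z0 \<in> W \<and> W \<subseteq> ?B \<and> bij_betw b (coord_names k n) (Basis :: 'e set) \<and>
    (\<forall>z\<in>W. darboux_at k n b (\<lambda>\<alpha>. rep1 A c (\<eta> \<alpha>)) (\<lambda>\<alpha>. rep2 A c (\<omega> \<alpha>)) (\<lambda>\<alpha>. vf_rep c (R \<alpha>)) z (frechet_derivative \<Phi> (at z)) \<and>
        (\<forall>i\<in>{1..n * k}. \<forall>j\<in>{1..n}. frechet_derivative \<Phi> (at z) (vf_rep c (X i) z) \<bullet> b (CY j) = 0))"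
      by (rule darboux_polarized[where U = ?B and \<eta> = ?\<eta> and \<omega> = ?\<omega> and R = ?R and X = ?X and J = ?I])
         (assumption | rule open_ball 1 2 3 4 5 6 7 8 9 10 11 12 13 14 z0)+
    then show ?thesis by (simp only: True simp_thms)
  next
    case False
    then have k1: "k = 1" by simp
    have one: "(1::nat) \<in> {1..k}" using k1 by simp
    have all1: "(\<forall>\<alpha>\<in>{1..k}. P \<alpha>) \<longleftrightarrow> (\<forall>\<alpha>\<in>{1..1::nat}. Q \<alpha>)" if "P 1 = Q 1" for P Q
      using that k1 by simp
    have "\<exists>W Y \<Phi> \<Psi> b. diffeo W Y \<Phi> \<Psi> \<and> z0 \<in> W \<and> W \<subseteq> ?B \<and> bij_betw b (coord_names 1 n) (Basis :: 'e set) \<and>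
    (\<forall>z\<in>W. darboux_at 1 n b (\<lambda>\<alpha>. rep1 A c (\<eta> 1)) (\<lambda>\<alpha>. rep2 A c (\<omega> 1)) (\<lambda>\<alpha>. ?R 1) z (frechet_derivative \<Phi> (at z)))"
    proof (rule darboux_cosymplectic)
      show "open ?B" "z0 \<in> ?B" by (rule open_ball) (rule z0)
      show "DIM('e) = n * (1 + 1) + 1" using 1 k1 by simp
      show "closed1 ?B (?\<eta> 1)" "closed2 ?B (?\<omega> 1)" "smooth_on ?B (?R 1)" by (rule 2[OF one] 3[OF one] 5[OF one])+
      fix z assume z: "z \<in> ?B"
      show "?\<eta> 1 z (?R 1 z) = 1" "?\<omega> 1 z (?R 1 z) w = 0" for w
        using 6[OF z one one] 7[OF z one one] by simp_all
      show "v = 0" if "?\<eta> 1 z v = 0" "\<And>w. ?\<omega> 1 z v w = 0" for v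
        using 4[OF z, of v] that k1 by simp
    qed
    moreover have "k \<noteq> 1 \<or> bracket_in A (ker2 A (\<omega> 1)) V (distrib_sum (ker2 A (\<omega> 1)) V) \<longleftrightarrow> False"
      using False by blast
    ultimately show ?thesis by (simp only: k1 atLeastAtMost_singleton ball_simps bex_simps simp_thms)
  qed
qed

end

theorem theorem4p2:
  fixes A :: "('m::{t2_space, second_countable_topology}, 'e::euclidean_space) chart set"
    and k n :: nat
    and \<eta> :: "nat \<Rightarrow> ('m, 'e) form1"
    and \<omega> :: "nat \<Rightarrow> ('m, 'e) form2"
    and V :: "('m, 'e) distrib"
    and R :: "nat \<Rightarrow> 'm \<Rightarrow> ('m, 'e) tvec"
    and p :: 'm
  assumes "k_cosymplectic A k n \<eta> \<omega> V"
    and "reeb_fields A k \<eta> \<omega> R"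
  shows "\<exists>c\<in>A. \<exists>b. p \<in> fst c \<and> bij_betw b (coord_names k n) (Basis :: 'e set) \<and>
    (\<forall>q\<in>fst c.
      (\<forall>\<alpha>\<in>{1..k}. \<forall>v\<in>tangent_space A q.
         \<eta> \<alpha> q v = differential A (coord c (b (CX \<alpha>))) q v) \<and>
      (\<forall>\<alpha>\<in>{1..k}. \<forall>v\<in>tangent_space A q. \<forall>w\<in>tangent_space A q.
         \<omega> \<alpha> q v w =
           (\<Sum>i=1..n. wedge11 (differential A (coord c (b (CY i))))
                            (differential A (coord c (b (CP \<alpha> i)))) q v w)) \<and>
      (\<forall>\<alpha>\<in>{1..k}. R \<alpha> q = coord_vec A c (b (CX \<alpha>)) q) \<and>
      (k \<noteq> 1 \<longrightarrow>
         V q = span {coord_vec A c (b (CP \<alpha> i)) q | \<alpha> i. \<alpha> \<in> {1..k} \<and> i \<in> {1..n}}) \<and>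
      (k = 1 \<and> bracket_in A (ker2 A (\<omega> 1)) V (distrib_sum (ker2 A (\<omega> 1)) V) \<longrightarrow>
         V q = span {coord_vec A c (b (CP 1 i)) q | i. i \<in> {1..n}}))"
proof -
  note KR = assms
  note K = k_cosymplecticD[OF KR]
  note M = K(1)
  have "p \<in> (\<Union>c\<in>A. fst c)" using M unfolding smooth_manifold_def by blast
  then obtain c where c: "c \<in> A" "p \<in> fst c" by blast
  note cc = is_chartD[OF atlas_chart[OF M c(1)]]
  obtain U X where U: "open U" "p \<in> U" and X: "\<forall>i\<in>{1..n * k}. vector_field_on A U (X i)"
    and VX: "\<forall>q\<in>U. V q = span ((\<lambda>i. X i q) ` {1..n * k})"
    using distribution_V[OF KR] unfolding distribution_def by blast
  have "open (snd c ` (fst c \<inter> U))" by (rule open_chart_image[OF atlas_chart[OF M c(1)] U(1)])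
  moreover have "snd c p \<in> snd c ` (fst c \<inter> U)" using c(2) U(2) by blast
  ultimately obtain r where r: "r > 0" "cball (snd c p) r \<subseteq> snd c ` (fst c \<inter> U)"
    by (meson open_contains_cball)
  obtain W Y \<Phi> \<Psi> b where D: "diffeo W Y \<Phi> \<Psi>" "snd c p \<in> W" "W \<subseteq> ball (snd c p) r"
      and b: "bij_betw b (coord_names k n) (Basis :: 'e set)"
    and W: "\<forall>z\<in>W. darboux_at k n b (\<lambda>\<alpha>. rep1 A c (\<eta> \<alpha>)) (\<lambda>\<alpha>. rep2 A c (\<omega> \<alpha>)) (\<lambda>\<alpha>. vf_rep c (R \<alpha>)) z (frechet_derivative \<Phi> (at z)) \<and>
      (k \<noteq> 1 \<or> bracket_in A (ker2 A (\<omega> 1)) V (distrib_sum (ker2 A (\<omega> 1)) V) \<longrightarrow>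
        (\<forall>i\<in>{1..n * k}. \<forall>j\<in>{1..n}. frechet_derivative \<Phi> (at z) (vf_rep c (X i) z) \<bullet> b (CY j) = 0))"
    using local_darboux[OF KR c(1) U(1) X VX r] by (elim exE conjE) (rule that, assumption+)
  have WO: "W \<subseteq> snd c ` (fst c \<inter> U)" using D(3) r(2) ball_subset_cball by blast
  then have Wc: "W \<subseteq> snd c ` fst c" by blast
  define c' where "c' = (fst c \<inter> snd c -` W, \<Phi> \<circ> snd c)"
  have c': "c' \<in> A" by (rule recoordinatized_chart(1)[OF M c(1) D(1) Wc c'_def])
  have comp: "v c' = frechet_derivative \<Phi> (at (snd c q)) (v c)"
    if "q \<in> fst c'" "v \<in> tangent_space A q" for q v
    by (rule recoordinatized_chart(2)[OF M c(1) D(1) Wc c'_def that])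
  have f: "fst c' = fst c \<inter> snd c -` W" by (simp add: c'_def)
  have main: "(\<forall>\<alpha>\<in>{1..k}. \<forall>v\<in>tangent_space A q.
         \<eta> \<alpha> q v = differential A (coord c' (b (CX \<alpha>))) q v) \<and>
      (\<forall>\<alpha>\<in>{1..k}. \<forall>v\<in>tangent_space A q. \<forall>w\<in>tangent_space A q.
         \<omega> \<alpha> q v w =
           (\<Sum>i=1..n. wedge11 (differential A (coord c' (b (CY i))))
                            (differential A (coord c' (b (CP \<alpha> i)))) q v w)) \<and>
      (\<forall>\<alpha>\<in>{1..k}. R \<alpha> q = coord_vec A c' (b (CX \<alpha>)) q) \<and>
      (k \<noteq> 1 \<or> bracket_in A (ker2 A (\<omega> 1)) V (distrib_sum (ker2 A (\<omega> 1)) V) \<longrightarrow>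
         V q = span {coord_vec A c' (b (CP \<alpha> i)) q | \<alpha> i. \<alpha> \<in> {1..k} \<and> i \<in> {1..n}})"
    if q: "q \<in> fst c'" for q
  proof -
    have qc: "q \<in> fst c" "snd c q \<in> W" using q unfolding f by blast+
    have Wq: "\<And>\<alpha> v. \<alpha> \<in> {1..k} \<Longrightarrow> rep1 A c (\<eta> \<alpha>) (snd c q) v = frechet_derivative \<Phi> (at (snd c q)) v \<bullet> b (CX \<alpha>)"
      "\<And>\<alpha> v w. \<alpha> \<in> {1..k} \<Longrightarrow> rep2 A c (\<omega> \<alpha>) (snd c q) v w = (\<Sum>i=1..n.
          (frechet_derivative \<Phi> (at (snd c q)) v \<bullet> b (CY i)) * (frechet_derivative \<Phi> (at (snd c q)) w \<bullet> b (CP \<alpha> i))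
        - (frechet_derivative \<Phi> (at (snd c q)) w \<bullet> b (CY i)) * (frechet_derivative \<Phi> (at (snd c q)) v \<bullet> b (CP \<alpha> i)))"
      "\<And>\<alpha>. \<alpha> \<in> {1..k} \<Longrightarrow> frechet_derivative \<Phi> (at (snd c q)) (R \<alpha> q c) = b (CX \<alpha>)"
      "\<And>i j. k \<noteq> 1 \<or> bracket_in A (ker2 A (\<omega> 1)) V (distrib_sum (ker2 A (\<omega> 1)) V) \<Longrightarrow> i \<in> {1..n * k} \<Longrightarrow> j \<in> {1..n}
        \<Longrightarrow> frechet_derivative \<Phi> (at (snd c q)) (X i q c) \<bullet> b (CY j) = 0"
      using bspec[OF W qc(2)] unfolding vf_rep_apply[OF M c(1) qc(1)] by blast+
    have \<eta>: "\<eta> \<alpha> q v = v c' \<bullet> b (CX \<alpha>)" if "\<alpha> \<in> {1..k}" and v: "v \<in> tangent_space A q" for \<alpha> v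
      using Wq(1)[OF that(1), of "v c"] unfolding comp[OF q v] rep1_apply[OF M v c(1) qc(1)] .
    have \<omega>: "\<omega> \<alpha> q v w = (\<Sum>i=1..n. (v c' \<bullet> b (CY i)) * (w c' \<bullet> b (CP \<alpha> i)) - (w c' \<bullet> b (CY i)) * (v c' \<bullet> b (CP \<alpha> i)))"
      if "\<alpha> \<in> {1..k}" and v: "v \<in> tangent_space A q" and w: "w \<in> tangent_space A q" for \<alpha> v w
      using Wq(2)[OF that(1), of "v c" "w c"] unfolding comp[OF q v] comp[OF q w] rep2_apply[OF M v w c(1) qc(1)] .
    have R: "R \<alpha> q = coord_vec A c' (b (CX \<alpha>)) q" if "\<alpha> \<in> {1..k}" for \<alpha>
    proof -
      note RT = reeb_field_tangent[OF KR that, of q]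
      have "R \<alpha> q c' = b (CX \<alpha>)" unfolding comp[OF q RT] by (rule Wq(3)[OF that])
      then show ?thesis using tangent_coord_vec[OF M RT c' q] by simp
    qed
    have V: "V q = span {coord_vec A c' (b (CP \<alpha> i)) q | \<alpha> i. \<alpha> \<in> {1..k} \<and> i \<in> {1..n}}"
      if br: "k \<noteq> 1 \<or> bracket_in A (ker2 A (\<omega> 1)) V (distrib_sum (ker2 A (\<omega> 1)) V)"
    proof -
      obtain x where x: "snd c q = snd c x" "x \<in> fst c" "x \<in> U" using qc(2) WO by blast
      have "q = x" using cc(5)[OF qc(1)] cc(5)[OF x(2)] x(1) by argo
      then have qU: "q \<in> U" using x(3) by simp
      note VXq = bspec[OF VX qU]
      have XV: "X i q \<in> V q" if "i \<in> {1..n * k}" for i unfolding VXq using that by (intro span_base imageI)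
      have XT: "X i q \<in> tangent_space A q" if "i \<in> {1..n * k}" for i using XV[OF that] V_tangent[OF KR] by blast
      show ?thesis
        unfolding VXq
      proof (rule span_coord_vec_eq[OF M c' q b _ _ frame_lin_indep[where X = X, OF KR VXq]])
        show "X i q c' \<bullet> b (CX \<alpha>) = 0" if "i \<in> {1..n * k}" "\<alpha> \<in> {1..k}" for i \<alpha>
          using \<eta>[OF that(2) XT[OF that(1)]] K(7)[OF that(2) XV[OF that(1)]] by simp
        show "X i q c' \<bullet> b (CY j) = 0" if "i \<in> {1..n * k}" "j \<in> {1..n}" for i j
          unfolding comp[OF q XT[OF that(1)]] by (rule Wq(4)[OF br that])
      qed (simp_all add: XT)
    qed
    note dc = differential_coord[OF M c' q]
    show ?thesis
    proof (intro conjI ballI impI)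
      show "\<eta> \<alpha> q v = differential A (coord c' (b (CX \<alpha>))) q v"
        if "\<alpha> \<in> {1..k}" "v \<in> tangent_space A q" for \<alpha> v
        unfolding dc[OF that(2)] by (rule \<eta>[OF that])
      show "\<omega> \<alpha> q v w = (\<Sum>i=1..n. wedge11 (differential A (coord c' (b (CY i))))
                            (differential A (coord c' (b (CP \<alpha> i)))) q v w)"
        if "\<alpha> \<in> {1..k}" "v \<in> tangent_space A q" "w \<in> tangent_space A q" for \<alpha> v w
        unfolding wedge11_def dc[OF that(2)] dc[OF that(3)] by (rule \<omega>[OF that])
    qed (rule R V, assumption)+
  qed
  have k1: "{coord_vec A c' (b (CP 1 i)) q | i. i \<in> {1..n}}
      = {coord_vec A c' (b (CP \<alpha> i)) q | \<alpha> i. \<alpha> \<in> {1..k} \<and> i \<in> {1..n}}" if "k = 1" for q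
    unfolding that by auto
  show ?thesis
  proof (intro bexI[OF _ c'] exI[of _ b] conjI ballI impI b)
    show "p \<in> fst c'" using c(2) D(2) by (simp add: f)
    fix q assume q: "q \<in> fst c'"
    note m = main[OF q]
    show "V q = span {coord_vec A c' (b (CP \<alpha> i)) q | \<alpha> i. \<alpha> \<in> {1..k} \<and> i \<in> {1..n}}" if "k \<noteq> 1"
      using m that by (elim conjE) (erule mp, rule disjI1)
    show "V q = span {coord_vec A c' (b (CP 1 i)) q | i. i \<in> {1..n}}"
      if "k = 1 \<and> bracket_in A (ker2 A (\<omega> 1)) V (distrib_sum (ker2 A (\<omega> 1)) V)"
      using m conjunct2[OF that] unfolding k1[OF conjunct1[OF that]] by (elim conjE) (erule mp, rule disjI2)
    show "\<eta> \<alpha> q v = differential A (coord c' (b (CX \<alpha>))) q v"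
      if "\<alpha> \<in> {1..k}" "v \<in> tangent_space A q" for \<alpha> v
      using bspec[OF bspec[OF conjunct1[OF m] that(1)] that(2)] .
    show "\<omega> \<alpha> q v w = (\<Sum>i=1..n. wedge11 (differential A (coord c' (b (CY i))))
                          (differential A (coord c' (b (CP \<alpha> i)))) q v w)"
      if "\<alpha> \<in> {1..k}" "v \<in> tangent_space A q" "w \<in> tangent_space A q" for \<alpha> v w
      using bspec[OF bspec[OF bspec[OF conjunct1[OF conjunct2[OF m]] that(1)] that(2)] that(3)] .
    show "R \<alpha> q = coord_vec A c' (b (CX \<alpha>)) q" if "\<alpha> \<in> {1..k}" for \<alpha>
      using bspec[OF conjunct1[OF conjunct2[OF conjunct2[OF m]]] that] .
  qed
qed

end
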